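(* If $\phi$ is a flow of level $N$, then there exists a homogeneous rational function $\mathscr{W}(u,v)$ of degree $N$ such that the orbit of any given $\mathbf{x}=(x,y)$ is an algebraic curve of genus $0$ given by $\mathscr{W}(u,v)\equiv\mathscr{W}(x,y)\equiv\mathrm{const}\in\mathbb{R}\cup\{\infty\}$. Conversely: in order for a homogeneous rational function $\mathscr{W}$ of degree $N$ to serve as an equation $\mathscr{W}(u,v)\equiv\mathrm{const}$ for the orbit of a point of a certain flow, it is necessary and sufficient that $$\mathscr{W}(u,v)=\frac{P^{N}(u,v)}{Q^{N}(u,v)}\cdot\big(uv^{N-1}\big)\circ L(u,v),$$ where $L$ is a non-degenerate linear transformation of the plane, and $P$ and $Q$ are homogeneous polynomials of the same degree $d\ge0$.
   Context: Everything is over $\mathbb{R}$. A flow is a pair $\phi=(u,v)$ of rational functions in $\mathbb{R}(x,y)$, $\phi\ne(x,y)$, satisfying $(1-z)\phi(\mathbf{x})=\phi\big(\phi(\mathbf{x}z)\frac{1-z}{z}\big)$ and $\lim_{z\to0}\phi(\mathbf{x}z)/z=\mathbf{x}$, where $\mathbf{x}=(x,y)$. A $1$-BIR is a birational plane transformation whose two coordinates are homogeneous rational functions of degree $1$. The level of a flow $\phi$ is the integer $N\ge 0$ such that $\phi=\ell^{-1}\circ\phi_N\circ\ell$ for some $1$-BIR $\ell$, where $\phi_N(x,y)=\big(x(y+1)^{N-1},\frac{y}{y+1}\big)$. The orbit of $\mathbf{x}\in\mathbb{R}^2$ is the set $\mathscr{V}(\mathbf{x})=\{\frac1z\phi(\mathbf{x}z):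 z\in\mathbb{R}\}$ (with value $\mathbf{x}$ at $z=0$).
   Formalization: Genus 0 is claimed only for points that are not fixed and satisfy the boundary limit; for N≥1 the exact equation W=const only where W(x) is not 0 or ∞ (such levels may be reducible; W is still constant on the orbit); in the single-orbit converse the constant is finite. *)

theory Defs
  imports "HOL-Analysis.Analysis" "HOL-Computational_Algebra.Fraction_Field"
begin

section \<open>Bivariate polynomials and rational functions\<close>

text \<open>
  The ring \<open>k[x,y]\<close> is \<open>k poly poly\<close>, the inner variable being \<open>x\<close> and the outer one \<open>y\<close>, so
  that the coefficient of \<open>x^i y^j\<close> in \<open>p\<close> is \<open>coeff (coeff p j) i\<close>. The field \<open>k(x,y)\<close> is its
  fraction field.
\<close>

type_synonym 'k rat_fun = "'k poly poly fract"

definition cpoly :: "'k::comm_ring_1 \<Rightarrow> 'k poly poly" where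
  "cpoly c = [:[:c:]:]"

definition ratf :: "'k::field poly poly \<Rightarrow> 'k rat_fun" where
  "ratf p = Fract p 1"

definition constf :: "'k::field \<Rightarrow> 'k rat_fun" where
  "constf c = ratf (cpoly c)"

definition Xf :: "'k::field rat_fun" where
  "Xf = ratf [:[:0, 1:]:]"

definition Yf :: "'k::field rat_fun" where
  "Yf = ratf [:0, 1:]"

text \<open>
  Substitution of two elements \<open>a\<close>, \<open>b\<close> of a field extension of \<open>k\<close> for \<open>x\<close> and \<open>y\<close>, where
  \<open>\<iota>\<close> is the embedding of \<open>k\<close> into the extension. The extension may be \<open>k\<close> itself (evaluation at a
  point), or a field of rational functions (composition). The result is meaningful only if the
  rational function has a representation whose denominator does not become zero.
\<close>

definition subst_poly :: "('k::comm_ring_1 \<Rightarrow> 'l::comm_ring_1) \<Rightarrow> 'k poly poly \<Rightarrow> 'l \<Rightarrow> 'l \<Rightarrow> 'l" where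
  "subst_poly \<iota> p a b = poly (map_poly (\<lambda>c. poly (map_poly \<iota> c) a) p) b"

definition substitutable :: "('k::field \<Rightarrow> 'l::field) \<Rightarrow> 'k rat_fun \<Rightarrow> 'l \<Rightarrow> 'l \<Rightarrow> bool" where
  "substitutable \<iota> f a b \<longleftrightarrow> (\<exists>p q. f = Fract p q \<and> subst_poly \<iota> q a b \<noteq> 0)"

definition subst_rat :: "('k::field \<Rightarrow> 'l::field) \<Rightarrow> 'k rat_fun \<Rightarrow> 'l \<Rightarrow> 'l \<Rightarrow> 'l" where
  "subst_rat \<iota> f a b = (THE w. \<exists>p q. f = Fract p q \<and> subst_poly \<iota> q a b \<noteq> 0 \<and>
      w = subst_poly \<iota> p a b / subst_poly \<iota> q a b)"

definition hom_poly :: "nat \<Rightarrow> 'k::zero poly poly \<Rightarrow> bool" where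
  "hom_poly d p \<longleftrightarrow> (\<forall>i j. coeff (coeff p j) i \<noteq> 0 \<longrightarrow> i + j = d)"

definition hom_rat :: "nat \<Rightarrow> 'k::field rat_fun \<Rightarrow> bool" where
  "hom_rat n f \<longleftrightarrow> (\<exists>p q d. hom_poly (n + d) p \<and> hom_poly d q \<and> q \<noteq> 0 \<and> f = Fract p q)"


section \<open>Points of the real plane\<close>

definition eval_poly :: "real poly poly \<Rightarrow> real \<times> real \<Rightarrow> real" where
  "eval_poly p a = subst_poly id p (fst a) (snd a)"

definition regular_at :: "real rat_fun \<Rightarrow> real \<times> real \<Rightarrow> bool" where
  "regular_at f a \<longleftrightarrow> substitutable id f (fst a) (snd a)"

definition eval_rat :: "real rat_fun \<Rightarrow> real \<times> real \<Rightarrow> real" where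
  "eval_rat f a = subst_rat id f (fst a) (snd a)"

text \<open>
  The value in \<open>\<real> \<union> {\<infinity>}\<close>, with \<open>None\<close> standing for \<open>\<infinity>\<close>. It is used only for homogeneous rational
  functions at points other than the origin; there the reduced numerator and denominator have no
  common zero, so that failing to be regular does mean having the value \<open>\<infinity>\<close>.
\<close>

definition proj_value :: "real rat_fun \<Rightarrow> real \<times> real \<Rightarrow> real option" where
  "proj_value f a = (if regular_at f a then Some (eval_rat f a) else None)"

text \<open>Validity off the zero set of some nonzero polynomial.\<close>

definition generically :: "(real \<times> real \<Rightarrow> bool) \<Rightarrow> bool" where
  "generically P \<longleftrightarrow> (\<exists>D. D \<noteq> 0 \<and> (\<forall>a. eval_poly D a \<noteq> 0 \<longrightarrow> P a))"


section \<open>Rational maps of the plane\<close>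

type_synonym rat_map = "real rat_fun \<times> real rat_fun"

definition id_map :: rat_map where
  "id_map = (Xf, Yf)"

definition composable :: "rat_map \<Rightarrow> rat_map \<Rightarrow> bool" where
  "composable f g \<longleftrightarrow>
     substitutable constf (fst f) (fst g) (snd g) \<and> substitutable constf (snd f) (fst g) (snd g)"

definition comp_map :: "rat_map \<Rightarrow> rat_map \<Rightarrow> rat_map" where
  "comp_map f g = (subst_rat constf (fst f) (fst g) (snd g), subst_rat constf (snd f) (fst g) (snd g))"

definition inverse_maps :: "rat_map \<Rightarrow> rat_map \<Rightarrow> bool" where
  "inverse_maps f g \<longleftrightarrow> composable f g \<and> comp_map f g = id_map \<and>
                        composable g f \<and> comp_map g f = id_map"

definition one_BIR :: "rat_map \<Rightarrow> bool" where
  "one_BIR l \<longleftrightarrow> hom_rat 1 (fst l) \<and> hom_rat 1 (snd l) \<and> (\<exists>m. inverse_maps l m)"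


section \<open>Flows, levels and orbits\<close>

text \<open>The field \<open>\<real>(x,y)(z)\<close>, its generator \<open>z\<close>, and the embeddings of \<open>\<real>(x,y)\<close> and \<open>\<real>\<close>.\<close>

type_synonym rat_fun3 = "real rat_fun poly fract"

definition emb3 :: "real rat_fun \<Rightarrow> rat_fun3" where
  "emb3 f = Fract [:f:] 1"

definition const3 :: "real \<Rightarrow> rat_fun3" where
  "const3 c = emb3 (constf c)"

definition Z3 :: rat_fun3 where
  "Z3 = Fract [:0, 1:] 1"

text \<open>The identity \<open>(1 - z) \<phi>(x) = \<phi>(\<phi>(x z) (1 - z) / z)\<close> in \<open>\<real>(x,y,z)\<close>.\<close>

definition translation_equation :: "rat_map \<Rightarrow> bool" where
  "translation_equation \<phi> \<longleftrightarrow>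
     (let a = subst_rat const3 (fst \<phi>) (emb3 Xf * Z3) (emb3 Yf * Z3) * ((1 - Z3) / Z3);
          b = subst_rat const3 (snd \<phi>) (emb3 Xf * Z3) (emb3 Yf * Z3) * ((1 - Z3) / Z3)
      in substitutable const3 (fst \<phi>) a b \<and> substitutable const3 (snd \<phi>) a b \<and>
         (1 - Z3) * emb3 (fst \<phi>) = subst_rat const3 (fst \<phi>) a b \<and>
         (1 - Z3) * emb3 (snd \<phi>) = subst_rat const3 (snd \<phi>) a b)"

definition map_regular_at :: "rat_map \<Rightarrow> real \<times> real \<Rightarrow> bool" where
  "map_regular_at \<phi> a \<longleftrightarrow> regular_at (fst \<phi>) a \<and> regular_at (snd \<phi>) a"

definition eval_map :: "rat_map \<Rightarrow> real \<times> real \<Rightarrow> real \<times> real" where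
  "eval_map \<phi> a = (eval_rat (fst \<phi>) a, eval_rat (snd \<phi>) a)"

definition boundary_condition_at :: "rat_map \<Rightarrow> real \<times> real \<Rightarrow> bool" where
  "boundary_condition_at \<phi> a \<longleftrightarrow> ((\<lambda>z. (1 / z) *\<^sub>R eval_map \<phi> (z *\<^sub>R a)) \<longlongrightarrow> a) (at 0)"

text \<open>
  The boundary condition is a generic one: the flow \<open>(x,y) / (1 + x\<^sup>2/y)\<close> violates it on \<open>y = 0\<close>.
\<close>

definition flow :: "rat_map \<Rightarrow> bool" where
  "flow \<phi> \<longleftrightarrow> \<phi> \<noteq> id_map \<and> translation_equation \<phi> \<and> generically (boundary_condition_at \<phi>)"

definition canonical_flow :: "nat \<Rightarrow> rat_map" where
  "canonical_flow N = (Xf * (Yf + 1) powi (int N - 1), Yf / (Yf + 1))"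

definition has_level :: "rat_map \<Rightarrow> nat \<Rightarrow> bool" where
  "has_level \<phi> N \<longleftrightarrow> (\<exists>l m. one_BIR l \<and> inverse_maps l m \<and>
     \<phi> = comp_map m (comp_map (canonical_flow N) l))"

definition orbit :: "rat_map \<Rightarrow> real \<times> real \<Rightarrow> (real \<times> real) set" where
  "orbit \<phi> a = insert a {(1 / z) *\<^sub>R eval_map \<phi> (z *\<^sub>R a) | z. z \<noteq> 0 \<and> map_regular_at \<phi> (z *\<^sub>R a)}"

text \<open>
  The points whose orbit is a curve through the point: the boundary condition holds there, and the
  point is not fixed by the flow.
\<close>

definition nondegenerate_at :: "rat_map \<Rightarrow> real \<times> real \<Rightarrow> bool" where
  "nondegenerate_at \<phi> a \<longleftrightarrow> boundary_condition_at \<phi> a \<and> infinite (orbit \<phi> a)"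


section \<open>Plane curves and their equations\<close>

text \<open>
  \<open>S\<close> is the curve with equation \<open>F = 0\<close>: the polynomials vanishing on \<open>S\<close> are the multiples of
  \<open>F\<close>, and \<open>S\<close> comprises all but finitely many real points of \<open>F = 0\<close>. (The curve parametrised by
  \<open>z \<mapsto> \<phi>(x z) / z\<close> usually misses a point, such as the one for \<open>z = \<infinity>\<close>.)
\<close>

definition curve_given_by :: "(real \<times> real) set \<Rightarrow> real poly poly \<Rightarrow> bool" where
  "curve_given_by S F \<longleftrightarrow> {G. \<forall>a\<in>S. eval_poly G a = 0} = {G. F dvd G} \<and>
     finite ({a. eval_poly F a = 0} - S)"

text \<open>
  The equation \<open>W(u,v) = W(a)\<close> with denominators cleared, for \<open>W = A/B\<close> in lowest terms: if
  \<open>W(a) = \<infinity>\<close>, that is \<open>B(a) = 0 \<noteq> A(a)\<close>, then it becomes \<open>B(u,v) = 0\<close>.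
\<close>

definition orbit_given_by :: "rat_map \<Rightarrow> real rat_fun \<Rightarrow> real \<times> real \<Rightarrow> bool" where
  "orbit_given_by \<phi> W a \<longleftrightarrow> (\<exists>A B. B \<noteq> 0 \<and> coprime A B \<and> W = Fract A B \<and>
     curve_given_by (orbit \<phi> a) (cpoly (eval_poly B a) * A - cpoly (eval_poly A a) * B))"

definition orbit_equation :: "rat_map \<Rightarrow> real rat_fun \<Rightarrow> bool" where
  "orbit_equation \<phi> W \<longleftrightarrow>
     (\<forall>a b. a \<noteq> 0 \<longrightarrow> b \<in> orbit \<phi> a \<longrightarrow> b \<noteq> 0 \<longrightarrow> proj_value W b = proj_value W a) \<and>
     generically (orbit_given_by \<phi> W)"


section \<open>The genus of an irreducible plane curve\<close>

text \<open>
  The function field of the curve \<open>F = 0\<close> over an algebraically closed field is the residue field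
  \<open>O/M\<close> of the local ring \<open>O\<close> of rational functions that are defined at the generic point of the
  curve. Its elements are represented by elements of \<open>O\<close>, and its places by normalised discrete
  valuations on \<open>O - M\<close> that respect congruence modulo \<open>M\<close>.
\<close>

definition curve_ring :: "'k::field poly poly \<Rightarrow> 'k rat_fun set" where
  "curve_ring F = {Fract p q | p q. \<not> F dvd q}"

definition curve_ideal :: "'k::field poly poly \<Rightarrow> 'k rat_fun set" where
  "curve_ideal F = {Fract p q | p q. F dvd p \<and> \<not> F dvd q}"

definition place :: "'k::field poly poly \<Rightarrow> ('k rat_fun \<Rightarrow> int) \<Rightarrow> bool" where
  "place F v \<longleftrightarrow>
     (let U = curve_ring F - curve_ideal F in
       (\<forall>f\<in>U. \<forall>g\<in>U. v (f * g) = v f + v g) \<and>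
       (\<forall>f\<in>U. \<forall>g\<in>U. f + g \<in> U \<longrightarrow> min (v f) (v g) \<le> v (f + g)) \<and>
       (\<forall>f\<in>U. \<forall>g\<in>U. f - g \<in> curve_ideal F \<longrightarrow> v f = v g) \<and>
       (\<forall>c. c \<noteq> 0 \<longrightarrow> v (constf c) = 0) \<and>
       (\<exists>f\<in>U. v f = 1) \<and>
       (\<forall>f. f \<notin> U \<longrightarrow> v f = 0))"

definition divisor :: "'k::field poly poly \<Rightarrow> (('k rat_fun \<Rightarrow> int) \<Rightarrow> int) \<Rightarrow> bool" where
  "divisor F D \<longleftrightarrow> finite {v. D v \<noteq> 0} \<and> (\<forall>v. D v \<noteq> 0 \<longrightarrow> place F v)"

definition degree_divisor :: "(('k::field rat_fun \<Rightarrow> int) \<Rightarrow> int) \<Rightarrow> int" where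
  "degree_divisor D = (\<Sum>v | D v \<noteq> 0. D v)"

definition rr_space ::
    "'k::field poly poly \<Rightarrow> (('k rat_fun \<Rightarrow> int) \<Rightarrow> int) \<Rightarrow> 'k rat_fun set" where
  "rr_space F D = {f \<in> curve_ring F. f \<in> curve_ideal F \<or> (\<forall>v. place F v \<longrightarrow> 0 \<le> v f + D v)}"

text \<open>The dimension of \<open>rr_space F D\<close> modulo \<open>curve_ideal F\<close> as a vector space over \<open>k\<close>.\<close>

definition rr_dim :: "'k::field poly poly \<Rightarrow> (('k rat_fun \<Rightarrow> int) \<Rightarrow> int) \<Rightarrow> nat" where
  "rr_dim F D = Sup {card S | S. finite S \<and> S \<subseteq> rr_space F D \<and>
     (\<forall>c. (\<Sum>f\<in>S. constf (c f) * f) \<in> curve_ideal F \<longrightarrow> (\<forall>f\<in>S. c f = 0))}"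

text \<open>
  The genus in the sense of Riemann: the maximum of \<open>deg D + 1 - dim L(D)\<close> over all divisors \<open>D\<close>.
  It exists by Riemann's theorem.
\<close>

definition genus :: "'k::field poly poly \<Rightarrow> int" where
  "genus F = Sup {degree_divisor D + 1 - int (rr_dim F D) | D. divisor F D}"

definition complexify :: "real poly poly \<Rightarrow> complex poly poly" where
  "complexify F = map_poly (map_poly complex_of_real) F"

definition algebraic_curve_of_genus_0 :: "(real \<times> real) set \<Rightarrow> bool" where
  "algebraic_curve_of_genus_0 S \<longleftrightarrow>
     (\<exists>F. curve_given_by S F \<and> irreducible (complexify F) \<and> genus (complexify F) = 0)"


section \<open>The normal form of orbit equations\<close>

text \<open>\<open>W = P^N / Q^N \<cdot> (u v^(N-1)) \<circ> L\<close> with \<open>L(u,v) = (a u + b v, c u + d v)\<close>.\<close>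

definition orbit_equation_form :: "nat \<Rightarrow> real rat_fun \<Rightarrow> bool" where
  "orbit_equation_form N W \<longleftrightarrow>
     (\<exists>P Q deg a b c d. hom_poly deg P \<and> hom_poly deg Q \<and> P \<noteq> 0 \<and> Q \<noteq> 0 \<and>
        a * d - b * c \<noteq> 0 \<and>
        W = (ratf P) ^ N / (ratf Q) ^ N *
            subst_rat constf (Xf * Yf powi (int N - 1))
              (constf a * Xf + constf b * Yf) (constf c * Xf + constf d * Yf))"

end

theory Submission
  imports Defs "HOL-Computational_Algebra.Polynomial_Factorial" "HOL-Computational_Algebra.Field_as_Ring"
    "HOL-Computational_Algebra.Fundamental_Theorem_Algebra"
begin

text \<open>
  Let \<open>c(z) = \<phi>(a z) / z\<close> be the trajectory of a point \<open>a\<close>. The translation equation is an addition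
  law: \<open>c(z + w)\<close> is the point with parameter \<open>w\<close> on the trajectory of \<open>c(z)\<close>.

  For the canonical flow of level \<open>N > 0\<close> the trajectory of \<open>(x, y)\<close> is
  \<open>(x (1 + y z)^(N-1), y / (1 + y z))\<close>, along which \<open>x y^(N-1)\<close> is constant. A homogeneous birational
  map \<open>l\<close> with inverse \<open>k\<close> carries trajectories to trajectories; thus \<open>W = (x y^(N-1)) \<circ> l\<close> is
  constant along those of \<open>k \<circ> \<phi>\<^sub>N \<circ> l\<close>. In the parameter \<open>s = z + 1/y\<close> all orbits on the level \<open>c\<close>
  are parts of the single curve \<open>s \<mapsto> k(c s^(N-1), 1/s)\<close>. The parameter \<open>s\<close> is a rational function of
  the point, so that the function field of this curve is \<open>\<complex>(s)\<close>, and the Riemann-Roch spaces can be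
  written down (\<open>rational_real_curve_genus_zero\<close>). If \<open>W = A/B\<close> in lowest terms, then the vanishing
  ideal of the curve is generated by \<open>A - c B\<close>: up to the factor \<open>1/s\<close> the curve depends on \<open>s^N\<close>
  only, which splits a vanishing polynomial into parts that, multiplied by a power of \<open>A\<close>, become
  forms modulo \<open>A - c B\<close> (\<open>level_curve_ideal\<close>). For \<open>N = 0\<close> the trajectories lie on lines through the
  origin and have the form \<open>a / (1 + k z)\<close>.

  The converse uses nothing but the addition law and one orbit with the equation \<open>W = const\<close>
  (\<open>orbit_given_by_imp_form\<close>). If this equation is homogeneous, that is, if \<open>N = 0\<close> or the constant is
  zero, then it has to be the equation of a line. Otherwise write \<open>c = \<rho> (\<alpha>, \<beta>)\<close> with coprime
  polynomials \<open>\<alpha>\<close> and \<open>\<beta>\<close>. The terms of lowest order in \<open>w\<close> of the addition law show that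
  \<open>(\<alpha> \<beta>' - \<alpha>' \<beta>) / \<rho>\<close> is a quotient of two forms in \<open>(\<alpha>, \<beta>)\<close> (\<open>trajectory_velocity\<close>). Eliminating \<open>\<rho>\<close>
  by means of \<open>W = const\<close> gives an equation \<open>(\<alpha> \<beta>' - \<alpha>' \<beta>)^N Q(\<alpha>, \<beta>) = P(\<alpha>, \<beta>)\<close> with forms \<open>P\<close> and
  \<open>Q\<close>. Counting zeros and degrees, one finds that after a linear change of coordinates \<open>(\<alpha>, \<beta>)\<close> is
  \<open>((z - z\<^sub>0)^n, 1)\<close> (\<open>form_equation_solution\<close>). The degree of the equation of the orbit forces
  \<open>n = N\<close>, and solving for \<open>W\<close> yields the normal form, the two coordinates being the factors of
  \<open>u v^(N-1)\<close>.

  Finally, every normal form occurs. The map \<open>l = (P/Q) L\<close> is homogeneous of degree one; it is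
  birational because the factor \<open>P/Q\<close> of degree zero is constant on lines through the origin. For
  \<open>N > 0\<close> the normal form is \<open>(x y^(N-1)) \<circ> l\<close>, and for \<open>N = 0\<close> it is a quotient of linear forms; in
  both cases it is the equation of the orbits of \<open>l\<^sup>-\<^sup>1 \<circ> \<phi>\<^sub>N \<circ> l\<close>.
\<close>


section \<open>Ring homomorphisms and substitution\<close>

locale ringhom =
  fixes h :: "'a::comm_ring_1 \<Rightarrow> 'b::comm_ring_1"
  assumes one: "h 1 = 1"
    and add: "h (x + y) = h x + h y"
    and mult: "h (x * y) = h x * h y"
begin

lemma zero: "h 0 = 0"
  using add[of 0 0] by simp

lemma uminus: "h (- x) = - h x"
  using add[of x "- x"] zero by (simp add: eq_neg_iff_add_eq_0 add.commute)

lemma diff: "h (x - y) = h x - h y"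
  using add[of x "- y"] uminus by simp

lemma power: "h (x ^ n) = h x ^ n"
  by (induction n) (simp_all add: one mult)

lemma sum: "h (sum f A) = (\<Sum>i\<in>A. h (f i))"
  by (induction A rule: infinite_finite_induct) (simp_all add: zero add)

lemmas hom_simps = zero one add mult uminus diff power sum

end

lemma ringhom_id: "ringhom (\<lambda>x. x)" "ringhom id"
  by unfold_locales auto

lemma ringhom_comp: "ringhom f \<Longrightarrow> ringhom g \<Longrightarrow> ringhom (\<lambda>x. g (f x))"
  by (simp add: ringhom_def)

lemma ringhom_map_poly: assumes "ringhom h" shows "ringhom (map_poly h)"
proof -
  interpret ringhom h by fact
  show ?thesis
    by unfold_locales
      (auto simp: poly_eq_iff coeff_map_poly coeff_mult hom_simps one zero)
qed

lemma ringhom_poly: "ringhom (\<lambda>p. poly p a)"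
  by unfold_locales auto

lemma ringhom_const_poly: "ringhom (\<lambda>c. [:c:])"
  by unfold_locales (auto simp: one_pCons)

lemma ringhom_pcompose: "ringhom (\<lambda>p. pcompose p q)"
  by unfold_locales (auto simp: pcompose_1 pcompose_add pcompose_mult)

lemma ringhom_cpoly: "ringhom cpoly"
  unfolding cpoly_def by (intro ringhom_comp[OF ringhom_const_poly] ringhom_const_poly)

lemma ringhom_ratf: "ringhom ratf"
  by unfold_locales (auto simp: ratf_def One_fract_def)

lemma ringhom_constf: "ringhom constf"
  unfolding constf_def by (intro ringhom_comp[OF ringhom_cpoly ringhom_ratf])

lemma ringhom_subst_poly:
  assumes "ringhom \<iota>" shows "ringhom (\<lambda>p. subst_poly \<iota> p a b)"
  unfolding subst_poly_def
  by (intro ringhom_comp[OF ringhom_map_poly ringhom_poly] ringhom_comp[OF ringhom_map_poly[OF assms]] ringhom_poly)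

abbreviation px :: "'k::comm_ring_1 poly poly" where "px \<equiv> [:[:0, 1:]:]"
abbreviation py :: "'k::comm_ring_1 poly poly" where "py \<equiv> [:0, 1:]"

lemma subst_poly_gens:
  assumes "ringhom \<iota>"
  shows "subst_poly \<iota> (cpoly c) a b = \<iota> c" "subst_poly \<iota> px a b = a" "subst_poly \<iota> py a b = b"
proof -
  interpret ringhom \<iota> by fact
  show "subst_poly \<iota> (cpoly c) a b = \<iota> c" "subst_poly \<iota> px a b = a" "subst_poly \<iota> py a b = b"
    by (simp_all add: subst_poly_def cpoly_def map_poly_pCons zero one)
qed

lemma polypoly_induct [case_names const X Y add mult]:
  fixes p :: "'k::comm_ring_1 poly poly"
  assumes c: "\<And>c. P (cpoly c)" and x: "P px" and y: "P py"
    and add: "\<And>p q. P p \<Longrightarrow> P q \<Longrightarrow> P (p + q)" and mult: "\<And>p q. P p \<Longrightarrow> P q \<Longrightarrow> P (p * q)"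
  shows "P p"
proof (induction p)
  case 0
  show ?case using c[of 0] by (simp add: cpoly_def)
next
  case (pCons q p)
  have "P [:q:]"
  proof (induction q)
    case 0
    show ?case using c[of 0] by (simp add: cpoly_def)
  next
    case (pCons a q)
    have "[:pCons a q:] = cpoly a + px * [:q:]" by (simp add: cpoly_def)
    thus ?case using add[OF c mult[OF x pCons(2)]] by metis
  qed
  moreover have "pCons q p = [:q:] + py * p" by simp
  ultimately show ?case using add mult y pCons by metis
qed

text \<open>
  Substitution, evaluation and grading are homomorphisms out of \<open>k[x,y]\<close>, so that their identities
  reduce to the constants and the two generators.
\<close>

lemma ringhom_polypoly_eq:
  assumes f: "ringhom f" and g: "ringhom g"
    and "\<And>c. f (cpoly c) = g (cpoly c)" "f px = g px" "f py = g py"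
  shows "f p = g p"
proof -
  interpret f: ringhom f by fact
  interpret g: ringhom g by fact
  show ?thesis by (induction p rule: polypoly_induct) (simp_all add: f.hom_simps g.hom_simps assms)
qed

lemma subst_poly_natural:
  assumes g: "ringhom g" and i: "ringhom \<iota>" and gi: "\<And>c. g (\<iota> c) = \<iota>' c"
  shows "g (subst_poly \<iota> p a b) = subst_poly \<iota>' p (g a) (g b)"
proof -
  have "(\<lambda>c. g (\<iota> c)) = \<iota>'" using gi by auto
  hence i': "ringhom \<iota>'" using ringhom_comp[OF i g] by simp
  show ?thesis
    by (rule ringhom_polypoly_eq[OF ringhom_comp[OF ringhom_subst_poly[OF i] g] ringhom_subst_poly[OF i']])
       (simp_all add: subst_poly_gens i i' gi)
qed

lemma subst_poly_subst:
  assumes i: "ringhom \<iota>"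
  shows "subst_poly \<iota> (subst_poly cpoly p f g) a b = subst_poly \<iota> p (subst_poly \<iota> f a b) (subst_poly \<iota> g a b)"
  by (rule subst_poly_natural[OF ringhom_subst_poly[OF i] ringhom_cpoly]) (simp add: subst_poly_gens i)

lemma ratf_eq_subst: "ratf p = subst_poly constf p Xf Yf"
  by (rule ringhom_polypoly_eq[OF ringhom_ratf ringhom_subst_poly[OF ringhom_constf]])
     (simp_all add: subst_poly_gens ringhom_constf constf_def Xf_def Yf_def)

lemma eval_poly_hom: "ringhom (\<lambda>p. eval_poly p a)"
  unfolding eval_poly_def by (intro ringhom_subst_poly ringhom_id)

lemmas eval_poly_simps = ringhom.hom_simps[OF eval_poly_hom]

lemma eval_poly_gens [simp]:
  "eval_poly (cpoly c) a = c" "eval_poly px a = fst a" "eval_poly py a = snd a"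
  by (simp_all add: eval_poly_def subst_poly_gens ringhom_id)

lemma eval_poly_eq_0_imp_0:
  assumes "\<And>a. eval_poly p a = 0" shows "p = 0"
proof -
  have "coeff p j = 0" for j
  proof -
    have "poly (coeff p j) x = 0" for x
    proof -
      have "poly (map_poly (\<lambda>c. poly c x) p) y = 0" for y
        using assms[of "(x, y)"] by (simp add: eval_poly_def subst_poly_def)
      hence "map_poly (\<lambda>c. poly c x) p = 0" using poly_all_0_iff_0 by blast
      hence "coeff (map_poly (\<lambda>c. poly c x) p) j = 0" by simp
      thus ?thesis by (simp add: coeff_map_poly)
    qed
    thus ?thesis using poly_all_0_iff_0 by blast
  qed
  thus ?thesis by (simp add: poly_eq_iff)
qed

lemma eval_poly_eqI: "(\<And>a. eval_poly p a = eval_poly q a) \<Longrightarrow> p = q"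
  using eval_poly_eq_0_imp_0[of "p - q"] by (simp add: eval_poly_simps)

lemma eval_poly_eq_0_generic:
  assumes "D \<noteq> 0" "\<And>a. eval_poly D a \<noteq> 0 \<Longrightarrow> eval_poly p a = 0" shows "p = 0"
proof -
  have "D * p = 0"
    by (rule eval_poly_eq_0_imp_0) (use assms(2) in \<open>auto simp: eval_poly_simps\<close>)
  thus ?thesis using assms(1) by simp
qed

lemma generic_point_exists: "D \<noteq> 0 \<Longrightarrow> \<exists>a. eval_poly D a \<noteq> 0"
  using eval_poly_eq_0_imp_0 by blast


section \<open>The grading of the polynomial ring\<close>

text \<open>
  The polynomial \<open>p(x z, y z)\<close> in \<open>z\<close>, whose coefficients are the homogeneous components of \<open>p\<close>.
\<close>

definition graded :: "'k::comm_ring_1 poly poly \<Rightarrow> 'k poly poly poly" where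
  "graded p = subst_poly (\<lambda>c. [:cpoly c:]) p [:0, px:] [:0, py:]"

lemma ringhom_cpoly2: "ringhom (\<lambda>c. [:cpoly c:])"
  by (intro ringhom_comp[OF ringhom_cpoly] ringhom_const_poly)

lemma ringhom_graded: "ringhom graded"
  unfolding graded_def by (intro ringhom_subst_poly ringhom_cpoly2)

lemmas graded_simps = ringhom.hom_simps[OF ringhom_graded]

lemma graded_gens: "graded (cpoly c) = [:cpoly c:]" "graded px = [:0, px:]" "graded py = [:0, py:]"
  by (simp_all add: graded_def subst_poly_gens ringhom_cpoly2)

lemma coeff_graded:
  "coeff (coeff (coeff (graded p) d) j) i = (if i + j = d then coeff (coeff p j) i else 0)"
proof -
  have const: "coeff (coeff (coeff (graded [:q:]) d) j) i = (if j = 0 \<and> i = d then coeff q i else 0)" for q :: "'a poly" and d i j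
  proof (induction q arbitrary: d i)
    case 0
    show ?case by (simp add: graded_simps)
  next
    case (pCons a q)
    have "[:pCons a q:] = cpoly a + px * [:q:]" by (simp add: cpoly_def)
    hence "graded [:pCons a q:] = [:cpoly a:] + [:0, px:] * graded [:q:]"
      by (simp only: graded_simps graded_gens)
    thus ?case using pCons(2)
      by (cases d; cases i) (auto simp: cpoly_def coeff_pCons split: nat.splits)
  qed
  show ?thesis
  proof (induction p arbitrary: d j)
    case 0
    show ?case by (simp add: graded_simps)
  next
    case (pCons q p)
    have "pCons q p = [:q:] + py * p" by simp
    hence "graded (pCons q p) = graded [:q:] + [:0, py:] * graded p"
      by (simp only: graded_simps graded_gens)
    thus ?case using pCons(2)
      by (cases d; cases j) (auto simp: const coeff_pCons split: nat.splits)
  qed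
qed

lemma hom_poly_iff_graded: "hom_poly d p \<longleftrightarrow> graded p = monom p d"
  by (auto simp: hom_poly_def poly_eq_iff coeff_graded coeff_monom)

lemma hom_poly_component: "hom_poly d (coeff (graded p) d)"
  by (auto simp: hom_poly_def coeff_graded)

lemma subst_poly_scale:
  assumes "ringhom \<iota>"
  shows "subst_poly \<iota> p (z * a) (z * b) = poly (map_poly (\<lambda>c. subst_poly \<iota> c a b) (graded p)) z"
proof -
  interpret s: ringhom "\<lambda>p. subst_poly \<iota> p a b" by (rule ringhom_subst_poly[OF assms])
  show ?thesis
    by (rule ringhom_polypoly_eq[OF ringhom_subst_poly[OF assms]
          ringhom_comp[OF ringhom_comp[OF ringhom_graded ringhom_map_poly[OF s.ringhom_axioms]] ringhom_poly]])
       (simp_all add: subst_poly_gens assms graded_gens map_poly_pCons s.zero)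
qed

lemma poly_graded_1: "poly (graded p) 1 = p"
  by (rule ringhom_polypoly_eq[OF ringhom_comp[OF ringhom_graded ringhom_poly] ringhom_id(1)])
     (simp_all add: graded_gens)

lemma graded_eq_0_iff [simp]: "graded p = 0 \<longleftrightarrow> p = 0"
  using poly_graded_1[of p] by (auto simp: graded_simps)

lemma sum_components: "(\<Sum>k\<le>degree (graded p). coeff (graded p) k) = p"
  using poly_graded_1[of p] by (simp add: poly_altdef)

lemma graded_monomD: "graded p = monom c d \<Longrightarrow> hom_poly d p"
  using poly_graded_1[of p] by (simp add: hom_poly_iff_graded poly_monom)

lemma hom_subst:
  assumes "ringhom \<iota>" "hom_poly d p"
  shows "subst_poly \<iota> p (z * a) (z * b) = z ^ d * subst_poly \<iota> p a b"
proof -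
  interpret s: ringhom "\<lambda>p. subst_poly \<iota> p a b" by (rule ringhom_subst_poly[OF assms(1)])
  show ?thesis using assms(2)
    unfolding subst_poly_scale[OF assms(1)] hom_poly_iff_graded by (simp add: map_poly_monom s.zero poly_monom mult.commute)
qed

lemma hom_eval: "hom_poly d p \<Longrightarrow> eval_poly p (z *\<^sub>R a) = z ^ d * eval_poly p a"
  unfolding eval_poly_def using hom_subst[OF ringhom_id(2)] by simp

lemma hom_poly_0: "hom_poly d 0"
  by (simp add: hom_poly_def)

lemma hom_poly_add: "hom_poly d (p :: 'k::comm_ring_1 poly poly) \<Longrightarrow> hom_poly d q \<Longrightarrow> hom_poly d (p + q)"
  by (simp add: hom_poly_iff_graded graded_simps add_monom)

lemma hom_poly_diff: "hom_poly d (p :: 'k::comm_ring_1 poly poly) \<Longrightarrow> hom_poly d q \<Longrightarrow> hom_poly d (p - q)"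
  by (simp add: hom_poly_iff_graded graded_simps diff_monom)

lemma hom_poly_mult: "hom_poly d (p :: 'k::comm_ring_1 poly poly) \<Longrightarrow> hom_poly e q \<Longrightarrow> hom_poly (d + e) (p * q)"
  by (simp add: hom_poly_iff_graded graded_simps mult_monom)

lemma hom_poly_power: "hom_poly d (p :: 'k::comm_ring_1 poly poly) \<Longrightarrow> hom_poly (d * n) (p ^ n)"
  by (simp add: hom_poly_iff_graded graded_simps monom_power)

lemma hom_poly_gens: "hom_poly 0 (cpoly (c :: 'k::comm_ring_1))" "hom_poly 1 (px :: 'k poly poly)" "hom_poly 1 (py :: 'k poly poly)" "hom_poly 0 (1 :: 'k poly poly)"
  by (simp_all add: hom_poly_iff_graded graded_gens graded_simps(2) monom_0 monom_Suc)

lemma hom_poly_sum: "(\<And>i. i \<in> A \<Longrightarrow> hom_poly d (f i :: 'k::comm_ring_1 poly poly)) \<Longrightarrow> hom_poly d (sum f A)"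
  by (induction A rule: infinite_finite_induct) (simp_all add: hom_poly_0 hom_poly_add)

lemma hom_poly_cmult: "hom_poly d p \<Longrightarrow> hom_poly d (cpoly c * p)"
  using hom_poly_mult[OF hom_poly_gens(1)] by fastforce

lemma hom_poly_subst:
  assumes p: "hom_poly d p" and f: "hom_poly e f" and g: "hom_poly e g"
  shows "hom_poly (d * e) (subst_poly cpoly p f g)"
proof -
  have "graded (subst_poly cpoly p f g) = subst_poly (\<lambda>c. [:cpoly c:]) p (graded f) (graded g)"
    by (rule subst_poly_natural[OF ringhom_graded ringhom_cpoly]) (simp add: graded_gens)
  also have "\<dots> = subst_poly (\<lambda>c. [:cpoly c:]) p (monom 1 e * [:f:]) (monom 1 e * [:g:])"
    using f g by (simp add: hom_poly_iff_graded flip: monom_0) (simp add: mult_monom)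
  also have "\<dots> = monom 1 e ^ d * subst_poly (\<lambda>c. [:cpoly c:]) p [:f:] [:g:]"
    by (rule hom_subst[OF ringhom_cpoly2 p])
  also have "subst_poly (\<lambda>c. [:cpoly c:]) p [:f:] [:g:] = [:subst_poly cpoly p f g:]"
    by (rule subst_poly_natural[OF ringhom_const_poly ringhom_cpoly, symmetric]) simp
  finally have "graded (subst_poly cpoly p f g) = monom (subst_poly cpoly p f g) (d * e)"
    by (simp add: monom_power mult_monom mult.commute flip: monom_0)
  thus ?thesis by (rule graded_monomD)
qed

text \<open>The degree and the order at zero are additive, and they agree only for monomials.\<close>

lemma factor_monom:
  fixes f g :: "'a::idom poly"
  assumes "f * g = monom c n" "c \<noteq> 0"
  shows "\<exists>a i. f = monom a i"
proof -
  have ne: "f \<noteq> 0" "g \<noteq> 0" using assms by auto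
  have "degree f + degree g = n"
    using degree_mult_eq[OF ne] assms by (simp add: degree_monom_eq)
  moreover have "order 0 f + order 0 g = n"
    using order_mult[of f g 0] ne assms by simp
  moreover have "order 0 f \<le> degree f" "order 0 g \<le> degree g" using ne by (auto intro: order_degree)
  ultimately have eq: "order 0 f = degree f" by linarith
  have "monom 1 (degree f) dvd f" using monom_1_dvd_iff[OF ne(1)] eq by simp
  then obtain r where r: "f = monom 1 (degree f) * r" by (auto elim: dvdE)
  have "r \<noteq> 0" using r ne by auto
  hence "degree f = degree f + degree r"
    using r ne by (metis degree_mult_eq degree_monom_eq monom_eq_0_iff zero_neq_one)
  then obtain b where "r = [:b:]" by (metis add_cancel_right_right degree_eq_zeroE)
  hence "f = monom b (degree f)" using r by (simp add: mult_monom flip: monom_0)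
  thus ?thesis by blast
qed

lemma hom_poly_unique: "hom_poly d p \<Longrightarrow> hom_poly e p \<Longrightarrow> p \<noteq> 0 \<Longrightarrow> d = e"
proof -
  assume *: "hom_poly d p" "hom_poly e p" "p \<noteq> 0"
  then obtain j i where "coeff (coeff p j) i \<noteq> 0" by (metis leading_coeff_0_iff)
  thus ?thesis using *(1,2) unfolding hom_poly_def by blast
qed

text \<open>
  Factors of forms are forms, because factors of a monomial in the grading variable are monomials.
\<close>

lemma hom_poly_factor:
  fixes p q :: "'k::idom poly poly"
  assumes "hom_poly d (p * q)" "p * q \<noteq> 0"
  obtains e where "hom_poly e p" "hom_poly (d - e) q" "e \<le> d"
proof -
  have eq: "graded p * graded q = monom (p * q) d"
    using assms(1) by (simp add: hom_poly_iff_graded graded_simps)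
  obtain e where e: "hom_poly e p"
    using factor_monom[OF eq assms(2)] graded_monomD by blast
  have "graded q * graded p = monom (p * q) d" using eq by (simp add: mult.commute)
  then obtain f where f: "hom_poly f q"
    using factor_monom[OF _ assms(2)] graded_monomD by blast
  have "e + f = d" using hom_poly_unique[OF hom_poly_mult[OF e f] assms(1) assms(2)] .
  thus thesis using that[of e] e f by auto
qed


section \<open>Specialization of rational functions\<close>

text \<open>
  A ring is mapped by \<open>e\<close> into a field and by \<open>h\<close> to values; quotients of elements in the image of \<open>e\<close>
  then have partially defined values. This one relation serves the evaluation at real points, the
  composition of rational functions, and the field \<open>\<real>(x,y)(z)\<close> of the translation equation.
\<close>

definition spec :: "('d::comm_ring_1 \<Rightarrow> 'k::field) \<Rightarrow> ('d \<Rightarrow> 'l::field) \<Rightarrow> 'k \<Rightarrow> 'l \<Rightarrow> bool" where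
  "spec e h x w \<longleftrightarrow> (\<exists>p q. h q \<noteq> 0 \<and> e q \<noteq> 0 \<and> x = e p / e q \<and> w = h p / h q)"

locale specialization = e: ringhom e + h: ringhom h
  for e :: "'d::comm_ring_1 \<Rightarrow> 'k::field" and h :: "'d \<Rightarrow> 'l::field" +
  assumes ker: "e p = 0 \<Longrightarrow> h p = 0"
begin

lemma base: "spec e h (e p) (h p)"
  unfolding spec_def by (rule exI[of _ p], rule exI[of _ 1]) (simp add: e.one h.one)

lemma quotient: "h q \<noteq> 0 \<Longrightarrow> spec e h (e p / e q) (h p / h q)"
  unfolding spec_def using ker by blast

lemma unique: assumes "spec e h x w" "spec e h x w'" shows "w = w'"
proof -
  obtain p q p' q' where *: "h q \<noteq> 0" "e q \<noteq> 0" "x = e p / e q" "w = h p / h q"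
    "h q' \<noteq> 0" "e q' \<noteq> 0" "x = e p' / e q'" "w' = h p' / h q'"
    using assms unfolding spec_def by blast
  have "e (p * q' - p' * q) = 0" using * by (simp add: e.hom_simps field_simps)
  hence "h (p * q' - p' * q) = 0" by (rule ker)
  hence "h p * h q' = h p' * h q" by (simp add: h.hom_simps)
  thus ?thesis using * by (simp add: frac_eq_eq)
qed

lemma add: assumes "spec e h x w" "spec e h x' w'" shows "spec e h (x + x') (w + w')"
proof -
  obtain p q p' q' where *: "h q \<noteq> 0" "e q \<noteq> 0" "x = e p / e q" "w = h p / h q"
    "h q' \<noteq> 0" "e q' \<noteq> 0" "x' = e p' / e q'" "w' = h p' / h q'"
    using assms unfolding spec_def by blast
  show ?thesis unfolding spec_def
    by (rule exI[of _ "p * q' + p' * q"], rule exI[of _ "q * q'"])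
       (use * in \<open>simp add: e.hom_simps h.hom_simps add_frac_eq\<close>)
qed

lemma mult: assumes "spec e h x w" "spec e h x' w'" shows "spec e h (x * x') (w * w')"
proof -
  obtain p q p' q' where *: "h q \<noteq> 0" "e q \<noteq> 0" "x = e p / e q" "w = h p / h q"
    "h q' \<noteq> 0" "e q' \<noteq> 0" "x' = e p' / e q'" "w' = h p' / h q'"
    using assms unfolding spec_def by blast
  show ?thesis unfolding spec_def
    by (rule exI[of _ "p * p'"], rule exI[of _ "q * q'"])
       (use * in \<open>simp add: e.hom_simps h.hom_simps\<close>)
qed

lemma inverse: assumes "spec e h x w" "w \<noteq> 0" shows "spec e h (inverse x) (inverse w)"
proof -
  obtain p q where *: "h q \<noteq> 0" "e q \<noteq> 0" "x = e p / e q" "w = h p / h q"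
    using assms unfolding spec_def by blast
  have "h p \<noteq> 0" using * assms by auto
  thus ?thesis unfolding spec_def
    by (intro exI[of _ q] exI[of _ p]) (use * ker in auto)
qed

lemma divide: "spec e h x w \<Longrightarrow> spec e h x' w' \<Longrightarrow> w' \<noteq> 0 \<Longrightarrow> spec e h (x / x') (w / w')"
  by (simp add: divide_inverse mult inverse)

lemma nonzero: "spec e h x w \<Longrightarrow> w \<noteq> 0 \<Longrightarrow> x \<noteq> 0"
  using base[of 0] unique[of 0 w 0] by (auto simp: e.zero h.zero)

lemma one: "spec e h 1 1" using base[of 1] by (simp add: e.one h.one)

lemma uminus: "spec e h x w \<Longrightarrow> spec e h (- x) (- w)"
  using mult[OF base[of "- 1"]] by (fastforce simp: e.hom_simps h.hom_simps)

lemma diff: "spec e h x w \<Longrightarrow> spec e h x' w' \<Longrightarrow> spec e h (x - x') (w - w')"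
  using add[OF _ uminus] by fastforce

lemma power: "spec e h x w \<Longrightarrow> spec e h (x ^ n) (w ^ n)"
  by (induction n) (auto intro: one mult)

lemma power_int: "spec e h x w \<Longrightarrow> w \<noteq> 0 \<or> 0 \<le> n \<Longrightarrow> spec e h (x powi n) (w powi n)"
  by (auto simp: power_int_def intro: power inverse)

lemma subst_poly:
  assumes "ringhom \<iota>" "ringhom \<iota>'" "\<And>c. spec e h (\<iota> c) (\<iota>' c)" "spec e h a a'" "spec e h b b'"
  shows "spec e h (subst_poly \<iota> p a b) (subst_poly \<iota>' p a' b')"
proof -
  interpret s: ringhom "\<lambda>p. subst_poly \<iota> p a b" by (rule ringhom_subst_poly[OF assms(1)])
  interpret s': ringhom "\<lambda>p. subst_poly \<iota>' p a' b'" by (rule ringhom_subst_poly[OF assms(2)])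
  show ?thesis
    by (induction p rule: polypoly_induct)
       (simp_all add: subst_poly_gens assms s.hom_simps s'.hom_simps add mult)
qed

end

definition subst_val :: "('k::field \<Rightarrow> 'l::field) \<Rightarrow> 'k rat_fun \<Rightarrow> 'l \<Rightarrow> 'l \<Rightarrow> 'l \<Rightarrow> bool" where
  "subst_val \<iota> f a b w \<longleftrightarrow> (\<exists>p q. f = Fract p q \<and> subst_poly \<iota> q a b \<noteq> 0 \<and>
      w = subst_poly \<iota> p a b / subst_poly \<iota> q a b)"

lemma Fract_eq_ratf: "Fract p q = ratf p / ratf q"
  by (cases "q = 0") (auto simp: ratf_def fract_collapse Zero_fract_def[symmetric])

lemma ratf_eq_0_iff [simp]: "ratf p = 0 \<longleftrightarrow> p = 0"
  by (simp add: ratf_def Zero_fract_def eq_fract)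

lemma specialization_subst:
  assumes "ringhom \<iota>" shows "specialization ratf (\<lambda>p. subst_poly \<iota> p a b)"
proof -
  interpret s: ringhom "\<lambda>p. subst_poly \<iota> p a b" by (rule ringhom_subst_poly[OF assms(1)])
  show ?thesis
    by (intro specialization.intro ringhom_ratf s.ringhom_axioms specialization_axioms.intro)
       (simp add: s.zero)
qed

lemma subst_val_iff_spec:
  assumes "ringhom \<iota>" shows "subst_val \<iota> f a b w \<longleftrightarrow> spec ratf (\<lambda>p. subst_poly \<iota> p a b) f w"
proof -
  interpret s: ringhom "\<lambda>p. subst_poly \<iota> p a b" by (rule ringhom_subst_poly[OF assms(1)])
  show ?thesis unfolding subst_val_def spec_def using s.zero by (auto simp: Fract_eq_ratf)
qed

lemma substitutable_iff: "substitutable \<iota> f a b \<longleftrightarrow> (\<exists>w. subst_val \<iota> f a b w)"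
  by (auto simp: substitutable_def subst_val_def)

lemma subst_rat_eq:
  assumes "ringhom \<iota>" "subst_val \<iota> f a b w" shows "subst_rat \<iota> f a b = w"
proof -
  interpret specialization ratf "\<lambda>p. subst_poly \<iota> p a b" by (rule specialization_subst[OF assms(1)])
  have "subst_rat \<iota> f a b = (THE w. subst_val \<iota> f a b w)" by (simp add: subst_rat_def subst_val_def)
  also have "\<dots> = w" using assms unique by (auto simp: subst_val_iff_spec)
  finally show ?thesis .
qed

lemma subst_val_Fract:
  "subst_poly \<iota> q a b \<noteq> 0 \<Longrightarrow> subst_val \<iota> (Fract p q) a b (subst_poly \<iota> p a b / subst_poly \<iota> q a b)"
  by (auto simp: subst_val_def)

text \<open>
  A denominator whose specialization is not zero is itself not zero. Thus a substitution is meaningful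
  as soon as it is so at one point, and its value can be computed there.
\<close>

lemma (in specialization) subst_val:
  assumes "ringhom \<iota>" "ringhom \<iota>'" "\<And>c. spec e h (\<iota> c) (\<iota>' c)" "spec e h a a'" "spec e h b b'"
    and "subst_val \<iota>' f a' b' w"
  shows "subst_val \<iota> f a b (subst_rat \<iota> f a b)" "spec e h (subst_rat \<iota> f a b) w"
proof -
  obtain p q where *: "f = Fract p q" "subst_poly \<iota>' q a' b' \<noteq> 0"
    "w = subst_poly \<iota>' p a' b' / subst_poly \<iota>' q a' b'"
    using assms(6) by (auto simp: subst_val_def)
  note s = subst_poly[OF assms(1-5)]
  have 1: "subst_poly \<iota> q a b \<noteq> 0" using nonzero[OF s *(2)] .
  hence 2: "subst_val \<iota> f a b (subst_poly \<iota> p a b / subst_poly \<iota> q a b)"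
    using *(1) subst_val_Fract by blast
  show "subst_val \<iota> f a b (subst_rat \<iota> f a b)" "spec e h (subst_rat \<iota> f a b) w"
    using 2 divide[OF s s *(2)] *(3) subst_rat_eq[OF assms(1) 2] by auto
qed


section \<open>Evaluation at real points\<close>

abbreviation spec_at :: "real \<times> real \<Rightarrow> real rat_fun \<Rightarrow> real \<Rightarrow> bool" where
  "spec_at a \<equiv> spec ratf (\<lambda>p. eval_poly p a)"

interpretation at: specialization ratf "\<lambda>p. eval_poly p a" for a
  unfolding eval_poly_def by (rule specialization_subst[OF ringhom_id(2)])

lemma regular_at_iff: "regular_at f a \<longleftrightarrow> (\<exists>w. spec_at a f w)"
  by (simp add: regular_at_def substitutable_iff subst_val_iff_spec[OF ringhom_id(2)] eval_poly_def)

lemma subst_val_id_iff: "subst_val id f a b w \<longleftrightarrow> spec_at (a, b) f w"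
  by (simp add: subst_val_iff_spec[OF ringhom_id(2)] eval_poly_def)

lemma eval_rat_eq: "spec_at a f w \<Longrightarrow> eval_rat f a = w"
  unfolding eval_rat_def by (rule subst_rat_eq[OF ringhom_id(2)]) (simp add: subst_val_id_iff)

lemma spec_at_constf: "spec_at a (constf c) c"
  using at.base[of a "cpoly c"] by (simp add: constf_def)

lemma spec_at_gens: "spec_at a Xf (fst a)" "spec_at a Yf (snd a)"
  using at.base[of a px] at.base[of a py] by (simp_all add: Xf_def Yf_def)

lemma spec_at_Fract: "eval_poly q a \<noteq> 0 \<Longrightarrow> spec_at a (Fract p q) (eval_poly p a / eval_poly q a)"
  unfolding Fract_eq_ratf by (rule at.quotient)

lemma coprime_representation:
  fixes p q :: "'a::{factorial_ring_gcd,semiring_gcd_mult_normalize}"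
  assumes "p \<noteq> 0 \<or> q \<noteq> 0"
  obtains g p' q' where "g \<noteq> 0" "p = g * p'" "q = g * q'" "coprime p' q'"
proof -
  have "gcd p q \<noteq> 0" using assms by simp
  moreover obtain p' q' where "p = p' * gcd p q" "q = q' * gcd p q" "coprime p' q'"
    using gcd_coprime_exists[OF \<open>gcd p q \<noteq> 0\<close>] by blast
  ultimately show thesis using that[of "gcd p q" p' q'] by (simp add: mult.commute)
qed

lemma rat_fun_coprime:
  fixes f :: "real rat_fun"
  obtains p q where "q \<noteq> 0" "coprime p q" "f = Fract p q"
proof -
  obtain p q where f: "f = Fract p q" "q \<noteq> 0" by (cases f) auto
  obtain g p' q' where *: "g \<noteq> 0" "p = g * p'" "q = g * q'" "coprime p' q'"
    using coprime_representation[of p q] f by blast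
  show thesis by (rule that[of q' p']) (use * f in \<open>auto simp: eq_fract\<close>)
qed

text \<open>
  Any denominator is a multiple of the reduced one, so that it vanishes wherever the latter does.
\<close>

lemma spec_at_coprime_iff:
  assumes "q \<noteq> 0" "coprime p q"
  shows "spec_at a (Fract p q) w \<longleftrightarrow> eval_poly q a \<noteq> 0 \<and> w = eval_poly p a / eval_poly q a"
proof
  assume *: "spec_at a (Fract p q) w"
  have "eval_poly q a \<noteq> 0"
  proof -
    obtain p' q' where "eval_poly q' a \<noteq> 0" "q' \<noteq> 0" "Fract p q = Fract p' q'"
      using * unfolding spec_def by (auto simp: Fract_eq_ratf)
    hence "p * q' = p' * q" using assms by (simp add: eq_fract)
    hence "q dvd p * q'" by simp
    hence "q dvd q'" using assms(2) by (simp add: coprime_commute coprime_dvd_mult_right_iff)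
    then obtain k where "q' = q * k" by blast
    thus ?thesis using \<open>eval_poly q' a \<noteq> 0\<close> by (simp add: eval_poly_simps)
  qed
  thus "eval_poly q a \<noteq> 0 \<and> w = eval_poly p a / eval_poly q a"
    using at.unique[OF * spec_at_Fract] by blast
qed (auto intro: spec_at_Fract)

lemma proj_value_coprime:
  assumes "q \<noteq> 0" "coprime p q"
  shows "proj_value (Fract p q) a = (if eval_poly q a = 0 then None else Some (eval_poly p a / eval_poly q a))"
  using spec_at_coprime_iff[OF assms, of a] eval_rat_eq[of a "Fract p q"]
  by (auto simp: proj_value_def regular_at_iff)

locale rat_map_rep =
  fixes \<phi> :: rat_map and P1 P2 Q :: "real poly poly"
  assumes Q0: "Q \<noteq> 0"
    and regular_iff: "map_regular_at \<phi> x \<longleftrightarrow> eval_poly Q x \<noteq> 0"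
    and phi: "\<phi> = (Fract P1 Q, Fract P2 Q)"
begin

lemma eval: "eval_poly Q x \<noteq> 0 \<Longrightarrow> eval_map \<phi> x = (eval_poly P1 x / eval_poly Q x, eval_poly P2 x / eval_poly Q x)"
  by (simp add: eval_map_def phi eval_rat_eq[OF spec_at_Fract])

end

text \<open>
  Each component is reduced on its own before passing to a common denominator; the zeros of the
  product are therefore exactly the points where a component is not regular.
\<close>

lemma rat_map_rep_exists: "\<exists>P1 P2 Q. rat_map_rep \<phi> P1 P2 Q"
proof -
  obtain p1 q1 where 1: "q1 \<noteq> 0" "coprime p1 q1" "fst \<phi> = Fract p1 q1" using rat_fun_coprime .
  obtain p2 q2 where 2: "q2 \<noteq> 0" "coprime p2 q2" "snd \<phi> = Fract p2 q2" using rat_fun_coprime .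
  have "rat_map_rep \<phi> (p1 * q2) (p2 * q1) (q1 * q2)"
  proof
    show "\<phi> = (Fract (p1 * q2) (q1 * q2), Fract (p2 * q1) (q1 * q2))"
      using 1 2 by (intro prod_eqI) (auto simp: eq_fract mult_ac)
  qed (use 1 2 in \<open>auto simp: map_regular_at_def regular_at_iff spec_at_coprime_iff eval_poly_simps\<close>)
  thus ?thesis by blast
qed

lemma spec_at_subst_rat:
  assumes "spec_at a g u" "spec_at a h v" "spec_at (u, v) f w"
  shows "spec_at a (subst_rat constf f g h) w" "substitutable constf f g h"
  using at.subst_val[OF ringhom_constf ringhom_id(2), of a g u h v f w] assms spec_at_constf
  by (auto simp: subst_val_id_iff substitutable_iff)


section \<open>Specialization of the field of the translation equation\<close>

text \<open>
  The elements of \<open>\<real>(x,y)(z)\<close> are quotients of polynomials from \<open>\<real>[x,y][z]\<close>, which can be evaluated at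
  a point and a value of \<open>z\<close>.
\<close>

definition frac3 :: "real poly poly poly \<Rightarrow> rat_fun3" where
  "frac3 p = Fract (map_poly ratf p) 1"

definition eval3 :: "real \<times> real \<Rightarrow> real \<Rightarrow> real poly poly poly \<Rightarrow> real" where
  "eval3 a z p = poly (map_poly (\<lambda>c. eval_poly c a) p) z"

lemma ringhom_Fract1: "ringhom (\<lambda>p. Fract p 1)"
  by unfold_locales (auto simp: One_fract_def)

lemma ringhom_frac3: "ringhom frac3"
  unfolding frac3_def by (intro ringhom_comp[OF ringhom_map_poly ringhom_Fract1] ringhom_ratf)

lemma ringhom_eval3: "ringhom (eval3 a z)"
  unfolding eval3_def by (intro ringhom_comp[OF ringhom_map_poly ringhom_poly] eval_poly_hom)

lemma frac3_eq_0_iff: "frac3 p = 0 \<longleftrightarrow> p = 0"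
  by (auto simp: frac3_def Zero_fract_def eq_fract map_poly_eq_0_iff ratf_def)

interpretation at3: specialization frac3 "eval3 a z" for a z
  by (intro specialization.intro ringhom_frac3 ringhom_eval3 specialization_axioms.intro)
     (simp add: frac3_eq_0_iff ringhom.zero[OF ringhom_eval3])

abbreviation spec_at3 :: "real \<times> real \<Rightarrow> real \<Rightarrow> rat_fun3 \<Rightarrow> real \<Rightarrow> bool" where
  "spec_at3 a z \<equiv> spec frac3 (eval3 a z)"

lemma ringhom_emb3: "ringhom emb3"
  unfolding emb3_def by (intro ringhom_comp[OF ringhom_const_poly ringhom_Fract1])

lemma ringhom_const3: "ringhom const3"
  unfolding const3_def by (intro ringhom_comp[OF ringhom_constf ringhom_emb3])

lemma spec_at3_emb3: assumes "spec_at a f w" shows "spec_at3 a z (emb3 f) w"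
proof -
  interpret emb3: ringhom emb3 by (rule ringhom_emb3)
  obtain p q where *: "eval_poly q a \<noteq> 0" "ratf q \<noteq> 0" "f = ratf p / ratf q" "w = eval_poly p a / eval_poly q a"
    using assms unfolding spec_def by blast
  have e: "emb3 (ratf r) = frac3 [:r:]" for r by (simp add: emb3_def frac3_def map_poly_pCons ratf_def Zero_fract_def)
  have v: "eval3 a z [:r:] = eval_poly r a" for r by (simp add: eval3_def map_poly_pCons eval_poly_simps)
  have "emb3 f * emb3 (ratf q) = emb3 (ratf p)" using * by (simp flip: emb3.mult)
  moreover have "emb3 (ratf q) \<noteq> 0" using * by (simp add: e frac3_eq_0_iff)
  ultimately have "emb3 f = frac3 [:p:] / frac3 [:q:]" by (simp add: e field_simps)
  thus ?thesis using at3.quotient[of a z "[:q:]" "[:p:]"] * by (simp add: v)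
qed

lemma spec_at3_Z3: "spec_at3 a z Z3 z"
proof -
  have "Z3 = frac3 [:0, 1:]" by (simp add: Z3_def frac3_def map_poly_pCons ratf_def Zero_fract_def[symmetric] One_fract_def[symmetric])
  thus ?thesis using at3.base[of a z "[:0, 1:]"] by (simp add: eval3_def map_poly_pCons eval_poly_simps)
qed

lemma spec_at3_const3: "spec_at3 a z (const3 c) c"
  unfolding const3_def by (rule spec_at3_emb3[OF spec_at_constf])

lemma spec_at3_subst_rat:
  assumes "spec_at3 a z g u" "spec_at3 a z h v" "spec_at (u, v) f w"
  shows "spec_at3 a z (subst_rat const3 f g h) w" "substitutable const3 f g h"
  using at3.subst_val[OF ringhom_const3 ringhom_id(2), of a z g u h v f w] assms spec_at3_const3
  by (auto simp: subst_val_id_iff substitutable_iff)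

lemma map_regular_atD:
  assumes "map_regular_at \<phi> x"
  shows "spec_at x (fst \<phi>) (fst (eval_map \<phi> x))" "spec_at x (snd \<phi>) (snd (eval_map \<phi> x))"
  using assms by (auto simp: map_regular_at_def regular_at_iff eval_map_def eval_rat_eq)

text \<open>
  This is what links the formal translation equation with real points: if the three values of \<open>\<phi>\<close>
  exist, then both of its sides have the expected values.
\<close>

lemma translation_sides:
  assumes z: "z \<noteq> 0" and r: "map_regular_at \<phi> x" "map_regular_at \<phi> (z *\<^sub>R x)"
    "map_regular_at \<phi> (((1 - z) / z) *\<^sub>R eval_map \<phi> (z *\<^sub>R x))"
  defines "a \<equiv> subst_rat const3 (fst \<phi>) (emb3 Xf * Z3) (emb3 Yf * Z3) * ((1 - Z3) / Z3)"
  defines "b \<equiv> subst_rat const3 (snd \<phi>) (emb3 Xf * Z3) (emb3 Yf * Z3) * ((1 - Z3) / Z3)"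
  shows "substitutable const3 (fst \<phi>) a b" "substitutable const3 (snd \<phi>) a b"
    "spec_at3 x z ((1 - Z3) * emb3 (fst \<phi>)) ((1 - z) * fst (eval_map \<phi> x))"
    "spec_at3 x z ((1 - Z3) * emb3 (snd \<phi>)) ((1 - z) * snd (eval_map \<phi> x))"
    "spec_at3 x z (subst_rat const3 (fst \<phi>) a b) (fst (eval_map \<phi> (((1 - z) / z) *\<^sub>R eval_map \<phi> (z *\<^sub>R x))))"
    "spec_at3 x z (subst_rat const3 (snd \<phi>) a b) (snd (eval_map \<phi> (((1 - z) / z) *\<^sub>R eval_map \<phi> (z *\<^sub>R x))))"
proof -
  have s: "spec_at3 x z (emb3 Xf * Z3) (fst (z *\<^sub>R x))" "spec_at3 x z (emb3 Yf * Z3) (snd (z *\<^sub>R x))"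
    using at3.mult[OF spec_at3_emb3[OF spec_at_gens(1)] spec_at3_Z3, of x z] at3.mult[OF spec_at3_emb3[OF spec_at_gens(2)] spec_at3_Z3, of x z]
    by (simp_all add: mult.commute)
  have q: "spec_at3 x z ((1 - Z3) / Z3) ((1 - z) / z)" "spec_at3 x z (1 - Z3) (1 - z)"
    using z by (auto intro: at3.divide at3.diff at3.one spec_at3_Z3)
  have m: "spec_at3 x z a (fst (((1 - z) / z) *\<^sub>R eval_map \<phi> (z *\<^sub>R x)))"
     "spec_at3 x z b (snd (((1 - z) / z) *\<^sub>R eval_map \<phi> (z *\<^sub>R x)))"
    using at3.mult[OF spec_at3_subst_rat(1)[OF s, unfolded prod.collapse, OF map_regular_atD(1)[OF r(2)]] q(1)]
      at3.mult[OF spec_at3_subst_rat(1)[OF s, unfolded prod.collapse, OF map_regular_atD(2)[OF r(2)]] q(1)]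
    unfolding a_def b_def by (simp_all add: mult.commute)
  show "spec_at3 x z ((1 - Z3) * emb3 (fst \<phi>)) ((1 - z) * fst (eval_map \<phi> x))"
    "spec_at3 x z ((1 - Z3) * emb3 (snd \<phi>)) ((1 - z) * snd (eval_map \<phi> x))"
    by (intro at3.mult q spec_at3_emb3 map_regular_atD r)+
  show "substitutable const3 (fst \<phi>) a b" "substitutable const3 (snd \<phi>) a b"
    "spec_at3 x z (subst_rat const3 (fst \<phi>) a b) (fst (eval_map \<phi> (((1 - z) / z) *\<^sub>R eval_map \<phi> (z *\<^sub>R x))))"
    "spec_at3 x z (subst_rat const3 (snd \<phi>) a b) (snd (eval_map \<phi> (((1 - z) / z) *\<^sub>R eval_map \<phi> (z *\<^sub>R x))))"
    using spec_at3_subst_rat[OF m, unfolded prod.collapse, OF map_regular_atD(1)[OF r(3)]]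
      spec_at3_subst_rat[OF m, unfolded prod.collapse, OF map_regular_atD(2)[OF r(3)]] by blast+
qed

lemma translation_equation_at:
  assumes "translation_equation \<phi>" "z \<noteq> 0" "map_regular_at \<phi> x" "map_regular_at \<phi> (z *\<^sub>R x)"
    "map_regular_at \<phi> (((1 - z) / z) *\<^sub>R eval_map \<phi> (z *\<^sub>R x))"
  shows "(1 - z) *\<^sub>R eval_map \<phi> x = eval_map \<phi> (((1 - z) / z) *\<^sub>R eval_map \<phi> (z *\<^sub>R x))"
proof -
  note s = translation_sides[OF assms(2-5)]
  from assms(1) show ?thesis unfolding translation_equation_def Let_def
    using at3.unique[OF s(3)] at3.unique[OF s(4)] s(5,6) by (auto intro!: prod_eqI)
qed

text \<open>The polynomial \<open>p(z a)\<close> in \<open>z\<close>.\<close>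

definition ray :: "real \<times> real \<Rightarrow> real poly poly \<Rightarrow> real poly" where
  "ray a p = map_poly (\<lambda>c. eval_poly c a) (graded p)"

lemma poly_ray: "poly (ray a p) z = eval_poly p (z *\<^sub>R a)"
  using subst_poly_scale[OF ringhom_id(2), of p z "fst a" "snd a"] by (simp add: ray_def eval_poly_def)

lemma infinite_roots_poly_0: "infinite {z. poly p z = 0} \<Longrightarrow> p = (0 :: 'a::idom poly)"
  using poly_roots_finite by blast

lemma infinite_mono: "infinite {z. P z} \<Longrightarrow> (\<And>z. P z \<Longrightarrow> Q z) \<Longrightarrow> infinite {z. Q z}"
  by (erule contrapos_nn, rule finite_subset) auto

lemma infinite2_mono:
  "infinite {l. infinite {z. P l z}} \<Longrightarrow> (\<And>l z. P l z \<Longrightarrow> Q l z) \<Longrightarrow> infinite {l. infinite {z. Q l z}}"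
  by (erule infinite_mono, erule infinite_mono) auto

lemma eval_poly_0_of_rays:
  assumes "D \<noteq> 0" "\<And>x. eval_poly D x \<noteq> 0 \<Longrightarrow> infinite {l. eval_poly p (l *\<^sub>R x) = 0}"
  shows "p = 0"
proof (rule eval_poly_eq_0_generic[OF assms(1)])
  fix x assume "eval_poly D x \<noteq> 0"
  hence "infinite {l. poly (ray x p) l = 0}" using assms(2) by (simp add: poly_ray)
  hence "ray x p = 0" by (rule infinite_roots_poly_0)
  thus "eval_poly p x = 0" using poly_ray[of x p 1] by simp
qed

text \<open>Each coefficient vanishes at infinitely many points of almost every ray.\<close>

lemma eval3_0_of_rays:
  assumes D: "D \<noteq> 0"
    and inf: "\<And>x. eval_poly D x \<noteq> 0 \<Longrightarrow> infinite {l. infinite {z. eval3 (l *\<^sub>R x) z p = 0}}"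
  shows "p = 0"
proof -
  have "coeff p j = 0" for j
  proof (rule eval_poly_0_of_rays[OF D])
    fix x assume "eval_poly D x \<noteq> 0"
    hence i: "infinite {l. infinite {z. eval3 (l *\<^sub>R x) z p = 0}}" by (rule inf)
    have "eval_poly (coeff p j) (l *\<^sub>R x) = 0" if "infinite {z. eval3 (l *\<^sub>R x) z p = 0}" for l
    proof -
      have "map_poly (\<lambda>c. eval_poly c (l *\<^sub>R x)) p = 0"
        using infinite_roots_poly_0 that unfolding eval3_def by blast
      from this[THEN arg_cong, of "\<lambda>p. coeff p j"] show ?thesis by (simp add: coeff_map_poly eval_poly_simps)
    qed
    thus "infinite {l. eval_poly (coeff p j) (l *\<^sub>R x) = 0}"
      by (rule infinite_mono[OF i])
  qed
  thus ?thesis by (simp add: poly_eq_iff)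
qed

lemma rat_fun3_eqI:
  assumes D: "D \<noteq> 0" and "\<And>x. eval_poly D x \<noteq> 0 \<Longrightarrow>
     infinite {l. infinite {z. \<exists>w. spec_at3 (l *\<^sub>R x) z f w \<and> spec_at3 (l *\<^sub>R x) z g w}}"
  shows "f = g"
proof -
  obtain x where "eval_poly D x \<noteq> 0" using generic_point_exists[OF D] by blast
  have ex: "\<exists>y. y \<in> A" if "infinite A" for A :: "real set" using that by (metis finite.emptyI equals0I)
  from ex[OF assms(2)[OF \<open>eval_poly D x \<noteq> 0\<close>]] obtain l z w where
    "spec_at3 (l *\<^sub>R x) z f w" "spec_at3 (l *\<^sub>R x) z g w" using ex by blast
  from at3.diff[OF this] obtain p q where pq: "frac3 q \<noteq> 0" "f - g = frac3 p / frac3 q"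
    unfolding spec_def by blast
  have z: "eval3 a z p = 0" if w: "spec_at3 a z f w" "spec_at3 a z g w" for a z w
  proof -
    have "spec_at3 a z (f - g) 0" using at3.diff[OF w] by simp
    hence "spec_at3 a z (frac3 p) 0"
      using at3.mult[OF _ at3.base[of a z q]] pq by fastforce
    thus ?thesis using at3.unique at3.base by blast
  qed
  have "p = 0"
    by (rule eval3_0_of_rays[OF D], erule infinite2_mono[OF assms(2)]) (use z in blast)
  thus ?thesis using pq by (simp add: ringhom.zero[OF ringhom_frac3])
qed

text \<open>
  An identity of rational functions holds if it does so on a dense set. The set is chosen with a view
  to homogeneous maps, for which the exceptions on a ray and among the parameters are finite in
  number.
\<close>

lemma translation_equationI:
  assumes D: "D \<noteq> 0" and "\<And>x. eval_poly D x \<noteq> 0 \<Longrightarrow>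
     infinite {l. infinite {z. z \<noteq> 0 \<and> map_regular_at \<phi> (l *\<^sub>R x) \<and> map_regular_at \<phi> (z *\<^sub>R l *\<^sub>R x) \<and>
       map_regular_at \<phi> (((1 - z) / z) *\<^sub>R eval_map \<phi> (z *\<^sub>R l *\<^sub>R x)) \<and>
       (1 - z) *\<^sub>R eval_map \<phi> (l *\<^sub>R x) = eval_map \<phi> (((1 - z) / z) *\<^sub>R eval_map \<phi> (z *\<^sub>R l *\<^sub>R x))}}"
    (is "\<And>x. _ \<Longrightarrow> infinite {l. infinite {z. ?good (l *\<^sub>R x) z}}")
  shows "translation_equation \<phi>"
proof -
  define a where "a = subst_rat const3 (fst \<phi>) (emb3 Xf * Z3) (emb3 Yf * Z3) * ((1 - Z3) / Z3)"
  define b where "b = subst_rat const3 (snd \<phi>) (emb3 Xf * Z3) (emb3 Yf * Z3) * ((1 - Z3) / Z3)"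
  have ex: "\<exists>y. y \<in> A" if "infinite A" for A :: "real set" using that by (metis finite.emptyI equals0I)
  obtain x where "eval_poly D x \<noteq> 0" using generic_point_exists[OF D] by blast
  from ex[OF assms(2)[OF this]] obtain l z where "?good (l *\<^sub>R x) z" using ex by blast
  hence s: "substitutable const3 (fst \<phi>) a b" "substitutable const3 (snd \<phi>) a b"
    using translation_sides(1,2)[of z \<phi> "l *\<^sub>R x", folded a_def b_def] by simp_all
  have good: "\<exists>w. spec_at3 y z ((1 - Z3) * emb3 (fst \<phi>)) w \<and> spec_at3 y z (subst_rat const3 (fst \<phi>) a b) w"
    "\<exists>w. spec_at3 y z ((1 - Z3) * emb3 (snd \<phi>)) w \<and> spec_at3 y z (subst_rat const3 (snd \<phi>) a b) w"
    if "?good y z" for y z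
  proof -
    let ?w = "eval_map \<phi> (((1 - z) / z) *\<^sub>R eval_map \<phi> (z *\<^sub>R y))"
    have e: "(1 - z) * fst (eval_map \<phi> y) = fst ?w" "(1 - z) * snd (eval_map \<phi> y) = snd ?w"
      using that by (metis fst_scaleR real_scaleR_def, metis snd_scaleR real_scaleR_def)
    note ts = translation_sides(3-6)[of z \<phi> y, folded a_def b_def, unfolded e]
    show "\<exists>w. spec_at3 y z ((1 - Z3) * emb3 (fst \<phi>)) w \<and> spec_at3 y z (subst_rat const3 (fst \<phi>) a b) w"
      by (rule exI[of _ "fst ?w"], intro conjI ts) (use that in simp_all)
    show "\<exists>w. spec_at3 y z ((1 - Z3) * emb3 (snd \<phi>)) w \<and> spec_at3 y z (subst_rat const3 (snd \<phi>) a b) w"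
      by (rule exI[of _ "snd ?w"], intro conjI ts) (use that in simp_all)
  qed
  have "(1 - Z3) * emb3 (fst \<phi>) = subst_rat const3 (fst \<phi>) a b"
    by (rule rat_fun3_eqI[OF D], erule infinite2_mono[OF assms(2)], rule good(1))
  moreover have "(1 - Z3) * emb3 (snd \<phi>) = subst_rat const3 (snd \<phi>) a b"
    by (rule rat_fun3_eqI[OF D], erule infinite2_mono[OF assms(2)], rule good(2))
  ultimately show ?thesis
    using s unfolding translation_equation_def Let_def a_def b_def by blast
qed


section \<open>Trajectories\<close>

definition traj :: "rat_map \<Rightarrow> real \<times> real \<Rightarrow> real \<Rightarrow> real \<times> real" where
  "traj \<phi> a z = (1 / z) *\<^sub>R eval_map \<phi> (z *\<^sub>R a)"

lemma orbit_eq_traj: "orbit \<phi> a = insert a (traj \<phi> a ` {z. z \<noteq> 0 \<and> map_regular_at \<phi> (z *\<^sub>R a)})"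
  by (auto simp: orbit_def traj_def)

text \<open>This is the translation equation at the point \<open>(z + w) a\<close> with the parameter \<open>z / (z + w)\<close>.\<close>

lemma traj_shift:
  assumes t: "translation_equation \<phi>" and nz: "z \<noteq> 0" "w \<noteq> 0" "z + w \<noteq> 0"
    and r: "map_regular_at \<phi> (z *\<^sub>R a)" "map_regular_at \<phi> ((z + w) *\<^sub>R a)"
      "map_regular_at \<phi> (w *\<^sub>R traj \<phi> a z)"
  shows "traj \<phi> a (z + w) = traj \<phi> (traj \<phi> a z) w"
proof -
  define z' where "z' = z / (z + w)"
  have z'1: "z' * (z + w) = z" using nz by (simp add: z'_def)
  have z': "z' \<noteq> 0" "1 - z' = w / (z + w)" "z' *\<^sub>R (z + w) *\<^sub>R a = z *\<^sub>R a"
    using nz z'1 by (auto simp: z'_def diff_divide_eq_iff)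
  have z'': "(1 - z') / z' = w / z" unfolding z'(2) using nz by (simp add: z'_def)
  have wz: "(w / z) *\<^sub>R eval_map \<phi> (z *\<^sub>R a) = w *\<^sub>R traj \<phi> a z"
    by (simp add: traj_def)
  have "(w / (z + w)) *\<^sub>R eval_map \<phi> ((z + w) *\<^sub>R a) = eval_map \<phi> (w *\<^sub>R traj \<phi> a z)"
    using translation_equation_at[OF t z'(1), of "(z + w) *\<^sub>R a", unfolded z'(3), unfolded z'', unfolded z'(2) wz] r
    by blast
  hence "(1 / w) *\<^sub>R (w / (z + w)) *\<^sub>R eval_map \<phi> ((z + w) *\<^sub>R a) = (1 / w) *\<^sub>R eval_map \<phi> (w *\<^sub>R traj \<phi> a z)"
    by simp
  thus ?thesis using nz by (simp add: traj_def)
qed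

lemma traj_scale: "l \<noteq> 0 \<Longrightarrow> traj \<phi> (l *\<^sub>R a) z = l *\<^sub>R traj \<phi> a (l * z)"
  by (simp add: traj_def mult.commute)


section \<open>Binary forms evaluated at two polynomials in one variable\<close>

definition form_at :: "real poly poly \<Rightarrow> real poly \<Rightarrow> real poly \<Rightarrow> real poly" where
  "form_at G \<alpha> \<beta> = subst_poly (\<lambda>c. [:c:]) G \<alpha> \<beta>"

lemma poly_eqI_all: "(\<And>x. poly p x = poly q x) \<Longrightarrow> p = (q :: real poly)"
  by (intro poly_eq_poly_eq_iff[THEN iffD1] ext)

lemma ringhom_form_at: "ringhom (\<lambda>G. form_at G \<alpha> \<beta>)"
  unfolding form_at_def by (rule ringhom_subst_poly[OF ringhom_const_poly])

lemmas form_at_simps = ringhom.hom_simps[OF ringhom_form_at]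

lemma form_at_gens [simp]: "form_at (cpoly c) \<alpha> \<beta> = [:c:]" "form_at px \<alpha> \<beta> = \<alpha>" "form_at py \<alpha> \<beta> = \<beta>"
  by (simp_all add: form_at_def subst_poly_gens ringhom_const_poly)

lemma poly_form_at: "poly (form_at G \<alpha> \<beta>) z = eval_poly G (poly \<alpha> z, poly \<beta> z)"
  unfolding form_at_def eval_poly_def
  using subst_poly_natural[OF ringhom_poly[of z] ringhom_const_poly, of id G \<alpha> \<beta>] by simp

lemma form_at_subst: "form_at (subst_poly cpoly G f g) \<alpha> \<beta> = form_at G (form_at f \<alpha> \<beta>) (form_at g \<alpha> \<beta>)"
  unfolding form_at_def by (rule subst_poly_subst[OF ringhom_const_poly])

lemma form_at_pcompose: "pcompose (form_at G \<alpha> \<beta>) s = form_at G (pcompose \<alpha> s) (pcompose \<beta> s)"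
  unfolding form_at_def by (rule subst_poly_natural[OF ringhom_pcompose ringhom_const_poly]) simp

text \<open>The homogenization of \<open>p\<close> in degree \<open>d\<close>, taken at \<open>(\<alpha>, \<beta>)\<close>.\<close>

definition hz :: "nat \<Rightarrow> real poly \<Rightarrow> real poly \<Rightarrow> real poly \<Rightarrow> real poly" where
  "hz d p \<alpha> \<beta> = (\<Sum>j\<le>d. smult (coeff p j) (\<alpha> ^ (d - j) * \<beta> ^ j))"

text \<open>The polynomial \<open>G(1, t)\<close> of a form \<open>G\<close> of degree \<open>d\<close>.\<close>

definition dehom :: "nat \<Rightarrow> real poly poly \<Rightarrow> real poly" where
  "dehom d G = (\<Sum>j\<le>d. monom (coeff (coeff G j) (d - j)) j)"

lemma coeff_dehom: "coeff (dehom d G) j = (if j \<le> d then coeff (coeff G j) (d - j) else 0)"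
  unfolding dehom_def by (auto simp: coeff_sum intro: sum.neutral)

lemma degree_dehom: "degree (dehom d G) \<le> d"
  by (rule degree_le) (simp add: coeff_dehom)

lemma form_expansion:
  assumes "hom_poly d G"
  shows "G = (\<Sum>j\<le>d. cpoly (coeff (dehom d G) j) * (px ^ (d - j) * py ^ j))"
proof -
  have m: "cpoly c * (px ^ i * py ^ j) = monom (monom c i) j" for c :: real and i j
  proof -
    have "(px :: real poly poly) ^ i = [:monom 1 i:]"
      by (induction i) (simp_all add: monom_Suc one_pCons mult_pCons_left)
    moreover have "(py :: real poly poly) ^ j = monom 1 j" by (simp add: monom_altdef)
    ultimately show ?thesis by (simp add: cpoly_def smult_monom mult_pCons_left)
  qed
  have "coeff (coeff G j) i = (if j \<le> d \<and> i = d - j then coeff (coeff G j) (d - j) else 0)" for i j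
    using assms unfolding hom_poly_def by (metis add_diff_cancel_right' le_add2)
  moreover have "coeff (coeff (\<Sum>k\<le>d. monom (monom (coeff (dehom d G) k) (d - k)) k) j) i
      = (if j \<le> d \<and> i = d - j then coeff (coeff G j) (d - j) else 0)" for i j
  proof -
    have "coeff (coeff (\<Sum>k\<le>d. monom (monom (coeff (dehom d G) k) (d - k)) k) j) i
        = (\<Sum>k\<le>d. if k = j then (if i = d - j then coeff (dehom d G) j else 0) else 0)"
      unfolding coeff_sum by (intro sum.cong) auto
    thus ?thesis by (simp add: coeff_dehom)
  qed
  ultimately show ?thesis unfolding m by (simp add: poly_eq_iff)
qed

lemma form_at_eq_hz: "hom_poly d G \<Longrightarrow> form_at G \<alpha> \<beta> = hz d (dehom d G) \<alpha> \<beta>"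
  by (subst form_expansion) (auto simp: form_at_simps hz_def)

lemma dehom_eq_0: "hom_poly d G \<Longrightarrow> dehom d G = 0 \<Longrightarrow> G = 0"
  by (subst form_expansion) (auto simp: cpoly_def)

lemma hz_const: "hz d p [:k:] \<beta> = pcompose (\<Sum>j\<le>d. monom (coeff p j * k ^ (d - j)) j) \<beta>"
proof -
  have "pcompose (monom c j) \<beta> = smult c (\<beta> ^ j)" for c j
    by (simp add: monom_altdef pcompose_smult ringhom.power[OF ringhom_pcompose] pcompose_pCons)
  thus ?thesis by (simp add: hz_def pcompose_sum poly_const_pow mult.commute)
qed

lemma hz_const_coeff: "coeff (\<Sum>j\<le>d. monom (coeff p j * k ^ (d - j)) j) i = (if i \<le> d then coeff p i * k ^ (d - i) else (0::real))"
  by (auto simp: coeff_sum intro: sum.neutral)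

lemma hz_lower:
  assumes "degree p \<le> d"
  shows "hz d p \<alpha> \<beta> = \<alpha> ^ (d - degree p) * hz (degree p) p \<alpha> \<beta>"
proof -
  have "hz d p \<alpha> \<beta> = (\<Sum>j\<le>degree p. smult (coeff p j) (\<alpha> ^ (d - j) * \<beta> ^ j))"
    unfolding hz_def by (rule sum.mono_neutral_right) (use assms in \<open>auto simp: coeff_eq_0\<close>)
  also have "\<dots> = (\<Sum>j\<le>degree p. \<alpha> ^ (d - degree p) * smult (coeff p j) (\<alpha> ^ (degree p - j) * \<beta> ^ j))"
    by (rule sum.cong) (use assms in \<open>auto simp flip: power_add mult.assoc\<close>)
  finally show ?thesis by (simp add: hz_def sum_distrib_left)
qed

lemma hz_Suc: "hz (Suc d) p \<alpha> \<beta> = \<alpha> * hz d p \<alpha> \<beta> + smult (coeff p (Suc d)) (\<beta> ^ Suc d)"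
  by (simp add: hz_def sum_distrib_left Suc_diff_le mult.assoc)

text \<open>
  If \<open>\<alpha>\<close> is not a unit, then it divides all terms except for the multiple of \<open>\<beta>^d\<close>. Hence this term is
  zero, and \<open>\<alpha>\<close> can be cancelled. If \<open>\<alpha>\<close> is a constant, then \<open>\<beta>\<close> is transcendental.
\<close>

lemma hz_eq_0_imp_0:
  assumes cop: "coprime \<alpha> \<beta>" and nc: "degree \<alpha> > 0 \<or> degree \<beta> > 0"
    and "degree p \<le> d" "hz d p \<alpha> \<beta> = 0"
  shows "p = 0"
proof (cases "is_unit \<alpha>")
  case True
  hence "degree \<alpha> = 0" "\<alpha> \<noteq> 0" using is_unit_iff_degree[of \<alpha>] not_is_unit_0 by blast+
  then obtain k where k: "\<alpha> = [:k:]" "k \<noteq> 0" by (metis degree_eq_zeroE pCons_0_0)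
  hence "degree \<beta> > 0" using nc by simp
  hence "(\<Sum>j\<le>d. monom (coeff p j * k ^ (d - j)) j) = 0"
    using assms(4) pcompose_eq_0 unfolding k hz_const by blast
  hence "(if i \<le> d then coeff p i * k ^ (d - i) else 0) = 0" for i
    using hz_const_coeff[of p k d i] by simp
  hence "coeff p i = 0" if "i \<le> d" for i using that k by (metis mult_eq_0_iff power_not_zero)
  thus ?thesis using assms(3) by (metis leading_coeff_0_iff)
next
  case False
  have "\<alpha> \<noteq> 0"
  proof
    assume "\<alpha> = 0"
    hence "is_unit \<beta>" "degree \<beta> > 0" using cop nc by auto
    thus False using is_unit_iff_degree[of \<beta>] by force
  qed
  show ?thesis using assms(3,4)
  proof (induction d)
    case 0
    hence "coeff p 0 = 0" by (simp add: hz_def)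
    thus ?case using 0 by (metis le_zero_eq leading_coeff_0_iff)
  next
    case (Suc d)
    have "coeff p (Suc d) = 0"
    proof (rule ccontr)
      assume c: "coeff p (Suc d) \<noteq> 0"
      have "smult (coeff p (Suc d)) (\<beta> ^ Suc d) = \<alpha> * - hz d p \<alpha> \<beta>"
        using Suc.prems(2) unfolding hz_Suc by (simp add: eq_neg_iff_add_eq_0 add.commute)
      hence "\<alpha> dvd smult (coeff p (Suc d)) (\<beta> ^ Suc d)" by simp
      hence "\<alpha> dvd \<beta> ^ Suc d" using c by (simp add: dvd_smult_iff)
      moreover have "coprime \<alpha> (\<beta> ^ Suc d)" using cop by (simp only: coprime_power_right_iff) simp
      ultimately show False using False by (metis coprime_absorb_left)
    qed
    moreover from this have "degree p \<le> d"
      using Suc.prems(1) by (metis le_SucE leading_coeff_0_iff degree_0 zero_le)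
    ultimately show ?case using Suc \<open>\<alpha> \<noteq> 0\<close> by (simp add: hz_Suc)
  qed
qed

lemma form_at_eq_0_imp_0:
  assumes "coprime \<alpha> \<beta>" "degree \<alpha> > 0 \<or> degree \<beta> > 0" "hom_poly d G" "form_at G \<alpha> \<beta> = 0"
  shows "G = 0"
  using hz_eq_0_imp_0[OF assms(1,2) degree_dehom, of d G] assms(3,4) form_at_eq_hz dehom_eq_0 by metis


section \<open>Polynomials whose derivative is algebraic over their values\<close>

lemma coprime_pcompose:
  fixes p q \<beta> :: "real poly"
  assumes "coprime p q" shows "coprime (pcompose p \<beta>) (pcompose q \<beta>)"
proof -
  obtain u v where "u * p + v * q = 1"
    using bezout_coefficients_fst_snd[of p q] assms by (metis coprime_iff_gcd_eq_1)
  from this[THEN arg_cong, of "\<lambda>p. pcompose p \<beta>"]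
  have e: "pcompose u \<beta> * pcompose p \<beta> + pcompose v \<beta> * pcompose q \<beta> = 1"
    by (simp add: pcompose_add pcompose_mult pcompose_1)
  show ?thesis
  proof (rule coprimeI)
    fix c assume "c dvd pcompose p \<beta>" "c dvd pcompose q \<beta>"
    thus "is_unit c" using e by (metis dvd_add dvd_mult)
  qed
qed

lemma prime_factor_poly:
  fixes f :: "real poly"
  assumes "degree f > 0" obtains \<pi> where "prime_elem \<pi>" "\<pi> dvd f"
proof -
  have "f \<noteq> 0" using assms by auto
  moreover have "\<not> is_unit f" using assms is_unit_iff_degree[OF \<open>f \<noteq> 0\<close>] by simp
  ultimately show thesis using prime_divisor_exists[of f] that by (metis prime_def)
qed

lemma degree_1_polyE:
  assumes "degree p = 1" obtains a b where "p = [:a, b:]" "b \<noteq> 0"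
proof -
  obtain a q where p: "p = pCons a q" by (cases p)
  hence "degree q = 0" "q \<noteq> 0" using assms by (auto split: if_splits)
  then obtain b where "q = [:b:]" "b \<noteq> 0" by (metis degree_eq_zeroE pCons_0_0)
  thus thesis using that p by blast
qed

lemma prime_elem_degree: "prime_elem (\<pi> :: real poly) \<Longrightarrow> degree \<pi> > 0"
  by (metis gr0I is_unit_iff_degree prime_elem_def)

lemma prime_elem_not_dvd_pderiv:
  fixes \<pi> :: "real poly" assumes "prime_elem \<pi>" shows "\<not> \<pi> dvd pderiv \<pi>"
proof
  have d: "degree \<pi> > 0" using assms by (rule prime_elem_degree)
  assume "\<pi> dvd pderiv \<pi>"
  hence "degree \<pi> \<le> degree (pderiv \<pi>)"
    using d by (intro dvd_imp_degree_le) (auto simp: pderiv_eq_0_iff)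
  thus False using d by (simp add: degree_pderiv)
qed

lemma multiplicity_decompose:
  fixes f \<pi> :: "real poly"
  assumes "prime_elem \<pi>" "f \<noteq> 0"
  obtains g where "f = \<pi> ^ multiplicity \<pi> f * g" "\<not> \<pi> dvd g"
  using multiplicity_decompose'[of f \<pi>] assms prime_elem_not_unit by metis

lemma multiplicityI:
  fixes \<pi> :: "real poly"
  assumes "prime_elem \<pi>" "f = \<pi> ^ n * g" "\<not> \<pi> dvd g"
  shows "multiplicity \<pi> f = n"
proof (rule multiplicity_eqI)
  show "\<pi> ^ n dvd f" using assms by simp
  show "\<not> \<pi> ^ Suc n dvd f" using assms by (auto simp: mult.commute)
qed

text \<open>Only the term \<open>f' g\<close> has the lower multiplicity, as \<open>\<pi>\<close> does not divide its own derivative.\<close>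

lemma multiplicity_wronskian:
  fixes f g \<pi> :: "real poly"
  assumes \<pi>: "prime_elem \<pi>" "\<pi> dvd f" "f \<noteq> 0" "\<not> \<pi> dvd g"
  shows "multiplicity \<pi> (f * pderiv g - pderiv f * g) + 1 = multiplicity \<pi> f"
proof -
  obtain h where h: "f = \<pi> ^ multiplicity \<pi> f * h" "\<not> \<pi> dvd h"
    using multiplicity_decompose \<pi> by blast
  have "multiplicity \<pi> f \<noteq> 0" using h \<pi>(2) by (metis mult_1 power_0)
  then obtain r where r: "multiplicity \<pi> f = Suc r" using not0_implies_Suc by blast
  have f: "f = \<pi> ^ Suc r * h" using h r by simp
  have "f * pderiv g - pderiv f * g
      = \<pi> ^ r * (\<pi> * (h * pderiv g - pderiv h * g) - smult (real (Suc r)) (pderiv \<pi> * h * g))"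
    unfolding f pderiv_mult pderiv_power_Suc by (simp add: algebra_simps)
  moreover have "\<not> \<pi> dvd \<pi> * (h * pderiv g - pderiv h * g) - smult (real (Suc r)) (pderiv \<pi> * h * g)"
  proof
    assume "\<pi> dvd \<pi> * (h * pderiv g - pderiv h * g) - smult (real (Suc r)) (pderiv \<pi> * h * g)"
    hence "\<pi> dvd smult (real (Suc r)) (pderiv \<pi> * h * g)"
      by (metis dvd_diff_right_iff dvd_triv_left)
    hence "\<pi> dvd pderiv \<pi> * h * g" by (subst (asm) dvd_smult_iff) auto
    thus False using \<pi>(1,4) h(2) prime_elem_not_dvd_pderiv prime_elem_dvd_mult_iff by blast
  qed
  ultimately show ?thesis using multiplicityI[OF \<pi>(1)] r by simp
qed

lemma multiplicity_pderiv:
  fixes f \<pi> :: "real poly"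
  assumes "prime_elem \<pi>" "\<pi> dvd f" "f \<noteq> 0"
  shows "multiplicity \<pi> (pderiv f) + 1 = multiplicity \<pi> f"
  using multiplicity_wronskian[OF assms, of "-1"] assms(1) prime_elem_not_unit[of \<pi>]
  by (simp add: pderiv_minus)

text \<open>
  After cancellation, \<open>q\<close> is a constant, because \<open>p(\<beta>)\<close> and \<open>q(\<beta>)\<close> remain coprime. Then \<open>deg p < N\<close>.
  Let \<open>\<pi>\<close> be a prime factor of \<open>p\<close> of multiplicity \<open>e\<close>, and let \<open>m\<close> be the multiplicity of a prime
  factor of \<open>\<pi>(\<beta>)\<close>. Comparing multiplicities gives \<open>N (m - 1) = e m\<close>, whence \<open>m \<ge> 2\<close> and \<open>2 e \<ge> N\<close>.
  There is no room below degree \<open>N\<close> for two such factors or for one of degree two. Hence \<open>p\<close> is a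
  power of a linear polynomial, and the comparison of degrees shows that \<open>m = deg \<beta>\<close>, that is, \<open>\<pi>(\<beta>)\<close>
  is a pure power.
\<close>

lemma pure_power_of_derivative:
  fixes \<beta> p q :: "real poly"
  assumes n: "degree \<beta> > 0" and N: "N > 0" and q: "q \<noteq> 0"
    and eq: "pderiv \<beta> ^ N * pcompose q \<beta> = pcompose p \<beta>"
  obtains \<tau> c z where "c \<noteq> 0" "\<beta> = [:\<tau>:] + smult c ([:- z, 1:] ^ degree \<beta>)"
proof (cases "degree \<beta> = 1")
  case True
  then obtain a b where b: "\<beta> = [:a, b:]" "b \<noteq> 0" by (rule degree_1_polyE)
  show thesis by (rule that[of b 0 "- a / b"]) (use b in auto)
next
  case False
  obtain g q' p' where g: "g \<noteq> 0" "q = g * q'" "p = g * p'" "coprime q' p'"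
    using coprime_representation[of q p] q by blast
  have nz: "pcompose f \<beta> \<noteq> 0" if "f \<noteq> 0" for f using n that by (metis pcompose_eq_0)
  have eq': "pderiv \<beta> ^ N * pcompose q' \<beta> = pcompose p' \<beta>"
    using eq nz[OF g(1)] unfolding g pcompose_mult by (simp add: mult.left_commute)
  hence "pcompose q' \<beta> dvd pcompose p' \<beta>" by (metis dvd_triv_right)
  hence "is_unit (pcompose q' \<beta>)" using coprime_pcompose[OF g(4), of \<beta>] by (metis coprime_absorb_left)
  moreover have "pcompose q' \<beta> \<noteq> 0" using nz g(2) q by auto
  ultimately have "degree (pcompose q' \<beta>) = 0" using is_unit_iff_degree by blast
  hence "degree q' = 0" using n by (simp add: degree_pcompose)
  then obtain k where k: "q' = [:k:]" by (rule degree_eq_zeroE)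
  have k0: "k \<noteq> 0" using k g q by auto
  have eq'': "smult k (pderiv \<beta> ^ N) = pcompose p' \<beta>" using eq' unfolding k by simp
  have d\<beta>: "pderiv \<beta> \<noteq> 0" using n by (auto simp: pderiv_eq_0_iff)
  have p0: "p' \<noteq> 0" using eq'' k0 d\<beta> by auto
  have deg: "degree p' * degree \<beta> = N * (degree \<beta> - 1)"
    using arg_cong[OF eq'', of degree] k0 d\<beta> by (simp add: degree_pcompose degree_power_eq degree_pderiv)
  have degN: "degree p' < N"
  proof (rule ccontr)
    assume "\<not> degree p' < N"
    hence "N * degree \<beta> \<le> degree p' * degree \<beta>" by simp
    thus False using deg n N by simp
  qed
  have degp: "degree p' > 0" using deg False n N by (cases "degree p'") auto
  \<comment> \<open>Over a root of \<open>p'\<close> of multiplicity \<open>e\<close> all ramification indices \<open>m\<close> satisfy \<open>N (m - 1) = e m\<close>.\<close>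
  have ram: "\<exists>\<rho>. prime_elem \<rho> \<and> \<rho> dvd pcompose \<pi> \<beta> \<and> N * (multiplicity \<rho> (pcompose \<pi> \<beta>) - 1)
       = multiplicity \<pi> p' * multiplicity \<rho> (pcompose \<pi> \<beta>) \<and> N \<le> 2 * multiplicity \<pi> p'"
    if \<pi>: "prime_elem \<pi>" "\<pi> dvd p'" for \<pi>
  proof -
    define e where "e = multiplicity \<pi> p'"
    obtain r where r: "p' = \<pi> ^ e * r" "\<not> \<pi> dvd r"
      unfolding e_def using multiplicity_decompose[OF \<pi>(1) p0] by blast
    have e0: "e \<noteq> 0" using r \<pi>(2) by (metis mult_1 power_0)
    have "degree (pcompose \<pi> \<beta>) > 0" using n prime_elem_degree[OF \<pi>(1)] by (simp add: degree_pcompose)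
    then obtain \<rho> where \<rho>: "prime_elem \<rho>" "\<rho> dvd pcompose \<pi> \<beta>" by (rule prime_factor_poly)
    define m where "m = multiplicity \<rho> (pcompose \<pi> \<beta>)"
    have \<pi>0: "pcompose \<pi> \<beta> \<noteq> 0" using nz \<pi>(1) by auto
    have nd: "\<not> \<rho> dvd pcompose f \<beta>" if "\<not> \<pi> dvd f" for f
    proof
      assume "\<rho> dvd pcompose f \<beta>"
      moreover have "coprime \<pi> f" using that \<pi>(1) by (metis prime_elem_imp_coprime)
      ultimately show False using coprime_pcompose[of \<pi> f \<beta>] \<rho> prime_elem_not_unit
        by (meson coprime_common_divisor)
    qed
    have m1: "multiplicity \<rho> (pderiv (pcompose \<pi> \<beta>)) + 1 = m"
      unfolding m_def by (rule multiplicity_pderiv[OF \<rho> \<pi>0])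
    have "pcompose (pderiv \<pi>) \<beta> \<noteq> 0" using nd[OF prime_elem_not_dvd_pderiv[OF \<pi>(1)]] by auto
    hence m2: "multiplicity \<rho> (pderiv (pcompose \<pi> \<beta>)) = multiplicity \<rho> (pderiv \<beta>)"
      unfolding pderiv_pcompose using \<rho>(1) d\<beta> nd[OF prime_elem_not_dvd_pderiv[OF \<pi>(1)]]
      by (simp add: prime_elem_multiplicity_mult_distrib not_dvd_imp_multiplicity_0)
    have r0: "pcompose r \<beta> \<noteq> 0" using nd[OF r(2)] by auto
    have "multiplicity \<rho> (pcompose p' \<beta>) = e * m"
      unfolding r(1) pcompose_mult ringhom.power[OF ringhom_pcompose] m_def
      using \<rho>(1) \<pi>0 r0 nd[OF r(2)]
      by (simp add: prime_elem_multiplicity_mult_distrib prime_elem_multiplicity_power_distrib not_dvd_imp_multiplicity_0)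
    moreover have "multiplicity \<rho> (smult k (pderiv \<beta> ^ N)) = N * multiplicity \<rho> (pderiv \<beta>)"
    proof -
      have "is_unit [:k:]" using k0 is_unit_iff_degree[of "[:k:]"] by simp
      hence "multiplicity \<rho> [:k:] = 0"
        using \<rho>(1) dvd_unit_imp_unit prime_elem_not_unit
        by (intro not_dvd_imp_multiplicity_0) blast
      moreover have "smult k (pderiv \<beta> ^ N) = [:k:] * pderiv \<beta> ^ N" by simp
      moreover have "multiplicity \<rho> ([:k:] * pderiv \<beta> ^ N) = multiplicity \<rho> [:k:] + multiplicity \<rho> (pderiv \<beta> ^ N)"
        using \<rho>(1) k0 d\<beta> by (intro prime_elem_multiplicity_mult_distrib) auto
      ultimately show ?thesis using \<rho>(1) d\<beta>
        by (simp add: prime_elem_multiplicity_power_distrib)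
    qed
    moreover have "m - 1 = multiplicity \<rho> (pderiv \<beta>)" using m1 m2 by linarith
    ultimately have m3: "N * (m - 1) = e * m" using eq'' by metis
    have "m \<ge> 2"
    proof (rule ccontr)
      assume "\<not> m \<ge> 2"
      hence "m = 1" using m1 by linarith
      thus False using m3 e0 by simp
    qed
    have "N * m \<le> 2 * (N * (m - 1))" using \<open>m \<ge> 2\<close> by (cases m) auto
    hence "N * m \<le> (2 * e) * m" unfolding m3 by (simp only: mult.assoc)
    hence "N \<le> 2 * e" using \<open>m \<ge> 2\<close> by simp
    thus ?thesis using \<rho> m3 unfolding m_def e_def by blast
  qed
  obtain \<pi> where \<pi>: "prime_elem \<pi>" "\<pi> dvd p'" using prime_factor_poly[OF degp] .
  define e where "e = multiplicity \<pi> p'"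
  obtain \<rho> where \<rho>: "prime_elem \<rho>" "\<rho> dvd pcompose \<pi> \<beta>"
    and \<rho>e: "N * (multiplicity \<rho> (pcompose \<pi> \<beta>) - 1) = e * multiplicity \<rho> (pcompose \<pi> \<beta>)" and Ne: "N \<le> 2 * e"
    using ram[OF \<pi>] unfolding e_def by blast
  obtain r where r: "p' = \<pi> ^ e * r" "\<not> \<pi> dvd r"
    unfolding e_def using multiplicity_decompose[OF \<pi>(1) p0] by blast
  have degr: "degree p' = e * degree \<pi> + degree r"
    using p0 unfolding r(1) by (subst degree_mult_eq) (auto simp: degree_power_eq)
  have "degree r = 0"
  proof (rule ccontr)
    assume "degree r \<noteq> 0"
    then obtain \<pi>2 where \<pi>2: "prime_elem \<pi>2" "\<pi>2 dvd r" using prime_factor_poly[of r] by blast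
    define e2 where "e2 = multiplicity \<pi>2 p'"
    have "N \<le> 2 * e2" using ram[of \<pi>2] \<pi>2 r(1) unfolding e2_def by auto
    have "\<not> \<pi>2 dvd \<pi>"
    proof
      assume "\<pi>2 dvd \<pi>"
      hence "\<pi> dvd \<pi>2" using \<pi>(1) \<pi>2(1) by (metis prime_elem_not_unit irreducibleD' prime_elem_imp_irreducible)
      thus False using \<pi>2(2) r(2) dvd_trans by blast
    qed
    hence "e2 = multiplicity \<pi>2 r"
      unfolding e2_def r(1) using \<pi>2(1) p0 r(1)
      by (auto simp: prime_elem_multiplicity_mult_distrib prime_elem_multiplicity_power_distrib not_dvd_imp_multiplicity_0)
    hence "\<pi>2 ^ e2 dvd r" by (simp add: multiplicity_dvd)
    hence "degree (\<pi>2 ^ e2) \<le> degree r" using p0 r(1) by (intro dvd_imp_degree_le) auto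
    hence "e2 \<le> degree r" using prime_elem_degree[OF \<pi>2(1)] \<pi>2(1)
      by (simp add: degree_power_eq) (metis One_nat_def Suc_leI dual_order.trans mult.right_neutral mult_le_mono2)
    moreover have "e \<le> e * degree \<pi>" using prime_elem_degree[OF \<pi>(1)] by simp
    ultimately show False using degr degN Ne \<open>N \<le> 2 * e2\<close> by linarith
  qed
  have "degree \<pi> = 1"
  proof (rule ccontr)
    assume "degree \<pi> \<noteq> 1"
    hence "2 \<le> degree \<pi>" using prime_elem_degree[OF \<pi>(1)] by simp
    hence "e * 2 \<le> e * degree \<pi>" by (rule mult_le_mono2)
    thus False using degr degN Ne by linarith
  qed
  hence "degree p' = e" using degr \<open>degree r = 0\<close> by simp
  define m where "m = multiplicity \<rho> (pcompose \<pi> \<beta>)"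
  have \<pi>0: "pcompose \<pi> \<beta> \<noteq> 0" using nz \<pi>(1) by auto
  have "m \<noteq> 0" unfolding m_def using \<rho> \<pi>0 by (metis not_dvd_imp_multiplicity_0 multiplicity_eq_zero_iff prime_elem_not_unit)
  have "N * (m * (degree \<beta> - 1)) = N * ((m - 1) * degree \<beta>)"
    using \<rho>e deg unfolding m_def[symmetric] \<open>degree p' = e\<close>
    by (metis mult.assoc mult.commute)
  hence "m * (degree \<beta> - 1) = (m - 1) * degree \<beta>" using N by simp
  hence mn: "m = degree \<beta>" using \<open>m \<noteq> 0\<close> n
    by (cases m; cases "degree \<beta>") auto
  obtain h where h: "pcompose \<pi> \<beta> = \<rho> ^ m * h"
    using multiplicity_decompose[OF \<rho>(1) \<pi>0] unfolding m_def by blast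
  have "degree (pcompose \<pi> \<beta>) = degree \<beta>" by (simp add: degree_pcompose \<open>degree \<pi> = 1\<close>)
  moreover have "degree (pcompose \<pi> \<beta>) = m * degree \<rho> + degree h"
    using \<pi>0 unfolding h by (subst degree_mult_eq) (auto simp: degree_power_eq)
  ultimately have "degree \<rho> = 1" "degree h = 0"
    using mn n prime_elem_degree[OF \<rho>(1)] by (auto; cases "degree \<rho>"; auto)+
  obtain a0 a1 where \<pi>e: "\<pi> = [:a0, a1:]" "a1 \<noteq> 0" using \<open>degree \<pi> = 1\<close> by (rule degree_1_polyE)
  obtain b0 b1 where \<rho>e: "\<rho> = [:b0, b1:]" "b1 \<noteq> 0" using \<open>degree \<rho> = 1\<close> by (rule degree_1_polyE)
  obtain k' where k': "h = [:k':]" using \<open>degree h = 0\<close> by (rule degree_eq_zeroE)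
  have k'0: "k' \<noteq> 0" using \<pi>0 h k' by auto
  have "\<rho> = smult b1 [:- (- b0 / b1), 1:]" using \<rho>e by simp
  hence "\<rho> ^ m * [:k':] = smult (b1 ^ m * k') ([:- (- b0 / b1), 1:] ^ m)"
    by (simp only: smult_power mult_smult_left) (simp add: mult.commute)
  moreover have "pcompose \<pi> \<beta> = [:a0:] + smult a1 \<beta>" unfolding \<pi>e by (simp add: pcompose_pCons mult.commute)
  ultimately have "[:a0:] + smult a1 \<beta> = smult (b1 ^ m * k') ([:- (- b0 / b1), 1:] ^ m)"
    using h unfolding k' by simp
  hence "smult a1 \<beta> = smult (b1 ^ m * k') ([:- (- b0 / b1), 1:] ^ m) - [:a0:]"
    by (metis add_diff_cancel_left')
  hence "smult a1 \<beta> = [:- a0:] + smult (b1 ^ m * k') ([:- (- b0 / b1), 1:] ^ m)"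
    by (simp only: diff_conv_add_uminus minus_pCons minus_zero add.commute)
  hence "smult (1 / a1) (smult a1 \<beta>) = smult (1 / a1) ([:- a0:] + smult (b1 ^ m * k') ([:- (- b0 / b1), 1:] ^ m))"
    by simp
  hence "\<beta> = [:- a0 / a1:] + smult (b1 ^ m * k' / a1) ([:- (- b0 / b1), 1:] ^ m)"
    using \<pi>e(2) by (simp add: smult_add_right)
  thus thesis using that[of "b1 ^ m * k' / a1" "- a0 / a1" "- b0 / b1"] \<pi>e(2) \<rho>e(2) k'0 mn by simp
qed

lemma degree_hz_le:
  assumes "degree \<alpha> \<le> degree \<beta>" shows "degree (hz d p \<alpha> \<beta>) \<le> d * degree \<beta>"
  unfolding hz_def
proof (rule degree_sum_le)
  fix j assume "j \<in> {..d}"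
  have "degree (\<alpha> ^ (d - j) * \<beta> ^ j) \<le> degree \<alpha> * (d - j) + degree \<beta> * j"
    by (meson add_mono degree_mult_le degree_power_le order_trans)
  also have "\<dots> \<le> degree \<beta> * (d - j) + degree \<beta> * j" using assms by simp
  also have "\<dots> = d * degree \<beta>" using \<open>j \<in> {..d}\<close> by (simp flip: add_mult_distrib2)
  finally show "degree (smult (coeff p j) (\<alpha> ^ (d - j) * \<beta> ^ j)) \<le> d * degree \<beta>"
    by (meson degree_smult_le order_trans)
qed simp

lemma hz_leading:
  assumes "p \<noteq> 0"
  obtains h where "hz (degree p) p \<alpha> \<beta> = \<alpha> * h + smult (lead_coeff p) (\<beta> ^ degree p)"
    "degree \<alpha> \<le> degree \<beta> \<Longrightarrow> degree h \<le> (degree p - 1) * degree \<beta>" "degree p = 0 \<Longrightarrow> h = 0"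
proof (cases "degree p")
  case 0
  thus thesis using that[of 0] by (simp add: hz_def)
next
  case (Suc d)
  thus thesis using that[of "hz d p \<alpha> \<beta>"] degree_hz_le[of \<alpha> \<beta> d p] by (simp add: hz_Suc)
qed

lemma degree_hz:
  assumes "degree \<alpha> < degree \<beta>" "p \<noteq> 0"
  shows "degree (hz (degree p) p \<alpha> \<beta>) = degree p * degree \<beta>" "hz (degree p) p \<alpha> \<beta> \<noteq> 0"
proof -
  obtain h where h: "hz (degree p) p \<alpha> \<beta> = \<alpha> * h + smult (lead_coeff p) (\<beta> ^ degree p)"
    "degree \<alpha> \<le> degree \<beta> \<Longrightarrow> degree h \<le> (degree p - 1) * degree \<beta>" "degree p = 0 \<Longrightarrow> h = 0"
    using hz_leading[OF assms(2)] by blast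
  have d: "degree (smult (lead_coeff p) (\<beta> ^ degree p)) = degree p * degree \<beta>"
    using assms by (subst degree_smult_eq, subst degree_power_eq) auto
  have "degree (hz (degree p) p \<alpha> \<beta>) = degree p * degree \<beta> \<and> hz (degree p) p \<alpha> \<beta> \<noteq> 0"
  proof (cases "degree p = 0")
    case True
    thus ?thesis using h assms(2) by (simp flip: leading_coeff_0_iff)
  next
    case False
    have "degree (\<alpha> * h) \<le> degree \<alpha> + (degree p - 1) * degree \<beta>"
      using h(2) assms(1) by (meson add_left_mono degree_mult_le less_imp_le order_trans)
    also have "\<dots> < degree \<beta> + (degree p - 1) * degree \<beta>" using assms(1) by simp
    also have "\<dots> = degree p * degree \<beta>" using False by (cases "degree p") auto
    finally have lt: "degree (\<alpha> * h) < degree p * degree \<beta>" .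
    have eq: "degree (hz (degree p) p \<alpha> \<beta>) = degree p * degree \<beta>"
      using degree_add_eq_right[of "\<alpha> * h" "smult (lead_coeff p) (\<beta> ^ degree p)"] lt unfolding h(1) d by blast
    moreover have "degree p * degree \<beta> \<noteq> 0" using False assms(1) by simp
    ultimately show ?thesis by (metis degree_0)
  qed
  thus "degree (hz (degree p) p \<alpha> \<beta>) = degree p * degree \<beta>" "hz (degree p) p \<alpha> \<beta> \<noteq> 0" by auto
qed

lemma hz_not_dvd:
  assumes "prime_elem \<pi>" "\<pi> dvd \<alpha>" "\<not> \<pi> dvd \<beta>" "p \<noteq> 0"
  shows "\<not> \<pi> dvd hz (degree p) p \<alpha> \<beta>"
proof
  assume *: "\<pi> dvd hz (degree p) p \<alpha> \<beta>"
  obtain h where h: "hz (degree p) p \<alpha> \<beta> = \<alpha> * h + smult (lead_coeff p) (\<beta> ^ degree p)"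
    using hz_leading[OF assms(4)] by blast
  have "\<pi> dvd smult (lead_coeff p) (\<beta> ^ degree p)"
    using * assms(2) unfolding h by (metis dvd_add_right_iff dvd_mult2)
  hence "\<pi> dvd \<beta> ^ degree p" using assms(4) by (subst (asm) dvd_smult_iff) auto
  thus False using assms(1,3) prime_elem_dvd_power by blast
qed

lemma degree_wronskian:
  fixes \<alpha> \<beta> :: "real poly"
  assumes "0 < degree \<alpha>" "degree \<alpha> < degree \<beta>"
  shows "degree (\<alpha> * pderiv \<beta> - pderiv \<alpha> * \<beta>) = degree \<alpha> + degree \<beta> - 1" (is "degree ?w = ?k")
proof (rule antisym)
  have d: "degree (pderiv \<alpha>) = degree \<alpha> - 1" "degree (pderiv \<beta>) = degree \<beta> - 1" by (simp_all add: degree_pderiv)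
  have "degree (\<alpha> * pderiv \<beta>) \<le> ?k" "degree (pderiv \<alpha> * \<beta>) \<le> ?k"
    using degree_mult_le[of \<alpha> "pderiv \<beta>"] degree_mult_le[of "pderiv \<alpha>" \<beta>] assms d by auto
  thus "degree ?w \<le> ?k" by (rule degree_diff_le)
  have k: "?k = degree \<alpha> + degree (pderiv \<beta>)" "?k = degree (pderiv \<alpha>) + degree \<beta>" using assms d by auto
  have "coeff (\<alpha> * pderiv \<beta>) ?k = lead_coeff \<alpha> * (real (degree \<beta>) * lead_coeff \<beta>)"
    unfolding k(1) coeff_mult_degree_sum using assms by (simp add: d coeff_pderiv)
  moreover have "coeff (pderiv \<alpha> * \<beta>) ?k = (real (degree \<alpha>) * lead_coeff \<alpha>) * lead_coeff \<beta>"
    unfolding k(2) coeff_mult_degree_sum using assms by (simp add: d coeff_pderiv)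
  ultimately have "coeff ?w ?k = (real (degree \<beta>) - real (degree \<alpha>)) * (lead_coeff \<alpha> * lead_coeff \<beta>)"
    by (simp add: algebra_simps)
  moreover have "\<alpha> \<noteq> 0" "\<beta> \<noteq> 0" using assms by auto
  ultimately have "coeff ?w ?k \<noteq> 0" using assms by simp
  thus "?k \<le> degree ?w" by (rule le_degree)
qed

text \<open>
  A prime factor of \<open>\<alpha>\<close> does not divide \<open>\<beta>\<close>, so that it divides a form in \<open>(\<alpha>, \<beta>)\<close> only through the
  visible power of \<open>\<alpha>\<close>. The multiplicities of such a factor and the degrees of the two sides lead to
  contradictory estimates.
\<close>

lemma form_equation_denominator_const:
  fixes \<alpha> \<beta> p q :: "real poly"
  assumes cop: "coprime \<alpha> \<beta>" and lt: "degree \<alpha> < degree \<beta>" and N: "N > 0"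
    and q: "q \<noteq> 0" "degree q \<le> D" and p: "degree p \<le> D + 2 * N"
    and eq: "(\<alpha> * pderiv \<beta> - pderiv \<alpha> * \<beta>) ^ N * hz D q \<alpha> \<beta> = hz (D + 2 * N) p \<alpha> \<beta>"
  shows "degree \<alpha> = 0"
proof (rule ccontr)
  assume a0: "degree \<alpha> \<noteq> 0"
  let ?w = "\<alpha> * pderiv \<beta> - pderiv \<alpha> * \<beta>"
  have \<alpha>: "\<alpha> \<noteq> 0" using a0 by auto
  have degw: "degree ?w = degree \<alpha> + degree \<beta> - 1" using a0 lt by (intro degree_wronskian) auto
  hence w0: "?w \<noteq> 0" using a0 lt by (metis Nat.add_diff_assoc One_nat_def Suc_leI add_is_0 degree_0 gr0I less_trans neq0_conv)
  define i where "i = D - degree q"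
  define j where "j = D + 2 * N - degree p"
  note hq = hz_lower[OF q(2), of \<alpha> \<beta>, folded i_def] and hp = hz_lower[OF p, of \<alpha> \<beta>, folded j_def]
  have hq0: "hz (degree q) q \<alpha> \<beta> \<noteq> 0" by (rule degree_hz(2)[OF lt q(1)])
  have "hz (D + 2 * N) p \<alpha> \<beta> \<noteq> 0" unfolding eq[symmetric] hq using w0 hq0 \<alpha> by simp
  hence p0: "p \<noteq> 0" by (auto simp: hz_def)
  have hp0: "hz (degree p) p \<alpha> \<beta> \<noteq> 0" by (rule degree_hz(2)[OF lt p0])
  have eq': "?w ^ N * (\<alpha> ^ i * hz (degree q) q \<alpha> \<beta>) = \<alpha> ^ j * hz (degree p) p \<alpha> \<beta>"
    using eq unfolding hq hp .
  obtain \<pi> where \<pi>: "prime_elem \<pi>" "\<pi> dvd \<alpha>" using prime_factor_poly[of \<alpha>] a0 by blast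
  have nd: "\<not> \<pi> dvd \<beta>" using cop \<pi> prime_elem_not_unit coprime_common_divisor by blast
  define r where "r = multiplicity \<pi> \<alpha>"
  have mw: "multiplicity \<pi> ?w + 1 = r" unfolding r_def by (rule multiplicity_wronskian[OF \<pi> \<alpha> nd])
  have "multiplicity \<pi> (?w ^ N * (\<alpha> ^ i * hz (degree q) q \<alpha> \<beta>)) = N * (r - 1) + i * r"
    using \<pi>(1) w0 \<alpha> hq0 hz_not_dvd[OF \<pi> nd q(1)] mw
    by (simp add: prime_elem_multiplicity_mult_distrib prime_elem_multiplicity_power_distrib
        not_dvd_imp_multiplicity_0 flip: r_def) auto
  moreover have "multiplicity \<pi> (\<alpha> ^ j * hz (degree p) p \<alpha> \<beta>) = j * r"
    using \<pi>(1) \<alpha> hp0 hz_not_dvd[OF \<pi> nd p0]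
    by (simp add: prime_elem_multiplicity_mult_distrib prime_elem_multiplicity_power_distrib
        not_dvd_imp_multiplicity_0 r_def[symmetric])
  ultimately have E2: "N * (r - 1) + i * r = j * r" using eq' by simp
  have "degree (?w ^ N * (\<alpha> ^ i * hz (degree q) q \<alpha> \<beta>)) = N * (degree \<alpha> + degree \<beta> - 1) + (i * degree \<alpha> + degree q * degree \<beta>)"
    using w0 \<alpha> hq0 by (simp add: degree_mult_eq degree_power_eq degw degree_hz(1)[OF lt q(1)])
  moreover have "degree (\<alpha> ^ j * hz (degree p) p \<alpha> \<beta>) = j * degree \<alpha> + degree p * degree \<beta>"
    using \<alpha> hp0 by (simp add: degree_mult_eq degree_power_eq degree_hz(1)[OF lt p0])
  ultimately have E1: "N * (degree \<alpha> + degree \<beta> - 1) + (i * degree \<alpha> + degree q * degree \<beta>) = j * degree \<alpha> + degree p * degree \<beta>"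
    using eq' by simp
  \<comment> \<open>The excess \<open>j - i\<close> is less than \<open>N\<close> by the count at \<open>\<pi>\<close>, and greater than \<open>N\<close> by the degrees.\<close>
  define t where "t = int j - int i"
  have r1: "r \<ge> 1" using mw by simp
  have "int N * (int r - 1) + int i * int r = int j * int r"
    using arg_cong[OF E2, of int] r1 by (simp add: of_nat_diff)
  hence "t * int r = int N * int r - int N" by (simp add: t_def algebra_simps)
  hence "t * int r < int N * int r" using N by simp
  hence "t < int N" using r1 by simp
  have q': "int (degree q) = int D - int i" unfolding i_def using q(2) by simp
  have p': "int (degree p) = int D + 2 * int N - int j" unfolding j_def using p by simp
  have "int N * (int (degree \<alpha>) + int (degree \<beta>) - 1) + (int i * int (degree \<alpha>) + int (degree q) * int (degree \<beta>))
      = int j * int (degree \<alpha>) + int (degree p) * int (degree \<beta>)"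
    using arg_cong[OF E1, of int] a0 by (simp add: of_nat_diff)
  hence "t * (int (degree \<beta>) - int (degree \<alpha>)) = int N * (int (degree \<beta>) - int (degree \<alpha>) + 1)"
    unfolding q' p' t_def by (simp add: algebra_simps)
  moreover have "t * (int (degree \<beta>) - int (degree \<alpha>)) \<le> int N * (int (degree \<beta>) - int (degree \<alpha>))"
    using \<open>t < int N\<close> lt by (intro mult_right_mono) auto
  ultimately show False using N by (simp add: algebra_simps)
qed

text \<open>Once \<open>\<alpha>\<close> is known to be constant, the equation involves \<open>\<beta>\<close> and its derivative alone.\<close>

lemma form_equation_solution_ordered:
  fixes \<alpha> \<beta> :: "real poly"
  assumes cop: "coprime \<alpha> \<beta>" and lt: "degree \<alpha> < degree \<beta>" and N: "N > 0"
    and P: "hom_poly (D + 2 * N) P" and Q: "hom_poly D Q" "Q \<noteq> 0"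
    and eq: "(\<alpha> * pderiv \<beta> - pderiv \<alpha> * \<beta>) ^ N * form_at Q \<alpha> \<beta> = form_at P \<alpha> \<beta>"
  obtains k \<tau> c z where "k \<noteq> 0" "c \<noteq> 0" "\<alpha> = [:k:]" "\<beta> = [:\<tau>:] + smult c ([:- z, 1:] ^ degree \<beta>)"
proof -
  define p where "p = dehom (D + 2 * N) P"
  define q where "q = dehom D Q"
  have q0: "q \<noteq> 0" using dehom_eq_0 Q unfolding q_def by blast
  have eq': "(\<alpha> * pderiv \<beta> - pderiv \<alpha> * \<beta>) ^ N * hz D q \<alpha> \<beta> = hz (D + 2 * N) p \<alpha> \<beta>"
    using eq unfolding form_at_eq_hz[OF P] form_at_eq_hz[OF Q(1)] p_def q_def .
  have "degree \<alpha> = 0"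
    by (rule form_equation_denominator_const[OF cop lt N q0 _ _ eq']) (auto simp: p_def q_def degree_dehom)
  then obtain k where k: "\<alpha> = [:k:]" by (rule degree_eq_zeroE)
  have k0: "k \<noteq> 0"
  proof
    assume "k = 0"
    hence "is_unit \<beta>" using cop k by simp
    thus False using lt is_unit_iff_degree[of \<beta>] by force
  qed
  define q1 where "q1 = (\<Sum>j\<le>D. monom (coeff q j * k ^ (D - j)) j)"
  define p1 where "p1 = (\<Sum>j\<le>D + 2 * N. monom (coeff p j * k ^ (D + 2 * N - j)) j)"
  have "coeff q1 (degree q) \<noteq> 0"
    unfolding q1_def hz_const_coeff using degree_dehom[of D Q, folded q_def] q0 k0 by simp
  hence q10: "q1 \<noteq> 0" by auto
  have "smult k (pderiv \<beta>) ^ N * pcompose q1 \<beta> = pcompose p1 \<beta>"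
    using eq' unfolding k hz_const q1_def[symmetric] p1_def[symmetric] by (simp add: pderiv_pCons)
  hence "pderiv \<beta> ^ N * pcompose (smult (k ^ N) q1) \<beta> = pcompose p1 \<beta>"
    by (simp add: smult_power pcompose_smult)
  moreover have "smult (k ^ N) q1 \<noteq> 0" using q10 k0 by simp
  moreover have "degree \<beta> > 0" using lt by simp
  ultimately show thesis
    by - (rule pure_power_of_derivative[OF _ N], assumption+, rule that[OF k0 _ k])
qed

text \<open>
  The substitution \<open>(\<alpha>, \<beta>) \<mapsto> (\<kappa> \<alpha> - \<beta>, \<alpha>)\<close> has determinant one. It therefore preserves the Wronskian,
  and with a suitable \<open>\<kappa>\<close> it lowers the degree of the first component below that of the second.
\<close>

lemma form_equation_solution:
  fixes \<alpha> \<beta> :: "real poly"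
  assumes cop: "coprime \<alpha> \<beta>" and nc: "degree \<alpha> > 0 \<or> degree \<beta> > 0" and N: "N > 0"
    and P: "hom_poly (D + 2 * N) P" and Q: "hom_poly D Q" "Q \<noteq> 0"
    and eq: "(\<alpha> * pderiv \<beta> - pderiv \<alpha> * \<beta>) ^ N * form_at Q \<alpha> \<beta> = form_at P \<alpha> \<beta>"
  obtains a b c d z n where "a * d - b * c \<noteq> 0" "n > 0"
    "smult a \<alpha> + smult b \<beta> = [:- z, 1:] ^ n" "smult c \<alpha> + smult d \<beta> = 1"
proof (cases "degree \<alpha> < degree \<beta>")
  case True
  obtain k \<tau> c z where k: "k \<noteq> 0" "c \<noteq> 0" and \<alpha>: "\<alpha> = [:k:]" and \<beta>: "\<beta> = [:\<tau>:] + smult c ([:- z, 1:] ^ degree \<beta>)"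
    by (rule form_equation_solution_ordered[OF cop True N P Q eq])
  define X where "X = [:- z, 1:] ^ degree \<beta>"
  have \<beta>': "\<beta> = [:\<tau>:] + smult c X" using \<beta> X_def by simp
  show thesis
  proof (rule that[of "- \<tau> / (c * k)" 0 "1 / c" "1 / k" "degree \<beta>" z])
    have "poly (smult (- \<tau> / (c * k)) \<alpha> + smult (1 / c) \<beta>) x = poly X x" for x
      unfolding \<alpha> poly_add poly_smult arg_cong[OF \<beta>', of "\<lambda>p. poly p x"] using k by (simp add: distrib_left)
    thus "smult (- \<tau> / (c * k)) \<alpha> + smult (1 / c) \<beta> = [:- z, 1:] ^ degree \<beta>"
      unfolding X_def[symmetric] by (intro poly_eq_poly_eq_iff[THEN iffD1] ext)
  qed (use k nc True \<alpha> in \<open>auto simp: one_pCons\<close>)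
next
  case False
  hence n0: "degree \<alpha> > 0" using nc by auto
  define \<kappa> where "\<kappa> = coeff \<beta> (degree \<alpha>) / lead_coeff \<alpha>"
  define \<alpha>' where "\<alpha>' = smult \<kappa> \<alpha> - \<beta>"
  have "\<alpha> \<noteq> 0" using n0 by auto
  have lt: "degree \<alpha>' < degree \<alpha>"
  proof -
    have "degree \<alpha>' \<le> degree \<alpha>"
      unfolding \<alpha>'_def using False by (intro degree_diff_le) (auto intro: order_trans[OF degree_smult_le])
    moreover have "coeff \<alpha>' (degree \<alpha>) = 0" using \<open>\<alpha> \<noteq> 0\<close> by (simp add: \<alpha>'_def \<kappa>_def)
    ultimately show ?thesis using n0 by (metis degree_0 leading_coeff_0_iff le_neq_implies_less)
  qed
  have cop': "coprime \<alpha>' \<alpha>"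
  proof (rule coprimeI)
    fix c assume c: "c dvd \<alpha>'" "c dvd \<alpha>"
    have "\<beta> = smult \<kappa> \<alpha> - \<alpha>'" by (simp add: \<alpha>'_def)
    hence "c dvd \<beta>" using c by (metis dvd_diff dvd_smult)
    thus "is_unit c" using cop c coprime_common_divisor by blast
  qed
  have \<beta>: "\<beta> = smult \<kappa> \<alpha> - \<alpha>'" by (simp add: \<alpha>'_def)
  let ?T = "\<lambda>G. subst_poly cpoly G py (cpoly \<kappa> * py - px)"
  have T: "form_at (?T G) \<alpha>' \<alpha> = form_at G \<alpha> \<beta>" for G
  proof -
    have "form_at (cpoly \<kappa> * py - px) \<alpha>' \<alpha> = \<beta>"
      by (simp only: form_at_simps form_at_gens) (simp add: \<beta>)
    thus ?thesis unfolding form_at_subst by simp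
  qed
  have hT: "hom_poly e (?T G)" if "hom_poly e G" for G e
    using hom_poly_subst[OF that hom_poly_gens(3) hom_poly_diff[OF hom_poly_cmult[OF hom_poly_gens(3)] hom_poly_gens(2)], of \<kappa>] by simp
  have Q0: "?T Q \<noteq> 0"
  proof
    assume "?T Q = 0"
    hence "form_at Q \<alpha> \<beta> = 0" using T[of Q] by (simp add: form_at_simps)
    thus False using form_at_eq_0_imp_0[OF cop nc Q(1)] Q(2) by blast
  qed
  have w: "\<alpha>' * pderiv \<alpha> - pderiv \<alpha>' * \<alpha> = \<alpha> * pderiv \<beta> - pderiv \<alpha> * \<beta>"
    unfolding \<alpha>'_def by (simp add: pderiv_diff pderiv_smult algebra_simps)
  obtain k \<tau> c z where k: "k \<noteq> 0" "c \<noteq> 0" and \<alpha>': "\<alpha>' = [:k:]" and \<alpha>: "\<alpha> = [:\<tau>:] + smult c ([:- z, 1:] ^ degree \<alpha>)"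
    by (rule form_equation_solution_ordered[OF cop' lt N hT[OF P] hT[OF Q(1)] Q0 eq[folded w T]])
  define X where "X = [:- z, 1:] ^ degree \<alpha>"
  have e: "\<alpha> = [:\<tau>:] + smult c X" using \<alpha> X_def by simp
  show thesis
  proof (rule that[of "1 / c - \<tau> * \<kappa> / (c * k)" "- 1 / k" "\<tau> / (c * k)" "\<kappa> / k" "degree \<alpha>" z])
    show "(1 / c - \<tau> * \<kappa> / (c * k)) * (- 1 / k) - \<tau> / (c * k) * (\<kappa> / k) \<noteq> 0"
      using k by (simp add: field_simps)
    have "poly (smult (1 / c - \<tau> * \<kappa> / (c * k)) \<alpha> + smult (\<tau> / (c * k)) \<beta>) x = poly X x" for x
      unfolding \<beta> \<alpha>' e using k by (simp add: field_simps)
    thus "smult (1 / c - \<tau> * \<kappa> / (c * k)) \<alpha> + smult (\<tau> / (c * k)) \<beta> = [:- z, 1:] ^ degree \<alpha>"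
      unfolding X_def[symmetric] by (intro poly_eq_poly_eq_iff[THEN iffD1] ext)
    have "poly (smult (\<kappa> / k) \<alpha> + smult (- 1 / k) \<beta>) x = poly 1 x" for x
      unfolding \<beta> \<alpha>' using k by (simp add: field_simps)
    thus "smult (\<kappa> / k) \<alpha> + smult (- 1 / k) \<beta> = 1"
      by (intro poly_eq_poly_eq_iff[THEN iffD1] ext)
  qed (rule n0)
qed


section \<open>The curve traced by a trajectory\<close>

text \<open>A reduced numerator and denominator are factors of homogeneous ones.\<close>

lemma coprime_hom_representation:
  assumes W: "hom_rat N (Fract A B)" and B: "B \<noteq> 0" and cop: "coprime A (B :: real poly poly)"
  obtains e where "hom_poly (N + e) A" "hom_poly e B"
proof -
  obtain p q d where *: "hom_poly (N + d) p" "hom_poly d q" "q \<noteq> 0" "Fract A B = Fract p q"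
    using W unfolding hom_rat_def by blast
  have eq: "A * q = p * B" using * B by (simp add: eq_fract)
  hence "B dvd A * q" by simp
  hence "B dvd q" using cop by (simp add: coprime_commute coprime_dvd_mult_right_iff)
  then obtain k where k: "q = B * k" by blast
  have p: "p = A * k" using eq B k by (simp add: mult.left_commute mult.commute)
  obtain e where e: "hom_poly e B" "hom_poly (d - e) k" "e \<le> d"
    using hom_poly_factor[of d B k] * k by auto
  show thesis
  proof (cases "A = 0")
    case True
    thus thesis using that e hom_poly_0 by blast
  next
    case False
    have k0: "k \<noteq> 0" using k * by auto
    obtain f where f: "hom_poly f A" "hom_poly (N + d - f) k" "f \<le> N + d"
      using hom_poly_factor[of "N + d" A k] *(1) False k0 p by auto
    have "N + d - f = d - e" using hom_poly_unique[OF f(2) e(2) k0] .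
    hence "f = N + e" using f(3) e(3) by linarith
    thus thesis using that e f by blast
  qed
qed

lemma hom_poly_1E:
  assumes "hom_poly 1 (A :: real poly poly)"
  obtains a b where "A = cpoly a * px + cpoly b * py"
proof -
  have "A = cpoly (coeff (dehom 1 A) 0) * px + cpoly (coeff (dehom 1 A) 1) * py"
    using form_expansion[OF assms] by simp
  thus thesis by (rule that)
qed

lemma hom_poly_0E:
  assumes "hom_poly 0 (A :: real poly poly)" obtains c where "A = cpoly c"
  using form_expansion[OF assms] that by simp

lemma hom_linear: "hom_poly 1 (cpoly a * px + cpoly b * (py :: real poly poly))"
  by (intro hom_poly_add hom_poly_cmult hom_poly_gens)

lemma eval_linear [simp]: "eval_poly (cpoly a * px + cpoly b * py) x = a * fst x + b * snd x"
  by (simp only: eval_poly_simps eval_poly_gens)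

lemma form_at_linear: "form_at (cpoly a * px + cpoly b * py) \<alpha> \<beta> = smult a \<alpha> + smult b \<beta>"
  by (simp only: form_at_simps form_at_gens) simp

lemma coprime_px_py_shift: "coprime (px - cpoly a) (py - cpoly (b :: real))"
proof (rule coprimeI)
  fix c assume c: "c dvd px - cpoly a" "c dvd py - cpoly b"
  have l: "px - cpoly a = [:[:- a, 1:]:]" "py - cpoly b = [:[:- b:], 1:]"
    by (simp_all add: cpoly_def)
  have "degree c \<le> degree (px - cpoly a)" using c(1) by (intro dvd_imp_degree_le) (auto simp: l)
  hence "degree c = 0" by (simp add: l)
  then obtain c0 where c0: "c = [:c0:]" by (rule degree_eq_zeroE)
  have "c0 dvd coeff (py - cpoly b) 1" using c(2) unfolding c0 const_poly_dvd_iff by blast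
  hence "c0 dvd 1" by (simp add: l)
  thus "is_unit c" unfolding c0 by (simp add: is_unit_const_poly_iff)
qed

lemma coprime_px_py: "coprime px (py :: real poly poly)"
  using coprime_px_py_shift[of 0 0] by (simp add: cpoly_def)

lemma dvd_of_dvd_coprime_mults:
  fixes F G :: "'a::{factorial_ring_gcd,semiring_gcd_mult_normalize}"
  assumes "F dvd G * l1" "F dvd G * l2" "coprime l1 l2" shows "F dvd G"
proof -
  have "F dvd gcd (G * l1) (G * l2)" using assms by simp
  also have "gcd (G * l1) (G * l2) = normalize (G * gcd l1 l2)" by (simp add: gcd_mult_left)
  finally show ?thesis using assms(3) by simp
qed

text \<open>
  A curve \<open>c(z) = (g(z) / m(z)) (\<alpha>(z), \<beta>(z))\<close>, parametrised outside the zeros of \<open>m\<close>. The coprime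
  pair \<open>(\<alpha>, \<beta>)\<close> records its direction.
\<close>

locale rational_curve =
  fixes m g \<alpha> \<beta> :: "real poly"
  assumes m0: "m \<noteq> 0" and g0: "g \<noteq> 0" and cop: "coprime \<alpha> \<beta>"
begin

definition rho :: "real \<Rightarrow> real" where "rho z = poly g z / poly m z"
definition pt :: "real \<Rightarrow> real \<times> real" where "pt z = rho z *\<^sub>R (poly \<alpha> z, poly \<beta> z)"

lemma pt_form: "hom_poly d G \<Longrightarrow> eval_poly G (pt z) = rho z ^ d * poly (form_at G \<alpha> \<beta>) z"
  unfolding pt_def by (simp add: hom_eval poly_form_at del: scaleR_Pair)

lemma poly_eq_cofinite:
  assumes "q \<noteq> 0" "\<And>z. poly q z \<noteq> 0 \<Longrightarrow> poly p1 z = poly p2 z" shows "p1 = (p2 :: real poly)"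
proof -
  have "q * (p1 - p2) = 0"
    by (rule poly_all_0_iff_0[THEN iffD1]) (use assms(2) in auto)
  thus ?thesis using assms(1) by simp
qed

lemma rho_nonzero: "poly (m * g) z \<noteq> 0 \<Longrightarrow> rho z \<noteq> 0"
  by (simp add: rho_def)

lemma form_at_vanishing:
  assumes "hom_poly d G" "\<And>z. poly m z \<noteq> 0 \<Longrightarrow> eval_poly G (pt z) = 0"
  shows "form_at G \<alpha> \<beta> = 0"
  by (rule poly_eq_cofinite[of "m * g"]) (use m0 g0 assms(2) rho_nonzero pt_form[OF assms(1)] in fastforce)+

lemma form_vanishing:
  assumes "hom_poly d G" "\<And>z. poly m z \<noteq> 0 \<Longrightarrow> eval_poly G (pt z) = 0"
    and "degree \<alpha> > 0 \<or> degree \<beta> > 0"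
  shows "G = 0"
  using form_at_eq_0_imp_0[OF cop assms(3,1) form_at_vanishing[OF assms(1,2)]] .

lemma constant_direction:
  assumes "degree \<alpha> = 0" "degree \<beta> = 0"
  obtains e1 e2 where "\<alpha> = [:e1:]" "\<beta> = [:e2:]" "e1 \<noteq> 0 \<or> e2 \<noteq> 0"
proof -
  obtain e1 e2 where e: "\<alpha> = [:e1:]" "\<beta> = [:e2:]" using assms degree_eq_zeroE by metis
  moreover have "e1 \<noteq> 0 \<or> e2 \<noteq> 0" using cop e by auto
  ultimately show thesis by (rule that)
qed

end

context rat_map_rep
begin

lemma traj_polys:
  assumes "z \<noteq> 0" "map_regular_at \<phi> (z *\<^sub>R a)"
  shows "traj \<phi> a z = (poly (ray a P1) z / (z * poly (ray a Q) z), poly (ray a P2) z / (z * poly (ray a Q) z))"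
  using assms eval[of "z *\<^sub>R a"] unfolding regular_iff traj_def by (simp add: poly_ray)

lemma trajectory_curve:
  assumes reg: "map_regular_at \<phi> (z0 *\<^sub>R a)" and nz: "ray a P1 \<noteq> 0 \<or> ray a P2 \<noteq> 0"
  obtains m g \<alpha> \<beta> where "rational_curve m g \<alpha> \<beta>"
    "\<And>z. poly m z \<noteq> 0 \<longleftrightarrow> z \<noteq> 0 \<and> map_regular_at \<phi> (z *\<^sub>R a)"
    "\<And>z. poly m z \<noteq> 0 \<Longrightarrow> traj \<phi> a z = rational_curve.pt m g \<alpha> \<beta> z"
proof -
  define m where "m = [:0, 1:] * ray a Q"
  obtain g \<alpha> \<beta> where g: "g \<noteq> 0" "ray a P1 = g * \<alpha>" "ray a P2 = g * \<beta>" "coprime \<alpha> \<beta>"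
    using coprime_representation[OF nz] by blast
  have "poly (ray a Q) z0 \<noteq> 0" using reg regular_iff by (simp add: poly_ray)
  hence "ray a Q \<noteq> 0" by auto
  hence *: "rational_curve m g \<alpha> \<beta>" by unfold_locales (use g in \<open>auto simp: m_def\<close>)
  have mz: "poly m z = z * poly (ray a Q) z" for z by (simp add: m_def)
  have r: "poly m z \<noteq> 0 \<longleftrightarrow> z \<noteq> 0 \<and> map_regular_at \<phi> (z *\<^sub>R a)" for z
    by (simp add: regular_iff poly_ray mz)
  have "traj \<phi> a z = rational_curve.pt m g \<alpha> \<beta> z" if "poly m z \<noteq> 0" for z
    using traj_polys[of z a] that r[of z] by (simp add: rational_curve.pt_def[OF *] rational_curve.rho_def[OF *] g mz)
  thus thesis using that * r by blast
qed

end


section \<open>The equation of a single orbit\<close>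

text \<open>
  The orbit consists of the trajectory and the point \<open>a\<close>. If \<open>G\<close> vanishes on the trajectory, then \<open>G\<close>
  times each of two coprime lines through \<open>a\<close> vanishes on the orbit.
\<close>

lemma orbit_ideal_of_trajectory:
  assumes F: "{G. \<forall>x\<in>orbit \<phi> a. eval_poly G x = 0} = {G. F dvd G}"
    and G: "\<And>z. z \<noteq> 0 \<Longrightarrow> map_regular_at \<phi> (z *\<^sub>R a) \<Longrightarrow> eval_poly G (traj \<phi> a z) = 0"
  shows "F dvd G"
proof (rule dvd_of_dvd_coprime_mults[OF _ _ coprime_px_py_shift[of "fst a" "snd a"]])
  have v: "\<forall>x\<in>orbit \<phi> a. eval_poly (G * l) x = 0" if "eval_poly l a = 0" for l
    using that G by (auto simp: orbit_eq_traj eval_poly_simps)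
  have d: "F dvd H" if "\<forall>x\<in>orbit \<phi> a. eval_poly H x = 0" for H using F that by blast
  show "F dvd G * (px - cpoly (fst a))" "F dvd G * (py - cpoly (snd a))"
    by (intro d v; simp only: eval_poly_simps eval_poly_gens; simp)+
qed

text \<open>
  If \<open>F\<close> were zero, then the orbit would contain almost all points of every line \<open>x = r\<close>, and the
  first coordinate of the trajectory, a rational function of \<open>z\<close>, would be constantly \<open>r\<close> for each
  \<open>r\<close>.
\<close>

lemma orbit_curve_nontrivial:
  assumes rep: "rat_map_rep \<phi> P1 P2 Q" and F: "curve_given_by (orbit \<phi> a) F"
  shows "F \<noteq> 0" "\<not> F dvd 1" "\<exists>z. map_regular_at \<phi> (z *\<^sub>R a)" "ray a P1 \<noteq> 0 \<or> ray a P2 \<noteq> 0"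
proof -
  interpret rat_map_rep \<phi> P1 P2 Q by fact
  have I: "{G. \<forall>x\<in>orbit \<phi> a. eval_poly G x = 0} = {G. F dvd G}"
    and cof: "finite ({x. eval_poly F x = 0} - orbit \<phi> a)"
    using F unfolding curve_given_by_def by auto
  have a: "a \<in> orbit \<phi> a" by (simp add: orbit_def)
  show nu: "\<not> F dvd 1"
  proof
    assume "F dvd 1"
    hence "eval_poly 1 a = 0" using I a by blast
    thus False by (simp add: eval_poly_simps)
  qed
  show r: "\<exists>z. map_regular_at \<phi> (z *\<^sub>R a)"
    using orbit_ideal_of_trajectory[OF I, of 1] nu by blast
  show nz: "ray a P1 \<noteq> 0 \<or> ray a P2 \<noteq> 0"
  proof (rule ccontr)
    assume "\<not> ?thesis"
    hence "traj \<phi> a z = 0" if "z \<noteq> 0" "map_regular_at \<phi> (z *\<^sub>R a)" for z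
      using traj_polys[OF that] by (simp add: zero_prod_def)
    hence "F dvd px" "F dvd py" by (auto intro!: orbit_ideal_of_trajectory[OF I])
    thus False using coprime_px_py nu coprime_common_divisor by blast
  qed
  show "F \<noteq> 0"
  proof
    assume "F = 0"
    hence fin: "finite (UNIV - orbit \<phi> a)" using cof by (simp add: eval_poly_simps)
    define m where "m = [:0, 1:] * ray a Q"
    have "m \<noteq> 0" unfolding m_def using r by (auto simp: regular_iff simp flip: poly_ray)
    have "ray a P1 = smult r m" for r
    proof -
      have "infinite (range (\<lambda>y::real. (r, y)))"
        using finite_imageD[of "\<lambda>y::real. (r, y)" UNIV] infinite_UNIV_char_0[where 'a = real]
        by (auto simp: inj_on_def)
      hence "infinite (range (\<lambda>y::real. (r, y)) - ((UNIV - orbit \<phi> a) \<union> {a}))"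
        using fin by (intro Diff_infinite_finite) auto
      moreover have "range (\<lambda>y::real. (r, y)) - ((UNIV - orbit \<phi> a) \<union> {a}) \<subseteq> traj \<phi> a ` {z. poly (ray a P1 - smult r m) z = 0}"
      proof
        fix x assume "x \<in> range (\<lambda>y::real. (r, y)) - ((UNIV - orbit \<phi> a) \<union> {a})"
        hence "fst x = r" "x \<in> orbit \<phi> a" "x \<noteq> a" by auto
        then obtain z where z: "x = traj \<phi> a z" "z \<noteq> 0" "map_regular_at \<phi> (z *\<^sub>R a)" "fst x = r"
          unfolding orbit_eq_traj by blast
        have "poly (ray a Q) z \<noteq> 0" using z(3) by (simp add: regular_iff poly_ray)
        hence "poly (ray a P1) z = r * poly m z"
          using z traj_polys[OF z(2,3)] by (auto simp: m_def field_simps)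
        thus "x \<in> traj \<phi> a ` {z. poly (ray a P1 - smult r m) z = 0}" using z by auto
      qed
      ultimately have "infinite {z. poly (ray a P1 - smult r m) z = 0}"
        using finite_subset finite_imageI by metis
      hence "ray a P1 - smult r m = 0" by (rule infinite_roots_poly_0)
      thus ?thesis by simp
    qed
    from this[of 0] this[of 1] have "m = 0" by simp
    thus False using \<open>m \<noteq> 0\<close> by simp
  qed
qed

text \<open>
  A nonzero form vanishes on no trajectory of varying direction. The trajectory therefore lies on a
  line through the origin, and \<open>F\<close> divides the equation of this line.
\<close>

lemma homogeneous_orbit_equation_linear:
  assumes rep: "rat_map_rep \<phi> P1 P2 Q" and F: "curve_given_by (orbit \<phi> a) F" and hom: "hom_poly D F"
  shows "D = 1"
proof -
  interpret rat_map_rep \<phi> P1 P2 Q by fact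
  have I: "{G. \<forall>x\<in>orbit \<phi> a. eval_poly G x = 0} = {G. F dvd G}" using F unfolding curve_given_by_def by auto
  note nt = orbit_curve_nontrivial[OF rep F]
  obtain z0 where "map_regular_at \<phi> (z0 *\<^sub>R a)" using nt(3) by blast
  then obtain m g \<alpha> \<beta> where c: "rational_curve m g \<alpha> \<beta>"
    and m: "\<And>z. poly m z \<noteq> 0 \<longleftrightarrow> z \<noteq> 0 \<and> map_regular_at \<phi> (z *\<^sub>R a)"
    and pt: "\<And>z. poly m z \<noteq> 0 \<Longrightarrow> traj \<phi> a z = rational_curve.pt m g \<alpha> \<beta> z"
    using trajectory_curve[OF _ nt(4)] by metis
  interpret rational_curve m g \<alpha> \<beta> by (rule c)
  have "F \<in> {G. \<forall>x\<in>orbit \<phi> a. eval_poly G x = 0}" unfolding I by simp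
  hence Fv0: "eval_poly F x = 0" if "x \<in> orbit \<phi> a" for x using that by simp
  have Fv: "eval_poly F (pt z) = 0" if "poly m z \<noteq> 0" for z
  proof -
    have "traj \<phi> a z \<in> orbit \<phi> a" using m[of z] that unfolding orbit_eq_traj by blast
    thus ?thesis using Fv0 pt[OF that] by simp
  qed
  have "\<not> (degree \<alpha> > 0 \<or> degree \<beta> > 0)" using form_vanishing[OF hom] Fv nt(1) by blast
  hence "degree \<alpha> = 0 \<and> degree \<beta> = 0" by simp
  then obtain e1 e2 where e: "\<alpha> = [:e1:]" "\<beta> = [:e2:]" "e1 \<noteq> 0 \<or> e2 \<noteq> 0" using constant_direction by metis
  define L where "L = cpoly e2 * px + cpoly (- e1) * py"
  have "F dvd L"
  proof (rule orbit_ideal_of_trajectory[OF I])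
    fix z assume "z \<noteq> 0" "map_regular_at \<phi> (z *\<^sub>R a)"
    hence "traj \<phi> a z = pt z" using pt m by blast
    moreover have "pt z = rho z *\<^sub>R (e1, e2)" unfolding pt_def by (simp add: e)
    ultimately show "eval_poly L (traj \<phi> a z) = 0" unfolding L_def eval_linear by simp
  qed
  then obtain K where K: "L = F * K" by blast
  have "L \<noteq> 0"
  proof
    assume "L = 0"
    hence "eval_poly L (1, 0) = 0" "eval_poly L (0, 1) = 0" by (simp_all add: eval_poly_simps)
    thus False using e(3) unfolding L_def eval_linear by simp
  qed
  obtain d where d: "hom_poly d F" "d \<le> 1"
    using hom_poly_factor[of 1 F K] hom_linear \<open>L \<noteq> 0\<close> unfolding K[symmetric] L_def by metis
  have "D = d" using hom_poly_unique[OF hom d(1) nt(1)] .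
  moreover have "D \<noteq> 0"
  proof
    assume "D = 0"
    then obtain c where c: "F = cpoly c" using hom hom_poly_0E by blast
    have "eval_poly F a = 0" using I by (auto simp: orbit_def)
    hence "c = 0" unfolding c by (simp only: eval_poly_gens)
    thus False using c nt(1) by (simp add: cpoly_def)
  qed
  ultimately show ?thesis using d by simp
qed

lemma coeff_mult_low:
  fixes p q :: "real poly"
  assumes "\<And>i. i < k \<Longrightarrow> coeff p i = 0"
  shows "coeff (p * q) k = coeff p k * coeff q 0"
    "coeff (p * q) (Suc k) = coeff p k * coeff q 1 + coeff p (Suc k) * coeff q 0"
proof -
  have z: "(\<Sum>i<k. coeff p i * f i) = 0" for f using assms by (intro sum.neutral) auto
  have s: "(\<Sum>i\<le>k. f i) = (\<Sum>i<k. f i) + f k" for f :: "nat \<Rightarrow> real"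
    by (simp flip: lessThan_Suc_atMost)
  show "coeff (p * q) k = coeff p k * coeff q 0" unfolding coeff_mult s z by simp
  show "coeff (p * q) (Suc k) = coeff p k * coeff q 1 + coeff p (Suc k) * coeff q 0"
    unfolding coeff_mult sum.atMost_Suc s z by simp
qed

lemma coeff_shift_low:
  "coeff (pcompose \<alpha> [:z, 1:]) 0 = poly \<alpha> (z::real)" "coeff (pcompose \<alpha> [:z, 1:]) 1 = poly (pderiv \<alpha>) z"
proof -
  show "coeff (pcompose \<alpha> [:z, 1:]) 0 = poly \<alpha> z" by (simp flip: poly_0_coeff_0 add: poly_pcompose)
  have "coeff (pcompose \<alpha> [:z, 1:]) 1 = poly (pderiv (pcompose \<alpha> [:z, 1:])) 0"
    by (simp add: poly_0_coeff_0 coeff_pderiv)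
  thus "coeff (pcompose \<alpha> [:z, 1:]) 1 = poly (pderiv \<alpha>) z"
    by (simp add: pderiv_pcompose pderiv_pCons poly_pcompose)
qed

lemma coeff_ray: "coeff (ray a p) k = eval_poly (coeff (graded p) k) a"
  by (simp add: ray_def coeff_map_poly eval_poly_simps)

text \<open>
  The velocity of a trajectory with non-constant direction: comparing the two lowest coefficients in
  \<open>w\<close> of \<open>c(z + w) = \<phi>(w c(z)) / w\<close> shows that \<open>(\<alpha> \<beta>' - \<alpha>' \<beta>) / \<rho>\<close> is a quotient of two forms in
  \<open>(\<alpha>, \<beta>)\<close>.
\<close>

lemma trajectory_velocity:
  assumes rep: "rat_map_rep \<phi> P1 P2 Q" and te: "translation_equation \<phi>" and c: "rational_curve m g \<alpha> \<beta>"
    and m: "\<And>z. poly m z \<noteq> 0 \<longleftrightarrow> z \<noteq> 0 \<and> map_regular_at \<phi> (z *\<^sub>R a)"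
    and pt: "\<And>z. poly m z \<noteq> 0 \<Longrightarrow> traj \<phi> a z = rational_curve.pt m g \<alpha> \<beta> z"
    and nc: "degree \<alpha> > 0 \<or> degree \<beta> > 0" and nz: "P1 \<noteq> 0 \<or> P2 \<noteq> 0"
  obtains k E J where "hom_poly k E" "E \<noteq> 0" "hom_poly (k + 3) J"
    "m * form_at E \<alpha> \<beta> * (\<alpha> * pderiv \<beta> - pderiv \<alpha> * \<beta>) = g * form_at J \<alpha> \<beta>"
proof -
  interpret rat_map_rep \<phi> P1 P2 Q by fact
  interpret rational_curve m g \<alpha> \<beta> by fact
  define nonz where "nonz k \<longleftrightarrow> coeff (graded P1) k \<noteq> 0 \<or> coeff (graded P2) k \<noteq> 0" for k
  have "\<exists>k. nonz k" using nz unfolding nonz_def by (metis graded_eq_0_iff leading_coeff_0_iff)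
  define \<mu> where "\<mu> = (LEAST k. nonz k)"
  have \<mu>: "nonz \<mu>" unfolding \<mu>_def using \<open>\<exists>k. nonz k\<close> by (rule LeastI_ex)
  have low: "coeff (graded P1) k = 0" "coeff (graded P2) k = 0" if "k < \<mu>" for k
    using not_less_Least[of k nonz] that unfolding \<mu>_def nonz_def by auto
  define A1 where "A1 = coeff (graded P1) \<mu>"
  define A2 where "A2 = coeff (graded P2) \<mu>"
  define B1 where "B1 = coeff (graded P1) (Suc \<mu>)"
  define B2 where "B2 = coeff (graded P2) (Suc \<mu>)"
  have h: "hom_poly \<mu> A1" "hom_poly \<mu> A2" "hom_poly (Suc \<mu>) B1" "hom_poly (Suc \<mu>) B2"
    unfolding A1_def A2_def B1_def B2_def by (rule hom_poly_component)+
  obtain j where j: "coeff (graded Q) j \<noteq> 0" using Q0 by (metis graded_eq_0_iff leading_coeff_0_iff)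
  \<comment> \<open>Where \<open>q\<close> is not zero, \<open>c(z)\<close> is defined and nonzero, and \<open>\<phi>\<close> is regular on almost all of its ray.\<close>
  define q where "q = m * g * form_at (coeff (graded Q) j) \<alpha> \<beta>"
  have q0: "q \<noteq> 0"
    unfolding q_def using m0 g0 form_at_eq_0_imp_0[OF cop nc hom_poly_component[of j Q]] j by auto
  have key: "eval_poly A1 (pt z) * poly \<beta> z = eval_poly A2 (pt z) * poly \<alpha> z \<and>
      eval_poly A1 (pt z) * poly (pderiv \<beta>) z + eval_poly B1 (pt z) * poly \<beta> z
      = eval_poly A2 (pt z) * poly (pderiv \<alpha>) z + eval_poly B2 (pt z) * poly \<alpha> z"
    if "poly q z \<noteq> 0" for z
  proof -
    have mz: "poly m z \<noteq> 0" and gz: "poly g z \<noteq> 0" and fz: "poly (form_at (coeff (graded Q) j) \<alpha> \<beta>) z \<noteq> 0"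
      using that by (auto simp: q_def)
    have "rho z \<noteq> 0" using mz gz by (simp add: rho_def)
    hence "coeff (ray (pt z) Q) j \<noteq> 0" unfolding coeff_ray pt_form[OF hom_poly_component] using fz by simp
    hence rQ: "ray (pt z) Q \<noteq> 0" by auto
    have z: "z \<noteq> 0" "map_regular_at \<phi> (z *\<^sub>R a)" using m mz by auto
    define shift where "shift = (\<lambda>p::real poly. pcompose p [:z, 1:])"
    have sm: "shift m \<noteq> 0" unfolding shift_def using m0 by (auto simp: pcompose_eq_0_iff)
    have "ray (pt z) P1 * shift \<beta> = ray (pt z) P2 * shift \<alpha>"
    proof (rule poly_eq_cofinite)
      show "[:0, 1:] * ray (pt z) Q * shift m \<noteq> 0" using rQ sm by simp
      fix w assume *: "poly ([:0, 1:] * ray (pt z) Q * shift m) w \<noteq> 0"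
      hence w: "w \<noteq> 0" "eval_poly Q (w *\<^sub>R pt z) \<noteq> 0" "poly m (z + w) \<noteq> 0"
        by (auto simp: poly_ray shift_def poly_pcompose)
      have zw: "z + w \<noteq> 0" "map_regular_at \<phi> ((z + w) *\<^sub>R a)" using m w(3) by auto
      have wr: "map_regular_at \<phi> (w *\<^sub>R traj \<phi> a z)" unfolding pt[OF mz] regular_iff by (rule w(2))
      have "pt (z + w) = traj \<phi> (pt z) w"
        using traj_shift[OF te z(1) w(1) zw(1) z(2) zw(2) wr] pt[OF mz] pt[OF w(3)] by simp
      also have "\<dots> = (1 / (w * eval_poly Q (w *\<^sub>R pt z))) *\<^sub>R (eval_poly P1 (w *\<^sub>R pt z), eval_poly P2 (w *\<^sub>R pt z))"
        unfolding traj_def eval[OF w(2)] by simp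
      finally have e: "fst (pt (z + w)) * eval_poly P2 (w *\<^sub>R pt z) = snd (pt (z + w)) * eval_poly P1 (w *\<^sub>R pt z)"
        by simp
      show "poly (ray (pt z) P1 * shift \<beta>) w = poly (ray (pt z) P2 * shift \<alpha>) w"
      proof (cases "rho (z + w) = 0")
        case True
        hence "pt (z + w) = 0" by (simp add: pt_def zero_prod_def)
        hence "(1 / (w * eval_poly Q (w *\<^sub>R pt z))) *\<^sub>R (eval_poly P1 (w *\<^sub>R pt z), eval_poly P2 (w *\<^sub>R pt z)) = 0"
          using \<open>pt (z + w) = traj \<phi> (pt z) w\<close> \<open>traj \<phi> (pt z) w = _\<close> by simp
        hence "eval_poly P1 (w *\<^sub>R pt z) = 0" "eval_poly P2 (w *\<^sub>R pt z) = 0"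
          using w by (simp_all add: prod_eq_iff)
        thus ?thesis by (simp add: poly_ray)
      next
        case False
        thus ?thesis using e by (simp add: poly_ray pt_def shift_def poly_pcompose mult.commute)
      qed
    qed
    hence "coeff (ray (pt z) P1 * shift \<beta>) \<mu> = coeff (ray (pt z) P2 * shift \<alpha>) \<mu>"
      "coeff (ray (pt z) P1 * shift \<beta>) (Suc \<mu>) = coeff (ray (pt z) P2 * shift \<alpha>) (Suc \<mu>)" by simp_all
    moreover have "coeff (ray (pt z) P1) i = 0" "coeff (ray (pt z) P2) i = 0" if "i < \<mu>" for i
      using low[OF that] by (simp_all add: coeff_ray eval_poly_simps)
    ultimately show ?thesis
      by (simp add: coeff_mult_low shift_def coeff_shift_low[simplified] coeff_ray A1_def A2_def B1_def B2_def)
  qed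
  have "form_at (A1 * py - A2 * px) \<alpha> \<beta> = 0"
  proof (rule poly_eq_cofinite[OF q0])
    fix z assume z: "poly q z \<noteq> 0"
    hence "rho z \<noteq> 0" by (auto simp: q_def rho_def)
    thus "poly (form_at (A1 * py - A2 * px) \<alpha> \<beta>) z = poly 0 z"
      using key[OF z] unfolding pt_form[OF h(1)] pt_form[OF h(2)] form_at_simps form_at_gens by simp
  qed
  moreover have "hom_poly (\<mu> + 1) (A1 * py - A2 * px)"
    by (intro hom_poly_diff hom_poly_mult h hom_poly_gens)
  ultimately have "A1 * py - A2 * px = 0" using form_at_eq_0_imp_0[OF cop nc] by blast
  hence A12: "A1 * py = A2 * px" by simp
  hence "px dvd A1 * py" by (metis dvd_triv_right)
  hence "px dvd A1" using coprime_dvd_mult_left_iff[OF coprime_px_py] by blast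
  then obtain E where E: "A1 = px * E" by blast
  have "px * (E * py) = px * A2" using A12 unfolding E by (simp only: mult_ac)
  hence E2: "A2 = E * py" by (subst (asm) mult_cancel_left) auto
  have "E \<noteq> 0" using \<mu> E E2 by (auto simp: nonz_def A1_def A2_def)
  hence A10: "A1 \<noteq> 0" using E by simp
  have "\<exists>e. hom_poly e (px :: real poly poly) \<and> hom_poly (\<mu> - e) E \<and> e \<le> \<mu>"
    by (rule hom_poly_factor[OF h(1)[unfolded E] A10[unfolded E]]) blast
  then obtain e where e: "hom_poly e (px :: real poly poly)" "hom_poly (\<mu> - e) E" "e \<le> \<mu>" by blast
  have "e = 1" using hom_poly_unique[OF e(1) hom_poly_gens(2)] by simp
  define k where "k = \<mu> - 1"
  have k: "\<mu> = Suc k" "hom_poly k E" using e \<open>e = 1\<close> by (auto simp: k_def)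
  define J where "J = B2 * px - B1 * py"
  have "hom_poly (Suc \<mu> + 1) J" unfolding J_def by (intro hom_poly_diff hom_poly_mult h hom_poly_gens)
  hence J: "hom_poly (k + 3) J" using k(1) by (simp add: numeral_3_eq_3)
  have "m * form_at E \<alpha> \<beta> * (\<alpha> * pderiv \<beta> - pderiv \<alpha> * \<beta>) = g * form_at J \<alpha> \<beta>"
  proof (rule poly_eq_cofinite[OF q0])
    fix z assume z: "poly q z \<noteq> 0"
    hence mz: "poly m z \<noteq> 0" and r: "rho z \<noteq> 0" by (auto simp: q_def rho_def)
    define R where "R = rho z ^ \<mu>"
    have R: "R \<noteq> 0" using r by (simp add: R_def)
    define e' where "e' = poly (form_at E \<alpha> \<beta>) z"
    have a1: "poly (form_at A1 \<alpha> \<beta>) z = poly \<alpha> z * e'" unfolding E e'_def by (simp only: form_at_simps form_at_gens poly_mult)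
    have a2: "poly (form_at A2 \<alpha> \<beta>) z = e' * poly \<beta> z" unfolding E2 e'_def by (simp only: form_at_simps form_at_gens poly_mult)
    have "R * (poly \<alpha> z * e' * poly (pderiv \<beta>) z + rho z * poly (form_at B1 \<alpha> \<beta>) z * poly \<beta> z)
        = R * (e' * poly \<beta> z * poly (pderiv \<alpha>) z + rho z * poly (form_at B2 \<alpha> \<beta>) z * poly \<alpha> z)"
      using key[OF z] unfolding pt_form[OF h(1)] pt_form[OF h(2)] pt_form[OF h(3)] pt_form[OF h(4)] a1 a2 R_def
      by (simp add: algebra_simps)
    hence "poly \<alpha> z * e' * poly (pderiv \<beta>) z + rho z * poly (form_at B1 \<alpha> \<beta>) z * poly \<beta> z
        = e' * poly \<beta> z * poly (pderiv \<alpha>) z + rho z * poly (form_at B2 \<alpha> \<beta>) z * poly \<alpha> z"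
      using R by simp
    hence "e' * (poly \<alpha> z * poly (pderiv \<beta>) z - poly (pderiv \<alpha>) z * poly \<beta> z)
        = rho z * (poly (form_at B2 \<alpha> \<beta>) z * poly \<alpha> z - poly (form_at B1 \<alpha> \<beta>) z * poly \<beta> z)"
      by (simp add: algebra_simps)
    moreover have "poly (form_at J \<alpha> \<beta>) z = poly (form_at B2 \<alpha> \<beta>) z * poly \<alpha> z - poly (form_at B1 \<alpha> \<beta>) z * poly \<beta> z"
      unfolding J_def by (simp only: form_at_simps form_at_gens poly_mult poly_diff)
    ultimately have "e' * (poly \<alpha> z * poly (pderiv \<beta>) z - poly (pderiv \<alpha>) z * poly \<beta> z) = rho z * poly (form_at J \<alpha> \<beta>) z"
      by simp
    hence "poly m z * e' * (poly \<alpha> z * poly (pderiv \<beta>) z - poly (pderiv \<alpha>) z * poly \<beta> z) = poly g z * poly (form_at J \<alpha> \<beta>) z"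
      using mz by (simp add: rho_def field_simps)
    thus "poly (m * form_at E \<alpha> \<beta> * (\<alpha> * pderiv \<beta> - pderiv \<alpha> * \<beta>)) z = poly (g * form_at J \<alpha> \<beta>) z"
      by (simp add: e'_def)
  qed
  thus thesis using that[OF k(2) \<open>E \<noteq> 0\<close> J] by blast
qed


section \<open>Orbit equations have the normal form\<close>

lemma subst_linear_monomial:
  fixes L1 L2 :: "real rat_fun"
  assumes "N > 0 \<or> L2 \<noteq> 0"
  shows "subst_rat constf (Xf * Yf powi (int N - 1)) L1 L2 = L1 * L2 powi (int N - 1)"
proof (cases N)
  case 0
  have "subst_val constf (Fract px py) L1 L2 (subst_poly constf px L1 L2 / subst_poly constf py L1 L2)"
    by (rule subst_val_Fract) (use assms 0 in \<open>simp add: subst_poly_gens ringhom_constf\<close>)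
  moreover have "Fract px py = Xf * Yf powi (int N - 1)"
    by (simp add: 0 Fract_eq_ratf Xf_def Yf_def divide_inverse power_int_minus)
  ultimately have "subst_rat constf (Xf * Yf powi (int N - 1)) L1 L2 = subst_poly constf px L1 L2 / subst_poly constf py L1 L2"
    using subst_rat_eq[OF ringhom_constf] by metis
  thus ?thesis
    by (simp add: 0 subst_poly_gens ringhom_constf divide_inverse power_int_minus)
next
  case (Suc n)
  interpret s: ringhom "\<lambda>p. subst_poly constf p L1 L2" by (rule ringhom_subst_poly[OF ringhom_constf])
  have "subst_val constf (Fract (px * py ^ n) 1) L1 L2 (subst_poly constf (px * py ^ n) L1 L2 / subst_poly constf 1 L1 L2)"
    by (rule subst_val_Fract) (simp add: s.one)
  moreover have "Fract (px * py ^ n) 1 = Xf * Yf powi (int N - 1)"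
    unfolding Fract_eq_ratf ringhom.mult[OF ringhom_ratf] ringhom.power[OF ringhom_ratf] ringhom.one[OF ringhom_ratf]
    by (simp add: Suc Xf_def Yf_def)
  moreover have "subst_poly constf (px * py ^ n) L1 L2 = L1 * L2 ^ n"
    by (simp only: s.mult s.power subst_poly_gens[OF ringhom_constf])
  ultimately have "subst_rat constf (Xf * Yf powi (int N - 1)) L1 L2 = L1 * L2 ^ n / subst_poly constf 1 L1 L2"
    using subst_rat_eq[OF ringhom_constf] by metis
  thus ?thesis by (simp add: Suc s.one)
qed

lemma ratf_linear: "ratf (cpoly a * px + cpoly b * py) = constf a * Xf + constf b * Yf"
  by (simp only: ringhom.hom_simps[OF ringhom_ratf] constf_def Xf_def Yf_def)

lemma linear_form_eq_0_iff: "cpoly a * px + cpoly b * py = (0 :: real poly poly) \<longleftrightarrow> a = 0 \<and> b = 0"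
proof
  assume *: "cpoly a * px + cpoly b * py = 0"
  have "eval_poly (cpoly a * px + cpoly b * py) x = 0" for x unfolding * by (simp add: eval_poly_simps)
  from this[of "(1, 0)"] this[of "(0, 1)"] show "a = 0 \<and> b = 0" unfolding eval_linear by simp
qed (simp add: cpoly_def)

lemma ratf_divide_eq_Fract: "q \<noteq> 0 \<Longrightarrow> q' \<noteq> 0 \<Longrightarrow> p * q' = p' * q \<Longrightarrow> Fract p q = ratf p' / ratf q'"
  unfolding Fract_eq_ratf[symmetric] by (simp add: eq_fract)

lemma orbit_equation_formI:
  assumes "hom_poly d P" "hom_poly d Q" "P \<noteq> 0" "Q \<noteq> 0" "a1 * b2 - b1 * a2 \<noteq> 0" and B: "B \<noteq> 0"
    and N: "N > 0" and eq: "A * (Q ^ N) = P ^ N * ((cpoly a1 * px + cpoly b1 * py) * (cpoly a2 * px + cpoly b2 * py) ^ (N - 1)) * B"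
  shows "orbit_equation_form N (Fract A B)"
proof -
  have "Fract A B = ratf (P ^ N * ((cpoly a1 * px + cpoly b1 * py) * (cpoly a2 * px + cpoly b2 * py) ^ (N - 1))) / ratf (Q ^ N)"
    by (rule ratf_divide_eq_Fract) (use assms in auto)
  also have "\<dots> = ratf P ^ N / ratf Q ^ N * ((constf a1 * Xf + constf b1 * Yf) * (constf a2 * Xf + constf b2 * Yf) ^ (N - 1))"
    by (simp only: ringhom.mult[OF ringhom_ratf] ringhom.power[OF ringhom_ratf] ratf_linear times_divide_eq_left)
  also have "(constf a2 * Xf + constf b2 * Yf) ^ (N - 1) = (constf a2 * Xf + constf b2 * Yf) powi (int N - 1)"
    using N by (cases N) auto
  also have "(constf a1 * Xf + constf b1 * Yf) * (constf a2 * Xf + constf b2 * Yf) powi (int N - 1)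
      = subst_rat constf (Xf * Yf powi (int N - 1)) (constf a1 * Xf + constf b1 * Yf) (constf a2 * Xf + constf b2 * Yf)"
    by (rule subst_linear_monomial[symmetric]) (use N in simp)
  finally show ?thesis
    unfolding orbit_equation_form_def
    by (intro exI[of _ P] exI[of _ Q] exI[of _ d] exI[of _ a1] exI[of _ b1] exI[of _ a2] exI[of _ b2] conjI assms(1-5))
qed

text \<open>
  The distance between the highest and the lowest degree of the homogeneous components is additive in
  products.
\<close>

lemma two_forms_dvd:
  fixes F1 F2 G1 G2 :: "real poly poly"
  assumes "hom_poly (d + N) F1" "hom_poly d F2" "hom_poly (e + n) G1" "hom_poly e G2"
    and "F1 \<noteq> 0" "F2 \<noteq> 0" "G1 \<noteq> 0" "G2 \<noteq> 0" "N > 0" "n > 0" and dvd: "F1 - F2 dvd G1 - G2"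
  shows "N \<le> n"
proof -
  obtain K where K: "G1 - G2 = (F1 - F2) * K" using dvd by blast
  have gF: "graded (F1 - F2) = monom F1 (d + N) - monom F2 d" and gG: "graded (G1 - G2) = monom G1 (e + n) - monom G2 e"
    using assms by (simp_all add: hom_poly_iff_graded graded_simps)
  have deg: "degree (monom u (d + N) - monom v d) = d + N" "order 0 (monom u (d + N) - monom v d) = d"
    "monom u (d + N) - monom v d \<noteq> 0"
    if "u \<noteq> 0" "v \<noteq> 0" "N > 0" for u v :: "real poly poly" and d N :: nat
  proof -
    let ?p = "monom u (d + N) - monom v d"
    have c: "coeff ?p (d + N) = u" "coeff ?p d = - v" using that by auto
    show nz: "?p \<noteq> 0" using c(1) that(1) by (metis coeff_0)
    show "degree ?p = d + N"
      by (rule antisym[OF degree_le le_degree]) (use c that in auto)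
    have "?p = monom 1 d * (monom u N - [:v:])"
      by (simp add: right_diff_distrib mult_monom flip: monom_0)
    moreover have "order 0 (monom u N - [:v:]) = 0"
      using that by (intro order_0I) (simp add: poly_monom zero_power)
    moreover have "order 0 (monom (1 :: real poly poly) d) = d" by simp
    ultimately show "order 0 ?p = d" using nz order_mult[of "monom 1 d" "monom u N - [:v:]" 0] by simp
  qed
  have gK: "graded (G1 - G2) = graded (F1 - F2) * graded K" unfolding K graded_simps ..
  have K0: "graded K \<noteq> 0" using gK deg(3)[of G1 G2 n e] assms unfolding gG by auto
  have "e + n = d + N + degree (graded K)"
    using arg_cong[OF gK, of degree] deg[of F1 F2 N d] deg[of G1 G2 n e] assms K0
    unfolding gF gG by (simp add: degree_mult_eq)
  moreover have "e = d + order 0 (graded K)"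
    using arg_cong[OF gK, of "order 0"] deg[of F1 F2 N d] deg[of G1 G2 n e] assms K0 order_mult[of "graded (F1 - F2)" "graded K" 0]
    unfolding gF gG by auto
  moreover have "order 0 (graded K) \<le> degree (graded K)" using K0 by (rule order_degree)
  ultimately show "N \<le> n" by linarith
qed

text \<open>
  If the equation \<open>F = B(a) A - A(a) B\<close> of the orbit is homogeneous, then it is linear; this settles
  the cases \<open>N = 0\<close> and \<open>A(a) = 0\<close>. Otherwise the direction \<open>(\<alpha>, \<beta>)\<close> of the trajectory \<open>\<rho> (\<alpha>, \<beta>)\<close>
  varies. The velocity expresses the Wronskian \<open>\<omega>\<close> of \<open>\<alpha>\<close> and \<open>\<beta>\<close> by \<open>\<rho>\<close>, and \<open>F = 0\<close> expresses \<open>\<rho>^N\<close>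
  by forms in \<open>(\<alpha>, \<beta>)\<close>; together they give an equation \<open>\<omega>^N Q(\<alpha>, \<beta>) = P(\<alpha>, \<beta>)\<close>. Its solutions are
  known: two linear forms \<open>\<eta>\<close>, \<open>\<xi>\<close> in \<open>(\<alpha>, \<beta>)\<close> are \<open>(z - z1)^n\<close> and \<open>1\<close>. Once \<open>n = N\<close> is established,
  the equation is solved for \<open>A / B\<close>, and \<open>\<eta>\<close>, \<open>\<xi>\<close> become the linear forms of the normal form.
\<close>

lemma orbit_given_by_imp_form:
  assumes te: "translation_equation \<phi>" and W: "hom_rat N W" and pv: "proj_value W a \<noteq> None"
    and og: "orbit_given_by \<phi> W a"
  shows "orbit_equation_form N W"
proof -
  obtain A B where B0: "B \<noteq> 0" and copAB: "coprime A B" and WAB: "W = Fract A B"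
    and F: "curve_given_by (orbit \<phi> a) (cpoly (eval_poly B a) * A - cpoly (eval_poly A a) * B)"
    using og unfolding orbit_given_by_def by blast
  obtain e where hA: "hom_poly (N + e) A" and hB: "hom_poly e B"
    using coprime_hom_representation W B0 copAB unfolding WAB by metis
  define va where "va = eval_poly A a"
  define vb where "vb = eval_poly B a"
  have vb: "vb \<noteq> 0" using pv unfolding WAB proj_value_coprime[OF B0 copAB] vb_def by (auto split: if_splits)
  define F where "F = cpoly vb * A - cpoly va * B"
  have F: "curve_given_by (orbit \<phi> a) F" using F unfolding F_def va_def vb_def .
  obtain P1 P2 Q where rep: "rat_map_rep \<phi> P1 P2 Q" using rat_map_rep_exists by blast
  note nt = orbit_curve_nontrivial[OF rep F]
  consider (zero) "N = 0" | (line) "N > 0" "va = 0" | (curve) "N > 0" "va \<noteq> 0" by blast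
  thus ?thesis
  proof cases
    case zero
    have "hom_poly e F" unfolding F_def using hA hB zero by (intro hom_poly_diff hom_poly_cmult) auto
    hence e: "e = 1" using homogeneous_orbit_equation_linear[OF rep F] by blast
    have "hom_poly 1 A" "hom_poly 1 B" using hA hB zero e by simp_all
    obtain a1 b1 where A: "A = cpoly a1 * px + cpoly b1 * py" using \<open>hom_poly 1 A\<close> by (rule hom_poly_1E)
    obtain a2 b2 where B: "B = cpoly a2 * px + cpoly b2 * py" using \<open>hom_poly 1 B\<close> by (rule hom_poly_1E)
    have det: "a1 * b2 - b1 * a2 \<noteq> 0"
    proof
      assume d: "a1 * b2 - b1 * a2 = 0"
      have "eval_poly F x = 0" for x
      proof -
        have "eval_poly F x = (a2 * fst a + b2 * snd a) * (a1 * fst x + b1 * snd x) - (a1 * fst a + b1 * snd a) * (a2 * fst x + b2 * snd x)"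
          unfolding F_def va_def vb_def A B by (simp only: eval_poly_simps eval_poly_gens)
        also have "\<dots> = (a1 * b2 - b1 * a2) * (snd a * fst x - fst a * snd x)" by (simp add: algebra_simps)
        finally show ?thesis using d by simp
      qed
      hence "F = 0" by (rule eval_poly_eq_0_imp_0)
      thus False using nt(1) by simp
    qed
    have "W = ratf 1 ^ N / ratf 1 ^ N * subst_rat constf (Xf * Yf powi (int N - 1)) (constf a1 * Xf + constf b1 * Yf) (constf a2 * Xf + constf b2 * Yf)"
    proof -
      have "constf a2 * Xf + constf b2 * Yf \<noteq> 0" using B0 unfolding B ratf_linear[symmetric] by simp
      thus ?thesis unfolding WAB Fract_eq_ratf A B ratf_linear
        by (subst subst_linear_monomial) (auto simp: zero divide_inverse power_int_minus)
    qed
    thus ?thesis unfolding orbit_equation_form_def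
      by (intro exI[of _ 1] exI[of _ 0] exI[of _ a1] exI[of _ b1] exI[of _ a2] exI[of _ b2] conjI
          hom_poly_gens(4) one_neq_zero det)
  next
    case line
    have "hom_poly (N + e) F" unfolding F_def using hA line by (simp add: hom_poly_cmult cpoly_def[of 0])
    hence "N + e = 1" by (rule homogeneous_orbit_equation_linear[OF rep F])
    hence N: "N = 1" and e: "e = 0" using line by auto
    have "hom_poly 1 A" using hA N e by simp
    then obtain a1 b1 where A: "A = cpoly a1 * px + cpoly b1 * py" by (rule hom_poly_1E)
    obtain k where B: "B = cpoly k" using hB e hom_poly_0E by metis
    have k: "k \<noteq> 0" using B B0 by (auto simp: cpoly_def)
    have "A \<noteq> 0" using nt(1) line unfolding F_def by (auto simp: cpoly_def)
    hence ab: "a1 \<noteq> 0 \<or> b1 \<noteq> 0" unfolding A linear_form_eq_0_iff by simp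
    \<comment> \<open>For \<open>N = 1\<close> the second linear form has the exponent zero; any independent one will do.\<close>
    show ?thesis unfolding WAB
    proof (rule orbit_equation_formI[OF hom_poly_gens(4) hom_poly_gens(4)])
      have "(a1 / k) * a1 - (b1 / k) * (- b1) = (a1\<^sup>2 + b1\<^sup>2) / k" by (simp add: power2_eq_square add_divide_distrib)
      moreover have "a1\<^sup>2 + b1\<^sup>2 \<noteq> 0" using ab by (simp add: sum_power2_eq_zero_iff)
      ultimately show "(a1 / k) * a1 - (b1 / k) * (- b1) \<noteq> 0" using k by simp
      have "cpoly (a1 / k) * px * cpoly k = cpoly a1 * px" "cpoly (b1 / k) * py * cpoly k = cpoly b1 * py"
        using k by (simp_all add: cpoly_def)
      hence "(cpoly (a1 / k) * px + cpoly (b1 / k) * py) * cpoly k = A" unfolding A by (simp only: distrib_right)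
      thus "A * 1 ^ N = 1 ^ N * ((cpoly (a1 / k) * px + cpoly (b1 / k) * py) * (cpoly (- b1) * px + cpoly a1 * py) ^ (N - 1)) * B"
        unfolding B by (simp only: N power_one_right) simp
    qed (use B0 line in auto)
  next
    case curve
    have A0: "A \<noteq> 0" using curve(2) by (auto simp: va_def eval_poly_simps)
    have cvb: "cpoly vb \<noteq> 0" "cpoly va \<noteq> 0" using vb curve by (auto simp: cpoly_def)
    have I: "{G. \<forall>x\<in>orbit \<phi> a. eval_poly G x = 0} = {G. F dvd G}" using F unfolding curve_given_by_def by auto
    obtain z0 where "map_regular_at \<phi> (z0 *\<^sub>R a)" using nt(3) by blast
    then obtain m g \<alpha> \<beta> where c: "rational_curve m g \<alpha> \<beta>"
      and m: "\<And>z. poly m z \<noteq> 0 \<longleftrightarrow> z \<noteq> 0 \<and> map_regular_at \<phi> (z *\<^sub>R a)"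
      and pt: "\<And>z. poly m z \<noteq> 0 \<Longrightarrow> traj \<phi> a z = rational_curve.pt m g \<alpha> \<beta> z"
      using rat_map_rep.trajectory_curve[OF rep _ nt(4)] by metis
    interpret rational_curve m g \<alpha> \<beta> by (rule c)
    have ideal: "F dvd G" if "\<And>z. poly m z \<noteq> 0 \<Longrightarrow> eval_poly G (pt z) = 0" for G
      by (rule orbit_ideal_of_trajectory[OF I]) (use that m pt in metis)
    have Fv: "eval_poly F (pt z) = 0" if "poly m z \<noteq> 0" for z
    proof -
      have "traj \<phi> a z \<in> orbit \<phi> a" using m[of z] that unfolding orbit_eq_traj by blast
      moreover have "F \<in> {G. \<forall>x\<in>orbit \<phi> a. eval_poly G x = 0}" unfolding I by simp
      ultimately show ?thesis using pt[OF that] by simp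
    qed
    have nc: "degree \<alpha> > 0 \<or> degree \<beta> > 0"
    proof (rule ccontr)
      assume "\<not> ?thesis"
      then obtain e1 e2 where e12: "\<alpha> = [:e1:]" "\<beta> = [:e2:]" "e1 \<noteq> 0 \<or> e2 \<noteq> 0" using constant_direction by (metis gr0I)
      define L where "L = cpoly e2 * px + cpoly (- e1) * py"
      have "F dvd L"
      proof (rule ideal)
        fix z assume "poly m z \<noteq> 0"
        have "pt z = rho z *\<^sub>R (e1, e2)" unfolding pt_def by (simp add: e12)
        thus "eval_poly L (pt z) = 0" unfolding L_def eval_linear by simp
      qed
      then obtain K where K: "L = F * K" by blast
      have L0: "L \<noteq> 0" using e12(3) unfolding L_def linear_form_eq_0_iff by auto
      have "hom_poly 1 L" unfolding L_def by (rule hom_linear)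
      hence "\<exists>d. hom_poly d F"
        using L0 unfolding K by (elim hom_poly_factor) blast+
      then obtain d where d: "graded F = monom F d" unfolding hom_poly_iff_graded by blast
      have "graded F = monom (cpoly vb * A) (N + e) - monom (cpoly va * B) e"
        using hom_poly_cmult[OF hA, of vb] hom_poly_cmult[OF hB, of va]
        unfolding F_def graded_simps(5) hom_poly_iff_graded[symmetric] by (simp add: F_def graded_simps hom_poly_iff_graded)
      hence "coeff (graded F) (N + e) = cpoly vb * A" "coeff (graded F) e = - (cpoly va * B)"
        using curve(1) by auto
      hence "coeff (monom F d) (N + e) \<noteq> 0" "coeff (monom F d) e \<noteq> 0" unfolding d[symmetric] using cvb A0 B0 by auto
      thus False using curve(1) by (auto split: if_splits)
    qed
    have "P1 \<noteq> 0 \<or> P2 \<noteq> 0" using nt(4) by (auto simp: ray_def graded_simps)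
    then obtain k E J where hE: "hom_poly k E" and E0: "E \<noteq> 0" and hJ: "hom_poly (k + 3) J"
      and vel: "m * form_at E \<alpha> \<beta> * (\<alpha> * pderiv \<beta> - pderiv \<alpha> * \<beta>) = g * form_at J \<alpha> \<beta>"
      using trajectory_velocity[OF rep te c m pt nc] by metis
    define \<omega> where "\<omega> = \<alpha> * pderiv \<beta> - pderiv \<alpha> * \<beta>"
    define fE where "fE = form_at E \<alpha> \<beta>"
    define fJ where "fJ = form_at J \<alpha> \<beta>"
    define fA where "fA = form_at A \<alpha> \<beta>"
    define fB where "fB = form_at B \<alpha> \<beta>"
    have vel': "m * fE * \<omega> = g * fJ" using vel unfolding \<omega>_def fE_def fJ_def .
    have lev: "smult vb (g ^ N * fA) = smult va (m ^ N * fB)"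
    proof (rule poly_eq_cofinite[of "m * g"])
      show "m * g \<noteq> 0" using m0 g0 by simp
      fix z assume z: "poly (m * g) z \<noteq> 0"
      hence mz: "poly m z \<noteq> 0" and r: "rho z \<noteq> 0" by (auto simp: rho_def)
      have "vb * (rho z ^ (N + e) * poly fA z) = va * (rho z ^ e * poly fB z)"
        using Fv[OF mz] unfolding F_def eval_poly_simps eval_poly_gens pt_form[OF hA] pt_form[OF hB] fA_def fB_def by simp
      hence "rho z ^ e * (vb * (rho z ^ N * poly fA z)) = rho z ^ e * (va * poly fB z)" by (simp add: power_add mult_ac)
      hence "vb * (rho z ^ N * poly fA z) = va * poly fB z" using r by simp
      thus "poly (smult vb (g ^ N * fA)) z = poly (smult va (m ^ N * fB)) z"
        using mz by (simp add: rho_def power_divide field_simps)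
    qed
    define Qf where "Qf = cpoly vb * (E ^ N * A)"
    define Pf where "Pf = cpoly va * (J ^ N * B)"
    have hQ: "hom_poly (k * N + (N + e)) Qf" unfolding Qf_def by (intro hom_poly_cmult hom_poly_mult hom_poly_power hE hA)
    have "hom_poly ((k + 3) * N + e) Pf" unfolding Pf_def by (intro hom_poly_cmult hom_poly_mult hom_poly_power hJ hB)
    hence hP: "hom_poly (k * N + (N + e) + 2 * N) Pf" by (simp add: algebra_simps)
    have Q0: "Qf \<noteq> 0" unfolding Qf_def using cvb E0 A0 by simp
    have fQ: "form_at Qf \<alpha> \<beta> = smult vb (fE ^ N * fA)" and fP: "form_at Pf \<alpha> \<beta> = smult va (fJ ^ N * fB)"
      unfolding Qf_def Pf_def fE_def fA_def fJ_def fB_def by (simp_all only: form_at_simps form_at_gens) simp_all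
    have main: "\<omega> ^ N * form_at Qf \<alpha> \<beta> = form_at Pf \<alpha> \<beta>"
    proof -
      have "m ^ N * (\<omega> ^ N * form_at Qf \<alpha> \<beta>) = smult vb ((m * fE * \<omega>) ^ N * fA)"
        unfolding fQ by (simp add: power_mult_distrib mult_ac)
      also have "\<dots> = fJ ^ N * smult vb (g ^ N * fA)" unfolding vel' by (simp add: power_mult_distrib mult_ac)
      also have "\<dots> = m ^ N * form_at Pf \<alpha> \<beta>" unfolding lev fP by (simp add: mult_ac)
      finally show ?thesis using m0 by simp
    qed
    obtain a1 b1 a2 b2 z1 n where det: "a1 * b2 - b1 * a2 \<noteq> 0" and n: "n > 0"
      and eta: "smult a1 \<alpha> + smult b1 \<beta> = [:- z1, 1:] ^ n" and xi: "smult a2 \<alpha> + smult b2 \<beta> = 1"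
      by (rule form_equation_solution[OF cop nc curve(1) hP hQ Q0 main[unfolded \<omega>_def]])
    define s where "s = [:- z1, 1:]"
    define \<eta> where "\<eta> = cpoly a1 * px + cpoly b1 * py"
    define \<xi> where "\<xi> = cpoly a2 * px + cpoly b2 * py"
    have f\<eta>: "form_at \<eta> \<alpha> \<beta> = s ^ n" and f\<xi>: "form_at \<xi> \<alpha> \<beta> = 1"
      unfolding \<eta>_def \<xi>_def form_at_linear s_def using eta xi by auto
    have h\<eta>: "hom_poly 1 \<eta>" and h\<xi>: "hom_poly 1 \<xi>" unfolding \<eta>_def \<xi>_def by (rule hom_linear)+
    have \<eta>0: "\<eta> \<noteq> 0" and \<xi>0: "\<xi> \<noteq> 0" using det unfolding \<eta>_def \<xi>_def linear_form_eq_0_iff by auto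
    define \<Delta> where "\<Delta> = a1 * b2 - b1 * a2"
    define \<kappa> where "\<kappa> = - real n / \<Delta>"
    have \<kappa>0: "\<kappa> \<noteq> 0" using n det by (simp add: \<kappa>_def \<Delta>_def)
    have om: "\<omega> = smult \<kappa> (s ^ (n - 1))"
    proof -
      have d\<eta>: "smult a1 (pderiv \<alpha>) + smult b1 (pderiv \<beta>) = smult (real n) (s ^ (n - 1))"
        using arg_cong[OF eta, of pderiv] n by (simp add: pderiv_add pderiv_smult pderiv_power pderiv_pCons s_def)
      have d\<xi>: "smult a2 (pderiv \<alpha>) + smult b2 (pderiv \<beta>) = 0"
        using arg_cong[OF xi, of pderiv] by (simp add: pderiv_add pderiv_smult)
      have "smult \<Delta> \<omega> = (smult a1 \<alpha> + smult b1 \<beta>) * (smult a2 (pderiv \<alpha>) + smult b2 (pderiv \<beta>))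
          - (smult a1 (pderiv \<alpha>) + smult b1 (pderiv \<beta>)) * (smult a2 \<alpha> + smult b2 \<beta>)"
        by (rule poly_eqI_all) (simp add: \<Delta>_def \<omega>_def algebra_simps)
      also have "\<dots> = smult (- real n) (s ^ (n - 1))" unfolding d\<eta> d\<xi> xi by simp
      finally have "smult (1 / \<Delta>) (smult \<Delta> \<omega>) = smult (1 / \<Delta>) (smult (- real n) (s ^ (n - 1)))" by simp
      thus ?thesis using det by (simp add: \<kappa>_def \<Delta>_def)
    qed
    have s0: "s \<noteq> 0" "degree s = 1" by (simp_all add: s_def)
    have w0: "\<omega> \<noteq> 0" unfolding om using \<kappa>0 s0 by simp
    have fE0: "fE \<noteq> 0" unfolding fE_def using form_at_eq_0_imp_0[OF cop nc hE] E0 by blast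
    have J0: "J \<noteq> 0" using vel' m0 fE0 w0 by (auto simp: fJ_def form_at_simps)
    \<comment> \<open>\<open>\<alpha>\<close> and \<open>\<beta>\<close> are polynomials in \<open>s\<^sup>n\<close>, so that counting degrees in \<open>main\<close> gives \<open>n dvd N\<close>.\<close>
    define \<alpha>' where "\<alpha>' = [:- b1 / \<Delta>, b2 / \<Delta>:]"
    define \<beta>' where "\<beta>' = [:a1 / \<Delta>, - a2 / \<Delta>:]"
    have \<Delta>0: "\<Delta> \<noteq> 0" using det by (simp add: \<Delta>_def)
    have e1: "poly (s ^ n) x = a1 * poly \<alpha> x + b1 * poly \<beta> x" and e2: "a2 * poly \<alpha> x + b2 * poly \<beta> x = 1" for x
      using arg_cong[OF eta, of "\<lambda>p. poly p x"] arg_cong[OF xi, of "\<lambda>p. poly p x"] unfolding s_def by simp_all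
    have \<alpha>_eq: "\<alpha> = pcompose \<alpha>' (s ^ n)"
    proof (rule poly_eqI_all)
      fix x
      have "\<Delta> * poly \<alpha> x = b2 * poly (s ^ n) x - b1 * (a2 * poly \<alpha> x + b2 * poly \<beta> x)"
        unfolding e1 \<Delta>_def by (simp add: algebra_simps)
      hence "poly \<alpha> x = (b2 * poly (s ^ n) x - b1) / \<Delta>" unfolding e2 using \<Delta>0 by (simp add: field_simps)
      thus "poly \<alpha> x = poly (pcompose \<alpha>' (s ^ n)) x" by (simp add: \<alpha>'_def poly_pcompose diff_divide_distrib mult.commute)
    qed
    have \<beta>_eq: "\<beta> = pcompose \<beta>' (s ^ n)"
    proof (rule poly_eqI_all)
      fix x
      have "\<Delta> * poly \<beta> x = a1 * (a2 * poly \<alpha> x + b2 * poly \<beta> x) - a2 * poly (s ^ n) x"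
        unfolding e1 \<Delta>_def by (simp add: algebra_simps)
      hence "poly \<beta> x = (a1 - a2 * poly (s ^ n) x) / \<Delta>" unfolding e2 using \<Delta>0 by (simp add: field_simps)
      thus "poly \<beta> x = poly (pcompose \<beta>' (s ^ n)) x" by (simp add: \<beta>'_def poly_pcompose diff_divide_distrib mult.commute)
    qed
    have comp: "degree (form_at G \<alpha> \<beta>) = degree (form_at G \<alpha>' \<beta>') * n" for G
      using form_at_pcompose[of G \<alpha>' \<beta>' "s ^ n", folded \<alpha>_eq \<beta>_eq, symmetric] s0
      by (simp add: degree_pcompose degree_power_eq)
    have fQ0: "form_at Qf \<alpha> \<beta> \<noteq> 0" using form_at_eq_0_imp_0[OF cop nc hQ] Q0 by blast
    have "N * (n - 1) + degree (form_at Qf \<alpha>' \<beta>') * n = degree (form_at Pf \<alpha>' \<beta>') * n"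
      using arg_cong[OF main, of degree] w0 fQ0 s0 \<kappa>0 unfolding om comp[symmetric]
      by (simp add: degree_mult_eq degree_power_eq mult.commute)
    hence "N * n + degree (form_at Qf \<alpha>' \<beta>') * n = degree (form_at Pf \<alpha>' \<beta>') * n + N"
      using n by (cases n) auto
    hence "n dvd N" by (metis dvd_add_right_iff dvd_triv_right add.commute dvd_add)
    \<comment> \<open>The velocity and the value \<open>s^n\<close> of \<open>\<eta>\<close> yield a relation between two forms whose degrees differ by
      \<open>n\<close>; as a multiple of \<open>F\<close> it forces \<open>N \<le> n\<close>.\<close>
    define Vn where "Vn = \<eta> * J ^ n"
    define Vd where "Vd = \<xi> ^ (n + 1) * (\<eta> ^ n * E ^ n)"
    have hVd: "hom_poly (1 * (n + 1) + (1 * n + k * n)) Vd"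
      unfolding Vd_def by (intro hom_poly_mult hom_poly_power h\<xi> h\<eta> hE)
    have "hom_poly (1 + (k + 3) * n) Vn" unfolding Vn_def by (intro hom_poly_mult hom_poly_power h\<eta> hJ)
    moreover have "1 + (k + 3) * n = 1 * (n + 1) + (1 * n + k * n) + n" by (simp add: algebra_simps)
    ultimately have hVn: "hom_poly (1 * (n + 1) + (1 * n + k * n) + n) Vn" by simp
    have "F dvd Vn - cpoly (\<kappa> ^ n) * Vd"
    proof (rule ideal)
      fix z assume mz: "poly m z \<noteq> 0"
      have rJ: "rho z * poly fJ z = poly fE z * poly \<omega> z"
        using arg_cong[OF vel', of "\<lambda>p. poly p z"] mz by (simp add: rho_def field_simps)
      have "poly (form_at Vn \<alpha> \<beta>) z = poly s z ^ n * poly fJ z ^ n"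
        unfolding Vn_def form_at_simps f\<eta> fJ_def by simp
      hence "rho z ^ n * poly (form_at Vn \<alpha> \<beta>) z = poly s z ^ n * (rho z * poly fJ z) ^ n"
        by (simp add: power_mult_distrib)
      also have "\<dots> = \<kappa> ^ n * ((poly s z ^ n) ^ n * poly fE z ^ n)"
        unfolding rJ om using n by (cases n) (simp_all add: power_mult_distrib mult_ac)
      also have "(poly s z ^ n) ^ n * poly fE z ^ n = poly (form_at Vd \<alpha> \<beta>) z"
        unfolding Vd_def form_at_simps f\<eta> f\<xi> fE_def by simp
      finally have "rho z ^ n * poly (form_at Vn \<alpha> \<beta>) z = \<kappa> ^ n * poly (form_at Vd \<alpha> \<beta>) z" .
      thus "eval_poly (Vn - cpoly (\<kappa> ^ n) * Vd) (pt z) = 0"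
        unfolding eval_poly_simps eval_poly_gens pt_form[OF hVn] pt_form[OF hVd] by (simp add: power_add mult_ac)
    qed
    moreover have "hom_poly (e + N) (cpoly vb * A)" using hom_poly_cmult[OF hA] by (simp add: add.commute)
    moreover have "cpoly (\<kappa> ^ n) \<noteq> 0" using \<kappa>0 by (simp add: cpoly_def)
    ultimately have "N \<le> n"
      unfolding F_def using curve n cvb A0 B0 J0 \<eta>0 \<xi>0 E0
      by (intro two_forms_dvd[OF _ hom_poly_cmult[OF hB] hVn hom_poly_cmult[OF hVd], where ?F1.0 = "cpoly vb * A"])
         (simp_all add: Vn_def Vd_def)
    hence nN: "n = N" using \<open>n dvd N\<close> curve(1) by (meson dvd_imp_le le_antisym)
    have "form_at (cpoly (\<kappa> ^ N * vb) * (\<xi> ^ (N + 1) * (\<eta> ^ N * (E ^ N * A))) - cpoly va * (\<eta> * (J ^ N * B))) \<alpha> \<beta> = 0"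
    proof -
      have "s ^ N * (\<omega> ^ N * form_at Qf \<alpha> \<beta>) = smult (\<kappa> ^ N * vb) ((s ^ N) ^ N * (fE ^ N * fA))"
        unfolding fQ om nN using curve(1) by (cases N) (simp_all add: smult_power power_mult_distrib mult_ac)
      moreover have "s ^ N * form_at Pf \<alpha> \<beta> = smult va (s ^ N * (fJ ^ N * fB))" unfolding fP by simp
      ultimately have "smult (\<kappa> ^ N * vb) ((s ^ N) ^ N * (fE ^ N * fA)) = smult va (s ^ N * (fJ ^ N * fB))"
        using main by simp
      thus ?thesis unfolding form_at_simps form_at_gens f\<eta> f\<xi> nN fE_def[symmetric] fA_def[symmetric] fJ_def[symmetric] fB_def[symmetric]
        by simp
    qed
    moreover have "hom_poly (1 * (N + 1) + (1 * N + (k * N + (N + e)))) (cpoly (\<kappa> ^ N * vb) * (\<xi> ^ (N + 1) * (\<eta> ^ N * (E ^ N * A))))"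
      by (intro hom_poly_cmult hom_poly_mult hom_poly_power h\<xi> h\<eta> hE hA)
    moreover have "hom_poly (1 + ((k + 3) * N + e)) (cpoly va * (\<eta> * (J ^ N * B)))"
      by (intro hom_poly_cmult hom_poly_mult hom_poly_power h\<eta> hJ hB)
    moreover have "1 + ((k + 3) * N + e) = 1 * (N + 1) + (1 * N + (k * N + (N + e)))" by (simp add: algebra_simps)
    ultimately have fin: "cpoly (\<kappa> ^ N * vb) * (\<xi> ^ (N + 1) * (\<eta> ^ N * (E ^ N * A))) = cpoly va * (\<eta> * (J ^ N * B))"
      using form_at_eq_0_imp_0[OF cop nc hom_poly_diff] by (metis eq_iff_diff_eq_0)
    define l where "l = va / (\<kappa> ^ N * vb)"
    have l: "l * (\<kappa> ^ N * vb) = va" "\<kappa> ^ N * vb \<noteq> 0" "l \<noteq> 0" using \<kappa>0 vb curve by (auto simp: l_def)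
    have fin': "\<xi> ^ (N + 1) * (\<eta> ^ N * (E ^ N * A)) = cpoly l * (\<eta> * (J ^ N * B))"
    proof -
      have "cpoly va = cpoly (\<kappa> ^ N * vb) * cpoly l" unfolding l(1)[symmetric] by (simp add: cpoly_def mult.commute)
      hence "cpoly (\<kappa> ^ N * vb) * (\<xi> ^ (N + 1) * (\<eta> ^ N * (E ^ N * A))) = cpoly (\<kappa> ^ N * vb) * (cpoly l * (\<eta> * (J ^ N * B)))"
        using fin by (simp only: mult.assoc)
      moreover have "cpoly (\<kappa> ^ N * vb) \<noteq> 0" using l(2) by (simp add: cpoly_def)
      ultimately show ?thesis by (metis mult_left_cancel)
    qed
    have l\<eta>: "cpoly (l * a1) * px + cpoly (l * b1) * py = cpoly l * \<eta>"
      unfolding \<eta>_def by (simp add: cpoly_def algebra_simps)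
    show ?thesis unfolding WAB
    proof (rule orbit_equation_formI[OF hJ _ J0 _ _ B0 curve(1)])
      have "hom_poly (1 + (1 * 2 + k)) (\<eta> * (\<xi> ^ 2 * E))" by (intro hom_poly_mult hom_poly_power h\<xi> h\<eta> hE)
      thus "hom_poly (k + 3) (\<eta> * (\<xi> ^ 2 * E))" by (simp add: add.commute numeral_3_eq_3)
      show "\<eta> * (\<xi> ^ 2 * E) \<noteq> 0" using \<eta>0 \<xi>0 E0 by simp
      have "l * a1 * b2 - l * b1 * a2 = l * (a1 * b2 - b1 * a2)" by (simp add: algebra_simps)
      thus "l * a1 * b2 - l * b1 * a2 \<noteq> 0" using l det by simp
      have "A * (\<eta> * (\<xi> ^ 2 * E)) ^ N = \<xi> ^ (N - 1) * (\<xi> ^ (N + 1) * (\<eta> ^ N * (E ^ N * A)))"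
      proof -
        have "(\<xi> ^ 2) ^ N = \<xi> ^ (N - 1) * \<xi> ^ (N + 1)"
        proof -
          have "N - 1 + (N + 1) = 2 * N" using curve(1) by simp
          thus ?thesis by (metis power_add power_mult)
        qed
        thus ?thesis by (simp only: power_mult_distrib mult_ac)
      qed
      also have "\<dots> = J ^ N * (cpoly l * \<eta> * \<xi> ^ (N - 1)) * B" unfolding fin' by (simp only: mult_ac)
      finally show "A * (\<eta> * (\<xi> ^ 2 * E)) ^ N
          = J ^ N * ((cpoly (l * a1) * px + cpoly (l * b1) * py) * (cpoly a2 * px + cpoly b2 * py) ^ (N - 1)) * B"
        unfolding l\<eta> \<xi>_def[symmetric] .
    qed
  qed
qed


section \<open>Valuations of the field of rational functions in one variable\<close>

type_synonym crat = "complex poly fract"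

definition polyf :: "complex poly \<Rightarrow> crat" where "polyf p = Fract p 1"

lemma ringhom_polyf: "ringhom polyf"
  by unfold_locales (auto simp: polyf_def One_fract_def)

lemmas polyf_simps = ringhom.hom_simps[OF ringhom_polyf]

lemma polyf_eq_0_iff [simp]: "polyf p = 0 \<longleftrightarrow> p = 0"
  by (simp add: polyf_def Zero_fract_def eq_fract)

lemma polyf_inj: "polyf p = polyf q \<longleftrightarrow> p = q"
  by (simp add: polyf_def eq_fract)

lemma Fract_eq_polyf: "Fract p q = polyf p / polyf q"
  by (cases "q = 0") (auto simp: polyf_def fract_collapse Zero_fract_def[symmetric])

lemma crat_cases:
  obtains p q where "q \<noteq> 0" "coprime p q" "(w :: crat) = polyf p / polyf q"
proof -
  obtain p q where w: "w = Fract p q" "q \<noteq> 0" by (cases w) auto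
  obtain g p' q' where *: "g \<noteq> 0" "p = g * p'" "q = g * q'" "coprime p' q'"
    using coprime_representation[of p q] w by blast
  show thesis
    by (rule that[of q' p']) (use * w in \<open>auto simp: eq_fract Fract_eq_polyf[symmetric]\<close>)
qed

text \<open>A valuation of \<open>\<complex>(s)\<close> is given by its values on the polynomials.\<close>

locale poly_valuation =
  fixes ord :: "complex poly \<Rightarrow> int"
  assumes ord_mult: "p \<noteq> 0 \<Longrightarrow> q \<noteq> 0 \<Longrightarrow> ord (p * q) = ord p + ord q"
    and ord_add: "p \<noteq> 0 \<Longrightarrow> q \<noteq> 0 \<Longrightarrow> p + q \<noteq> 0 \<Longrightarrow> min (ord p) (ord q) \<le> ord (p + q)"
    and ord_const: "c \<noteq> 0 \<Longrightarrow> ord [:c:] = 0"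
begin

definition val :: "crat \<Rightarrow> int" where
  "val w = (THE n. \<exists>p q. p \<noteq> 0 \<and> q \<noteq> 0 \<and> w = polyf p / polyf q \<and> n = ord p - ord q)"

lemma val_quotient:
  assumes "p \<noteq> 0" "q \<noteq> 0" shows "val (polyf p / polyf q) = ord p - ord q"
  unfolding val_def
proof (rule the_equality)
  fix n assume "\<exists>p' q'. p' \<noteq> 0 \<and> q' \<noteq> 0 \<and> polyf p / polyf q = polyf p' / polyf q' \<and> n = ord p' - ord q'"
  then obtain p' q' where *: "p' \<noteq> 0" "q' \<noteq> 0" "polyf p / polyf q = polyf p' / polyf q'" "n = ord p' - ord q'" by blast
  have "polyf (p * q') = polyf (p' * q)" using * assms by (simp add: polyf_simps frac_eq_eq)
  hence "p * q' = p' * q" by (simp add: polyf_inj)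
  hence "ord p + ord q' = ord p' + ord q" using ord_mult[of p q'] ord_mult[of p' q] * assms by simp
  thus "n = ord p - ord q" using * by simp
qed (use assms in blast)

lemma val_polyf: "p \<noteq> 0 \<Longrightarrow> val (polyf p) = ord p"
  using val_quotient[of p 1] ord_const[of 1] by (simp add: polyf_simps flip: one_pCons)

lemma val_mult: assumes "w \<noteq> 0" "w' \<noteq> 0" shows "val (w * w') = val w + val w'"
proof -
  obtain p q p' q' where *: "w = polyf p / polyf q" "q \<noteq> 0" "w' = polyf p' / polyf q'" "q' \<noteq> 0"
    using crat_cases by metis
  have "p \<noteq> 0" "p' \<noteq> 0" using assms * by auto
  moreover have "w * w' = polyf (p * p') / polyf (q * q')" by (simp add: * polyf_simps)
  ultimately show ?thesis using * by (simp add: val_quotient ord_mult)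
qed

lemma val_add: assumes "w \<noteq> 0" "w' \<noteq> 0" "w + w' \<noteq> 0" shows "min (val w) (val w') \<le> val (w + w')"
proof -
  obtain p q p' q' where *: "w = polyf p / polyf q" "q \<noteq> 0" "w' = polyf p' / polyf q'" "q' \<noteq> 0"
    using crat_cases by metis
  have nz: "p \<noteq> 0" "p' \<noteq> 0" using assms * by auto
  have s: "w + w' = polyf (p * q' + p' * q) / polyf (q * q')" using * by (simp add: polyf_simps add_frac_eq)
  have nz': "p * q' + p' * q \<noteq> 0" using assms(3) unfolding s by auto
  have "min (ord p + ord q') (ord p' + ord q) \<le> ord (p * q' + p' * q)"
    using ord_add[of "p * q'" "p' * q"] nz nz' * by (simp add: ord_mult)
  moreover have "val (w + w') = ord (p * q' + p' * q) - (ord q + ord q')"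
    unfolding s using nz' * by (subst val_quotient) (auto simp: ord_mult)
  ultimately show ?thesis using * nz by (simp add: val_quotient)
qed

lemma val_1: "val 1 = 0"
  using val_polyf[of 1] ord_const[of 1] by (simp add: polyf_simps flip: one_pCons)

lemma val_power_int: assumes "w \<noteq> 0" shows "val (w powi n) = n * val w"
proof -
  have p: "val (w ^ k) = int k * val w" for k
    using assms by (induction k) (simp_all add: val_1 val_mult algebra_simps)
  have "val (inverse (w ^ k)) + val (w ^ k) = 0" for k
    using val_mult[of "inverse (w ^ k)" "w ^ k"] assms val_1 by simp
  hence "val (inverse (w ^ k)) = - int k * val w" for k using p by (simp add: eq_neg_iff_add_eq_0)
  thus ?thesis by (cases "n \<ge> 0") (auto simp: power_int_def p power_inverse)
qed

lemma val_prod: "(\<And>i. i \<in> A \<Longrightarrow> f i \<noteq> 0) \<Longrightarrow> val (prod f A) = (\<Sum>i\<in>A. val (f i))"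
  by (induction A rule: infinite_finite_induct) (simp_all add: val_1 val_mult)

end

interpretation root: poly_valuation "\<lambda>p. int (order a p)" for a
proof
  fix p q :: "complex poly" assume *: "p \<noteq> 0" "q \<noteq> 0" "p + q \<noteq> 0"
  define k where "k = min (order a p) (order a q)"
  have "[:- a, 1:] ^ k dvd p" "[:- a, 1:] ^ k dvd q" by (auto simp: order_divides k_def)
  hence "[:- a, 1:] ^ k dvd p + q" by (rule dvd_add)
  thus "min (int (order a p)) (int (order a q)) \<le> int (order a (p + q))"
    using * by (simp add: order_divides k_def)
qed (auto simp: order_mult order_0I)

interpretation infty: poly_valuation "\<lambda>p. - int (degree p)"
proof
  fix p q :: "complex poly"
  show "min (- int (degree p)) (- int (degree q)) \<le> - int (degree (p + q))"
    using degree_add_le_max[of p q] by linarith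
qed (auto simp: degree_mult_eq)

lemma order_linear: "order a [:- b, 1:] = (if a = (b :: complex) then 1 else 0)"
  using order_power_n_n[of a 1] by (auto intro: order_0I)

lemma complex_poly_linear_factors_induct [consumes 1, case_names const factor]:
  fixes p :: "complex poly"
  assumes "p \<noteq> 0" "\<And>c. c \<noteq> 0 \<Longrightarrow> P [:c:]" "\<And>b q. q \<noteq> 0 \<Longrightarrow> P q \<Longrightarrow> P ([:- b, 1:] * q)"
  shows "P p"
  using assms(1)
proof (induction "degree p" arbitrary: p)
  case 0
  then obtain c where "p = [:c:]" using degree_eq_zeroE by metis
  thus ?case using 0 assms(2) by auto
next
  case (Suc n)
  hence "\<not> Fundamental_Theorem_Algebra.constant (poly p)" by (simp add: constant_degree)
  then obtain b where "poly p b = 0" using fundamental_theorem_of_algebra by blast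
  then obtain q where q: "p = [:- b, 1:] * q" using poly_eq_0_iff_dvd by (metis dvdE)
  hence "q \<noteq> 0" using Suc by auto
  moreover have "degree p = Suc (degree q)" unfolding q using \<open>q \<noteq> 0\<close> by (subst degree_mult_eq) auto
  ultimately show ?case using Suc q assms(3) by auto
qed

text \<open>
  Suppose that the value of \<open>s\<close> is nonnegative. Two elements \<open>s - a\<close> differ by a constant and cannot
  both have positive values, whereas one of them must, as the valuation is not trivial. If the value
  of \<open>s\<close> is negative, then all \<open>s - a\<close> have the same value as \<open>s\<close>. Since every polynomial is a product
  of such elements, this determines the valuation up to normalization.
\<close>

lemma valuation_classification:
  fixes v :: "crat \<Rightarrow> int"
  assumes mult: "\<And>w w'. w \<noteq> 0 \<Longrightarrow> w' \<noteq> 0 \<Longrightarrow> v (w * w') = v w + v w'"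
    and add: "\<And>w w'. w \<noteq> 0 \<Longrightarrow> w' \<noteq> 0 \<Longrightarrow> w + w' \<noteq> 0 \<Longrightarrow> min (v w) (v w') \<le> v (w + w')"
    and const: "\<And>c. c \<noteq> 0 \<Longrightarrow> v (polyf [:c:]) = 0"
    and norm: "\<exists>w. w \<noteq> 0 \<and> v w = 1"
  shows "(\<forall>w. w \<noteq> 0 \<longrightarrow> v w = infty.val w) \<or> (\<exists>a. \<forall>w. w \<noteq> 0 \<longrightarrow> v w = root.val a w)"
proof -
  have proportional: "k = 1 \<and> (\<forall>w. w \<noteq> 0 \<longrightarrow> v w = poly_valuation.val ord w)"
    if ord: "poly_valuation ord" and lin: "\<And>b. v (polyf [:- b, 1:]) = k * ord [:- b, 1:]" and k: "k > 0" for ord k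
  proof -
    interpret o: poly_valuation ord by fact
    have p: "v (polyf p) = k * ord p" if "p \<noteq> 0" for p
      using that
    proof (induction p rule: complex_poly_linear_factors_induct)
      case (factor b q)
      thus ?case using mult[of "polyf [:- b, 1:]" "polyf q"] o.ord_mult[of "[:- b, 1:]" q] lin[of b]
        by (simp only: polyf_simps(4)[symmetric] polyf_eq_0_iff) (simp add: algebra_simps del: mult_pCons_left)
    qed (simp add: const o.ord_const)
    have w: "v w = k * o.val w" if "w \<noteq> 0" for w
    proof -
      obtain p q where *: "q \<noteq> 0" "w = polyf p / polyf q" using crat_cases by metis
      hence "p \<noteq> 0" using that by auto
      have "w * polyf q = polyf p" using * by simp
      hence "v w + v (polyf q) = v (polyf p)" using mult[of w "polyf q"] that * by simp
      thus ?thesis using p \<open>p \<noteq> 0\<close> * by (simp add: o.val_quotient algebra_simps)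
    qed
    obtain w1 where "w1 \<noteq> 0" "v w1 = 1" using norm by blast
    hence "k * o.val w1 = 1" using w by simp
    hence "k = 1" using k by (simp add: zmult_eq_1_iff)
    thus ?thesis using w by simp
  qed
  define s where "s = polyf [:0, 1:]"
  have s0: "s \<noteq> 0" by (simp add: s_def)
  have lin: "polyf [:- b, 1:] = s + polyf [:- b:]" for b
    by (simp add: s_def polyf_simps(3)[symmetric])
  have lin0: "polyf [:- b, 1:] \<noteq> 0" for b by simp
  show ?thesis
  proof (cases "v s \<ge> 0")
    case True
    have nonneg: "v (polyf [:- b, 1:]) \<ge> 0" for b
    proof (cases "b = 0")
      case False
      thus ?thesis using add[of s "polyf [:- b:]"] s0 lin0[of b] True const[of "- b"] unfolding lin by simp
    qed (use True in \<open>simp add: s_def\<close>)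
    have "\<exists>a. v (polyf [:- a, 1:]) > 0"
    proof (rule ccontr)
      assume "\<nexists>a. v (polyf [:- a, 1:]) > 0"
      hence z: "v (polyf [:- b, 1:]) = 0" for b using nonneg[of b] by (metis less_le)
      have p: "v (polyf p) = 0" if "p \<noteq> 0" for p
        using that
      proof (induction p rule: complex_poly_linear_factors_induct)
        case (factor b q)
        thus ?case using mult[of "polyf [:- b, 1:]" "polyf q"] z[of b]
          by (simp only: polyf_simps(4)[symmetric] polyf_eq_0_iff) (simp del: mult_pCons_left)
      qed (simp add: const)
      obtain w where w: "w \<noteq> 0" "v w = 1" using norm by blast
      obtain p q where *: "q \<noteq> 0" "w = polyf p / polyf q" using crat_cases by metis
      have "w * polyf q = polyf p" "p \<noteq> 0" using * w by auto
      hence "v w + v (polyf q) = v (polyf p)" using mult[of w "polyf q"] w * by simp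
      thus False using w p * \<open>p \<noteq> 0\<close> by simp
    qed
    then obtain a where a: "v (polyf [:- a, 1:]) > 0" by blast
    have other: "v (polyf [:- b, 1:]) = 0" if "b \<noteq> a" for b
    proof (rule ccontr)
      assume "v (polyf [:- b, 1:]) \<noteq> 0"
      hence pos: "v (polyf [:- b, 1:]) > 0" using nonneg[of b] by simp
      have "v (polyf [:- 1:]) = 0" by (rule const) simp
      hence neg: "v (polyf [:-1:] * polyf [:- b, 1:]) > 0" using pos mult[of "polyf [:- 1:]" "polyf [:- b, 1:]"] by simp
      have e: "polyf [:- a, 1:] + polyf [:-1:] * polyf [:- b, 1:] = polyf [:b - a:]"
        by (simp add: polyf_simps(3,4)[symmetric])
      have "min (v (polyf [:- a, 1:])) (v (polyf [:-1:] * polyf [:- b, 1:])) \<le> v (polyf [:b - a:])"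
        unfolding e[symmetric] by (rule add) (use that in \<open>auto simp: e\<close>)
      thus False using a neg const[of "b - a"] that by simp
    qed
    have "poly_valuation (\<lambda>p. int (order a p))" by unfold_locales
    moreover have "v (polyf [:- b, 1:]) = v (polyf [:- a, 1:]) * int (order a [:- b, 1:])" for b
      by (cases "b = a") (auto simp: other order_linear)
    ultimately show ?thesis using proportional a by blast
  next
    case False
    have eq: "v (polyf [:- b, 1:]) = v s" for b
    proof (cases "b = 0")
      case b: False
      have 1: "min (v s) 0 \<le> v (polyf [:- b, 1:])"
        using add[of s "polyf [:- b:]"] s0 lin0[of b] b const[of "- b"] unfolding lin by simp
      have e: "polyf [:- b, 1:] + polyf [:b:] = s" by (simp add: s_def polyf_simps(3)[symmetric])
      have "min (v (polyf [:- b, 1:])) 0 \<le> v s"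
        using add[of "polyf [:- b, 1:]" "polyf [:b:]"] s0 lin0[of b] b const[of b] unfolding e by simp
      thus ?thesis using 1 False by linarith
    qed (simp add: s_def)
    have "poly_valuation (\<lambda>p. - int (degree p))" by unfold_locales
    from proportional[OF this, of "- v s"] False show ?thesis by (auto simp: eq)
  qed
qed


section \<open>Curves with a rational parametrization have genus zero\<close>

lemma polynomial_dependence:
  fixes p :: "'a \<Rightarrow> complex poly"
  assumes "finite S" "n < card S" "\<And>f i. f \<in> S \<Longrightarrow> n \<le> i \<Longrightarrow> coeff (p f) i = 0"
  shows "\<exists>c. (\<exists>f\<in>S. c f \<noteq> 0) \<and> (\<Sum>f\<in>S. smult (c f) (p f)) = 0"
  using assms
proof (induction n arbitrary: S p)
  case 0
  then obtain f where "f \<in> S" by fastforce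
  moreover have "p f = 0" if "f \<in> S" for f using 0 that by (simp add: poly_eq_iff)
  ultimately show ?case by (intro exI[of _ "\<lambda>_. 1"]) auto
next
  case (Suc n)
  show ?case
  proof (cases "\<forall>f\<in>S. coeff (p f) n = 0")
    case True
    have "coeff (p f) i = 0" if "f \<in> S" "n \<le> i" for f i
      using True that Suc.prems(3)[of f i] by (cases "i = n") auto
    thus ?thesis using Suc.IH[of S p] Suc.prems(1,2) by simp
  next
    case False
    then obtain f0 where f0: "f0 \<in> S" "coeff (p f0) n \<noteq> 0" by blast
    define r where "r f = coeff (p f) n / coeff (p f0) n" for f
    define p' where "p' f = p f - smult (r f) (p f0)" for f
    have "coeff (p' f) i = 0" if "f \<in> S - {f0}" "n \<le> i" for f i
    proof (cases "i = n")
      case True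
      thus ?thesis using f0 by (simp add: p'_def r_def)
    next
      case False
      hence "Suc n \<le> i" using that by simp
      thus ?thesis using Suc.prems(3)[of f i] Suc.prems(3)[of f0 i] f0 that by (simp add: p'_def)
    qed
    moreover have "n < card (S - {f0})" using Suc.prems f0 by simp
    ultimately obtain c where c: "\<exists>f\<in>S - {f0}. c f \<noteq> 0" "(\<Sum>f\<in>S - {f0}. smult (c f) (p' f)) = 0"
      using Suc.IH[of "S - {f0}" p'] Suc.prems(1) by auto
    define c' where "c' = c(f0 := - (\<Sum>f\<in>S - {f0}. c f * r f))"
    have "(\<Sum>f\<in>S. smult (c' f) (p f)) = smult (c' f0) (p f0) + (\<Sum>f\<in>S - {f0}. smult (c' f) (p f))"
      using Suc.prems(1) f0 by (simp add: sum.remove)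
    also have "(\<Sum>f\<in>S - {f0}. smult (c' f) (p f)) = (\<Sum>f\<in>S - {f0}. smult (c f) (p' f) + smult (c f * r f) (p f0))"
      by (rule sum.cong) (auto simp: c'_def p'_def smult_diff_right)
    also have "\<dots> = (\<Sum>f\<in>S - {f0}. smult (c f * r f) (p f0))" using c(2) by (simp add: sum.distrib)
    also have "\<dots> = smult (\<Sum>f\<in>S - {f0}. c f * r f) (p f0)" by (simp add: smult_sum)
    finally have "(\<Sum>f\<in>S. smult (c' f) (p f)) = 0" by (simp add: c'_def)
    moreover have "\<exists>f\<in>S. c' f \<noteq> 0" using c(1) by (auto simp: c'_def)
    ultimately show ?thesis by blast
  qed
qed

definition constK :: "complex \<Rightarrow> crat" where "constK c = polyf [:c:]"

lemma ringhom_constK: "ringhom constK"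
  unfolding constK_def by (intro ringhom_comp[OF ringhom_const_poly ringhom_polyf])

text \<open>
  The curve \<open>F = 0\<close> is parametrised by \<open>(c1, c2)\<close>, and \<open>S\<close> expresses the parameter \<open>s\<close> in the coordinates.
\<close>

locale rational_parametrization =
  fixes F :: "complex poly poly" and c1 c2 :: crat and S :: "complex rat_fun"
  assumes F0: "F \<noteq> 0"
    and kernel: "subst_poly constK G c1 c2 = 0 \<longleftrightarrow> F dvd G"
    and param: "spec ratf (\<lambda>G. subst_poly constK G c1 c2) S (polyf [:0, 1:])"
begin

abbreviation "h \<equiv> \<lambda>G. subst_poly constK G c1 c2"
abbreviation "sp \<equiv> spec ratf h"

sublocale h: ringhom h by (rule ringhom_subst_poly[OF ringhom_constK])
sublocale sp: specialization ratf h by (rule specialization_subst[OF ringhom_constK])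

lemma irreducible: "irreducible F"
proof (rule prime_elem_imp_irreducible, rule prime_elemI)
  show "F \<noteq> 0" by (rule F0)
  show "\<not> F dvd 1" using kernel[of 1] h.one by simp
  show "F dvd a \<or> F dvd b" if "F dvd a * b" for a b
    using that unfolding kernel[symmetric] h.mult by simp
qed

lemma sp_iff: "sp f w \<longleftrightarrow> (\<exists>p q. f = Fract p q \<and> \<not> F dvd q \<and> w = h p / h q)"
proof
  assume "sp f w"
  then obtain p q where "h q \<noteq> 0" "f = ratf p / ratf q" "w = h p / h q" unfolding spec_def by blast
  thus "\<exists>p q. f = Fract p q \<and> \<not> F dvd q \<and> w = h p / h q" unfolding kernel[symmetric] Fract_eq_ratf by blast
next
  assume "\<exists>p q. f = Fract p q \<and> \<not> F dvd q \<and> w = h p / h q"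
  thus "sp f w" unfolding kernel[symmetric] Fract_eq_ratf using sp.quotient by blast
qed

lemma curve_ring_iff: "f \<in> curve_ring F \<longleftrightarrow> (\<exists>w. sp f w)"
  by (auto simp: curve_ring_def sp_iff)

lemma curve_ideal_iff: "f \<in> curve_ideal F \<longleftrightarrow> sp f 0"
proof -
  have "sp f 0 \<longleftrightarrow> (\<exists>p q. f = Fract p q \<and> \<not> F dvd q \<and> h p = 0)"
    unfolding sp_iff using kernel by (metis divide_eq_0_iff)
  thus ?thesis by (auto simp: curve_ideal_def kernel)
qed

definition units :: "complex rat_fun set" where "units = curve_ring F - curve_ideal F"

lemma units_iff: "f \<in> units \<longleftrightarrow> (\<exists>w. w \<noteq> 0 \<and> sp f w)"
  unfolding units_def using sp.unique by (auto simp: curve_ring_iff curve_ideal_iff) metis+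

definition img :: "complex rat_fun \<Rightarrow> crat" where "img f = (THE w. sp f w)"

lemma img_eq: "sp f w \<Longrightarrow> img f = w"
  unfolding img_def using sp.unique by blast

lemma unitsD: "f \<in> units \<Longrightarrow> sp f (img f)" "f \<in> units \<Longrightarrow> img f \<noteq> 0"
  using img_eq by (auto simp: units_iff)

lemma sp_const: "sp (constf c) (constK c)"
  using sp.base[of "cpoly c"] by (simp add: constf_def subst_poly_gens ringhom_constK)

lemma surj: "\<exists>f. sp f w"
proof -
  have p: "\<exists>f. sp f (polyf p)" for p
  proof (induction p)
    case 0
    thus ?case using sp.base[of 0] h.zero polyf_simps(1) by metis
  next
    case (pCons a p)
    then obtain f where "sp f (polyf p)" by blast
    from sp.add[OF sp_const[of a] sp.mult[OF param this]]
    have "sp (constf a + S * f) (polyf (pCons a p))"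
      by (simp add: constK_def polyf_simps(3,4)[symmetric])
    thus ?case by blast
  qed
  obtain p q where "q \<noteq> 0" "w = polyf p / polyf q" using crat_cases by metis
  thus ?thesis using p[of p] p[of q] sp.divide by (metis polyf_eq_0_iff)
qed

definition place_of :: "(crat \<Rightarrow> int) \<Rightarrow> complex rat_fun \<Rightarrow> int" where
  "place_of v f = (if f \<in> units then v (img f) else 0)"

lemma place_of_eq: "sp f w \<Longrightarrow> w \<noteq> 0 \<Longrightarrow> place_of v f = v w"
  using img_eq units_iff by (auto simp: place_of_def)

lemma place_iff:
  "place F v \<longleftrightarrow> (\<forall>f\<in>units. \<forall>g\<in>units. v (f * g) = v f + v g) \<and>
       (\<forall>f\<in>units. \<forall>g\<in>units. f + g \<in> units \<longrightarrow> min (v f) (v g) \<le> v (f + g)) \<and>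
       (\<forall>f\<in>units. \<forall>g\<in>units. f - g \<in> curve_ideal F \<longrightarrow> v f = v g) \<and>
       (\<forall>c. c \<noteq> 0 \<longrightarrow> v (constf c) = 0) \<and>
       (\<exists>f\<in>units. v f = 1) \<and>
       (\<forall>f. f \<notin> units \<longrightarrow> v f = 0)"
  unfolding place_def units_def Let_def ..

lemma place_of_is_place:
  assumes "poly_valuation ord" and norm: "w1 \<noteq> 0" "poly_valuation.val ord w1 = 1"
  shows "place F (place_of (poly_valuation.val ord))"
proof -
  interpret o: poly_valuation ord by fact
  show ?thesis unfolding place_iff
  proof (intro conjI ballI allI impI)
    fix f g assume fg: "f \<in> units" "g \<in> units"
    note s = unitsD[OF fg(1)] unitsD[OF fg(2)]
    show "place_of o.val (f * g) = place_of o.val f + place_of o.val g"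
      using place_of_eq[OF sp.mult[OF s(1,3)]] s fg by (simp add: o.val_mult place_of_def)
    show "min (place_of o.val f) (place_of o.val g) \<le> place_of o.val (f + g)" if "f + g \<in> units"
    proof -
      have "img (f + g) = img f + img g" using img_eq[OF sp.add[OF s(1,3)]] .
      thus ?thesis using o.val_add[OF s(2,4)] unitsD(2)[OF that] fg that by (simp add: place_of_def)
    qed
    show "place_of o.val f = place_of o.val g" if "f - g \<in> curve_ideal F"
    proof -
      have "img f - img g = 0" using that sp.unique[OF sp.diff[OF s(1,3)]] by (simp add: curve_ideal_iff)
      thus ?thesis using fg by (simp add: place_of_def)
    qed
  next
    fix c :: complex assume "c \<noteq> 0"
    hence "constK c \<noteq> 0" by (simp add: constK_def)
    thus "place_of o.val (constf c) = 0"
      using place_of_eq[OF sp_const] \<open>c \<noteq> 0\<close> by (simp add: constK_def o.val_polyf o.ord_const)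
  next
    obtain f where "sp f w1" using surj by blast
    thus "\<exists>f\<in>units. place_of o.val f = 1" using norm place_of_eq units_iff by metis
  qed (simp add: place_of_def)
qed

lemma place_root: "place F (place_of (root.val a))"
proof (rule place_of_is_place[of _ "polyf [:- a, 1:]"])
  show "poly_valuation (\<lambda>p. int (order a p))" by unfold_locales
qed (simp_all add: root.val_polyf order_linear)

lemma place_infty: "place F (place_of infty.val)"
proof (rule place_of_is_place[of _ "1 / polyf [:0, 1:]"])
  show "poly_valuation (\<lambda>p. - int (degree p))" by unfold_locales
  show "infty.val (1 / polyf [:0, 1:]) = 1"
    using infty.val_quotient[of 1 "[:0, 1:]"] polyf_simps(2) by simp
qed simp

text \<open>
  Elements of the curve ring with the same image in \<open>\<complex>(s)\<close> are congruent modulo the curve ideal, so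
  that a place induces a valuation of \<open>\<complex>(s)\<close>.
\<close>

lemma place_cases:
  assumes "place F v"
  shows "v = place_of infty.val \<or> (\<exists>a. v = place_of (root.val a))"
proof -
  note P = assms[unfolded place_iff]
  define v' where "v' w = v (SOME f. sp f w)" for w
  have some: "sp (SOME f. sp f w) w" for w using surj by (rule someI_ex)
  have v': "v f = v' w" if "sp f w" "w \<noteq> 0" for f w
  proof -
    have "sp (f - (SOME f. sp f w)) 0" using sp.diff[OF that(1) some[of w]] by simp
    moreover have "f \<in> units" "(SOME f. sp f w) \<in> units" using that some units_iff by blast+
    ultimately show ?thesis using P unfolding v'_def curve_ideal_iff by blast
  qed
  have u: "f \<in> units" if "sp f w" "w \<noteq> 0" for f w using that units_iff by blast
  have cl: "(\<forall>w. w \<noteq> 0 \<longrightarrow> v' w = infty.val w) \<or> (\<exists>a. \<forall>w. w \<noteq> 0 \<longrightarrow> v' w = root.val a w)"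
  proof (rule valuation_classification)
    fix w w' :: crat assume nz: "w \<noteq> 0" "w' \<noteq> 0"
    obtain f g where fg: "sp f w" "sp g w'" using surj by blast
    have fgu: "f \<in> units" "g \<in> units" using fg nz u by blast+
    show "v' (w * w') = v' w + v' w'"
      using P fgu v'[OF sp.mult[OF fg]] v'[OF fg(1)] v'[OF fg(2)] nz by simp
    show "min (v' w) (v' w') \<le> v' (w + w')" if "w + w' \<noteq> 0"
      using P fgu u[OF sp.add[OF fg] that] v'[OF sp.add[OF fg] that] v'[OF fg(1) nz(1)] v'[OF fg(2) nz(2)] by metis
  next
    fix c :: complex assume "c \<noteq> 0"
    thus "v' (polyf [:c:]) = 0" using P v'[OF sp_const[of c]] by (simp add: constK_def)
  next
    obtain f where "f \<in> units" "v f = 1" using P by blast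
    thus "\<exists>w. w \<noteq> 0 \<and> v' w = 1" using v' unitsD by metis
  qed
  have pV: "v = place_of V" if V: "\<forall>w. w \<noteq> 0 \<longrightarrow> v' w = V w" for V
  proof
    fix f show "v f = place_of V f"
    proof (cases "f \<in> units")
      case True
      thus ?thesis using V v'[OF unitsD[OF True]] unitsD(2)[OF True] by (simp add: place_of_def)
    next
      case False
      thus ?thesis using P by (simp add: place_of_def)
    qed
  qed
  from cl show ?thesis
  proof (elim disjE exE)
    fix a assume "\<forall>w. w \<noteq> 0 \<longrightarrow> v' w = root.val a w"
    thus ?thesis using pV[of "root.val a"] by blast
  qed (use pV[of infty.val] in blast)
qed

lemma place_root_inj: "place_of (root.val a) = place_of (root.val b) \<Longrightarrow> a = b"
proof -
  assume *: "place_of (root.val a) = place_of (root.val b)"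
  obtain f where f: "sp f (polyf [:- a, 1:])" using surj by blast
  have "root.val a (polyf [:- a, 1:]) = root.val b (polyf [:- a, 1:])"
    using fun_cong[OF *, of f] place_of_eq[OF f] by simp
  thus "a = b" by (simp add: root.val_polyf order_linear split: if_splits)
qed

lemma place_root_infty: "place_of (root.val a) \<noteq> place_of infty.val"
proof
  assume *: "place_of (root.val a) = place_of infty.val"
  obtain f where f: "sp f (polyf [:- a, 1:])" using surj by blast
  have "root.val a (polyf [:- a, 1:]) = infty.val (polyf [:- a, 1:])"
    using fun_cong[OF *, of f] place_of_eq[OF f] by simp
  thus False by (simp add: root.val_polyf infty.val_polyf order_linear)
qed

lemma effective_is_polynomial:
  assumes "w \<noteq> 0" "\<And>a. root.val a w \<ge> 0"
  obtains p where "p \<noteq> 0" "w = polyf p"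
proof -
  obtain p q where *: "q \<noteq> 0" "coprime p q" "w = polyf p / polyf q" using crat_cases by metis
  have p0: "p \<noteq> 0" using * assms by auto
  have "degree q = 0"
  proof (rule ccontr)
    assume "degree q \<noteq> 0"
    hence "\<not> Fundamental_Theorem_Algebra.constant (poly q)" by (simp add: constant_degree)
    then obtain b where b: "poly q b = 0" using fundamental_theorem_of_algebra by blast
    have "poly p b \<noteq> 0"
    proof
      assume "poly p b = 0"
      hence "[:- b, 1:] dvd p" "[:- b, 1:] dvd q" using b by (simp_all add: poly_eq_0_iff_dvd)
      hence "is_unit [:- b, 1:]" using *(2) coprime_common_divisor by blast
      thus False using is_unit_iff_degree[of "[:- b, 1:]"] by simp
    qed
    hence "order b p = 0" "order b q > 0" using b * by (auto simp: order_0I order_gt_0_iff)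
    thus False using assms(2)[of b] * p0 by (simp add: root.val_quotient)
  qed
  then obtain c where c: "q = [:c:]" by (rule degree_eq_zeroE)
  have "p = smult (1 / c) p * [:c:]" using c * by simp
  hence "polyf p = polyf (smult (1 / c) p) * polyf [:c:]" by (metis polyf_simps(4))
  hence "w = polyf (smult (1 / c) p)" using * c by simp
  thus thesis using that[of "smult (1 / c) p"] p0 c * by simp
qed

context
  fixes D :: "(complex rat_fun \<Rightarrow> int) \<Rightarrow> int"
  assumes D: "divisor F D"
begin

definition "pts = {a. D (place_of (root.val a)) \<noteq> 0}"

text \<open>A rational function whose divisor is \<open>- D\<close> away from infinity.\<close>

definition "base = (\<Prod>a\<in>pts. polyf [:- a, 1:] powi (- D (place_of (root.val a))))"

lemma finite_pts: "finite pts"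
proof (rule finite_imageD)
  show "finite ((\<lambda>a. place_of (root.val a)) ` pts)"
    by (rule finite_subset[of _ "{v. D v \<noteq> 0}"]) (use D in \<open>auto simp: pts_def divisor_def\<close>)
qed (auto intro!: inj_onI place_root_inj)

lemma degree_D: "degree_divisor D = D (place_of infty.val) + (\<Sum>a\<in>pts. D (place_of (root.val a)))"
proof -
  let ?R = "(\<lambda>a. place_of (root.val a)) ` pts"
  have eq: "{v. D v \<noteq> 0} = ?R \<union> ({place_of infty.val} \<inter> {v. D v \<noteq> 0})"
  proof -
    have "v \<in> ?R \<or> v = place_of infty.val" if "D v \<noteq> 0" for v
      using place_cases[of v] D that unfolding divisor_def pts_def by blast
    thus ?thesis by (auto simp: pts_def)
  qed
  have "degree_divisor D = (\<Sum>v\<in>?R \<union> ({place_of infty.val} \<inter> {v. D v \<noteq> 0}). D v)"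
    unfolding degree_divisor_def using eq by simp
  also have "\<dots> = (\<Sum>v\<in>?R. D v) + (\<Sum>v\<in>{place_of infty.val} \<inter> {v. D v \<noteq> 0}. D v)"
    by (rule sum.union_disjoint) (use finite_pts place_root_infty in \<open>auto dest: sym\<close>)
  also have "(\<Sum>v\<in>{place_of infty.val} \<inter> {v. D v \<noteq> 0}. D v) = D (place_of infty.val)"
    by (cases "D (place_of infty.val) = 0") auto
  also have "(\<Sum>v\<in>?R. D v) = (\<Sum>a\<in>pts. D (place_of (root.val a)))"
    by (subst sum.reindex) (auto intro!: inj_onI place_root_inj)
  finally show ?thesis by simp
qed

lemma base_nonzero: "base \<noteq> 0"
  unfolding base_def using finite_pts by simp

lemma val_root_base: "root.val b base = - D (place_of (root.val b))"
proof -
  have "root.val b base = (\<Sum>a\<in>pts. - D (place_of (root.val a)) * (if b = a then 1 else 0))"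
    unfolding base_def by (subst root.val_prod) (auto simp: root.val_power_int root.val_polyf order_linear intro!: sum.cong)
  also have "\<dots> = (\<Sum>a\<in>pts. if b = a then - D (place_of (root.val a)) else 0)" by (rule sum.cong) auto
  also have "\<dots> = (if b \<in> pts then - D (place_of (root.val b)) else 0)" using finite_pts by simp
  finally show ?thesis by (simp add: pts_def)
qed

lemma val_infty_base: "infty.val base = (\<Sum>a\<in>pts. D (place_of (root.val a)))"
  unfolding base_def by (subst infty.val_prod) (auto simp: infty.val_power_int infty.val_polyf)

text \<open>
  Division by \<open>base\<close> turns the conditions at the finite points into the absence of poles, and the
  condition at infinity into a bound for the degree.
\<close>

lemma rr_space_iff:
  "f \<in> rr_space F D \<longleftrightarrow> (\<exists>p. (\<forall>i. degree_divisor D < int i \<longrightarrow> coeff p i = 0) \<and> sp f (base * polyf p))"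
proof
  assume f: "f \<in> rr_space F D"
  show "\<exists>p. (\<forall>i. degree_divisor D < int i \<longrightarrow> coeff p i = 0) \<and> sp f (base * polyf p)"
  proof (cases "f \<in> curve_ideal F")
    case True
    thus ?thesis by (intro exI[of _ 0]) (simp add: curve_ideal_iff polyf_simps)
  next
    case False
    hence fu: "f \<in> units" and pl: "\<And>v. place F v \<Longrightarrow> 0 \<le> v f + D v" using f by (auto simp: rr_space_def units_def)
    define w where "w = img f / base"
    have w0: "w \<noteq> 0" using unitsD(2)[OF fu] base_nonzero by (simp add: w_def)
    have wb: "img f = w * base" using base_nonzero by (simp add: w_def)
    have "root.val a w \<ge> 0" for a
      using pl[OF place_root[of a]] fu root.val_mult[OF w0 base_nonzero, of a]
      by (simp add: place_of_def wb val_root_base)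
    then obtain p where p: "p \<noteq> 0" "w = polyf p" using effective_is_polynomial[OF w0] by blast
    have "int (degree p) \<le> degree_divisor D"
      using pl[OF place_infty] fu infty.val_mult[OF w0 base_nonzero] p
      by (simp add: place_of_def wb val_infty_base degree_D infty.val_polyf)
    hence "coeff p i = 0" if "degree_divisor D < int i" for i using that by (simp add: coeff_eq_0)
    thus ?thesis using unitsD(1)[OF fu] by (intro exI[of _ p]) (simp add: wb p mult.commute)
  qed
next
  assume "\<exists>p. (\<forall>i. degree_divisor D < int i \<longrightarrow> coeff p i = 0) \<and> sp f (base * polyf p)"
  then obtain p where p: "\<forall>i. degree_divisor D < int i \<longrightarrow> coeff p i = 0" "sp f (base * polyf p)" by blast
  show "f \<in> rr_space F D"
  proof (cases "p = 0")
    case True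
    hence "f \<in> curve_ideal F" using p(2) by (simp add: curve_ideal_iff polyf_simps)
    thus ?thesis using p(2) by (auto simp: rr_space_def curve_ring_iff)
  next
    case False
    have deg: "int (degree p) \<le> degree_divisor D" using p(1) False by (metis leading_coeff_0_iff not_le)
    have nz: "base * polyf p \<noteq> 0" using base_nonzero False by simp
    have "0 \<le> v f + D v" if "place F v" for v
    proof -
      consider "v = place_of infty.val" | a where "v = place_of (root.val a)" using place_cases[OF \<open>place F v\<close>] by blast
      thus ?thesis
      proof cases
        case 1
        thus ?thesis using place_of_eq[OF p(2) nz] base_nonzero False deg
          by (simp add: infty.val_mult infty.val_polyf val_infty_base degree_D)
      next
        case 2
        thus ?thesis using place_of_eq[OF p(2) nz] base_nonzero False
          by (simp add: root.val_mult root.val_polyf val_root_base)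
      qed
    qed
    thus ?thesis using p(2) by (auto simp: rr_space_def curve_ring_iff)
  qed
qed

lemma sp_combination:
  assumes "finite T" "\<And>f. f \<in> T \<Longrightarrow> sp f (base * polyf (p f))"
  shows "sp (\<Sum>f\<in>T. constf (c f) * f) (base * polyf (\<Sum>f\<in>T. smult (c f) (p f)))"
  using assms
proof (induction T rule: finite_induct)
  case empty
  thus ?case using sp.base[of 0] h.zero by (simp add: polyf_simps ringhom.zero[OF ringhom_ratf])
next
  case (insert f T)
  have "sp (constf (c f) * f) (base * polyf (smult (c f) (p f)))"
  proof -
    have "constK (c f) * (base * polyf (p f)) = base * polyf ([:c f:] * p f)"
      unfolding polyf_simps(4) constK_def by (simp only: mult_ac)
    hence e: "constK (c f) * (base * polyf (p f)) = base * polyf (smult (c f) (p f))" by simp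
    show ?thesis using sp.mult[OF sp_const[of "c f"] insert.prems[of f]] unfolding e by simp
  qed
  from sp.add[OF this insert.IH] show ?case
    using insert by (simp add: polyf_simps distrib_left)
qed

lemma rr_dim_eq: "rr_dim F D = nat (degree_divisor D + 1)"
proof -
  define n where "n = nat (degree_divisor D + 1)"
  have deg_iff: "degree_divisor D < int i \<longleftrightarrow> n \<le> i" for i unfolding n_def by linarith
  define indep where "indep T \<longleftrightarrow> (\<forall>c. (\<Sum>f\<in>T. constf (c f) * f) \<in> curve_ideal F \<longrightarrow> (\<forall>f\<in>T. c f = 0))" for T
  have upper: "card T \<le> n" if T: "finite T" "T \<subseteq> rr_space F D" "indep T" for T
  proof (rule ccontr)
    assume "\<not> card T \<le> n"
    hence "n < card T" by simp
    have "\<forall>f\<in>T. \<exists>p. (\<forall>i\<ge>n. coeff p i = 0) \<and> sp f (base * polyf p)"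
      using T(2) rr_space_iff deg_iff by blast
    then obtain p where p: "\<And>f i. f \<in> T \<Longrightarrow> n \<le> i \<Longrightarrow> coeff (p f) i = 0" "\<And>f. f \<in> T \<Longrightarrow> sp f (base * polyf (p f))"
      by metis
    have "\<exists>c. (\<exists>f\<in>T. c f \<noteq> 0) \<and> (\<Sum>f\<in>T. smult (c f) (p f)) = 0"
      by (rule polynomial_dependence[OF T(1) \<open>n < card T\<close>]) (rule p(1))
    then obtain c where c: "\<exists>f\<in>T. c f \<noteq> 0" "(\<Sum>f\<in>T. smult (c f) (p f)) = 0" by blast
    have "sp (\<Sum>f\<in>T. constf (c f) * f) 0"
      using sp_combination[OF T(1) p(2), of c] by (simp add: c(2) polyf_simps)
    thus False using T(3) c(1) unfolding indep_def curve_ideal_iff by blast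
  qed
  have "\<forall>i. \<exists>g. sp g (base * polyf (monom 1 i))" using surj by blast
  from choice[OF this] obtain f where f: "\<And>i. sp (f i) (base * polyf (monom 1 i))" by blast
  have inj: "inj_on f {..<n}"
  proof (rule inj_onI)
    fix i j assume "f i = f j"
    hence "base * polyf (monom 1 i) = base * polyf (monom 1 j)" using sp.unique[OF f[of i]] f[of j] by simp
    hence "monom (1::complex) i = monom 1 j" using base_nonzero by (simp add: polyf_inj)
    hence "degree (monom (1::complex) i) = degree (monom (1::complex) j)" by simp
    thus "i = j" by (simp add: degree_monom_eq)
  qed
  have "indep (f ` {..<n})" unfolding indep_def
  proof (intro allI impI ballI)
    fix c g assume c: "(\<Sum>f\<in>f ` {..<n}. constf (c f) * f) \<in> curve_ideal F" and g: "g \<in> f ` {..<n}"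
    define P where "P = (\<Sum>i<n. monom (c (f i)) i)"
    have "(\<Sum>g\<in>f ` {..<n}. smult (c g) (monom 1 (inv_into {..<n} f g))) = (\<Sum>i<n. smult (c (f i)) (monom 1 (inv_into {..<n} f (f i))))"
      by (simp add: sum.reindex[OF inj])
    also have "\<dots> = P" unfolding P_def by (rule sum.cong) (use inj in \<open>auto simp: smult_monom\<close>)
    finally have s: "(\<Sum>g\<in>f ` {..<n}. smult (c g) (monom 1 (inv_into {..<n} f g))) = P" .
    have "sp (\<Sum>f\<in>f ` {..<n}. constf (c f) * f) (base * polyf P)"
      unfolding s[symmetric] by (rule sp_combination) (use f inj in auto)
    hence "base * polyf P = 0" using c sp.unique unfolding curve_ideal_iff by blast
    hence P0: "P = 0" using base_nonzero by simp
    obtain j where j: "g = f j" "j < n" using g by auto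
    have "coeff P j = (\<Sum>i<n. if i = j then c (f i) else 0)" unfolding P_def coeff_sum by (intro sum.cong) auto
    also have "\<dots> = c (f j)" using j by simp
    finally show "c g = 0" using P0 j by simp
  qed
  moreover have "f ` {..<n} \<subseteq> rr_space F D"
  proof (rule image_subsetI)
    fix i assume "i \<in> {..<n}"
    thus "f i \<in> rr_space F D" unfolding rr_space_iff using f[of i] deg_iff by (intro exI[of _ "monom 1 i"]) auto
  qed
  moreover have "card (f ` {..<n}) = n" using inj by (simp add: card_image)
  ultimately have mem: "n \<in> {card T | T. finite T \<and> T \<subseteq> rr_space F D \<and> indep T}"
    by (intro CollectI exI[of _ "f ` {..<n}"]) auto
  have "rr_dim F D = Sup {card T | T. finite T \<and> T \<subseteq> rr_space F D \<and> indep T}"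
    unfolding rr_dim_def indep_def ..
  also have "\<dots> = n"
    by (rule cSup_eq_maximum[OF mem]) (use upper in auto)
  finally show ?thesis by (simp add: n_def)
qed

end

text \<open>The dimension of the space of \<open>D\<close> is \<open>deg D + 1\<close> unless this number is negative.\<close>

lemma genus_zero: "genus F = 0"
  unfolding genus_def
proof (rule cSup_eq_maximum)
  have d: "divisor F (\<lambda>_. 0)" by (simp add: divisor_def)
  show "0 \<in> {degree_divisor D + 1 - int (rr_dim F D) |D. divisor F D}"
    using d rr_dim_eq[OF d] by (auto intro!: exI[of _ "\<lambda>_. 0"] simp: degree_divisor_def)
  show "x \<le> 0" if "x \<in> {degree_divisor D + 1 - int (rr_dim F D) |D. divisor F D}" for x
    using that rr_dim_eq by auto
qed

end


section \<open>Real curves with a rational parametrization\<close>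

lemma ringhom_of_real: "ringhom complex_of_real"
  by unfold_locales auto

lemma ringhom_complexify: "ringhom complexify"
  unfolding complexify_def by (intro ringhom_map_poly ringhom_of_real)

lemma complexify_gens: "complexify (cpoly c) = cpoly (complex_of_real c)" "complexify px = px" "complexify py = py"
  by (simp_all add: complexify_def cpoly_def map_poly_pCons)

lemma eval_complexify:
  "subst_poly id (complexify G) (complex_of_real (fst x)) (complex_of_real (snd x)) = complex_of_real (eval_poly G x)"
  by (rule ringhom_polypoly_eq[OF ringhom_comp[OF ringhom_complexify ringhom_subst_poly[OF ringhom_id(2)]]
        ringhom_comp[OF eval_poly_hom ringhom_of_real]])
     (simp_all only: complexify_gens subst_poly_gens[OF ringhom_id(2)] eval_poly_gens id_apply)

definition re_part :: "complex poly poly \<Rightarrow> real poly poly" where "re_part = map_poly (map_poly Re)"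
definition im_part :: "complex poly poly \<Rightarrow> real poly poly" where "im_part = map_poly (map_poly Im)"

lemma complexify_parts: "G = complexify (re_part G) + cpoly \<i> * complexify (im_part G)"
  by (simp add: poly_eq_iff complexify_def re_part_def im_part_def coeff_map_poly cpoly_def complex_eq_iff)

lemma eval_parts:
  "subst_poly id G (complex_of_real (fst x)) (complex_of_real (snd x)) =
     complex_of_real (eval_poly (re_part G) x) + \<i> * complex_of_real (eval_poly (im_part G) x)"
proof -
  interpret s: ringhom "\<lambda>p. subst_poly id p (complex_of_real (fst x)) (complex_of_real (snd x))"
    by (rule ringhom_subst_poly[OF ringhom_id(2)])
  show ?thesis
    by (subst complexify_parts[of G]) (simp only: s.add s.mult eval_complexify subst_poly_gens[OF ringhom_id(2)] id_apply)
qed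

text \<open>
  A complex polynomial vanishes on the real curve only if its real and imaginary parts do. Hence the
  ideal of the parametrization over \<open>\<complex>\<close> is still generated by \<open>F\<close>, while \<open>R1 / R2\<close> expresses the
  parameter in the coordinates.
\<close>

lemma rational_real_curve_genus_zero:
  fixes m n1 n2 :: "real poly" and F R1 R2 :: "real poly poly"
  defines "c \<equiv> \<lambda>z. (poly n1 z / poly m z, poly n2 z / poly m z)"
  assumes m0: "m \<noteq> 0" and F0: "F \<noteq> 0"
    and ideal: "\<And>G. (\<forall>z. poly m z \<noteq> 0 \<longrightarrow> eval_poly G (c z) = 0) \<longleftrightarrow> F dvd G"
    and inv: "\<And>z. poly m z \<noteq> 0 \<Longrightarrow> eval_poly R1 (c z) = z * eval_poly R2 (c z)"
    and R2: "poly m z1 \<noteq> 0" "eval_poly R2 (c z1) \<noteq> 0"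
  shows "irreducible (complexify F)" "genus (complexify F) = 0"
proof -
  let ?cp = "map_poly complex_of_real"
  have cp: "poly (?cp p) (complex_of_real z) = complex_of_real (poly p z)" for p z
    by (induction p) (simp_all add: map_poly_pCons)
  define c1 where "c1 = polyf (?cp n1) / polyf (?cp m)"
  define c2 where "c2 = polyf (?cp n2) / polyf (?cp m)"
  have spz: "specialization polyf (\<lambda>p. poly p z)" for z
    by (intro specialization.intro ringhom_polyf ringhom_poly specialization_axioms.intro) simp
  interpret spz: specialization polyf "\<lambda>p. poly p z" for z by (rule spz)
  let ?sp = "\<lambda>z. spec polyf (\<lambda>p. poly p (complex_of_real z))"
  have sc: "?sp z c1 (complex_of_real (fst (c z)))" "?sp z c2 (complex_of_real (snd (c z)))" if "poly m z \<noteq> 0" for z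
    using spz.quotient[where z = "complex_of_real z" and q = "?cp m" and p = "?cp n1"]
      spz.quotient[where z = "complex_of_real z" and q = "?cp m" and p = "?cp n2"] that
    by (simp_all add: c1_def c2_def c_def cp)
  have sK: "?sp z (constK k) (id k)" for z k
    using spz.base[of "complex_of_real z" "[:k:]"] by (simp add: constK_def)
  have sG: "?sp z (subst_poly constK G c1 c2) (subst_poly id G (complex_of_real (fst (c z))) (complex_of_real (snd (c z))))"
    if "poly m z \<noteq> 0" for z G
    by (rule spz.subst_poly[OF ringhom_constK ringhom_id(2) sK sc[OF that]])
  have zero: "w = 0" if "\<And>z. poly m z \<noteq> 0 \<Longrightarrow> ?sp z w 0" for w
  proof -
    obtain p q where w: "q \<noteq> 0" "w = polyf p / polyf q" using crat_cases by metis
    have pz: "poly p (complex_of_real z) = 0" if "poly m z \<noteq> 0" for z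
    proof -
      have "?sp z (w * polyf q) (0 * poly q (complex_of_real z))"
        by (rule spz.mult[OF \<open>\<And>z. poly m z \<noteq> 0 \<Longrightarrow> ?sp z w 0\<close>[OF that] spz.base])
      moreover have "w * polyf q = polyf p" using w by simp
      ultimately have "?sp z (polyf p) 0" by simp
      thus ?thesis using spz.unique[OF spz.base[of "complex_of_real z" p]] by simp
    qed
    have "infinite (- {z. poly m z = 0})" using poly_roots_finite[OF m0] infinite_UNIV_char_0 by (simp add: finite_Collect_not Compl_eq_Diff_UNIV)
    hence "infinite (complex_of_real ` (- {z. poly m z = 0}))" by (simp add: finite_image_iff inj_on_def)
    moreover have "complex_of_real ` (- {z. poly m z = 0}) \<subseteq> {z. poly p z = 0}" using pz by auto
    ultimately have "infinite {z. poly p z = 0}" using finite_subset by blast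
    hence "p = 0" by (rule infinite_roots_poly_0)
    thus ?thesis using w by (simp add: polyf_simps)
  qed
  have Fc: "eval_poly F (c z) = 0" if "poly m z \<noteq> 0" for z using ideal[of F] that by simp
  have kernel: "subst_poly constK G c1 c2 = 0 \<longleftrightarrow> complexify F dvd G" for G
  proof
    assume *: "subst_poly constK G c1 c2 = 0"
    have "eval_poly (re_part G) (c z) = 0 \<and> eval_poly (im_part G) (c z) = 0" if "poly m z \<noteq> 0" for z
    proof -
      have "?sp z 0 0" using spz.base[of "complex_of_real z" 0] by (simp add: polyf_simps)
      hence "subst_poly id G (complex_of_real (fst (c z))) (complex_of_real (snd (c z))) = 0"
        using spz.unique sG[OF that, of G] * by metis
      thus ?thesis unfolding eval_parts by (simp add: complex_eq_iff)
    qed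
    hence "F dvd re_part G" "F dvd im_part G" using ideal by blast+
    then obtain k l where "re_part G = F * k" "im_part G = F * l" by (auto elim!: dvdE)
    hence "G = complexify F * complexify k + cpoly \<i> * (complexify F * complexify l)"
      using complexify_parts[of G] by (simp add: ringhom.mult[OF ringhom_complexify])
    also have "\<dots> = complexify F * (complexify k + cpoly \<i> * complexify l)" by (simp add: algebra_simps)
    finally show "complexify F dvd G" by (metis dvd_triv_left)
  next
    assume "complexify F dvd G"
    then obtain H where H: "G = complexify F * H" by blast
    show "subst_poly constK G c1 c2 = 0"
    proof (rule zero)
      fix z assume z: "poly m z \<noteq> 0"
      have "subst_poly id G (complex_of_real (fst (c z))) (complex_of_real (snd (c z))) = 0"
        unfolding H ringhom.mult[OF ringhom_subst_poly[OF ringhom_id(2)]] eval_complexify Fc[OF z] by simp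
      thus "?sp z (subst_poly constK G c1 c2) 0" using sG[OF z, of G] by simp
    qed
  qed
  have FC0: "complexify F \<noteq> 0"
  proof
    assume "complexify F = 0"
    hence "F = 0" unfolding complexify_def by (subst (asm) map_poly_eq_0_iff) (auto simp: map_poly_eq_0_iff)
    thus False using F0 by simp
  qed
  define h where "h G = subst_poly constK G c1 c2" for G
  have hR2: "h (complexify R2) \<noteq> 0"
    using spz.nonzero[OF sG[OF R2(1), of "complexify R2"]] R2(2) unfolding eval_complexify h_def by simp
  have "h (complexify R1) - polyf [:0, 1:] * h (complexify R2) = 0"
  proof (rule zero)
    fix z assume z: "poly m z \<noteq> 0"
    have "?sp z (h (complexify R1) - polyf [:0, 1:] * h (complexify R2))
      (complex_of_real (eval_poly R1 (c z)) - poly [:0, 1:] (complex_of_real z) * complex_of_real (eval_poly R2 (c z)))"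
      unfolding h_def by (intro spz.diff spz.mult spz.base) (use sG[OF z] in \<open>simp_all flip: eval_complexify\<close>)
    thus "?sp z (h (complexify R1) - polyf [:0, 1:] * h (complexify R2)) 0" by (simp add: inv[OF z])
  qed
  hence quot: "h (complexify R1) / h (complexify R2) = polyf [:0, 1:]" using hR2 by (simp add: field_simps)
  interpret sph: specialization ratf h unfolding h_def by (rule specialization_subst[OF ringhom_constK])
  have "spec ratf h (ratf (complexify R1) / ratf (complexify R2)) (polyf [:0, 1:])"
    using sph.quotient[OF hR2, of "complexify R1"] unfolding quot .
  hence "rational_parametrization (complexify F) c1 c2 (ratf (complexify R1) / ratf (complexify R2))"
    using FC0 kernel unfolding rational_parametrization_def h_def[abs_def] by blast
  thus "irreducible (complexify F)" "genus (complexify F) = 0"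
    by (rule rational_parametrization.irreducible, rule rational_parametrization.genus_zero)
qed


section \<open>Orbits on a line through the origin\<close>

lemma line_dvd:
  assumes L: "p \<noteq> 0 \<or> q \<noteq> 0" and a: "a \<noteq> 0" "p * fst a + q * snd a = 0" and G: "\<And>t. eval_poly G (t *\<^sub>R a) = 0"
  shows "cpoly p * px + cpoly q * py dvd G"
proof (cases "fst a = 0")
  case True
  hence a2: "snd a \<noteq> 0" using a(1) by (metis prod.collapse zero_prod_def)
  hence q: "q = 0" using a True by simp
  hence p: "p \<noteq> 0" using L by simp
  have "[:0, 1:] dvd coeff G j" for j
  proof -
    have "poly (map_poly (\<lambda>c. poly c 0) G) y = 0" for y
      using G[of "y / snd a"] True a2 by (simp add: eval_poly_def subst_poly_def)
    hence "map_poly (\<lambda>c. poly c 0) G = 0" using poly_all_0_iff_0 by blast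
    hence "coeff (map_poly (\<lambda>c. poly c 0) G) j = 0" by simp
    hence "poly (coeff G j) 0 = 0" by (simp add: coeff_map_poly)
    thus ?thesis by (simp add: poly_eq_0_iff_dvd)
  qed
  hence "px dvd G" by (simp add: const_poly_dvd_iff)
  then obtain H where "G = px * H" by blast
  hence "G = (cpoly p * px + cpoly q * py) * (cpoly (1 / p) * H)"
    using p q by (simp add: cpoly_def)
  thus ?thesis by (metis dvd_triv_left)
next
  case False
  have q: "q \<noteq> 0" using L a False by auto
  have pq: "p = - q * (snd a / fst a)" using a False by (simp add: field_simps eq_neg_iff_add_eq_0)
  have "poly G [:0, snd a / fst a:] = 0"
  proof -
    have "poly (poly G [:0, snd a / fst a:]) x = 0" for x
    proof -
      have "poly (poly G r) x = poly (map_poly (\<lambda>c. poly c x) G) (poly r x)" for r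
        by (induction G) (simp_all add: map_poly_pCons)
      thus ?thesis using G[of "x / fst a"] False by (simp add: eval_poly_def subst_poly_def)
    qed
    thus ?thesis using poly_all_0_iff_0 by blast
  qed
  then obtain H where H: "G = [:- [:0, snd a / fst a:], 1:] * H" using poly_eq_0_iff_dvd by (metis dvdE)
  have L': "cpoly p * px + cpoly q * py = cpoly q * [:- [:0, snd a / fst a:], 1:]"
    unfolding pq by (simp add: cpoly_def)
  have inv: "cpoly (1 / q) * cpoly q = 1" using q by (simp add: cpoly_def one_pCons)
  have "(cpoly p * px + cpoly q * py) * (cpoly (1 / q) * H)
      = (cpoly (1 / q) * cpoly q) * ([:- [:0, snd a / fst a:], 1:] * H)"
    unfolding L' by (simp only: mult_ac)
  hence "G = (cpoly p * px + cpoly q * py) * (cpoly (1 / q) * H)" unfolding inv H[symmetric] mult_1_left by (rule sym)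
  thus ?thesis by (metis dvd_triv_left)
qed

lemma on_line:
  assumes L: "p \<noteq> 0 \<or> q \<noteq> 0" and a: "a \<noteq> (0 :: real \<times> real)" "p * fst a + q * snd a = 0" and x: "p * fst x + q * snd x = 0"
  shows "\<exists>t. x = t *\<^sub>R a"
proof (cases "fst a = 0")
  case True
  hence "snd a \<noteq> 0" using a(1) by (metis prod.collapse zero_prod_def)
  hence "q = 0" "p \<noteq> 0" using a True L by auto
  hence "fst x = 0" using x by simp
  thus ?thesis using True \<open>snd a \<noteq> 0\<close> by (intro exI[of _ "snd x / snd a"] prod_eqI) auto
next
  case False
  have q: "q \<noteq> 0" using L a False by auto
  have "q * (fst a * snd x) = q * (fst x * snd a)"
  proof -
    have "q * snd x = - (p * fst x)" using x by linarith
    hence "fst a * (q * snd x) = fst a * (- (p * fst x))" by (rule arg_cong)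
    hence "q * (fst a * snd x) = - (p * fst x) * fst a" by (simp only: mult_ac)
    also have "\<dots> = - (p * fst a) * fst x" by simp
    also have "- (p * fst a) = q * snd a" using a(2) by (simp add: eq_neg_iff_add_eq_0)
    finally show ?thesis by (simp add: mult_ac)
  qed
  hence "fst a * snd x = fst x * snd a" using q by simp
  thus ?thesis using False by (intro exI[of _ "fst x / fst a"] prod_eqI) (auto simp: field_simps)
qed

lemma pderiv_const_linear:
  assumes "pderiv p = [:d:]" shows "p = [:coeff p 0, d :: real:]"
proof -
  have "coeff p (Suc n) = (if n = 0 then d else 0)" for n
    using arg_cong[OF assms, of "\<lambda>p. coeff p n"] by (cases n) (auto simp: coeff_pderiv)
  thus ?thesis by (auto simp: poly_eq_iff coeff_pCons split: nat.splits)
qed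

text \<open>
  The addition law for \<open>\<rho>(z) = c(z) / a\<close> reads \<open>\<rho>(z + w) = \<rho>(z) \<rho>(\<rho>(z) w)\<close>, whence \<open>\<rho>' = \<rho>'(0) \<rho>\<^sup>2\<close>.
  The numerator of a rational solution is coprime to the denominator and divides its own derivative,
  so that it is constant.
\<close>

lemma radial_trajectory:
  assumes te: "translation_equation \<phi>" and bc: "boundary_condition_at \<phi> a" and inf: "infinite (orbit \<phi> a)"
    and rad: "\<And>z. z \<noteq> 0 \<Longrightarrow> map_regular_at \<phi> (z *\<^sub>R a) \<Longrightarrow> \<exists>r. traj \<phi> a z = r *\<^sub>R a"
  obtains k where "k \<noteq> 0" "a \<noteq> 0"
    "\<And>z. z \<noteq> 0 \<Longrightarrow> map_regular_at \<phi> (z *\<^sub>R a) \<Longrightarrow> 1 + k * z \<noteq> 0 \<and> traj \<phi> a z = (1 / (1 + k * z)) *\<^sub>R a"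
    "finite {z. \<not> map_regular_at \<phi> (z *\<^sub>R a)}"
proof -
  obtain P1 P2 Q where rep: "rat_map_rep \<phi> P1 P2 Q" using rat_map_rep_exists by blast
  interpret rat_map_rep \<phi> P1 P2 Q by fact
  have sub: "infinite (traj \<phi> a ` {z. z \<noteq> 0 \<and> map_regular_at \<phi> (z *\<^sub>R a)})" using inf unfolding orbit_eq_traj by simp
  have a0: "a \<noteq> 0"
  proof
    assume "a = 0"
    hence "traj \<phi> a ` {z. z \<noteq> 0 \<and> map_regular_at \<phi> (z *\<^sub>R a)} \<subseteq> {0}" using rad by auto
    thus False using sub finite_subset by blast
  qed
  have "{z. z \<noteq> 0 \<and> map_regular_at \<phi> (z *\<^sub>R a)} \<noteq> {}" using sub by (metis finite.emptyI image_empty)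
  then obtain z0 where z0: "map_regular_at \<phi> (z0 *\<^sub>R a)" by blast
  define m where "m = [:0, 1:] * ray a Q"
  have "poly (ray a Q) z0 \<noteq> 0" using z0 by (simp add: regular_iff poly_ray)
  hence rQ: "ray a Q \<noteq> 0" by auto
  hence m0: "m \<noteq> 0" by (simp add: m_def)
  have mz: "poly m z \<noteq> 0 \<longleftrightarrow> z \<noteq> 0 \<and> map_regular_at \<phi> (z *\<^sub>R a)" for z by (simp add: m_def regular_iff poly_ray)
  have fin: "finite {z. \<not> map_regular_at \<phi> (z *\<^sub>R a)}"
    using poly_roots_finite[OF rQ] by (simp add: regular_iff poly_ray)
  have "\<exists>n. \<forall>z. poly m z \<noteq> 0 \<longrightarrow> traj \<phi> a z = (poly n z / poly m z) *\<^sub>R a"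
  proof (cases "fst a = 0")
    case False
    show ?thesis
    proof (intro exI[of _ "smult (1 / fst a) (ray a P1)"] allI impI)
      fix z assume z: "poly m z \<noteq> 0"
      then obtain r where r: "traj \<phi> a z = r *\<^sub>R a" using rad mz by blast
      have "r * fst a = poly (ray a P1) z / poly m z"
        using traj_polys[of z a] z mz[of z] unfolding r by (auto simp: m_def prod_eq_iff)
      hence "r = poly (ray a P1) z / poly m z / fst a" using False by (metis nonzero_mult_div_cancel_right)
      hence "r = poly (smult (1 / fst a) (ray a P1)) z / poly m z" by (simp add: mult.commute)
      thus "traj \<phi> a z = (poly (smult (1 / fst a) (ray a P1)) z / poly m z) *\<^sub>R a" using r by simp
    qed
  next
    case True
    hence s: "snd a \<noteq> 0" using a0 by (metis prod.collapse zero_prod_def)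
    show ?thesis
    proof (intro exI[of _ "smult (1 / snd a) (ray a P2)"] allI impI)
      fix z assume z: "poly m z \<noteq> 0"
      then obtain r where r: "traj \<phi> a z = r *\<^sub>R a" using rad mz by blast
      have "r * snd a = poly (ray a P2) z / poly m z"
        using traj_polys[of z a] z mz[of z] unfolding r by (auto simp: m_def prod_eq_iff)
      hence "r = poly (ray a P2) z / poly m z / snd a" using s by (metis nonzero_mult_div_cancel_right)
      hence "r = poly (smult (1 / snd a) (ray a P2)) z / poly m z" by (simp add: mult.commute)
      thus "traj \<phi> a z = (poly (smult (1 / snd a) (ray a P2)) z / poly m z) *\<^sub>R a" using r by simp
    qed
  qed
  then obtain n where n: "\<And>z. poly m z \<noteq> 0 \<Longrightarrow> traj \<phi> a z = (poly n z / poly m z) *\<^sub>R a" by blast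
  obtain d r1 r0 where dr: "d \<noteq> 0" "n = d * r1" "m = d * r0" "coprime r1 r0"
    using coprime_representation[of n m] m0 by blast
  have r00: "r0 \<noteq> 0" using dr m0 by auto
  have tr: "poly r0 z \<noteq> 0" "traj \<phi> a z = (poly r1 z / poly r0 z) *\<^sub>R a" if "poly m z \<noteq> 0" for z
    using n[OF that] that unfolding dr by auto
  have ev: "eventually (\<lambda>z. poly m z \<noteq> 0) (at 0)"
    using islimpt_finite[OF poly_roots_finite[OF m0], of 0] unfolding islimpt_iff_eventually by simp
  have lim: "((\<lambda>z. poly r1 z / poly r0 z) \<longlongrightarrow> 1) (at 0)"
  proof -
    have "((\<lambda>z. traj \<phi> a z) \<longlongrightarrow> a) (at 0)" using bc unfolding boundary_condition_at_def traj_def .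
    moreover have "eventually (\<lambda>z. traj \<phi> a z = (poly r1 z / poly r0 z) *\<^sub>R a) (at 0)" using ev by eventually_elim (rule tr)
    ultimately have l: "((\<lambda>z. (poly r1 z / poly r0 z) *\<^sub>R a) \<longlongrightarrow> a) (at 0)" by (rule Lim_transform_eventually)
    show ?thesis
    proof (cases "fst a = 0")
      case False
      have "((\<lambda>z. (poly r1 z / poly r0 z) * fst a / fst a) \<longlongrightarrow> fst a / fst a) (at 0)"
        using tendsto_fst[OF l] False by (intro tendsto_divide tendsto_const) auto
      thus ?thesis using False by simp
    next
      case True
      hence s: "snd a \<noteq> 0" using a0 by (metis prod.collapse zero_prod_def)
      have "((\<lambda>z. (poly r1 z / poly r0 z) * snd a / snd a) \<longlongrightarrow> snd a / snd a) (at 0)"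
        using tendsto_snd[OF l] s by (intro tendsto_divide tendsto_const) auto
      thus ?thesis using s by simp
    qed
  qed
  have r10: "poly r1 0 = poly r0 0"
  proof -
    have c: "(poly p \<longlongrightarrow> poly p 0) (at 0)" for p :: "real poly"
    proof -
      have "isCont (poly p) 0" by simp
      thus ?thesis unfolding isCont_def .
    qed
    have "((\<lambda>z. (poly r1 z / poly r0 z) * poly r0 z) \<longlongrightarrow> 1 * poly r0 0) (at 0)" by (intro tendsto_mult lim c)
    moreover have "eventually (\<lambda>z. (poly r1 z / poly r0 z) * poly r0 z = poly r1 z) (at 0)"
      using ev by eventually_elim (simp add: tr)
    ultimately have "(poly r1 \<longlongrightarrow> 1 * poly r0 0) (at 0)" by (rule Lim_transform_eventually)
    thus ?thesis using tendsto_unique[OF _ c] by fastforce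
  qed
  define e where "e = poly r0 0"
  have e0: "e \<noteq> 0"
  proof
    assume "e = 0"
    hence "[:0, 1:] dvd r1" "[:0, 1:] dvd r0" using r10 poly_eq_0_iff_dvd[of _ 0] by (auto simp: e_def)
    hence "is_unit [:0, 1 :: real:]" using dr(4) coprime_common_divisor by blast
    thus False using is_unit_iff_degree[of "[:0, 1 :: real:]"] by simp
  qed
  have r1n: "r1 \<noteq> 0" using r10 e0 by (auto simp: e_def)
  \<comment> \<open>The derivative of the addition law in \<open>w\<close> at \<open>w = 0\<close>.\<close>
  define K where "K = poly (pderiv r1) 0 - poly (pderiv r0) 0"
  have ode: "smult e (pderiv r1 * r0 - r1 * pderiv r0) = smult K (r1 * r1)"
  proof (rule poly_eqI_all)
    have eqc: "p1 = p2" if "\<And>z. poly (m * r1) z \<noteq> 0 \<Longrightarrow> poly p1 z = poly p2 z" for p1 p2 :: "real poly"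
    proof -
      have "m * r1 * (p1 - p2) = 0" by (rule poly_all_0_iff_0[THEN iffD1]) (use that in auto)
      thus ?thesis using m0 r1n by simp
    qed
    fix z0
    have "smult e (pderiv r1 * r0 - r1 * pderiv r0) = smult K (r1 * r1)"
    proof (rule eqc)
      fix z assume z: "poly (m * r1) z \<noteq> 0"
      hence zm: "poly m z \<noteq> 0" "poly r1 z \<noteq> 0" by auto
      note tz = tr[OF zm(1)]
      define r where "r = poly r1 z / poly r0 z"
      have r: "r \<noteq> 0" using zm tz by (simp add: r_def)
      define s1 where "s1 = pcompose r1 [:z, 1:]"
      define s0 where "s0 = pcompose r0 [:z, 1:]"
      define t1 where "t1 = pcompose r1 [:0, r:]"
      define t0 where "t0 = pcompose r0 [:0, r:]"
      define mm where "mm = [:0, 1:] * pcompose m [:z, 1:] * pcompose m [:0, r:]"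
      have mm0: "mm \<noteq> 0" unfolding mm_def using m0 r by (simp add: pcompose_eq_0_iff)
      have "s1 * t0 = smult r (s0 * t1)"
      proof -
        have "mm * (s1 * t0 - smult r (s0 * t1)) = 0"
        proof (rule poly_all_0_iff_0[THEN iffD1], rule allI)
          fix w
          show "poly (mm * (s1 * t0 - smult r (s0 * t1))) w = 0"
          proof (cases "poly mm w = 0")
            case False
            hence w: "w \<noteq> 0" "poly m (z + w) \<noteq> 0" "poly m (r * w) \<noteq> 0"
              by (auto simp: mm_def poly_pcompose mult.commute)
            have cz: "traj \<phi> a z = r *\<^sub>R a" using tz by (simp add: r_def)
            have "map_regular_at \<phi> (w *\<^sub>R traj \<phi> a z)" unfolding cz using mz[of "r * w"] w(3) by (simp add: mult.commute)
            hence "traj \<phi> a (z + w) = traj \<phi> (r *\<^sub>R a) w"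
              using traj_shift[OF te, of z w a] w mz[of z] mz[of "z + w"] zm unfolding cz by blast
            also have "\<dots> = r *\<^sub>R traj \<phi> a (r * w)" by (rule traj_scale[OF r])
            finally have "(poly r1 (z + w) / poly r0 (z + w)) *\<^sub>R a = (r * (poly r1 (r * w) / poly r0 (r * w))) *\<^sub>R a"
              using tr(2)[OF w(2)] tr(2)[OF w(3)] by simp
            hence "poly r1 (z + w) / poly r0 (z + w) = r * (poly r1 (r * w) / poly r0 (r * w))"
              using a0 scaleR_right_imp_eq by blast
            thus ?thesis using tr(1)[OF w(2)] tr(1)[OF w(3)]
              by (simp add: s1_def s0_def t1_def t0_def poly_pcompose field_simps)
          qed simp
        qed
        thus ?thesis using mm0 by simp
      qed
      hence "poly (pderiv (s1 * t0)) 0 = poly (pderiv (smult r (s0 * t1))) 0" by simp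
      hence "poly (pderiv r1) z * e + poly r1 z * (r * poly (pderiv r0) 0)
          = r * (poly (pderiv r0) z * e + poly r0 z * (r * poly (pderiv r1) 0))"
        by (simp add: s1_def s0_def t1_def t0_def pderiv_mult pderiv_smult pderiv_pcompose pderiv_pCons poly_pcompose
            r10 e_def algebra_simps)
      hence "(poly (pderiv r1) z * e + poly r1 z * (r * poly (pderiv r0) 0)) * poly r0 z
          = (r * (poly (pderiv r0) z * e + poly r0 z * (r * poly (pderiv r1) 0))) * poly r0 z" by simp
      hence "poly (pderiv r1) z * e * poly r0 z + poly r1 z * poly (pderiv r0) 0 * (r * poly r0 z)
          = (r * poly r0 z) * (poly (pderiv r0) z * e) + (r * poly r0 z) * (r * poly r0 z) * poly (pderiv r1) 0"
        by (simp add: algebra_simps)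
      moreover have "r * poly r0 z = poly r1 z" using tz by (simp add: r_def)
      ultimately have "poly (pderiv r1) z * e * poly r0 z + poly r1 z * poly (pderiv r0) 0 * poly r1 z
          = poly r1 z * (poly (pderiv r0) z * e) + poly r1 z * poly r1 z * poly (pderiv r1) 0"
        by simp
      thus "poly (smult e (pderiv r1 * r0 - r1 * pderiv r0)) z = poly (smult K (r1 * r1)) z"
        by (simp add: K_def algebra_simps)
    qed
    thus "poly (smult e (pderiv r1 * r0 - r1 * pderiv r0)) z0 = poly (smult K (r1 * r1)) z0" by simp
  qed
  have "r1 dvd smult e (pderiv r1 * r0)"
  proof -
    have "smult e (pderiv r1 * r0) = r1 * (smult K r1 + smult e (pderiv r0))"
      using ode by (simp add: smult_diff_right algebra_simps)
    thus ?thesis by simp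
  qed
  hence "r1 dvd pderiv r1 * r0" using e0 by (simp add: dvd_smult_iff)
  hence "r1 dvd pderiv r1" using coprime_dvd_mult_left_iff[OF dr(4)] by blast
  have "degree r1 = 0"
  proof (rule ccontr)
    assume d1: "degree r1 \<noteq> 0"
    hence "pderiv r1 \<noteq> 0" by (simp add: pderiv_eq_0_iff)
    hence "degree r1 \<le> degree (pderiv r1)" using \<open>r1 dvd pderiv r1\<close> by (rule dvd_imp_degree_le[rotated])
    thus False using d1 by (simp add: degree_pderiv)
  qed
  then obtain e' where "r1 = [:e':]" by (rule degree_eq_zeroE)
  hence r1e: "r1 = [:e:]" using r10 by (simp add: e_def)
  have "smult (e * e) (pderiv r0) = smult (e * e) [:- K:]"
    using ode unfolding r1e by (simp add: pderiv_pCons) (metis minus_equation_iff minus_mult_commute mult.assoc mult.commute minus_pCons neg_0_equal_iff_equal smult_minus_right smult_pCons smult_0_right)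
  hence "pderiv r0 = [:- K:]" using e0 by (metis mult_eq_0_iff smult_eq_iff smult_cancel)
  hence "r0 = [:coeff r0 0, - K:]" by (rule pderiv_const_linear)
  hence r0e: "r0 = [:e, - K:]" by (simp add: e_def poly_0_coeff_0)
  define k where "k = - K / e"
  have r0z: "poly r0 z = e * (1 + k * z)" for z unfolding r0e k_def using e0 by (simp add: field_simps)
  have T: "1 + k * z \<noteq> 0 \<and> traj \<phi> a z = (1 / (1 + k * z)) *\<^sub>R a" if "z \<noteq> 0" "map_regular_at \<phi> (z *\<^sub>R a)" for z
    using tr[of z] that mz e0 unfolding r0z r1e by auto
  have "k \<noteq> 0"
  proof
    assume "k = 0"
    hence "traj \<phi> a ` {z. z \<noteq> 0 \<and> map_regular_at \<phi> (z *\<^sub>R a)} \<subseteq> {a}" using T by auto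
    thus False using sub finite_subset by blast
  qed
  thus thesis using that a0 T fin by blast
qed

lemma curve_given_by_cmult:
  assumes "curve_given_by S F" "c \<noteq> 0" shows "curve_given_by S (cpoly c * F)"
proof -
  have "cpoly c * F dvd G \<longleftrightarrow> F dvd G" for G
  proof
    assume "F dvd G"
    then obtain H where "G = F * H" by blast
    moreover have "cpoly c * cpoly (1 / c) = 1" using assms(2) by (simp add: cpoly_def one_pCons)
    ultimately have "G = (cpoly c * F) * (cpoly (1 / c) * H)" by (metis mult.assoc mult.commute mult_1)
    thus "cpoly c * F dvd G" by (metis dvd_triv_left)
  qed (metis dvd_mult_right)
  moreover have "eval_poly (cpoly c * F) x = 0 \<longleftrightarrow> eval_poly F x = 0" for x
    unfolding eval_poly_simps eval_poly_gens using assms(2) by simp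
  ultimately show ?thesis using assms(1) unfolding curve_given_by_def by (simp cong: Collect_cong)
qed

text \<open>The function \<open>1 / (1 + k z)\<close> takes almost all real values, and it can be solved for \<open>z\<close>.\<close>

lemma radial_orbit:
  assumes te: "translation_equation \<phi>" and nd: "nondegenerate_at \<phi> a"
    and rad: "\<And>z. z \<noteq> 0 \<Longrightarrow> map_regular_at \<phi> (z *\<^sub>R a) \<Longrightarrow> \<exists>r. traj \<phi> a z = r *\<^sub>R a"
    and L: "p \<noteq> 0 \<or> q \<noteq> 0" "p * fst a + q * snd a = 0"
  shows "curve_given_by (orbit \<phi> a) (cpoly p * px + cpoly q * py)" "algebraic_curve_of_genus_0 (orbit \<phi> a)"
proof -
  obtain k where k: "k \<noteq> 0" and a0: "a \<noteq> 0"
    and T: "\<And>z. z \<noteq> 0 \<Longrightarrow> map_regular_at \<phi> (z *\<^sub>R a) \<Longrightarrow> 1 + k * z \<noteq> 0 \<and> traj \<phi> a z = (1 / (1 + k * z)) *\<^sub>R a"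
    and fin: "finite {z. \<not> map_regular_at \<phi> (z *\<^sub>R a)}"
    using radial_trajectory[OF te _ _ rad] nd unfolding nondegenerate_at_def by blast
  let ?L = "cpoly p * px + cpoly q * py"
  have sub: "\<exists>t. x = t *\<^sub>R a" if "x \<in> orbit \<phi> a" for x
    using that rad unfolding orbit_eq_traj by (auto intro: exI[of _ 1])
  define bad where "bad = insert 0 ((\<lambda>z. 1 / (1 + k * z)) ` insert 0 {z. \<not> map_regular_at \<phi> (z *\<^sub>R a)})"
  have finb: "finite bad" unfolding bad_def using fin by simp
  have mem: "t *\<^sub>R a \<in> orbit \<phi> a" if "t \<notin> bad" for t
  proof -
    define z where "z = (1 / t - 1) / k"
    have t: "t \<noteq> 0" "t = 1 / (1 + k * z)" using that k by (auto simp: bad_def z_def)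
    hence "z \<noteq> 0" "map_regular_at \<phi> (z *\<^sub>R a)" using that by (auto simp: bad_def)
    thus ?thesis using T[of z] t unfolding orbit_eq_traj by (metis (mono_tags, lifting) image_eqI insertI2 mem_Collect_eq)
  qed
  have Lv: "eval_poly ?L (t *\<^sub>R a) = 0" for t
    unfolding eval_linear using L(2) by simp (metis distrib_left mult.left_commute mult_zero_right)
  have ideal: "?L dvd G" if "infinite {t. eval_poly G (t *\<^sub>R a) = 0}" for G
  proof (rule line_dvd[OF L(1) a0 L(2)])
    have "ray a G = 0" using that infinite_roots_poly_0[of "ray a G"] by (simp add: poly_ray)
    thus "eval_poly G (t *\<^sub>R a) = 0" for t using poly_ray[of a G t] by simp
  qed
  show c: "curve_given_by (orbit \<phi> a) ?L" unfolding curve_given_by_def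
  proof
    show "{G. \<forall>x\<in>orbit \<phi> a. eval_poly G x = 0} = {G. ?L dvd G}"
    proof (intro set_eqI iffI CollectI; elim CollectE)
      fix G assume G: "\<forall>x\<in>orbit \<phi> a. eval_poly G x = 0"
      have "- bad \<subseteq> {t. eval_poly G (t *\<^sub>R a) = 0}" using G mem by auto
      moreover have "infinite (- bad)" using finb infinite_UNIV_char_0 by (simp add: Compl_eq_Diff_UNIV)
      ultimately show "?L dvd G" using ideal finite_subset by blast
    next
      fix G assume "?L dvd G"
      then obtain H where H: "G = ?L * H" by blast
      show "\<forall>x\<in>orbit \<phi> a. eval_poly G x = 0"
      proof
        fix x assume "x \<in> orbit \<phi> a"
        then obtain t where "x = t *\<^sub>R a" using sub by blast
        thus "eval_poly G x = 0" unfolding H eval_poly_simps(4) using Lv[of t] by simp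
      qed
    qed
    have "{x. eval_poly ?L x = 0} - orbit \<phi> a \<subseteq> (\<lambda>t. t *\<^sub>R a) ` bad"
    proof
      fix x assume x: "x \<in> {x. eval_poly ?L x = 0} - orbit \<phi> a"
      hence "p * fst x + q * snd x = 0" unfolding eval_linear by simp
      then obtain t where "x = t *\<^sub>R a" using on_line[OF L(1) a0 L(2)] by blast
      thus "x \<in> (\<lambda>t. t *\<^sub>R a) ` bad" using x mem by blast
    qed
    thus "finite ({x. eval_poly ?L x = 0} - orbit \<phi> a)" using finb finite_subset by blast
  qed
  define m :: "real poly" where "m = [:1, k:]"
  define cc where "cc z = (poly [:fst a:] z / poly m z, poly [:snd a:] z / poly m z)" for z
  have cc: "cc z = (1 / (1 + k * z)) *\<^sub>R a" for z by (simp add: cc_def m_def prod_eq_iff mult.commute)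
  have m0: "m \<noteq> 0" by (simp add: m_def)
  have mz: "poly m z = 1 + k * z" for z by (simp add: m_def mult.commute)
  have L0: "?L \<noteq> 0" unfolding linear_form_eq_0_iff using L(1) by blast
  have id: "(\<forall>z. poly m z \<noteq> 0 \<longrightarrow> eval_poly G (cc z) = 0) \<longleftrightarrow> ?L dvd G" for G
  proof
    assume G: "\<forall>z. poly m z \<noteq> 0 \<longrightarrow> eval_poly G (cc z) = 0"
    have "eval_poly G (t *\<^sub>R a) = 0" if "t \<noteq> 0" for t
    proof -
      have "1 + k * ((1 / t - 1) / k) = 1 / t" using k by simp
      thus ?thesis using G[rule_format, of "(1 / t - 1) / k"] that unfolding cc mz by simp
    qed
    hence "- {0} \<subseteq> {t. eval_poly G (t *\<^sub>R a) = 0}" by auto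
    moreover have "infinite (- {0 :: real})" using infinite_UNIV_char_0 by (simp add: Compl_eq_Diff_UNIV)
    ultimately show "?L dvd G" using ideal finite_subset by blast
  next
    assume "?L dvd G"
    then obtain H where H: "G = ?L * H" by blast
    show "\<forall>z. poly m z \<noteq> 0 \<longrightarrow> eval_poly G (cc z) = 0" unfolding H eval_poly_simps(4) cc Lv by simp
  qed
  have "irreducible (complexify ?L) \<and> genus (complexify ?L) = 0"
  proof (cases "fst a = 0")
    case False
    have i: "eval_poly (cpoly (fst a) - px) (cc z) = z * eval_poly (cpoly k * px) (cc z)" if "poly m z \<noteq> 0" for z
      unfolding eval_poly_simps eval_poly_gens cc using that unfolding mz by (simp add: field_simps)
    have "eval_poly (cpoly k * px) (cc 0) \<noteq> 0" unfolding eval_poly_simps eval_poly_gens cc using k False by simp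
    moreover have "poly m 0 \<noteq> 0" by (simp add: m_def)
    ultimately show ?thesis
      using rational_real_curve_genus_zero[OF m0 L0 id[unfolded cc_def] i[unfolded cc_def]] unfolding cc_def by blast
  next
    case True
    hence s: "snd a \<noteq> 0" using a0 by (metis prod.collapse zero_prod_def)
    have i: "eval_poly (cpoly (snd a) - py) (cc z) = z * eval_poly (cpoly k * py) (cc z)" if "poly m z \<noteq> 0" for z
      unfolding eval_poly_simps eval_poly_gens cc using that unfolding mz by (simp add: field_simps)
    have "eval_poly (cpoly k * py) (cc 0) \<noteq> 0" unfolding eval_poly_simps eval_poly_gens cc using k s by simp
    moreover have "poly m 0 \<noteq> 0" by (simp add: m_def)
    ultimately show ?thesis
      using rational_real_curve_genus_zero[OF m0 L0 id[unfolded cc_def] i[unfolded cc_def]] unfolding cc_def by blast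
  qed
  thus "algebraic_curve_of_genus_0 (orbit \<phi> a)" unfolding algebraic_curve_of_genus_0_def using c by blast
qed


section \<open>The vanishing ideal of a level curve\<close>

lemma coeff_pcompose_monom:
  fixes \<psi> :: "real poly"
  assumes "\<not> N dvd i" shows "coeff (pcompose \<psi> (monom 1 N)) i = 0"
proof -
  have "pcompose \<psi> (monom 1 N) = (\<Sum>j\<le>degree \<psi>. smult (coeff \<psi> j) (monom 1 (N * j)))"
    unfolding pcompose_altdef poly_altdef by (simp add: coeff_map_poly degree_map_poly monom_power)
  thus ?thesis using assms by (auto simp: coeff_sum intro!: sum.neutral)
qed

text \<open>
  All exponents in \<open>s^(M - k) \<psi>(s^N)\<close> are congruent to \<open>M - k\<close> modulo \<open>N\<close>, so that terms from
  different residue classes do not cancel.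
\<close>

lemma residue_class_sum_zero:
  fixes \<psi> :: "nat \<Rightarrow> real poly"
  assumes "(\<Sum>k\<le>M. monom 1 (M - k) * pcompose (\<psi> k) (monom 1 N)) = 0"
  shows "(\<Sum>k\<in>{k. k \<le> M \<and> k mod N = r}. monom 1 (M - k) * pcompose (\<psi> k) (monom 1 N)) = 0" (is "?S = 0")
proof -
  define t where "t k = monom 1 (M - k) * pcompose (\<psi> k) (monom 1 N)" for k
  let ?K = "{k. k \<le> M \<and> k mod N = r}"
  have nz: "\<exists>l. i + k = M + N * l" if "k \<le> M" "coeff (t k) i \<noteq> 0" for i k
  proof -
    have "M - k \<le> i" "coeff (pcompose (\<psi> k) (monom 1 N)) (i - (M - k)) \<noteq> 0"
      using that unfolding t_def by (auto simp: coeff_monom_mult split: if_splits)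
    hence "N dvd i - (M - k)" using coeff_pcompose_monom by blast
    then obtain l where "i - (M - k) = N * l" by blast
    hence "i + k = M + N * l" using \<open>M - k \<le> i\<close> that(1) by linarith
    thus ?thesis by blast
  qed
  have "coeff (\<Sum>k\<in>?K. t k) i = 0" for i
  proof (cases "\<exists>k\<in>?K. coeff (t k) i \<noteq> 0")
    case True
    then obtain k where k: "k \<le> M" "k mod N = r" "coeff (t k) i \<noteq> 0" by blast
    have "coeff (t k') i = 0" if "k' \<le> M" "k' \<notin> ?K" for k'
    proof (rule ccontr)
      assume "coeff (t k') i \<noteq> 0"
      hence "\<exists>l'. i + k' = M + N * l'" using nz that by blast
      then obtain l' where "i + k' = M + N * l'" by blast
      moreover obtain l where "i + k = M + N * l" using nz k by blast
      ultimately have "k + N * l' = k' + N * l" by linarith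
      hence "(k + N * l') mod N = (k' + N * l) mod N" by simp
      thus False using that k by simp
    qed
    hence "(\<Sum>k\<in>?K. coeff (t k) i) = (\<Sum>k\<le>M. coeff (t k) i)" by (intro sum.mono_neutral_left) auto
    also have "\<dots> = coeff (\<Sum>k\<le>M. t k) i" by (simp add: coeff_sum)
    also have "\<dots> = 0" using assms unfolding t_def by simp
    finally show ?thesis by (simp add: coeff_sum)
  next
    case False
    thus ?thesis by (auto simp: coeff_sum intro!: sum.neutral)
  qed
  thus ?thesis unfolding t_def[symmetric] by (simp add: poly_eq_iff)
qed

text \<open>
  The level curve \<open>A = c B\<close> of a homogeneous rational function of degree \<open>N\<close>, parametrised by
  \<open>s \<mapsto> (\<alpha>, \<beta>)(s^N) / (s q(s^N))\<close>. The form of degree \<open>k\<close> contained in \<open>G\<close> contributes terms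
  \<open>s^(-k) \<psi>(s^N)\<close>, so that the forms whose degrees lie in one residue class modulo \<open>N\<close> may be treated
  separately. Multiplied by powers of \<open>A\<close> and \<open>c B\<close>, which agree on the curve, they add up
  to a single form that vanishes on the curve, hence identically.
\<close>

lemma level_curve_ideal:
  fixes A B G :: "real poly poly" and \<alpha> \<beta> q :: "real poly"
  assumes N: "N > 0" and A: "hom_poly (e + N) A" and B: "hom_poly e B" and cop: "coprime A B" and B0: "B \<noteq> 0" and c: "c \<noteq> 0"
    and indep: "\<And>d G. hom_poly d G \<Longrightarrow> form_at G \<alpha> \<beta> = 0 \<Longrightarrow> G = 0"
    and q: "q \<noteq> 0" and rel: "form_at A \<alpha> \<beta> = smult c ([:0, 1:] * q ^ N * form_at B \<alpha> \<beta>)"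
    and van: "infinite {s. s \<noteq> 0 \<and> poly q (s ^ N) \<noteq> 0 \<and>
       eval_poly G ((1 / (s * poly q (s ^ N))) *\<^sub>R (poly \<alpha> (s ^ N), poly \<beta> (s ^ N))) = 0}"
  shows "A - cpoly c * B dvd G"
proof -
  define F where "F = A - cpoly c * B"
  define J where "J = degree (graded G)"
  \<comment> \<open>For \<open>k = r + j N\<close> the exponent \<open>M - k\<close> is \<open>N (J - j) + (N - 1 - r)\<close>, with the same rest for all \<open>j\<close>.\<close>
  define M where "M = N * J + (N - 1)"
  define g where "g k = coeff (graded G) k" for k
  have hg: "hom_poly k (g k)" for k unfolding g_def by (rule hom_poly_component)
  have "J \<le> M" unfolding M_def using N by (cases N) auto
  have Gsum: "G = (\<Sum>k\<le>M. g k)"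
  proof -
    have "(\<Sum>k\<le>M. g k) = (\<Sum>k\<le>J. g k)"
      by (rule sum.mono_neutral_right) (use \<open>J \<le> M\<close> in \<open>auto simp: g_def J_def coeff_eq_0\<close>)
    thus ?thesis using sum_components[of G] by (simp add: g_def J_def)
  qed
  define f where "f k = form_at (g k) \<alpha> \<beta>" for k
  define \<psi> where "\<psi> k = f k * q ^ (M - k)" for k
  have Phi: "(\<Sum>k\<le>M. monom 1 (M - k) * pcompose (\<psi> k) (monom 1 N)) = 0" (is "?P = 0")
  proof (rule infinite_roots_poly_0, rule infinite_mono[OF van])
    fix s assume s: "s \<noteq> 0 \<and> poly q (s ^ N) \<noteq> 0 \<and>
       eval_poly G ((1 / (s * poly q (s ^ N))) *\<^sub>R (poly \<alpha> (s ^ N), poly \<beta> (s ^ N))) = 0"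
    define y where "y = s * poly q (s ^ N)"
    have y: "y \<noteq> 0" using s by (simp add: y_def)
    have "eval_poly G ((1 / y) *\<^sub>R (poly \<alpha> (s ^ N), poly \<beta> (s ^ N))) = (\<Sum>k\<le>M. (1 / y) ^ k * poly (f k) (s ^ N))"
      by (subst Gsum) (simp add: eval_poly_simps(8) hom_eval[OF hg] poly_form_at f_def del: scaleR_Pair)
    hence "(\<Sum>k\<le>M. (1 / y) ^ k * poly (f k) (s ^ N)) = 0" using s by (simp add: y_def)
    hence "0 = y ^ M * (\<Sum>k\<le>M. (1 / y) ^ k * poly (f k) (s ^ N))" by simp
    also have "\<dots> = (\<Sum>k\<le>M. y ^ (M - k) * poly (f k) (s ^ N))"
      unfolding sum_distrib_left by (rule sum.cong) (use y in \<open>auto simp: power_diff power_divide field_simps\<close>)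
    also have "\<dots> = poly ?P s"
      by (simp add: poly_sum poly_monom poly_pcompose \<psi>_def y_def power_mult_distrib mult_ac)
    finally show "poly ?P s = 0" by simp
  qed
  have residue: "F dvd A ^ J * (\<Sum>k\<in>{k. k \<le> M \<and> k mod N = r}. g k)" if r: "r < N" for r
  proof -
    have K: "{k. k \<le> M \<and> k mod N = r} = (\<lambda>j. r + j * N) ` {..J}"
    proof (intro set_eqI iffI)
      fix k assume k: "k \<in> {k. k \<le> M \<and> k mod N = r}"
      have "k div N \<le> J"
      proof -
        have "k < (J + 1) * N" using k N unfolding M_def by (cases N) (auto simp: algebra_simps)
        thus ?thesis by (simp add: less_mult_imp_div_less less_Suc_eq_le[symmetric])
      qed
      moreover have "k = r + (k div N) * N" using k by (metis (mono_tags) add.commute div_mult_mod_eq mem_Collect_eq)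
      ultimately show "k \<in> (\<lambda>j. r + j * N) ` {..J}" by blast
    next
      fix k assume "k \<in> (\<lambda>j. r + j * N) ` {..J}"
      then obtain j where j: "k = r + j * N" "j \<le> J" by auto
      have "j * N \<le> J * N" using j by simp
      hence "r + j * N \<le> M" unfolding M_def mult.commute[of N J] using r by linarith
      thus "k \<in> {k. k \<le> M \<and> k mod N = r}" using j r by simp
    qed
    have inj: "inj_on (\<lambda>j. r + j * N) {..J}" using N by (auto simp: inj_on_def)
    have ex: "M - (r + j * N) = N * (J - j) + (N - 1 - r)" if "j \<le> J" for j
    proof -
      have "N * J = N * (J - j) + j * N" using that by (simp add: right_diff_distrib' mult.commute)
      thus ?thesis unfolding M_def using r by linarith
    qed
    define \<Theta> where "\<Theta> = (\<Sum>j\<le>J. [:0, 1:] ^ (J - j) * (f (r + j * N) * q ^ (N * (J - j))))"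
    have "0 = (\<Sum>j\<le>J. monom 1 (M - (r + j * N)) * pcompose (\<psi> (r + j * N)) (monom 1 N))"
      using residue_class_sum_zero[OF Phi, of r] unfolding K by (simp add: sum.reindex[OF inj])
    also have "\<dots> = (\<Sum>j\<le>J. monom 1 (N - 1 - r) * (pcompose (q ^ (N - 1 - r)) (monom 1 N) *
        pcompose ([:0, 1:] ^ (J - j) * (f (r + j * N) * q ^ (N * (J - j)))) (monom 1 N)))"
    proof (rule sum.cong)
      fix j assume "j \<in> {..J}"
      hence j: "j \<le> J" by simp
      have comp1: "pcompose ([:0, 1:] ^ (J - j)) (monom 1 N) = monom (1::real) (N * (J - j))"
        by (simp add: ringhom.power[OF ringhom_pcompose] pcompose_pCons monom_power)
      have "monom 1 (M - (r + j * N)) = monom 1 (N - 1 - r) * monom (1::real) (N * (J - j))"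
        unfolding ex[OF j] by (simp add: mult_monom add.commute)
      show "monom 1 (M - (r + j * N)) * pcompose (\<psi> (r + j * N)) (monom 1 N)
          = monom 1 (N - 1 - r) * (pcompose (q ^ (N - 1 - r)) (monom 1 N) *
        pcompose ([:0, 1:] ^ (J - j) * (f (r + j * N) * q ^ (N * (J - j)))) (monom 1 N))"
      proof -
        have ac: "(a * b) * ((x * (y * z))) = a * (z * (b * (x * y)))" for a b x y z :: "real poly" by (simp only: mult_ac)
        have psi: "\<psi> (r + j * N) = f (r + j * N) * (q ^ (N * (J - j)) * q ^ (N - 1 - r))"
          unfolding \<psi>_def ex[OF j] power_add ..
        show ?thesis unfolding psi pcompose_mult comp1 \<open>monom 1 (M - (r + j * N)) = _\<close> by (rule ac)
      qed
    qed simp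
    also have "\<dots> = monom 1 (N - 1 - r) * (pcompose (q ^ (N - 1 - r)) (monom 1 N) * pcompose \<Theta> (monom 1 N))"
      by (simp add: \<Theta>_def pcompose_sum sum_distrib_left)
    finally have "pcompose (q ^ (N - 1 - r) * \<Theta>) (monom 1 N) = 0" by (simp add: pcompose_mult)
    hence "q ^ (N - 1 - r) * \<Theta> = 0" by (rule pcompose_eq_0) (use N in \<open>simp add: degree_monom_eq\<close>)
    hence \<Theta>0: "\<Theta> = 0" using q by simp
    define b where "b = form_at B \<alpha> \<beta>"
    define H where "H = (\<Sum>j\<le>J. g (r + j * N) * (A ^ (J - j) * (cpoly c * B) ^ j))"
    have "hom_poly (r + J * N + e * J) H" unfolding H_def
    proof (rule hom_poly_sum)
      fix j assume "j \<in> {..J}"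
      hence j: "j \<le> J" by simp
      have "hom_poly (r + j * N + ((e + N) * (J - j) + e * j)) (g (r + j * N) * (A ^ (J - j) * (cpoly c * B) ^ j))"
        by (intro hom_poly_mult hom_poly_power hom_poly_cmult hg A B)
      moreover have "r + j * N + ((e + N) * (J - j) + e * j) = r + J * N + e * J"
      proof -
        obtain i where "J = j + i" using j le_Suc_ex by blast
        thus ?thesis by (simp add: algebra_simps)
      qed
      ultimately show "hom_poly (r + J * N + e * J) (g (r + j * N) * (A ^ (J - j) * (cpoly c * B) ^ j))" by simp
    qed
    moreover have "form_at H \<alpha> \<beta> = 0"
    proof -
      have "form_at H \<alpha> \<beta> = (\<Sum>j\<le>J. f (r + j * N) * ((smult c ([:0, 1:] * q ^ N * b)) ^ (J - j) * (smult c b) ^ j))"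
        unfolding H_def form_at_simps form_at_gens f_def rel b_def by simp
      also have "\<dots> = (\<Sum>j\<le>J. (smult c b) ^ J * ([:0, 1:] ^ (J - j) * (f (r + j * N) * q ^ (N * (J - j)))))"
      proof (rule sum.cong)
        fix j assume "j \<in> {..J}"
        hence j: "j \<le> J" by simp
        have "smult c ([:0, 1:] * q ^ N * b) = [:0, 1:] * q ^ N * smult c b" by simp
        hence "(smult c ([:0, 1:] * q ^ N * b)) ^ (J - j) = [:0, 1:] ^ (J - j) * q ^ (N * (J - j)) * (smult c b) ^ (J - j)"
          by (simp only: power_mult_distrib power_mult)
        moreover have "(smult c b) ^ J = (smult c b) ^ (J - j) * (smult c b) ^ j" using j by (simp flip: power_add)
        ultimately show "f (r + j * N) * ((smult c ([:0, 1:] * q ^ N * b)) ^ (J - j) * (smult c b) ^ j)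
            = (smult c b) ^ J * ([:0, 1:] ^ (J - j) * (f (r + j * N) * q ^ (N * (J - j))))"
          by (simp only: mult_ac)
      qed simp
      also have "\<dots> = (smult c b) ^ J * \<Theta>" unfolding \<Theta>_def sum_distrib_left ..
      finally show ?thesis using \<Theta>0 by simp
    qed
    ultimately have H0: "H = 0" by (rule indep)
    have "F dvd A ^ J * g (r + j * N) - g (r + j * N) * (A ^ (J - j) * (cpoly c * B) ^ j)" if "j \<le> J" for j
    proof -
      have "F dvd A ^ j - (cpoly c * B) ^ j"
        unfolding F_def by (cases j) (simp_all only: power_0 diff_self dvd_0_right power_diff_sumr2 dvd_triv_left)
      moreover have "A ^ J * g (r + j * N) - g (r + j * N) * (A ^ (J - j) * (cpoly c * B) ^ j)
          = (g (r + j * N) * A ^ (J - j)) * (A ^ j - (cpoly c * B) ^ j)"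
        using that by (simp add: right_diff_distrib mult_ac flip: power_add)
      ultimately show ?thesis by simp
    qed
    hence "F dvd (\<Sum>j\<le>J. A ^ J * g (r + j * N) - g (r + j * N) * (A ^ (J - j) * (cpoly c * B) ^ j))"
      by (intro dvd_sum) auto
    hence "F dvd A ^ J * (\<Sum>j\<le>J. g (r + j * N)) - H" by (simp add: sum_subtractf sum_distrib_left H_def)
    thus ?thesis unfolding K H0 by (simp add: sum.reindex[OF inj])
  qed
  have "F dvd A ^ J * G"
  proof -
    have "G = (\<Sum>r<N. \<Sum>k\<in>{k. k \<le> M \<and> k mod N = r}. g k)"
    proof -
      have "(\<lambda>k. k mod N) ` {..M} \<subseteq> {..<N}" using N by auto
      thus ?thesis using sum.group[of "{..M}" "{..<N}" "\<lambda>k. k mod N" g] Gsum by simp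
    qed
    hence "A ^ J * G = (\<Sum>r<N. A ^ J * (\<Sum>k\<in>{k. k \<le> M \<and> k mod N = r}. g k))" by (simp add: sum_distrib_left)
    thus ?thesis using residue by (auto intro: dvd_sum)
  qed
  moreover have "coprime F (A ^ J)"
  proof -
    have "coprime F A"
    proof (rule coprimeI)
      fix x assume x: "x dvd F" "x dvd A"
      have "cpoly c * B = A - F" by (simp add: F_def)
      hence "x dvd cpoly c * B" using x by (metis dvd_diff)
      moreover have comp2: "cpoly (1 / c) * cpoly c = 1" using c by (simp add: cpoly_def one_pCons)
      moreover have "B = cpoly (1 / c) * cpoly c * B" using comp2 by simp
      ultimately have "x dvd B" by (metis dvd_mult mult.assoc)
      thus "is_unit x" using cop x coprime_common_divisor by blast
    qed
    thus ?thesis by simp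
  qed
  ultimately show ?thesis unfolding F_def[symmetric] using coprime_dvd_mult_right_iff by blast
qed


section \<open>Homogeneous birational maps on their domain of bijectivity\<close>

definition quot_map :: "real poly poly \<Rightarrow> real poly poly \<Rightarrow> real poly poly \<Rightarrow> real \<times> real \<Rightarrow> real \<times> real" where
  "quot_map a1 a2 b x = (eval_poly a1 x / eval_poly b x, eval_poly a2 x / eval_poly b x)"

lemma quot_map_scale:
  assumes "hom_poly (d + 1) a1" "hom_poly (d + 1) a2" "hom_poly d b" "t \<noteq> 0"
  shows "quot_map a1 a2 b (t *\<^sub>R x) = t *\<^sub>R quot_map a1 a2 b x"
  unfolding quot_map_def hom_eval[OF assms(1)] hom_eval[OF assms(2)] hom_eval[OF assms(3)]
  using assms(4) by simp

lemma eval_form_comp: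
  assumes "hom_poly d G" "eval_poly b x \<noteq> 0"
  shows "eval_poly (subst_poly cpoly G a1 a2) x = eval_poly b x ^ d * eval_poly G (quot_map a1 a2 b x)"
proof -
  have "eval_poly (subst_poly cpoly G a1 a2) x = eval_poly G (eval_poly a1 x, eval_poly a2 x)"
    unfolding eval_poly_def subst_poly_subst[OF ringhom_id(2)] by simp
  also have "(eval_poly a1 x, eval_poly a2 x) = eval_poly b x *\<^sub>R quot_map a1 a2 b x"
    using assms(2) by (simp add: quot_map_def)
  finally show ?thesis unfolding hom_eval[OF assms(1)] .
qed

lemma coprime_forms_no_common_zero:
  assumes "hom_poly d A" "hom_poly e B" "coprime A B" "x \<noteq> (0 :: real \<times> real)"
  shows "eval_poly A x \<noteq> 0 \<or> eval_poly B x \<noteq> 0"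
proof (rule ccontr)
  assume "\<not> ?thesis"
  hence z: "eval_poly A (t *\<^sub>R x) = 0" "eval_poly B (t *\<^sub>R x) = 0" for t
    by (simp_all add: hom_eval[OF assms(1)] hom_eval[OF assms(2)] del: scaleR_Pair)
  have L: "snd x \<noteq> 0 \<or> - fst x \<noteq> 0" using assms(4) by (auto simp: prod_eq_iff)
  let ?L = "cpoly (snd x) * px + cpoly (- fst x) * py"
  have "?L dvd A" "?L dvd B" using line_dvd[OF L assms(4)] z by auto
  hence "is_unit ?L" using assms(3) coprime_common_divisor by blast
  then obtain K where K: "1 = ?L * K" by blast
  have "eval_poly 1 x = eval_poly ?L x * eval_poly K x" unfolding K eval_poly_simps(4) ..
  thus False unfolding eval_linear by (simp add: eval_poly_simps)
qed

text \<open>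
  A homogeneous map \<open>l = (a1, a2) / b\<close> and its inverse \<open>k = (p1, p2) / q\<close>, which are bijections
  between the complements of the zero sets of \<open>D1\<close> and \<open>D2\<close>. On its domain \<open>l\<close> avoids the coordinate
  axes; the orbits of the canonical flows are nondegenerate off the axes.
\<close>

locale hom_birational =
  fixes a1 a2 b p1 p2 q D1 D2 :: "real poly poly" and d f d1 d2 :: nat
  assumes hom_a: "hom_poly (d + 1) a1" "hom_poly (d + 1) a2" "hom_poly d b"
    and hom_p: "hom_poly (f + 1) p1" "hom_poly (f + 1) p2" "hom_poly f q"
    and hom_D: "hom_poly d1 D1" "hom_poly d2 D2"
    and D0: "D1 \<noteq> 0" "D2 \<noteq> 0"
    and dom1: "eval_poly D1 x \<noteq> 0 \<Longrightarrow> eval_poly b x \<noteq> 0 \<and> eval_poly a1 x \<noteq> 0 \<and> eval_poly a2 x \<noteq> 0 \<and>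
        eval_poly D2 (quot_map a1 a2 b x) \<noteq> 0 \<and> quot_map p1 p2 q (quot_map a1 a2 b x) = x"
    and dom2: "eval_poly D2 y \<noteq> 0 \<Longrightarrow> eval_poly q y \<noteq> 0 \<and> eval_poly D1 (quot_map p1 p2 q y) \<noteq> 0 \<and>
        quot_map a1 a2 b (quot_map p1 p2 q y) = y"
begin

abbreviation "l \<equiv> quot_map a1 a2 b"
abbreviation "k \<equiv> quot_map p1 p2 q"

lemma l_scale: "t \<noteq> 0 \<Longrightarrow> l (t *\<^sub>R x) = t *\<^sub>R l x"
  by (rule quot_map_scale[OF hom_a])

lemma k_scale: "t \<noteq> 0 \<Longrightarrow> k (t *\<^sub>R y) = t *\<^sub>R k y"
  by (rule quot_map_scale[OF hom_p])

lemma l_coords: "eval_poly D1 x \<noteq> 0 \<Longrightarrow> fst (l x) \<noteq> 0" "eval_poly D1 x \<noteq> 0 \<Longrightarrow> snd (l x) \<noteq> 0"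
  using dom1[of x] by (auto simp: quot_map_def)

lemma dom1_nonzero: "eval_poly D1 x \<noteq> 0 \<Longrightarrow> x \<noteq> 0"
proof
  assume "eval_poly D1 x \<noteq> 0" "x = 0"
  hence "eval_poly a1 (0 *\<^sub>R x) \<noteq> 0" using dom1[of x] by simp
  thus False unfolding hom_eval[OF hom_a(1)] by simp
qed

text \<open>The image of \<open>k\<close> contains the complement of \<open>D1 = 0\<close>.\<close>

lemma form_comp_eq_0: assumes G: "hom_poly e G" and z: "subst_poly cpoly G p1 p2 = 0" shows "G = 0"
proof (rule eval_poly_eq_0_generic[OF D0(1)])
  fix x assume x: "eval_poly D1 x \<noteq> 0"
  hence y: "eval_poly q (l x) \<noteq> 0" "k (l x) = x" using dom1[OF x] dom2[of "l x"] by auto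
  have "eval_poly q (l x) ^ e * eval_poly G (k (l x)) = 0"
    using eval_form_comp[OF G y(1), of p1 p2] unfolding z by (simp add: eval_poly_simps)
  thus "eval_poly G x = 0" using y by simp
qed

end

text \<open>The orbit map \<open>z \<mapsto> \<phi>\<^sub>N(y z) / z\<close> of the canonical flow.\<close>

definition canonical_orbit :: "nat \<Rightarrow> real \<times> real \<Rightarrow> real \<Rightarrow> real \<times> real" where
  "canonical_orbit N y z = (fst y * (1 + z * snd y) powi (int N - 1), snd y / (1 + z * snd y))"

lemma canonical_orbit_add:
  assumes "1 + z * snd y \<noteq> 0" "1 + (z + w) * snd y \<noteq> 0"
  shows "canonical_orbit N (canonical_orbit N y z) w = canonical_orbit N y (z + w)"
    "1 + w * snd (canonical_orbit N y z) \<noteq> 0"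
proof -
  have e: "1 + w * (snd y / (1 + z * snd y)) = (1 + (z + w) * snd y) / (1 + z * snd y)"
    using assms(1) by (simp add: field_simps)
  show "1 + w * snd (canonical_orbit N y z) \<noteq> 0" unfolding canonical_orbit_def snd_conv e using assms by simp
  have "(1 + z * snd y) powi (int N - 1) * ((1 + (z + w) * snd y) / (1 + z * snd y)) powi (int N - 1)
      = (1 + (z + w) * snd y) powi (int N - 1)"
    using assms(1) by (simp flip: power_int_mult_distrib)
  thus "canonical_orbit N (canonical_orbit N y z) w = canonical_orbit N y (z + w)"
    unfolding canonical_orbit_def fst_conv snd_conv e using assms(1) by (simp add: mult.assoc)
qed

lemma canonical_orbit_scaled:
  assumes "1 + z * snd y \<noteq> 0"
  shows "canonical_orbit N y z = (1 / (1 + z * snd y)) *\<^sub>R (fst y * (1 + z * snd y) ^ N, snd y)"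
  using assms by (simp add: canonical_orbit_def power_int_diff)

text \<open>
  The map \<open>\<phi>\<close> agrees with \<open>k \<circ> \<phi>\<^sub>N \<circ> l\<close> wherever the latter can be computed pointwise inside the two
  domains.
\<close>

locale conj_flow = hom_birational +
  fixes N :: nat and \<phi> :: rat_map
  assumes phi: "eval_poly D1 x \<noteq> 0 \<Longrightarrow> 1 + snd (l x) \<noteq> 0 \<Longrightarrow> eval_poly D2 (canonical_orbit N (l x) 1) \<noteq> 0 \<Longrightarrow>
     map_regular_at \<phi> x \<and> eval_map \<phi> x = k (canonical_orbit N (l x) 1)"
begin

abbreviation "co \<equiv> canonical_orbit N"

definition good :: "real \<times> real \<Rightarrow> real \<Rightarrow> bool" where
  "good y z \<longleftrightarrow> 1 + z * snd y \<noteq> 0 \<and> eval_poly D2 (co y z) \<noteq> 0"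

lemma traj_eq:
  assumes x: "eval_poly D1 x \<noteq> 0" and z: "z \<noteq> 0" and g: "good (l x) z"
  shows "map_regular_at \<phi> (z *\<^sub>R x)" "traj \<phi> x z = k (co (l x) z)"
proof -
  have D: "eval_poly D1 (z *\<^sub>R x) \<noteq> 0" unfolding hom_eval[OF hom_D(1)] using x z by simp
  have l: "l (z *\<^sub>R x) = z *\<^sub>R l x" by (rule l_scale[OF z])
  have c: "co (l (z *\<^sub>R x)) 1 = z *\<^sub>R co (l x) z" unfolding l by (simp add: canonical_orbit_def)
  have "eval_poly D2 (co (l (z *\<^sub>R x)) 1) \<noteq> 0"
    unfolding c hom_eval[OF hom_D(2)] using g z by (simp add: good_def)
  moreover have "1 + snd (l (z *\<^sub>R x)) \<noteq> 0" unfolding l using g by (simp add: good_def)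
  ultimately have "map_regular_at \<phi> (z *\<^sub>R x) \<and> eval_map \<phi> (z *\<^sub>R x) = k (z *\<^sub>R co (l x) z)" using phi[OF D] c by simp
  thus "map_regular_at \<phi> (z *\<^sub>R x)" "traj \<phi> x z = k (co (l x) z)"
    using z by (simp_all add: traj_def k_scale)
qed

lemma finite_bad: assumes "eval_poly D2 y \<noteq> 0" shows "finite {z. \<not> good y z}"
proof -
  define F where "F = [:1, snd y:] * form_at D2 ([:fst y:] * [:1, snd y:] ^ N) [:snd y:]"
  have "good y z" if "poly F z \<noteq> 0" for z
  proof -
    have nz: "1 + z * snd y \<noteq> 0" "eval_poly D2 (fst y * (1 + z * snd y) ^ N, snd y) \<noteq> 0"
    proof -
      have "poly F z = (1 + z * snd y) * eval_poly D2 (fst y * (1 + z * snd y) ^ N, snd y)"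
        unfolding F_def poly_mult poly_form_at by (simp add: mult.commute)
      thus "1 + z * snd y \<noteq> 0" "eval_poly D2 (fst y * (1 + z * snd y) ^ N, snd y) \<noteq> 0" using that by auto
    qed
    have "eval_poly D2 (co y z) \<noteq> 0"
      unfolding canonical_orbit_scaled[OF nz(1)] hom_eval[OF hom_D(2)] using nz by simp
    thus ?thesis using nz by (simp add: good_def)
  qed
  moreover have "F \<noteq> 0"
  proof
    assume "F = 0"
    hence "poly F 0 = 0" by simp
    thus False using assms by (simp add: F_def poly_form_at)
  qed
  ultimately show ?thesis using poly_roots_finite[of F] finite_subset[of "{z. \<not> good y z}" "{z. poly F z = 0}"] by blast
qed

lemma k_good: "good y z \<Longrightarrow> eval_poly D1 (k (co y z)) \<noteq> 0" "good y z \<Longrightarrow> l (k (co y z)) = co y z"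
  using dom2 by (auto simp: good_def)

text \<open>
  With finitely many exceptions on each ray, all values exist, and the translation equation becomes
  the addition law of the canonical orbits.
\<close>

lemma translation: "translation_equation \<phi>"
proof (rule translation_equationI[OF D0(1)])
  fix x assume x: "eval_poly D1 x \<noteq> 0"
  define y where "y = l x"
  have Dy: "eval_poly D2 y \<noteq> 0" unfolding y_def using dom1[OF x] by blast
  have fb: "finite {z. \<not> good y z}" by (rule finite_bad[OF Dy])
  let ?P = "\<lambda>t z. z \<noteq> 0 \<and> map_regular_at \<phi> (t *\<^sub>R x) \<and> map_regular_at \<phi> (z *\<^sub>R t *\<^sub>R x) \<and>
       map_regular_at \<phi> (((1 - z) / z) *\<^sub>R eval_map \<phi> (z *\<^sub>R t *\<^sub>R x)) \<and>
       (1 - z) *\<^sub>R eval_map \<phi> (t *\<^sub>R x) = eval_map \<phi> (((1 - z) / z) *\<^sub>R eval_map \<phi> (z *\<^sub>R t *\<^sub>R x))"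
  have P: "?P t z" if t: "t \<noteq> 0" "good y t" and z: "z \<noteq> 0" "z \<noteq> 1" "good y (z * t)" for t z
  proof -
    have zt: "z * t \<noteq> 0" using z t by simp
    note r1 = traj_eq[OF x t(1), folded y_def, OF t(2)]
    note r2 = traj_eq[OF x zt, folded y_def, OF z(3)]
    define c where "c = k (co y (z * t))"
    have c: "eval_poly D1 c \<noteq> 0" "l c = co y (z * t)" unfolding c_def using k_good[OF z(3)] by blast+
    define w where "w = (1 - z) * t"
    have w: "w \<noteq> 0" "z * t + w = t" using z t by (auto simp: w_def algebra_simps)
    have cw: "co (l c) w = co y t" "1 + w * snd (l c) \<noteq> 0"
      using canonical_orbit_add[of "z * t" y w N] z(3) t(2) unfolding c(2) w(2) by (auto simp: good_def)
    have "good (l c) w" using cw t(2) by (simp add: good_def)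
    note r3 = traj_eq[OF c(1) w(1) this, unfolded cw(1)]
    have e2: "eval_map \<phi> (z *\<^sub>R t *\<^sub>R x) = (z * t) *\<^sub>R c"
      using r2(2) zt unfolding traj_def c_def[symmetric] by (metis (no_types) divide_inverse_commute inverse_eq_divide mult.right_neutral scaleR_scaleR scaleR_one nonzero_mult_div_cancel_left times_divide_eq_right)
    have e3: "((1 - z) / z) *\<^sub>R eval_map \<phi> (z *\<^sub>R t *\<^sub>R x) = w *\<^sub>R c" unfolding e2 w_def using z by simp
    have "eval_map \<phi> (w *\<^sub>R c) = w *\<^sub>R k (co y t)" using r3(2) w(1) unfolding traj_def by (metis divide_self scaleR_one scaleR_scaleR times_divide_eq_right mult.right_neutral)
    also have "k (co y t) = (1 / t) *\<^sub>R eval_map \<phi> (t *\<^sub>R x)" using r1(2) unfolding traj_def by simp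
    also have "w *\<^sub>R (1 / t) *\<^sub>R eval_map \<phi> (t *\<^sub>R x) = (1 - z) *\<^sub>R eval_map \<phi> (t *\<^sub>R x)" unfolding w_def using t by simp
    finally have "(1 - z) *\<^sub>R eval_map \<phi> (t *\<^sub>R x) = eval_map \<phi> (w *\<^sub>R c)" by simp
    thus ?thesis using r1(1) r2(1) r3(1) z unfolding e3 by simp
  qed
  have "infinite {z. ?P t z}" if t: "t \<noteq> 0" "good y t" for t
  proof -
    have "finite ((\<lambda>s. s / t) ` {z. \<not> good y z} \<union> {0, 1})" using fb by simp
    hence "infinite (- ((\<lambda>s. s / t) ` {z. \<not> good y z} \<union> {0, 1}))" using infinite_UNIV_char_0 by (metis finite_compl)
    moreover have "- ((\<lambda>s. s / t) ` {z. \<not> good y z} \<union> {0, 1}) \<subseteq> {z. ?P t z}"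
    proof
      fix z assume z: "z \<in> - ((\<lambda>s. s / t) ` {z. \<not> good y z} \<union> {0, 1})"
      have "good y (z * t)"
      proof (rule ccontr)
        assume "\<not> good y (z * t)"
        hence "(z * t) / t \<in> (\<lambda>s. s / t) ` {z. \<not> good y z}" by blast
        thus False using z t by simp
      qed
      thus "z \<in> {z. ?P t z}" using P[OF t] z by blast
    qed
    ultimately show ?thesis using finite_subset by blast
  qed
  hence "- ({z. \<not> good y z} \<union> {0}) \<subseteq> {t. infinite {z. ?P t z}}" by blast
  moreover have "infinite (- ({z. \<not> good y z} \<union> {0}))" using fb infinite_UNIV_char_0 by (metis finite_Un finite.emptyI finite.insertI finite_compl)
  ultimately show "infinite {t. infinite {z. ?P t z}}" using finite_subset by blast
qed

lemma eval_poly_tendsto: "(g \<longlongrightarrow> y) F \<Longrightarrow> ((\<lambda>z. eval_poly p (g z)) \<longlongrightarrow> eval_poly p y) F"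
  by (induction p rule: polypoly_induct)
     (simp_all only: eval_poly_gens eval_poly_simps tendsto_const tendsto_fst tendsto_snd tendsto_add tendsto_mult)

lemma boundary: assumes x: "eval_poly D1 x \<noteq> 0" shows "boundary_condition_at \<phi> x"
proof -
  define y where "y = l x"
  have Dy: "eval_poly D2 y \<noteq> 0" and kx: "k y = x" unfolding y_def using dom1[OF x] by auto
  have q: "eval_poly q y \<noteq> 0" using dom2[OF Dy] by blast
  have "((\<lambda>z. 1 + z * snd y) \<longlongrightarrow> 1 + 0 * snd y) (at 0)" by (intro tendsto_intros)
  hence "((\<lambda>z. co y z) \<longlongrightarrow> (fst y * 1 powi (int N - 1), snd y / 1)) (at 0)"
    unfolding canonical_orbit_def by (intro tendsto_intros tendsto_power_int) auto
  hence "((\<lambda>z. co y z) \<longlongrightarrow> y) (at 0)" by simp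
  hence "((\<lambda>z. k (co y z)) \<longlongrightarrow> k y) (at 0)"
    unfolding quot_map_def using q by (intro tendsto_Pair tendsto_divide eval_poly_tendsto) auto
  moreover have "eventually (\<lambda>z. k (co y z) = (1 / z) *\<^sub>R eval_map \<phi> (z *\<^sub>R x)) (at 0)"
  proof -
    have "eventually (\<lambda>z. z \<notin> {z. \<not> good y z}) (at 0)"
      using islimpt_finite[OF finite_bad[OF Dy], of 0] unfolding islimpt_iff_eventually by simp
    moreover have "eventually (\<lambda>z::real. z \<noteq> 0) (at 0)" by (simp add: eventually_at_filter)
    ultimately show ?thesis by eventually_elim (use traj_eq(2)[OF x] in \<open>simp add: traj_def y_def\<close>)
  qed
  ultimately show ?thesis unfolding boundary_condition_at_def kx by (rule Lim_transform_eventually)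
qed

lemma traj_inj:
  assumes x: "eval_poly D1 x \<noteq> 0" and z: "good (l x) z" and w: "good (l x) w" and eq: "k (co (l x) z) = k (co (l x) w)"
  shows "z = w"
proof -
  have "co (l x) z = co (l x) w" using arg_cong[OF eq, of l] unfolding k_good(2)[OF z] k_good(2)[OF w] .
  moreover define t where "t = snd (l x)"
  ultimately have eq: "t / (1 + z * t) = t / (1 + w * t)" by (simp add: canonical_orbit_def)
  have t: "t \<noteq> 0" unfolding t_def by (rule l_coords(2)[OF x])
  have "1 + z * t = 1 + w * t" using eq t divide_cancel_left by blast
  thus ?thesis using t by simp
qed

lemma nondegenerate: assumes x: "eval_poly D1 x \<noteq> 0" shows "nondegenerate_at \<phi> x"
proof -
  have Dy: "eval_poly D2 (l x) \<noteq> 0" using dom1[OF x] by auto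
  define Z where "Z = - ({z. \<not> good (l x) z} \<union> {0})"
  have "infinite Z" unfolding Z_def using finite_bad[OF Dy] infinite_UNIV_char_0
    by (metis finite_Un finite.emptyI finite.insertI finite_compl)
  moreover have "inj_on (\<lambda>z. k (co (l x) z)) Z" by (rule inj_onI, rule traj_inj[OF x]) (auto simp: Z_def)
  ultimately have "infinite ((\<lambda>z. k (co (l x) z)) ` Z)" by (simp add: finite_image_iff)
  moreover have "(\<lambda>z. k (co (l x) z)) ` Z \<subseteq> orbit \<phi> x"
    using traj_eq[OF x] unfolding orbit_eq_traj Z_def by force
  ultimately have "infinite (orbit \<phi> x)" using finite_subset by blast
  thus ?thesis using boundary[OF x] by (simp add: nondegenerate_at_def)
qed

lemma is_flow: "flow \<phi>"
  unfolding flow_def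
proof (intro conjI)
  show "generically (boundary_condition_at \<phi>)" unfolding generically_def using D0(1) boundary by blast
  show "\<phi> \<noteq> id_map"
  proof
    assume "\<phi> = id_map"
    hence id: "traj \<phi> x z = x" if "z \<noteq> 0" for x z
      using that eval_rat_eq[OF spec_at_gens(1), of "z *\<^sub>R x"] eval_rat_eq[OF spec_at_gens(2), of "z *\<^sub>R x"]
      by (simp add: traj_def eval_map_def id_map_def)
    obtain x where x: "eval_poly D1 x \<noteq> 0" using generic_point_exists[OF D0(1)] by blast
    have "infinite (orbit \<phi> x)" using nondegenerate[OF x] by (simp add: nondegenerate_at_def)
    moreover have "orbit \<phi> x \<subseteq> {x}" unfolding orbit_eq_traj using id by auto
    ultimately show False using finite_subset by blast
  qed
qed (rule translation)

end

text \<open>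
  At the origin, \<open>\<phi>(a z) / z\<close> is a multiple of \<open>1 / z\<close> and has a limit only if it is zero; the orbit
  is then a single point.
\<close>

lemma boundary_imp_nonzero:
  assumes "nondegenerate_at \<phi> a" shows "a \<noteq> 0"
proof
  assume a: "a = 0"
  have bc: "((\<lambda>z. (1 / z) *\<^sub>R eval_map \<phi> 0) \<longlongrightarrow> 0) (at 0)"
    using assms by (simp add: nondegenerate_at_def boundary_condition_at_def a)
  have "((\<lambda>z. z *\<^sub>R (1 / z) *\<^sub>R eval_map \<phi> 0) \<longlongrightarrow> 0 *\<^sub>R 0) (at (0::real))"
    by (intro tendsto_scaleR tendsto_ident_at bc)
  moreover have "eventually (\<lambda>z::real. z *\<^sub>R (1 / z) *\<^sub>R eval_map \<phi> 0 = eval_map \<phi> 0) (at 0)"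
    by (simp add: eventually_at_filter)
  ultimately have "((\<lambda>z::real. eval_map \<phi> 0) \<longlongrightarrow> 0 *\<^sub>R 0) (at 0)" by (rule Lim_transform_eventually)
  hence "eval_map \<phi> 0 = 0" by (simp add: tendsto_const_iff)
  hence "orbit \<phi> a \<subseteq> {0}" by (auto simp: orbit_def a)
  thus False using assms finite_subset unfolding nondegenerate_at_def by blast
qed

text \<open>The starting point is the limit of the trajectory and thus lies on the same line.\<close>

lemma constant_direction_imp_radial:
  assumes nd: "nondegenerate_at \<phi> a" and fin: "finite {z. \<not> map_regular_at \<phi> (z *\<^sub>R a)}"
    and e: "e \<noteq> 0" and dir: "\<And>z. z \<noteq> 0 \<Longrightarrow> map_regular_at \<phi> (z *\<^sub>R a) \<Longrightarrow> \<exists>r. traj \<phi> a z = r *\<^sub>R e"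
    and z: "z \<noteq> 0" "map_regular_at \<phi> (z *\<^sub>R a)"
  shows "\<exists>r. traj \<phi> a z = r *\<^sub>R a"
proof -
  have a0: "a \<noteq> 0" by (rule boundary_imp_nonzero[OF nd])
  have L: "snd e \<noteq> 0 \<or> - fst e \<noteq> 0" using e by (auto simp: prod_eq_iff)
  have "((\<lambda>z. traj \<phi> a z) \<longlongrightarrow> a) (at 0)" using nd by (simp add: nondegenerate_at_def boundary_condition_at_def traj_def)
  hence "((\<lambda>z. snd e * fst (traj \<phi> a z) - fst e * snd (traj \<phi> a z)) \<longlongrightarrow> snd e * fst a - fst e * snd a) (at 0)"
    by (intro tendsto_intros)
  moreover have "eventually (\<lambda>z. snd e * fst (traj \<phi> a z) - fst e * snd (traj \<phi> a z) = 0) (at 0)"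
  proof -
    have "eventually (\<lambda>z. z \<notin> {z. \<not> map_regular_at \<phi> (z *\<^sub>R a)}) (at 0)"
      using islimpt_finite[OF fin, of 0] unfolding islimpt_iff_eventually by simp
    moreover have "eventually (\<lambda>z::real. z \<noteq> 0) (at 0)" by (simp add: eventually_at_filter)
    ultimately show ?thesis
    proof eventually_elim
      case (elim z)
      then obtain r where "traj \<phi> a z = r *\<^sub>R e" using dir by blast
      thus ?case by simp
    qed
  qed
  ultimately have "((\<lambda>z::real. 0::real) \<longlongrightarrow> snd e * fst a - fst e * snd a) (at 0)" by (rule Lim_transform_eventually)
  hence "snd e * fst a - fst e * snd a = 0" by (metis tendsto_const_iff trivial_limit_at)
  hence "\<exists>t. a = t *\<^sub>R e" using on_line[OF L e, of a] by simp
  then obtain t where t: "a = t *\<^sub>R e" by blast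
  hence "t \<noteq> 0" using a0 by auto
  obtain r where "traj \<phi> a z = r *\<^sub>R e" using dir z by blast
  hence "traj \<phi> a z = (r / t) *\<^sub>R a" using t \<open>t \<noteq> 0\<close> by simp
  thus ?thesis by blast
qed

lemma nondegenerate_curve:
  assumes rep: "rat_map_rep \<phi> P1 P2 Q" and nd: "nondegenerate_at \<phi> a"
  obtains m g \<alpha> \<beta> where "rational_curve m g \<alpha> \<beta>"
    "\<And>z. poly m z \<noteq> 0 \<longleftrightarrow> z \<noteq> 0 \<and> map_regular_at \<phi> (z *\<^sub>R a)"
    "\<And>z. poly m z \<noteq> 0 \<Longrightarrow> traj \<phi> a z = rational_curve.pt m g \<alpha> \<beta> z"
    "finite {z. \<not> map_regular_at \<phi> (z *\<^sub>R a)}"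
proof -
  interpret rat_map_rep \<phi> P1 P2 Q by fact
  have sub: "infinite (traj \<phi> a ` {z. z \<noteq> 0 \<and> map_regular_at \<phi> (z *\<^sub>R a)})"
    using nd unfolding nondegenerate_at_def orbit_eq_traj by simp
  hence "{z. z \<noteq> 0 \<and> map_regular_at \<phi> (z *\<^sub>R a)} \<noteq> {}" by (metis finite.emptyI image_empty)
  then obtain z0 where z0: "map_regular_at \<phi> (z0 *\<^sub>R a)" by blast
  have nz: "ray a P1 \<noteq> 0 \<or> ray a P2 \<noteq> 0"
  proof (rule ccontr)
    assume "\<not> ?thesis"
    hence "traj \<phi> a z = 0" if "z \<noteq> 0" "map_regular_at \<phi> (z *\<^sub>R a)" for z
      using traj_polys[OF that] by (simp add: zero_prod_def)
    hence "traj \<phi> a ` {z. z \<noteq> 0 \<and> map_regular_at \<phi> (z *\<^sub>R a)} \<subseteq> {0}" by auto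
    thus False using sub finite_subset by blast
  qed
  have "poly (ray a Q) z0 \<noteq> 0" using z0 by (simp add: regular_iff poly_ray)
  hence "ray a Q \<noteq> 0" by auto
  hence "finite {z. \<not> map_regular_at \<phi> (z *\<^sub>R a)}"
    using poly_roots_finite[of "ray a Q"] by (simp add: regular_iff poly_ray)
  thus thesis using trajectory_curve[OF z0 nz] that by metis
qed


section \<open>The orbits of a flow of positive level\<close>

lemma infinite_compl_finite: "finite (S :: real set) \<Longrightarrow> infinite (- S)"
  using infinite_UNIV_char_0 by (metis finite_compl)

text \<open>
  Since \<open>A\<close> and \<open>B\<close> are not both zero on a line through the origin, the equation of the level curve
  restricts to a nonzero polynomial in one variable there, and \<open>D\<close> vanishes on finitely many such
  lines.
\<close>

lemma level_curve_meets_lines_finitely: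
  fixes A B D :: "real poly poly"
  assumes A: "hom_poly (e + N) A" and B: "hom_poly e B" and cop: "coprime A B" and N: "N > 0" and c: "c \<noteq> 0"
    and D: "hom_poly n D" "D \<noteq> 0"
  shows "finite {x. eval_poly A x = c * eval_poly B x \<and> eval_poly D x = 0}"
proof -
  define r where "r = form_at D 1 [:0, 1:]"
  have "r \<noteq> 0" unfolding r_def using form_at_eq_0_imp_0[of 1 "[:0, 1:]" n D] D by auto
  define V :: "(real \<times> real) set" where "V = insert (0, 1) ((\<lambda>t. (1, t)) ` {t. poly r t = 0})"
  have finV: "finite V" unfolding V_def using poly_roots_finite[OF \<open>r \<noteq> 0\<close>] by simp
  have V0: "v \<noteq> 0" if "v \<in> V" for v using that by (auto simp: V_def zero_prod_def)
  define R where "R v = ray v (A - cpoly c * B)" for v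
  have R0: "R v \<noteq> 0" if "v \<noteq> 0" for v
  proof
    assume z: "R v = 0"
    have "graded (A - cpoly c * B) = monom A (e + N) - monom (cpoly c * B) e"
      using A hom_poly_cmult[OF B, of c] by (simp add: hom_poly_iff_graded graded_simps)
    hence "coeff (R v) (e + N) = eval_poly A v" "coeff (R v) e = - (c * eval_poly B v)"
      using N unfolding R_def coeff_ray by (auto simp: eval_poly_simps)
    thus False using coprime_forms_no_common_zero[OF A B cop that] z c by auto
  qed
  have "{x. eval_poly A x = c * eval_poly B x \<and> eval_poly D x = 0}
      \<subseteq> (\<Union>v\<in>V. (\<lambda>t. t *\<^sub>R v) ` {t. poly (R v) t = 0})"
  proof
    fix x assume x: "x \<in> {x. eval_poly A x = c * eval_poly B x \<and> eval_poly D x = 0}"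
    obtain t v where tv: "x = t *\<^sub>R v" "v \<in> V"
    proof (cases "fst x = 0")
      case True
      thus thesis using that[of "snd x" "(0, 1)"] by (auto simp: V_def prod_eq_iff)
    next
      case False
      have "eval_poly D (fst x *\<^sub>R (1, snd x / fst x)) = 0" using x False by simp
      hence "eval_poly D (1, snd x / fst x) = 0" unfolding hom_eval[OF D(1)] using False by simp
      hence "(1, snd x / fst x) \<in> V" by (auto simp: V_def r_def poly_form_at)
      thus thesis using that[of "fst x" "(1, snd x / fst x)"] False by (simp add: prod_eq_iff)
    qed
    have "poly (R v) t = 0" using x unfolding tv(1) R_def poly_ray by (simp add: eval_poly_simps)
    thus "x \<in> (\<Union>v\<in>V. (\<lambda>t. t *\<^sub>R v) ` {t. poly (R v) t = 0})" using tv by blast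
  qed
  moreover have "finite (\<Union>v\<in>V. (\<lambda>t. t *\<^sub>R v) ` {t. poly (R v) t = 0})"
    using finV V0 R0 poly_roots_finite by blast
  ultimately show ?thesis by (rule finite_subset)
qed

text \<open>
  The quotient \<open>A / B\<close> is the invariant \<open>x y^(N-1)\<close> of the canonical flow, transported by \<open>l\<close> and
  written in lowest terms.
\<close>

locale conj_level = conj_flow +
  fixes A B :: "real poly poly" and e :: nat
  assumes N: "N > 0" and hom_A: "hom_poly (e + N) A" and hom_B: "hom_poly e B" and cop: "coprime A B" and B0: "B \<noteq> 0"
    and level: "eval_poly D1 x \<noteq> 0 \<Longrightarrow> eval_poly A x = fst (l x) * snd (l x) ^ (N - 1) * eval_poly B x"
begin

lemma AB_nonzero: assumes "eval_poly D1 x \<noteq> 0" shows "eval_poly B x \<noteq> 0" "eval_poly A x \<noteq> 0"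
proof -
  show "eval_poly B x \<noteq> 0"
    using coprime_forms_no_common_zero[OF hom_A hom_B cop dom1_nonzero[OF assms]] level[OF assms] by auto
  thus "eval_poly A x \<noteq> 0" using level[OF assms] l_coords[OF assms] by simp
qed

lemma A0: "A \<noteq> 0"
  using generic_point_exists[OF D0(1)] AB_nonzero(2) by (auto simp: eval_poly_simps)

lemma canonical_invariant:
  assumes "1 + z * snd y \<noteq> 0" shows "fst (co y z) * snd (co y z) ^ (N - 1) = fst y * snd y ^ (N - 1)"
proof -
  have "(1 + z * snd y) powi (int N - 1) = (1 + z * snd y) ^ (N - 1)"
    using N by (cases N) auto
  thus ?thesis using assms by (simp add: canonical_orbit_def power_divide)
qed

text \<open>
  The invariance is known where \<open>\<phi>\<close> is computed through \<open>l\<close> and \<open>k\<close>. As a polynomial identity in the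
  numerators of \<open>\<phi>\<close> it extends to the points where \<open>l\<close> is undefined or degenerate.
\<close>

lemma invariant_map:
  assumes r: "map_regular_at \<phi> x"
  shows "eval_poly A (eval_map \<phi> x) * eval_poly B x = eval_poly B (eval_map \<phi> x) * eval_poly A x"
proof -
  obtain P1 P2 Q where rep: "rat_map_rep \<phi> P1 P2 Q" using rat_map_rep_exists by blast
  interpret rat_map_rep \<phi> P1 P2 Q by fact
  have AP: "eval_poly (subst_poly cpoly A P1 P2) y = eval_poly Q y ^ (e + N) * eval_poly A (eval_map \<phi> y)"
    and BP: "eval_poly (subst_poly cpoly B P1 P2) y = eval_poly Q y ^ e * eval_poly B (eval_map \<phi> y)"
    if "eval_poly Q y \<noteq> 0" for y
    using eval_form_comp[OF hom_A that, of P1 P2] eval_form_comp[OF hom_B that, of P1 P2] eval[OF that]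
    by (simp_all add: quot_map_def)
  define I where "I = subst_poly cpoly A P1 P2 * B - Q ^ N * subst_poly cpoly B P1 P2 * A"
  have Iy: "eval_poly I y = eval_poly Q y ^ (e + N) *
      (eval_poly A (eval_map \<phi> y) * eval_poly B y - eval_poly B (eval_map \<phi> y) * eval_poly A y)" if "eval_poly Q y \<noteq> 0" for y
    unfolding I_def eval_poly_simps AP[OF that] BP[OF that] by (simp add: power_add algebra_simps)
  have "I = 0"
  proof (rule eval_poly_0_of_rays[OF D0(1)])
    fix x assume x: "eval_poly D1 x \<noteq> 0"
    have Dy: "eval_poly D2 (l x) \<noteq> 0" using dom1[OF x] by blast
    have "eval_poly I (z *\<^sub>R x) = 0" if z: "z \<noteq> 0" "good (l x) z" for z
    proof -
      note t = traj_eq[OF x z]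
      have "eval_map \<phi> (z *\<^sub>R x) = z *\<^sub>R traj \<phi> x z" using z(1) by (simp add: traj_def)
      hence e1: "eval_map \<phi> (z *\<^sub>R x) = z *\<^sub>R k (co (l x) z)" unfolding t(2) .
      have lk: "eval_poly A (k (co (l x) z)) = fst (l x) * snd (l x) ^ (N - 1) * eval_poly B (k (co (l x) z))"
      proof -
        have n0: "1 + z * snd (l x) \<noteq> 0" using z(2) unfolding good_def by blast
        show ?thesis using level[OF k_good(1)[OF z(2)]] unfolding k_good(2)[OF z(2)] canonical_invariant[OF n0] .
      qed
      have "eval_poly Q (z *\<^sub>R x) \<noteq> 0" using t(1) regular_iff by blast
      thus ?thesis unfolding Iy[OF \<open>eval_poly Q (z *\<^sub>R x) \<noteq> 0\<close>] e1 hom_eval[OF hom_A] hom_eval[OF hom_B] lk level[OF x]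
        by simp
    qed
    hence "- ({z. \<not> good (l x) z} \<union> {0}) \<subseteq> {z. eval_poly I (z *\<^sub>R x) = 0}" by blast
    moreover have "infinite (- ({z. \<not> good (l x) z} \<union> {0}))"
      by (rule infinite_compl_finite) (use finite_bad[OF Dy] in simp)
    ultimately show "infinite {z. eval_poly I (z *\<^sub>R x) = 0}" using finite_subset by blast
  qed
  moreover have "eval_poly Q x \<noteq> 0" using r regular_iff by blast
  ultimately show ?thesis using Iy[of x] by (simp add: eval_poly_simps)
qed

lemma invariant_traj:
  assumes z: "z \<noteq> 0" and r: "map_regular_at \<phi> (z *\<^sub>R a)"
  shows "eval_poly A (traj \<phi> a z) * eval_poly B a = eval_poly B (traj \<phi> a z) * eval_poly A a"
proof -
  have t: "eval_map \<phi> (z *\<^sub>R a) = z *\<^sub>R traj \<phi> a z" using z by (simp add: traj_def)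
  have "z ^ (e + N) * z ^ e * (eval_poly A (traj \<phi> a z) * eval_poly B a) = z ^ (e + N) * z ^ e * (eval_poly B (traj \<phi> a z) * eval_poly A a)"
    using invariant_map[OF r] unfolding t hom_eval[OF hom_A] hom_eval[OF hom_B] by (simp add: mult_ac)
  thus ?thesis using z by simp
qed

lemma invariant_orbit:
  assumes "x \<in> orbit \<phi> a" shows "eval_poly A x * eval_poly B a = eval_poly B x * eval_poly A a"
proof (cases "x = a")
  case False
  then obtain z where "x = traj \<phi> a z" "z \<noteq> 0" "map_regular_at \<phi> (z *\<^sub>R a)" using assms unfolding orbit_eq_traj by blast
  thus ?thesis using invariant_traj by simp
qed simp

lemma proj_value_orbit:
  assumes a: "a \<noteq> 0" and x: "x \<in> orbit \<phi> a" "x \<noteq> 0"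
  shows "proj_value (Fract A B) x = proj_value (Fract A B) a"
proof -
  note i = invariant_orbit[OF x(1)]
  have na: "eval_poly A a \<noteq> 0 \<or> eval_poly B a \<noteq> 0" and nx: "eval_poly A x \<noteq> 0 \<or> eval_poly B x \<noteq> 0"
    using coprime_forms_no_common_zero[OF hom_A hom_B cop] a x(2) by auto
  show ?thesis
  proof (cases "eval_poly B a = 0")
    case True
    hence "eval_poly B x = 0" using i na by simp
    thus ?thesis using True by (simp add: proj_value_coprime[OF B0 cop])
  next
    case False
    hence "eval_poly B x \<noteq> 0" using i nx by auto
    thus ?thesis using i False by (simp add: proj_value_coprime[OF B0 cop] frac_eq_eq mult.commute)
  qed
qed

text \<open>
  The level curve of the value \<open>c\<close> is parametrised by \<open>s \<mapsto> k(c s^(N-1), 1/s)\<close>: the orbits of the canonical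
  flow are the translates in \<open>z\<close> of such curves, with \<open>s = z + 1/y\<close>.
\<close>

definition lev :: "real \<Rightarrow> real \<Rightarrow> real \<times> real" where
  "lev c s = k (c * s ^ (N - 1), 1 / s)"

context
  fixes c :: real assumes c: "c \<noteq> 0"
begin

text \<open>
  By homogeneity, \<open>lev c s\<close> depends on \<open>s\<close> only through \<open>T = s^N\<close>, up to the factor \<open>1 / s\<close>. The
  following polynomials in \<open>T\<close> are the numerators and denominators of \<open>k\<close>, and the form \<open>D2\<close>, on the
  line \<open>(c T, 1)\<close>.
\<close>

definition "al = form_at p1 [:0, c:] 1"
definition "be = form_at p2 [:0, c:] 1"
definition "qh = form_at q [:0, c:] 1"
definition "dh = form_at D2 [:0, c:] 1"

lemma lev_point: assumes "s \<noteq> 0" shows "(c * s ^ (N - 1), 1 / s) = (1 / s) *\<^sub>R (s ^ N * c, 1)"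
  using assms N by (cases N) auto

lemma lev_eq: assumes s: "s \<noteq> 0"
  shows "lev c s = (1 / (s * poly qh (s ^ N))) *\<^sub>R (poly al (s ^ N), poly be (s ^ N))"
proof -
  have "lev c s = (1 / s) *\<^sub>R k (s ^ N * c, 1)" unfolding lev_def lev_point[OF s] by (rule k_scale) (use s in simp)
  thus ?thesis by (simp add: quot_map_def al_def be_def qh_def poly_form_at)
qed

lemma dom_lev: assumes s: "s \<noteq> 0" and d: "poly dh (s ^ N) \<noteq> 0"
  shows "eval_poly D1 (lev c s) \<noteq> 0" "l (lev c s) = (c * s ^ (N - 1), 1 / s)" "poly qh (s ^ N) \<noteq> 0"
proof -
  have D: "eval_poly D2 (s ^ N * c, 1) \<noteq> 0" using d by (simp add: dh_def poly_form_at)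
  have "eval_poly D2 (c * s ^ (N - 1), 1 / s) \<noteq> 0"
    unfolding lev_point[OF s] hom_eval[OF hom_D(2)] using D s by simp
  from dom2[OF this] show "eval_poly D1 (lev c s) \<noteq> 0" "l (lev c s) = (c * s ^ (N - 1), 1 / s)" unfolding lev_def by blast+
  show "poly qh (s ^ N) \<noteq> 0" using dom2[OF D] by (simp add: qh_def poly_form_at)
qed

lemma coprime_line: "coprime [:0, c:] 1" "degree [:0, c:] > 0 \<or> degree (1 :: real poly) > 0"
  using c by auto

lemma dh0: "dh \<noteq> 0"
  unfolding dh_def using form_at_eq_0_imp_0[OF coprime_line hom_D(2)] D0(2) by blast

lemma dh_pow0: "pcompose dh (monom 1 N) \<noteq> 0"
  using dh0 pcompose_eq_0[of dh "monom 1 N"] N by (auto simp: degree_monom_eq)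

lemma finite_dh: "finite {s. poly dh (s ^ N) = 0}"
  using poly_roots_finite[OF dh_pow0] by (simp add: poly_pcompose poly_monom)

lemma qh0: "qh \<noteq> 0"
proof
  assume z: "qh = 0"
  have "infinite (- ({s. poly dh (s ^ N) = 0} \<union> {0}))" by (rule infinite_compl_finite) (use finite_dh in simp)
  then obtain s where "s \<in> - ({s. poly dh (s ^ N) = 0} \<union> {0})" using infinite_imp_nonempty by blast
  hence "s \<noteq> 0" "poly dh (s ^ N) \<noteq> 0" by auto
  thus False using dom_lev(3) z by simp
qed

lemma lev_level: assumes s: "s \<noteq> 0" and d: "poly dh (s ^ N) \<noteq> 0"
  shows "eval_poly A (lev c s) = c * eval_poly B (lev c s)"
proof -
  have "c * s ^ (N - 1) * (1 / s) ^ (N - 1) = c" using s by (simp add: power_one_over)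
  thus ?thesis using level[OF dom_lev(1)[OF s d]] unfolding dom_lev(2)[OF s d] by simp
qed

lemma lev_indep: assumes G: "hom_poly n G" and z: "form_at G al be = 0" shows "G = 0"
proof (rule form_comp_eq_0[OF G])
  have "form_at (subst_poly cpoly G p1 p2) [:0, c:] 1 = 0"
    unfolding form_at_subst al_def[symmetric] be_def[symmetric] by (rule z)
  thus "subst_poly cpoly G p1 p2 = 0"
    using form_at_eq_0_imp_0[OF coprime_line hom_poly_subst[OF G hom_p(1,2)]] by blast
qed

lemma lev_relation: "form_at A al be = smult c ([:0, 1:] * qh ^ N * form_at B al be)"
proof (rule poly_eqI_all)
  have eq: "poly (form_at A al be) T = poly (smult c ([:0, 1:] * qh ^ N * form_at B al be)) T" if T: "poly dh T \<noteq> 0" for T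
  proof -
    have D: "eval_poly D2 (T * c, 1) \<noteq> 0" using T by (simp add: dh_def poly_form_at)
    note d = dom2[OF D]
    have ab: "(poly al T, poly be T) = poly qh T *\<^sub>R k (T * c, 1)"
      using d by (simp add: al_def be_def qh_def poly_form_at quot_map_def)
    have "eval_poly A (k (T * c, 1)) = T * c * eval_poly B (k (T * c, 1))" using level[of "k (T * c, 1)"] d by simp
    thus ?thesis unfolding poly_smult poly_mult poly_form_at ab hom_eval[OF hom_A] hom_eval[OF hom_B]
      by (simp add: power_add mult_ac)
  qed
  fix T
  have "dh * (form_at A al be - smult c ([:0, 1:] * qh ^ N * form_at B al be)) = 0"
  proof (rule poly_all_0_iff_0[THEN iffD1], rule allI)
    fix T show "poly (dh * (form_at A al be - smult c ([:0, 1:] * qh ^ N * form_at B al be))) T = 0"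
    proof (cases "poly dh T = 0")
      case True
      thus ?thesis by (simp only: poly_mult mult_zero_left)
    next
      case False
      show ?thesis unfolding poly_mult poly_diff eq[OF False, unfolded poly_smult poly_mult] poly_smult by simp
    qed
  qed
  hence "form_at A al be = smult c ([:0, 1:] * qh ^ N * form_at B al be)" using dh0 by simp
  thus "poly (form_at A al be) T = poly (smult c ([:0, 1:] * qh ^ N * form_at B al be)) T" by simp
qed

lemma lev_ideal:
  assumes "infinite {s. s \<noteq> 0 \<and> poly dh (s ^ N) \<noteq> 0 \<and> eval_poly G (lev c s) = 0}"
  shows "A - cpoly c * B dvd G"
proof (rule level_curve_ideal[OF N hom_A hom_B cop B0 c lev_indep qh0 lev_relation])
  show "infinite {s. s \<noteq> 0 \<and> poly qh (s ^ N) \<noteq> 0 \<and>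
       eval_poly G ((1 / (s * poly qh (s ^ N))) *\<^sub>R (poly al (s ^ N), poly be (s ^ N))) = 0}"
  proof (rule infinite_mono[OF assms])
    fix s assume s: "s \<noteq> 0 \<and> poly dh (s ^ N) \<noteq> 0 \<and> eval_poly G (lev c s) = 0"
    thus "s \<noteq> 0 \<and> poly qh (s ^ N) \<noteq> 0 \<and>
       eval_poly G ((1 / (s * poly qh (s ^ N))) *\<^sub>R (poly al (s ^ N), poly be (s ^ N))) = 0"
      using dom_lev(3) by (subst lev_eq[symmetric]) auto
  qed
qed

lemma level_form_nonzero: "A - cpoly c * B \<noteq> 0"
proof
  assume "A - cpoly c * B = 0"
  hence e: "A = cpoly c * B" by simp
  have "hom_poly e A" unfolding e by (rule hom_poly_cmult[OF hom_B])
  thus False using hom_poly_unique[OF hom_A _ A0] N by fastforce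
qed

text \<open>
  The second coordinate of \<open>l\<close> is \<open>1 / s\<close> on the curve, so that \<open>b / a2\<close> recovers the parameter.
\<close>

lemma level_genus: "irreducible (complexify (A - cpoly c * B))" "genus (complexify (A - cpoly c * B)) = 0"
proof -
  define m where "m = monom 1 1 * pcompose (qh * dh) (monom 1 N)"
  define n1 where "n1 = pcompose (al * dh) (monom 1 N)"
  define n2 where "n2 = pcompose (be * dh) (monom 1 N)"
  have mz: "poly m s = s * (poly qh (s ^ N) * poly dh (s ^ N))" for s
    by (simp add: m_def poly_monom poly_pcompose)
  have m0: "m \<noteq> 0"
    unfolding m_def using qh0 dh0 N pcompose_eq_0[of "qh * dh" "monom 1 N"] by (auto simp: degree_monom_eq)
  have cc: "(poly n1 s / poly m s, poly n2 s / poly m s) = lev c s" if "poly m s \<noteq> 0" for s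
    using that lev_eq[of s] by (simp add: mz n1_def n2_def poly_pcompose poly_monom)
  have dom: "s \<noteq> 0 \<and> poly dh (s ^ N) \<noteq> 0" if "poly m s \<noteq> 0" for s using that by (simp add: mz)
  have id: "(\<forall>s. poly m s \<noteq> 0 \<longrightarrow> eval_poly G (poly n1 s / poly m s, poly n2 s / poly m s) = 0) \<longleftrightarrow> A - cpoly c * B dvd G" for G
  proof
    assume G: "\<forall>s. poly m s \<noteq> 0 \<longrightarrow> eval_poly G (poly n1 s / poly m s, poly n2 s / poly m s) = 0"
    have "infinite (- {s. poly m s = 0})" by (rule infinite_compl_finite[OF poly_roots_finite[OF m0]])
    moreover have "- {s. poly m s = 0} \<subseteq> {s. s \<noteq> 0 \<and> poly dh (s ^ N) \<noteq> 0 \<and> eval_poly G (lev c s) = 0}"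
      using G cc dom by auto
    ultimately show "A - cpoly c * B dvd G" using lev_ideal finite_subset by blast
  next
    assume "A - cpoly c * B dvd G"
    then obtain H where H: "G = (A - cpoly c * B) * H" by blast
    have "eval_poly G (lev c s) = 0" if "poly m s \<noteq> 0" for s
      unfolding H eval_poly_simps eval_poly_gens using lev_level dom[OF that] by simp
    thus "\<forall>s. poly m s \<noteq> 0 \<longrightarrow> eval_poly G (poly n1 s / poly m s, poly n2 s / poly m s) = 0" using cc by simp
  qed
  have inv: "eval_poly b (lev c s) = s * eval_poly a2 (lev c s)" if "poly m s \<noteq> 0" for s
  proof -
    have s: "s \<noteq> 0" "poly dh (s ^ N) \<noteq> 0" using dom[OF that] by auto
    have "snd (l (lev c s)) = 1 / s" unfolding dom_lev(2)[OF s] by simp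
    moreover have "eval_poly b (lev c s) \<noteq> 0" using dom1[OF dom_lev(1)[OF s]] by blast
    ultimately show ?thesis using s(1) by (simp add: quot_map_def field_simps)
  qed
  have "infinite (- {s. poly m s = 0})" by (rule infinite_compl_finite[OF poly_roots_finite[OF m0]])
  then obtain s1 where s1: "poly m s1 \<noteq> 0" by (metis (mono_tags, lifting) Compl_iff finite.emptyI mem_Collect_eq ex_in_conv)
  have "eval_poly a2 (lev c s1) \<noteq> 0" using dom1[OF dom_lev(1)] dom[OF s1] by blast
  hence a2: "eval_poly a2 (poly n1 s1 / poly m s1, poly n2 s1 / poly m s1) \<noteq> 0" unfolding cc[OF s1] .
  have inv': "eval_poly b (poly n1 s / poly m s, poly n2 s / poly m s) = s * eval_poly a2 (poly n1 s / poly m s, poly n2 s / poly m s)"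
    if "poly m s \<noteq> 0" for s unfolding cc[OF that] by (rule inv[OF that])
  show "irreducible (complexify (A - cpoly c * B))" "genus (complexify (A - cpoly c * B)) = 0"
    using rational_real_curve_genus_zero[OF m0 level_form_nonzero id inv' s1 a2] by blast+
qed

end

text \<open>
  Along a radial trajectory \<open>a / (1 + k z)\<close> a homogeneous function of degree \<open>N > 0\<close> is proportional
  to \<open>(1 + k z)^(-N)\<close>.
\<close>

lemma level_not_radial:
  assumes nd: "nondegenerate_at \<phi> a" and AB: "eval_poly A a \<noteq> 0" "eval_poly B a \<noteq> 0"
  shows "\<not> (\<forall>z. z \<noteq> 0 \<longrightarrow> map_regular_at \<phi> (z *\<^sub>R a) \<longrightarrow> (\<exists>r. traj \<phi> a z = r *\<^sub>R a))"
proof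
  assume rad: "\<forall>z. z \<noteq> 0 \<longrightarrow> map_regular_at \<phi> (z *\<^sub>R a) \<longrightarrow> (\<exists>r. traj \<phi> a z = r *\<^sub>R a)"
  obtain k' where k': "k' \<noteq> 0"
    and T: "\<And>z. z \<noteq> 0 \<Longrightarrow> map_regular_at \<phi> (z *\<^sub>R a) \<Longrightarrow> 1 + k' * z \<noteq> 0 \<and> traj \<phi> a z = (1 / (1 + k' * z)) *\<^sub>R a"
    and fin: "finite {z. \<not> map_regular_at \<phi> (z *\<^sub>R a)}"
    using radial_trajectory[OF translation _ _ ] nd rad unfolding nondegenerate_at_def by metis
  have "poly ([:1, k':] ^ N - 1) z = 0" if z: "z \<noteq> 0" "map_regular_at \<phi> (z *\<^sub>R a)" for z
  proof -
    define t where "t = 1 / (1 + k' * z)"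
    have t: "t \<noteq> 0" "traj \<phi> a z = t *\<^sub>R a" using T[OF z] by (auto simp: t_def)
    have "t ^ e * (t ^ N * (eval_poly A a * eval_poly B a)) = t ^ e * (eval_poly A a * eval_poly B a)"
      using invariant_traj[OF z] unfolding t(2) hom_eval[OF hom_A] hom_eval[OF hom_B] by (simp add: power_add mult_ac)
    hence "t ^ N = 1" using t(1) AB by simp
    moreover have "(1 + k' * z) ^ N * t ^ N = 1" using T[OF z] by (simp add: t_def power_one_over)
    ultimately show ?thesis by (simp add: mult.commute)
  qed
  hence "- ({z. \<not> map_regular_at \<phi> (z *\<^sub>R a)} \<union> {0}) \<subseteq> {z. poly ([:1, k':] ^ N - 1) z = 0}" by blast
  moreover have "infinite (- ({z. \<not> map_regular_at \<phi> (z *\<^sub>R a)} \<union> {0}))" by (rule infinite_compl_finite) (use fin in simp)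
  ultimately have "infinite {z. poly ([:1, k':] ^ N - 1) z = 0}" using finite_subset by blast
  hence "[:1, k':] ^ N - 1 = 0" by (rule infinite_roots_poly_0)
  hence "degree ([:1, k':] ^ N) = degree (1 :: real poly)" by simp
  thus False using k' N by (simp add: degree_power_eq)
qed

text \<open>
  The point \<open>a\<close> may lie outside the domain of \<open>l\<close>. As a form does not vanish on a trajectory of
  varying direction, some point of the trajectory lies in the domain, and from there the orbit can be
  followed through the canonical flow.
\<close>

lemma orbit_on_lev:
  assumes nd: "nondegenerate_at \<phi> a" and AB: "eval_poly A a \<noteq> 0" "eval_poly B a \<noteq> 0"
  obtains Z \<sigma> where "finite Z" "\<And>z. z \<notin> Z \<Longrightarrow> z \<noteq> 0 \<and> map_regular_at \<phi> (z *\<^sub>R a) \<and> z + \<sigma> \<noteq> 0 \<and> poly (dh (eval_poly A a / eval_poly B a)) ((z + \<sigma>) ^ N) \<noteq> 0 \<and>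
     traj \<phi> a z = lev (eval_poly A a / eval_poly B a) (z + \<sigma>)"
proof -
  define c where "c = eval_poly A a / eval_poly B a"
  have c0: "c \<noteq> 0" using AB by (simp add: c_def)
  obtain P1 P2 Q where rep: "rat_map_rep \<phi> P1 P2 Q" using rat_map_rep_exists by blast
  obtain m g \<alpha> \<beta> where cur: "rational_curve m g \<alpha> \<beta>"
    and m: "\<And>z. poly m z \<noteq> 0 \<longleftrightarrow> z \<noteq> 0 \<and> map_regular_at \<phi> (z *\<^sub>R a)"
    and pt: "\<And>z. poly m z \<noteq> 0 \<Longrightarrow> traj \<phi> a z = rational_curve.pt m g \<alpha> \<beta> z"
    and fin: "finite {z. \<not> map_regular_at \<phi> (z *\<^sub>R a)}"
    using nondegenerate_curve[OF rep nd] by metis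
  interpret cu: rational_curve m g \<alpha> \<beta> by fact
  have nc: "degree \<alpha> > 0 \<or> degree \<beta> > 0"
  proof (rule ccontr)
    assume "\<not> ?thesis"
    then obtain e1 e2 where e: "\<alpha> = [:e1:]" "\<beta> = [:e2:]" "e1 \<noteq> 0 \<or> e2 \<noteq> 0" using cu.constant_direction by (metis gr0I)
    have "\<exists>r. traj \<phi> a z = r *\<^sub>R (e1, e2)" if "z \<noteq> 0" "map_regular_at \<phi> (z *\<^sub>R a)" for z
    proof -
      have "traj \<phi> a z = cu.pt z" using pt m that by blast
      also have "\<dots> = cu.rho z *\<^sub>R (e1, e2)" unfolding cu.pt_def by (simp add: e)
      finally show ?thesis by blast
    qed
    moreover have "(e1, e2) \<noteq> 0" using e(3) by (simp add: zero_prod_def)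
    ultimately show False using constant_direction_imp_radial[OF nd fin] level_not_radial[OF nd AB] by blast
  qed
  have "\<exists>z. poly m z \<noteq> 0 \<and> eval_poly D1 (cu.pt z) \<noteq> 0"
  proof (rule ccontr)
    assume "\<not> ?thesis"
    hence "D1 = 0" using cu.form_vanishing[OF hom_D(1) _ nc] by blast
    thus False using D0 by simp
  qed
  then obtain z1 where z1: "z1 \<noteq> 0" "map_regular_at \<phi> (z1 *\<^sub>R a)" "eval_poly D1 (traj \<phi> a z1) \<noteq> 0"
    using m pt by metis
  define x where "x = traj \<phi> a z1"
  define y where "y = l x"
  have x: "eval_poly D1 x \<noteq> 0" using z1 by (simp add: x_def)
  have Dy: "eval_poly D2 y \<noteq> 0" unfolding y_def using dom1[OF x] by blast
  have y: "fst y \<noteq> 0" "snd y \<noteq> 0" unfolding y_def using l_coords[OF x] by auto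
  have yc: "fst y * snd y ^ (N - 1) = c"
  proof -
    have "fst y * snd y ^ (N - 1) * eval_poly B x * eval_poly B a = eval_poly B x * eval_poly A a"
      using invariant_traj[OF z1(1,2)] level[OF x] by (simp add: x_def y_def)
    thus ?thesis using AB AB_nonzero(1)[OF x] by (simp add: c_def field_simps)
  qed
  define \<sigma> where "\<sigma> = 1 / snd y - z1"
  define Z where "Z = {0, z1, - \<sigma>} \<union> {z. \<not> map_regular_at \<phi> (z *\<^sub>R a)} \<union> (\<lambda>w. z1 + w) ` {w. \<not> good y w}
      \<union> (\<lambda>s. s - \<sigma>) ` {s. poly (dh c) (s ^ N) = 0}"
  have "finite Z" unfolding Z_def using fin finite_bad[OF Dy] finite_dh[OF c0] by simp
  moreover have "z \<noteq> 0 \<and> map_regular_at \<phi> (z *\<^sub>R a) \<and> z + \<sigma> \<noteq> 0 \<and> poly (dh c) ((z + \<sigma>) ^ N) \<noteq> 0 \<and> traj \<phi> a z = lev c (z + \<sigma>)"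
    if zZ: "z \<notin> Z" for z
  proof -
    have z: "z \<noteq> 0" "z \<noteq> z1" "z + \<sigma> \<noteq> 0" "map_regular_at \<phi> (z *\<^sub>R a)" using zZ by (auto simp: Z_def eq_neg_iff_add_eq_0)
    define w where "w = z - z1"
    have w: "w \<noteq> 0" "z1 + w = z" using z by (auto simp: w_def)
    have gw: "good y w"
    proof (rule ccontr)
      assume "\<not> good y w"
      hence "z1 + w \<in> Z" unfolding Z_def by blast
      thus False using zZ w by simp
    qed
    have dz: "poly (dh c) ((z + \<sigma>) ^ N) \<noteq> 0"
    proof
      assume "poly (dh c) ((z + \<sigma>) ^ N) = 0"
      hence "(z + \<sigma>) - \<sigma> \<in> Z" unfolding Z_def by blast
      thus False using zZ by simp
    qed
    note t = traj_eq[OF x w(1), folded y_def, OF gw]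
    have "traj \<phi> a z = traj \<phi> x w"
      using traj_shift[OF translation z1(1) w(1), of a] z1(2) z w t(1) unfolding w(2) x_def by blast
    also have "\<dots> = k (co y w)" by (rule t(2))
    also have "co y w = (c * (z + \<sigma>) ^ (N - 1), 1 / (z + \<sigma>))"
    proof -
      have e: "1 + w * snd y = snd y * (z + \<sigma>)" using y by (simp add: w_def \<sigma>_def field_simps)
      have p: "(snd y * (z + \<sigma>)) powi (int N - 1) = (snd y * (z + \<sigma>)) ^ (N - 1)" using N by (cases N) auto
      show ?thesis unfolding canonical_orbit_def e p yc[symmetric] using y by (simp add: power_mult_distrib)
    qed
    finally show ?thesis using z dz unfolding lev_def by blast
  qed
  ultimately show thesis using that unfolding c_def by blast
qed

text \<open>Up to finitely many points, the orbit, the image of \<open>lev c\<close> and the level curve coincide.\<close>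

lemma orbit_curve:
  assumes nd: "nondegenerate_at \<phi> a" and AB: "eval_poly A a \<noteq> 0" "eval_poly B a \<noteq> 0"
  shows "curve_given_by (orbit \<phi> a) (A - cpoly (eval_poly A a / eval_poly B a) * B)"
proof -
  define c where "c = eval_poly A a / eval_poly B a"
  have c0: "c \<noteq> 0" using AB by (simp add: c_def)
  have Ba: "eval_poly A a = c * eval_poly B a" using AB by (simp add: c_def)
  obtain Z \<sigma> where Z: "finite Z" and T: "\<And>z. z \<notin> Z \<Longrightarrow> z \<noteq> 0 \<and> map_regular_at \<phi> (z *\<^sub>R a) \<and> z + \<sigma> \<noteq> 0 \<and> poly (dh c) ((z + \<sigma>) ^ N) \<noteq> 0 \<and> traj \<phi> a z = lev c (z + \<sigma>)"
    by (rule orbit_on_lev[OF nd AB, folded c_def]) (rule that)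
  have on: "eval_poly A x = c * eval_poly B x" if "x \<in> orbit \<phi> a" for x
    using invariant_orbit[OF that] AB(2) unfolding Ba by simp
  have mem: "lev c s \<in> orbit \<phi> a" if "s - \<sigma> \<notin> Z" for s
  proof -
    have "traj \<phi> a (s - \<sigma>) = lev c s" using T[OF that] by simp
    moreover have "s - \<sigma> \<in> {z. z \<noteq> 0 \<and> map_regular_at \<phi> (z *\<^sub>R a)}" using T[OF that] by blast
    ultimately show ?thesis unfolding orbit_eq_traj by (intro insertI2 image_eqI[of _ _ "s - \<sigma>"]) simp_all
  qed
  let ?F = "A - cpoly c * B"
  have ev: "eval_poly ?F x = eval_poly A x - c * eval_poly B x" for x by (simp only: eval_poly_simps eval_poly_gens)
  have "curve_given_by (orbit \<phi> a) ?F" unfolding curve_given_by_def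
  proof
    show "{G. \<forall>x\<in>orbit \<phi> a. eval_poly G x = 0} = {G. ?F dvd G}"
    proof (intro set_eqI iffI CollectI; elim CollectE)
      fix G assume G: "\<forall>x\<in>orbit \<phi> a. eval_poly G x = 0"
      have "infinite (- Z)" by (rule infinite_compl_finite[OF Z])
      hence "infinite ((\<lambda>z. z + \<sigma>) ` (- Z))" by (subst finite_image_iff) (auto simp: inj_on_def)
      moreover have "(\<lambda>z. z + \<sigma>) ` (- Z) \<subseteq> {s. s \<noteq> 0 \<and> poly (dh c) (s ^ N) \<noteq> 0 \<and> eval_poly G (lev c s) = 0}"
      proof
        fix s assume "s \<in> (\<lambda>z. z + \<sigma>) ` (- Z)"
        then obtain z where z: "s = z + \<sigma>" "z \<notin> Z" by blast
        hence "lev c s \<in> orbit \<phi> a" using mem[of s] by simp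
        thus "s \<in> {s. s \<noteq> 0 \<and> poly (dh c) (s ^ N) \<noteq> 0 \<and> eval_poly G (lev c s) = 0}"
          using T[OF z(2)] G z(1) by simp
      qed
      ultimately show "?F dvd G" using lev_ideal[OF c0] finite_subset by blast
    next
      fix G assume "?F dvd G"
      then obtain H where H: "G = ?F * H" by blast
      show "\<forall>x\<in>orbit \<phi> a. eval_poly G x = 0" unfolding H eval_poly_simps(4) ev using on by simp
    qed
    have "{x. eval_poly ?F x = 0} - orbit \<phi> a \<subseteq> {x. eval_poly A x = c * eval_poly B x \<and> eval_poly D1 x = 0} \<union> (\<lambda>z. lev c (z + \<sigma>)) ` Z"
    proof
      fix x assume x: "x \<in> {x. eval_poly ?F x = 0} - orbit \<phi> a"
      hence lx: "eval_poly A x = c * eval_poly B x" unfolding ev by simp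
      show "x \<in> {x. eval_poly A x = c * eval_poly B x \<and> eval_poly D1 x = 0} \<union> (\<lambda>z. lev c (z + \<sigma>)) ` Z"
      proof (cases "eval_poly D1 x = 0")
        case False
        define s where "s = 1 / snd (l x)"
        have s: "s \<noteq> 0" "snd (l x) = 1 / s" using l_coords[OF False] by (auto simp: s_def)
        have "fst (l x) * snd (l x) ^ (N - 1) = c" using level[OF False] lx AB_nonzero(1)[OF False] by simp
        hence "fst (l x) = c * s ^ (N - 1)" using s by (simp add: power_one_over field_simps)
        hence "l x = (c * s ^ (N - 1), 1 / s)" using s by (simp add: prod_eq_iff)
        moreover have "k (l x) = x" using dom1[OF False] by blast
        ultimately have xs: "x = lev c s" unfolding lev_def by simp
        have "s - \<sigma> \<in> Z" using mem x xs by blast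
        thus ?thesis unfolding xs by force
      qed (use lx in simp)
    qed
    moreover have "finite ({x. eval_poly A x = c * eval_poly B x \<and> eval_poly D1 x = 0} \<union> (\<lambda>z. lev c (z + \<sigma>)) ` Z)"
      using level_curve_meets_lines_finitely[OF hom_A hom_B cop N c0 hom_D(1) D0(1)] Z by simp
    ultimately show "finite ({x. eval_poly ?F x = 0} - orbit \<phi> a)" by (rule finite_subset)
  qed
  thus ?thesis unfolding c_def .
qed

lemma orbit_given:
  assumes nd: "nondegenerate_at \<phi> a" and AB: "eval_poly A a \<noteq> 0" "eval_poly B a \<noteq> 0"
  shows "orbit_given_by \<phi> (Fract A B) a" "algebraic_curve_of_genus_0 (orbit \<phi> a)"
proof -
  define c where "c = eval_poly A a / eval_poly B a"
  have c0: "c \<noteq> 0" using AB by (simp add: c_def)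
  note C = orbit_curve[OF nd AB, folded c_def]
  show "algebraic_curve_of_genus_0 (orbit \<phi> a)"
    unfolding algebraic_curve_of_genus_0_def using C level_genus[OF c0] by blast
  have cc: "cpoly (eval_poly B a) * cpoly c = cpoly (eval_poly A a)" using AB by (simp add: cpoly_def c_def)
  have "cpoly (eval_poly B a) * (A - cpoly c * B) = cpoly (eval_poly B a) * A - cpoly (eval_poly A a) * B"
    unfolding right_diff_distrib mult.assoc[symmetric] cc ..
  hence "curve_given_by (orbit \<phi> a) (cpoly (eval_poly B a) * A - cpoly (eval_poly A a) * B)"
    using curve_given_by_cmult[OF C AB(2)] by simp
  thus "orbit_given_by \<phi> (Fract A B) a" unfolding orbit_given_by_def using B0 cop by blast
qed

text \<open>
  On the exceptional levels \<open>0\<close> and \<open>\<infinity>\<close> a form vanishes along the trajectory, which is therefore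
  radial.
\<close>

lemma orbit_genus:
  assumes nd: "nondegenerate_at \<phi> a" shows "algebraic_curve_of_genus_0 (orbit \<phi> a)"
proof (cases "eval_poly A a = 0 \<or> eval_poly B a = 0")
  case False
  thus ?thesis using orbit_given[OF nd] by blast
next
  case True
  have a0: "a \<noteq> 0" by (rule boundary_imp_nonzero[OF nd])
  note na = coprime_forms_no_common_zero[OF hom_A hom_B cop a0]
  obtain P1 P2 Q where rep: "rat_map_rep \<phi> P1 P2 Q" using rat_map_rep_exists by blast
  obtain m g \<alpha> \<beta> where cur: "rational_curve m g \<alpha> \<beta>"
    and m: "\<And>z. poly m z \<noteq> 0 \<longleftrightarrow> z \<noteq> 0 \<and> map_regular_at \<phi> (z *\<^sub>R a)"
    and pt: "\<And>z. poly m z \<noteq> 0 \<Longrightarrow> traj \<phi> a z = rational_curve.pt m g \<alpha> \<beta> z"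
    and fin: "finite {z. \<not> map_regular_at \<phi> (z *\<^sub>R a)}"
    using nondegenerate_curve[OF rep nd] by metis
  interpret cu: rational_curve m g \<alpha> \<beta> by fact
  have inv: "eval_poly A (cu.pt z) * eval_poly B a = eval_poly B (cu.pt z) * eval_poly A a" if "poly m z \<noteq> 0" for z
    using invariant_traj[of z a] m[of z] that pt[OF that] by simp
  have "degree \<alpha> = 0 \<and> degree \<beta> = 0"
  proof (rule ccontr)
    assume "\<not> ?thesis"
    hence nc: "degree \<alpha> > 0 \<or> degree \<beta> > 0" by auto
    show False
    proof (cases "eval_poly A a = 0")
      case True
      hence "eval_poly A (cu.pt z) = 0" if "poly m z \<noteq> 0" for z using inv[OF that] na by simp
      thus False using cu.form_vanishing[OF hom_A _ nc] A0 by blast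
    next
      case False
      hence "eval_poly B (cu.pt z) = 0" if "poly m z \<noteq> 0" for z using inv[OF that] na True by simp
      thus False using cu.form_vanishing[OF hom_B _ nc] B0 by blast
    qed
  qed
  then obtain e1 e2 where e: "\<alpha> = [:e1:]" "\<beta> = [:e2:]" "e1 \<noteq> 0 \<or> e2 \<noteq> 0" using cu.constant_direction by metis
  have "\<exists>r. traj \<phi> a z = r *\<^sub>R (e1, e2)" if "z \<noteq> 0" "map_regular_at \<phi> (z *\<^sub>R a)" for z
  proof -
    have "traj \<phi> a z = cu.pt z" using pt m that by blast
    also have "\<dots> = cu.rho z *\<^sub>R (e1, e2)" unfolding cu.pt_def by (simp add: e)
    finally show ?thesis by blast
  qed
  moreover have "(e1, e2) \<noteq> 0" using e(3) by (simp add: zero_prod_def)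
  ultimately have rad: "\<exists>r. traj \<phi> a z = r *\<^sub>R a" if "z \<noteq> 0" "map_regular_at \<phi> (z *\<^sub>R a)" for z
    using constant_direction_imp_radial[OF nd fin _ _ that] by blast
  have "snd a \<noteq> 0 \<or> - fst a \<noteq> 0" using a0 by (auto simp: prod_eq_iff)
  moreover have "snd a * fst a + - fst a * snd a = 0" by simp
  ultimately show ?thesis using radial_orbit(2)[OF translation nd rad] by blast
qed

lemma is_orbit_equation: "orbit_equation \<phi> (Fract A B)"
  unfolding orbit_equation_def generically_def
  using proj_value_orbit orbit_given(1)[OF nondegenerate AB_nonzero(2,1)] D0(1) by blast

lemma orbit_given_proj:
  assumes "nondegenerate_at \<phi> a" "proj_value (Fract A B) a \<notin> {Some 0, None}"
  shows "orbit_given_by \<phi> (Fract A B) a"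
  using assms orbit_given(1) by (auto simp: proj_value_coprime[OF B0 cop] split: if_splits)

end


section \<open>Conjugates of the canonical flows\<close>

lemma eval_poly_comp: "eval_poly (subst_poly cpoly G f g) x = eval_poly G (eval_poly f x, eval_poly g x)"
  unfolding eval_poly_def subst_poly_subst[OF ringhom_id(2)] by simp

lemma spec_at_comp_map:
  assumes "spec_at x (fst g) (fst u)" "spec_at x (snd g) (snd u)" "spec_at u (fst f) (fst w)" "spec_at u (snd f) (snd w)"
  shows "spec_at x (fst (comp_map f g)) (fst w)" "spec_at x (snd (comp_map f g)) (snd w)"
  using spec_at_subst_rat(1)[OF assms(1,2), of "fst f" "fst w"] spec_at_subst_rat(1)[OF assms(1,2), of "snd f" "snd w"] assms
  by (simp_all add: comp_map_def)

lemma spec_at_quot_map: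
  assumes "eval_poly b x \<noteq> 0"
  shows "spec_at x (fst (Fract a1 b, Fract a2 b)) (fst (quot_map a1 a2 b x))"
    "spec_at x (snd (Fract a1 b, Fract a2 b)) (snd (quot_map a1 a2 b x))"
  using assms by (simp_all add: quot_map_def spec_at_Fract)

lemma quot_map_inverse:
  assumes "comp_map (Fract p1 q, Fract p2 q) (Fract a1 b, Fract a2 b) = id_map"
    and b: "eval_poly b x \<noteq> 0" and q: "eval_poly q (quot_map a1 a2 b x) \<noteq> 0"
  shows "quot_map p1 p2 q (quot_map a1 a2 b x) = x"
proof -
  note s = spec_at_comp_map[OF spec_at_quot_map[OF b, of a1 a2] spec_at_quot_map[OF q, of p1 p2], unfolded assms(1), unfolded id_map_def, unfolded fst_conv snd_conv]
  show ?thesis by (rule prod_eqI) (rule at.unique[OF s(1) spec_at_gens(1)], rule at.unique[OF s(2) spec_at_gens(2)])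
qed

lemma spec_at_canonical_flow:
  assumes "1 + snd y \<noteq> 0"
  shows "spec_at y (fst (canonical_flow N)) (fst (canonical_orbit N y 1))"
    "spec_at y (snd (canonical_flow N)) (snd (canonical_orbit N y 1))"
proof -
  have s: "spec_at y (Yf + 1) (1 + snd y)" using at.add[OF spec_at_gens(2) at.one] by (simp add: add.commute)
  show "spec_at y (fst (canonical_flow N)) (fst (canonical_orbit N y 1))"
    unfolding canonical_flow_def canonical_orbit_def fst_conv mult_1 by (rule at.mult[OF spec_at_gens(1) at.power_int[OF s]]) (use assms in simp)
  show "spec_at y (snd (canonical_flow N)) (snd (canonical_orbit N y 1))"
    unfolding canonical_flow_def canonical_orbit_def snd_conv mult_1 by (rule at.divide[OF spec_at_gens(2) s assms])
qed

lemma (in hom_birational) conj_flow: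
  "conj_flow a1 a2 b p1 p2 q D1 D2 d f d1 d2 N
     (comp_map (Fract p1 q, Fract p2 q) (comp_map (canonical_flow N) (Fract a1 b, Fract a2 b)))"
proof (unfold_locales, goal_cases)
  case (1 x)
  have b: "eval_poly b x \<noteq> 0" using dom1[OF 1(1)] by blast
  have q: "eval_poly q (canonical_orbit N (l x) 1) \<noteq> 0" using dom2[OF 1(3)] by blast
  note s = spec_at_comp_map[OF spec_at_comp_map[OF spec_at_quot_map[OF b, of a1 a2] spec_at_canonical_flow[OF 1(2)]] spec_at_quot_map[OF q, of p1 p2]]
  show ?case
    using s eval_rat_eq[OF s(1)] eval_rat_eq[OF s(2)] by (auto simp: map_regular_at_def regular_at_iff eval_map_def)
qed

text \<open>
  The form \<open>D1\<close> collects what is needed for \<open>k(l(x))\<close> to be defined and for \<open>l(x)\<close> to avoid the axes,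
  and \<open>D2\<close> requires the same of the point \<open>k(y)\<close>.
\<close>

lemma hom_birationalI:
  assumes hom_a: "hom_poly (d + 1) a1" "hom_poly (d + 1) a2" "hom_poly d b"
    and hom_p: "hom_poly (f + 1) p1" "hom_poly (f + 1) p2" "hom_poly f q"
    and nz: "a1 \<noteq> 0" "a2 \<noteq> 0" "b \<noteq> 0" "subst_poly cpoly q a1 a2 \<noteq> 0"
    and inv1: "\<And>x. eval_poly b x \<noteq> 0 \<Longrightarrow> eval_poly q (quot_map a1 a2 b x) \<noteq> 0 \<Longrightarrow> quot_map p1 p2 q (quot_map a1 a2 b x) = x"
    and inv2: "\<And>y. eval_poly q y \<noteq> 0 \<Longrightarrow> eval_poly b (quot_map p1 p2 q y) \<noteq> 0 \<Longrightarrow> quot_map a1 a2 b (quot_map p1 p2 q y) = y"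
  shows "\<exists>D1 D2 d1 d2. hom_birational a1 a2 b p1 p2 q D1 D2 d f d1 d2"
proof -
  define D1 where "D1 = b * subst_poly cpoly q a1 a2 * (a1 * a2)"
  define d1 where "d1 = d + f * (d + 1) + (d + 1 + (d + 1))"
  define D2 where "D2 = q * subst_poly cpoly D1 p1 p2"
  define d2 where "d2 = f + d1 * (f + 1)"
  have hD1: "hom_poly d1 D1" unfolding D1_def d1_def by (intro hom_poly_mult hom_poly_subst hom_a hom_p)
  have hD2: "hom_poly d2 D2" unfolding D2_def d2_def by (intro hom_poly_mult hom_poly_subst hD1 hom_p)
  have D1: "D1 \<noteq> 0" using nz by (simp add: D1_def)
  have dom1: "eval_poly b x \<noteq> 0 \<and> eval_poly a1 x \<noteq> 0 \<and> eval_poly a2 x \<noteq> 0 \<and>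
      eval_poly D2 (quot_map a1 a2 b x) \<noteq> 0 \<and> quot_map p1 p2 q (quot_map a1 a2 b x) = x" if "eval_poly D1 x \<noteq> 0" for x
  proof -
    have nz: "eval_poly b x \<noteq> 0" "eval_poly a1 x \<noteq> 0" "eval_poly a2 x \<noteq> 0" "eval_poly (subst_poly cpoly q a1 a2) x \<noteq> 0"
      using that by (auto simp: D1_def eval_poly_simps)
    have q: "eval_poly q (quot_map a1 a2 b x) \<noteq> 0"
      using nz(4) unfolding eval_form_comp[OF hom_p(3) nz(1)] by simp
    have "eval_poly D2 (quot_map a1 a2 b x) \<noteq> 0"
      unfolding D2_def eval_poly_simps eval_form_comp[OF hD1 q] inv1[OF nz(1) q] using that q by simp
    thus ?thesis using nz inv1[OF nz(1) q] by blast
  qed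
  have "hom_birational a1 a2 b p1 p2 q D1 D2 d f d1 d2"
  proof
    obtain x where "eval_poly D1 x \<noteq> 0" using generic_point_exists[OF D1] by blast
    thus "D2 \<noteq> 0" using dom1[of x] by (auto simp: eval_poly_simps)
  next
    fix y assume y: "eval_poly D2 y \<noteq> 0"
    have q: "eval_poly q y \<noteq> 0" using y by (auto simp: D2_def eval_poly_simps)
    have D: "eval_poly D1 (quot_map p1 p2 q y) \<noteq> 0"
      using y unfolding D2_def eval_poly_simps eval_form_comp[OF hD1 q] by simp
    show "eval_poly q y \<noteq> 0 \<and> eval_poly D1 (quot_map p1 p2 q y) \<noteq> 0 \<and> quot_map a1 a2 b (quot_map p1 p2 q y) = y"
      using q D inv2[OF q] by (auto simp: D1_def eval_poly_simps)
  qed (use dom1 hom_a hom_p hD1 hD2 D1 in blast)+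
  thus ?thesis by blast
qed

text \<open>
  Substituting \<open>m\<close> into \<open>G(l) = 0\<close> gives \<open>G = 0\<close>. In terms of specializations, \<open>l\<close> has the generic
  point \<open>(x, y)\<close> as its value at \<open>m\<close>.
\<close>

lemma right_inverse_dominant:
  assumes c: "composable l m" "comp_map l m = id_map" and G: "subst_poly constf G (fst l) (snd l) = 0"
  shows "G = 0"
proof -
  interpret s: specialization ratf "\<lambda>p. subst_poly constf p (fst m) (snd m)"
    by (rule specialization_subst[OF ringhom_constf])
  have v: "spec ratf (\<lambda>p. subst_poly constf p (fst m) (snd m)) h (subst_rat constf h (fst m) (snd m))"
    if "substitutable constf h (fst m) (snd m)" for h
    using that subst_rat_eq[OF ringhom_constf] unfolding substitutable_iff subst_val_iff_spec[OF ringhom_constf] by metis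
  have cst: "spec ratf (\<lambda>p. subst_poly constf p (fst m) (snd m)) (constf c) (constf c)" for c
    using s.base[of "cpoly c"] by (simp add: constf_def[symmetric] subst_poly_gens ringhom_constf)
  have "spec ratf (\<lambda>p. subst_poly constf p (fst m) (snd m)) (subst_poly constf G (fst l) (snd l)) (subst_poly constf G Xf Yf)"
    by (rule s.subst_poly[OF ringhom_constf ringhom_constf cst])
       (use c v[of "fst l"] v[of "snd l"] in \<open>auto simp: composable_def comp_map_def id_map_def\<close>)
  moreover have "subst_poly constf G Xf Yf = ratf G" by (rule ratf_eq_subst[symmetric])
  ultimately have "spec ratf (\<lambda>p. subst_poly constf p (fst m) (snd m)) 0 (ratf G)" using G by simp
  moreover have "spec ratf (\<lambda>p. subst_poly constf p (fst m) (snd m)) 0 0"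
    using s.base[of 0] by (simp only: s.h.zero ringhom.zero[OF ringhom_ratf])
  ultimately show ?thesis using s.unique by fastforce
qed

lemma form_of_ratios:
  assumes "hom_poly n G" "b \<noteq> 0"
  shows "subst_poly constf G (Fract a1 b) (Fract a2 b) = ratf (subst_poly cpoly G a1 a2) / ratf b ^ n"
proof -
  have "subst_poly constf G (1 / ratf b * ratf a1) (1 / ratf b * ratf a2) = (1 / ratf b) ^ n * subst_poly constf G (ratf a1) (ratf a2)"
    by (rule hom_subst[OF ringhom_constf assms(1)])
  also have "subst_poly constf G (ratf a1) (ratf a2) = ratf (subst_poly cpoly G a1 a2)"
    by (rule subst_poly_natural[OF ringhom_ratf ringhom_cpoly, symmetric]) (simp add: constf_def)
  finally show ?thesis by (simp add: Fract_eq_ratf power_one_over)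
qed

lemma poly_eq_0_off_0:
  assumes "\<And>t. t \<noteq> 0 \<Longrightarrow> poly p t = (0 :: real)" shows "p = 0"
proof -
  have "[:0, 1:] * p = 0" by (rule poly_all_0_iff_0[THEN iffD1]) (use assms in auto)
  thus ?thesis by simp
qed

lemma map_common_denominator:
  obtains M1 M2 R where "R \<noteq> 0" "m = (Fract M1 R, Fract M2 R :: real rat_fun)"
proof -
  obtain P1 P2 Q where "rat_map_rep m P1 P2 Q" using rat_map_rep_exists by blast
  then interpret rat_map_rep m P1 P2 Q .
  show thesis by (rule that[OF Q0 phi])
qed

text \<open>
  The point is that the inverse is homogeneous as well. Let \<open>m = (M\<^sub>1, M\<^sub>2) / R\<close>. In
  \<open>M\<^sub>i(l) = x\<^sub>i R(l)\<close> the terms of equal degree agree, so that the components of \<open>M\<^sub>i\<close> of degree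
  \<open>k + 1\<close> and the one of \<open>R\<close> of degree \<open>k\<close> represent the same inverse, for every \<open>k\<close> with a nonzero
  component of \<open>R\<close>.
\<close>

lemma hom_birational_of_one_BIR:
  assumes l: "one_BIR l" and inv: "inverse_maps l m"
  obtains a1 a2 b p1 p2 q D1 D2 d f d1 d2 where "hom_birational a1 a2 b p1 p2 q D1 D2 d f d1 d2"
    "l = (Fract a1 b, Fract a2 b)" "m = (Fract p1 q, Fract p2 q)"
proof -
  obtain u v d u' v' d' where *: "hom_poly (1 + d) u" "hom_poly d v" "v \<noteq> 0" "fst l = Fract u v"
    "hom_poly (1 + d') u'" "hom_poly d' v'" "v' \<noteq> 0" "snd l = Fract u' v'"
    using l unfolding one_BIR_def hom_rat_def by blast
  define a1 a2 b where "a1 = u * v'" and "a2 = v * u'" and "b = v * v'"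
  have hom_a: "hom_poly (d + d' + 1) a1" "hom_poly (d + d' + 1) a2" "hom_poly (d + d') b"
    using hom_poly_mult[OF *(1) *(6)] hom_poly_mult[OF *(2) *(5)] hom_poly_mult[OF *(2) *(6)]
    by (simp_all add: a1_def a2_def b_def add_ac)
  have b0: "b \<noteq> 0" using * by (simp add: b_def)
  have l_eq: "l = (Fract a1 b, Fract a2 b)"
    by (rule prod_eqI) (use * in \<open>simp_all add: a1_def a2_def b_def eq_fract mult_ac\<close>)
  have c: "composable l m" "comp_map l m = id_map" "composable m l" "comp_map m l = id_map"
    using inv unfolding inverse_maps_def by blast+
  have dominant: "G = 0" if "hom_poly n G" "subst_poly cpoly G a1 a2 = 0" for n G
    by (rule right_inverse_dominant[OF c(1,2)])
       (use that form_of_ratios[OF that(1) b0, of a1 a2] ringhom.zero[OF ringhom_ratf] in \<open>simp add: l_eq\<close>)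
  have vanish: "G = 0" if van: "\<And>x. eval_poly b x \<noteq> 0 \<Longrightarrow> eval_poly G (quot_map a1 a2 b x) = 0" for G
  proof -
    have "coeff (graded G) j = 0" for j
    proof (rule dominant[OF hom_poly_component], rule eval_poly_eq_0_generic[OF b0])
      fix x assume x: "eval_poly b x \<noteq> 0"
      have "ray (quot_map a1 a2 b x) G = 0"
      proof (rule poly_eq_0_off_0)
        fix t :: real assume t: "t \<noteq> 0"
        have "eval_poly b (t *\<^sub>R x) \<noteq> 0" unfolding hom_eval[OF hom_a(3)] using x t by simp
        from van[OF this] show "poly (ray (quot_map a1 a2 b x) G) t = 0"
          unfolding poly_ray using quot_map_scale[OF hom_a] t by simp
      qed
      hence "eval_poly (coeff (graded G) j) (quot_map a1 a2 b x) = 0" using coeff_ray[of "quot_map a1 a2 b x" G j] by simp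
      thus "eval_poly (subst_poly cpoly (coeff (graded G) j) a1 a2) x = 0"
        unfolding eval_form_comp[OF hom_poly_component x] by simp
    qed
    thus ?thesis using graded_eq_0_iff[of G] by (simp add: poly_eq_iff)
  qed
  obtain M1 M2 R where R0: "R \<noteq> 0" and m_eq: "m = (Fract M1 R, Fract M2 R)" by (rule map_common_denominator)
  have MR: "eval_poly M1 (quot_map a1 a2 b x) = fst x * eval_poly R (quot_map a1 a2 b x)"
    "eval_poly M2 (quot_map a1 a2 b x) = snd x * eval_poly R (quot_map a1 a2 b x)" if x: "eval_poly b x \<noteq> 0" for x
  proof -
    have "subst_poly constf R (fst l) (snd l) \<noteq> 0" using right_inverse_dominant[OF c(1,2)] R0 by blast
    hence e: "subst_poly constf M1 (fst l) (snd l) = Xf * subst_poly constf R (fst l) (snd l)"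
      "subst_poly constf M2 (fst l) (snd l) = Yf * subst_poly constf R (fst l) (snd l)"
      using c(4) subst_rat_eq[OF ringhom_constf subst_val_Fract, of R "fst l" "snd l"]
      by (auto simp: comp_map_def id_map_def m_eq field_simps)
    have s: "spec_at x (subst_poly constf G (fst l) (snd l)) (eval_poly G (quot_map a1 a2 b x))" for G
      using at.subst_poly[OF ringhom_constf ringhom_id(2), of x "fst l" "fst (quot_map a1 a2 b x)" "snd l" "snd (quot_map a1 a2 b x)" G]
        spec_at_constf spec_at_quot_map[OF x, of a1 a2] unfolding eval_poly_def l_eq by simp
    show "eval_poly M1 (quot_map a1 a2 b x) = fst x * eval_poly R (quot_map a1 a2 b x)"
      by (rule at.unique[OF s[of M1, unfolded e(1)] at.mult[OF spec_at_gens(1) s]])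
    show "eval_poly M2 (quot_map a1 a2 b x) = snd x * eval_poly R (quot_map a1 a2 b x)"
      by (rule at.unique[OF s[of M2, unfolded e(2)] at.mult[OF spec_at_gens(2) s]])
  qed
  obtain k where k: "coeff (graded R) k \<noteq> 0" using R0 graded_eq_0_iff[of R] by (metis leading_coeff_0_iff)
  define p1 p2 q where "p1 = coeff (graded M1) (k + 1)" and "p2 = coeff (graded M2) (k + 1)" and "q = coeff (graded R) k"
  have hom_p: "hom_poly (k + 1) p1" "hom_poly (k + 1) p2" "hom_poly k q"
    unfolding p1_def p2_def q_def by (rule hom_poly_component)+
  have component: "eval_poly (coeff (graded M) (k + 1)) (quot_map a1 a2 b x) = \<xi> x * eval_poly q (quot_map a1 a2 b x)"
    if M: "\<And>x. eval_poly b x \<noteq> 0 \<Longrightarrow> eval_poly M (quot_map a1 a2 b x) = \<xi> x * eval_poly R (quot_map a1 a2 b x)"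
      and \<xi>: "\<And>t x. \<xi> (t *\<^sub>R x) = t * \<xi> x" and x: "eval_poly b x \<noteq> 0" for M and \<xi> :: "real \<times> real \<Rightarrow> real" and x
  proof -
    define y where "y = quot_map a1 a2 b x"
    have "ray y M - [:0, \<xi> x:] * ray y R = 0"
    proof (rule poly_eq_0_off_0)
      fix t :: real assume t: "t \<noteq> 0"
      have "eval_poly b (t *\<^sub>R x) \<noteq> 0" unfolding hom_eval[OF hom_a(3)] using x t by simp
      from M[OF this] show "poly (ray y M - [:0, \<xi> x:] * ray y R) t = 0"
        using quot_map_scale[OF hom_a, of t x] t unfolding y_def by (simp add: poly_ray \<xi>)
    qed
    hence "coeff (ray y M) (k + 1) = coeff ([:0, \<xi> x:] * ray y R) (k + 1)" by simp
    thus ?thesis unfolding coeff_ray y_def[symmetric] q_def by (simp add: coeff_ray)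
  qed
  have pq: "eval_poly p1 (quot_map a1 a2 b x) = fst x * eval_poly q (quot_map a1 a2 b x)"
    "eval_poly p2 (quot_map a1 a2 b x) = snd x * eval_poly q (quot_map a1 a2 b x)" if "eval_poly b x \<noteq> 0" for x
    unfolding p1_def p2_def by (rule component[OF MR(1) _ that], assumption, simp, rule component[OF MR(2) _ that], assumption, simp)
  have "M1 * q - p1 * R = 0" "M2 * q - p2 * R = 0"
    by (rule vanish, simp add: eval_poly_simps MR pq)+
  hence m_eq': "m = (Fract p1 q, Fract p2 q)" unfolding m_eq using R0 k by (simp add: eq_fract q_def)
  have "a1 \<noteq> 0" using dominant[OF hom_poly_gens(2)] by (auto simp: subst_poly_gens ringhom_cpoly)
  moreover have "a2 \<noteq> 0" using dominant[OF hom_poly_gens(3)] by (auto simp: subst_poly_gens ringhom_cpoly)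
  moreover have "subst_poly cpoly q a1 a2 \<noteq> 0" using dominant[OF hom_p(3)] k unfolding q_def by blast
  ultimately obtain D1 D2 d1 d2 where "hom_birational a1 a2 b p1 p2 q D1 D2 (d + d') k d1 d2"
    using hom_birationalI[OF hom_a hom_p _ _ b0 _ quot_map_inverse[OF c(4)[unfolded m_eq' l_eq]] quot_map_inverse[OF c(2)[unfolded m_eq' l_eq]]]
    by blast
  thus thesis using that l_eq m_eq' by blast
qed

lemma (in conj_flow) conj_level:
  assumes N: "N > 0" and B: "B \<noteq> 0" and cop: "coprime A B" and W: "Fract A B = Fract (a1 * a2 ^ (N - 1)) (b ^ N)"
  shows "\<exists>e. conj_level a1 a2 b p1 p2 q D1 D2 d f d1 d2 N \<phi> A B e"
proof -
  have b: "b \<noteq> 0"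
  proof
    assume "b = 0"
    obtain x where "eval_poly D1 x \<noteq> 0" using generic_point_exists[OF D0(1)] by blast
    thus False using dom1[of x] \<open>b = 0\<close> by (simp add: eval_poly_simps)
  qed
  have eq: "A * b ^ N = a1 * a2 ^ (N - 1) * B" using W B b by (simp add: eq_fract)
  have h1: "hom_poly (d + 1 + (d + 1) * (N - 1)) (a1 * a2 ^ (N - 1))"
    by (intro hom_poly_mult hom_poly_power hom_a)
  have "d + 1 + (d + 1) * (N - 1) = N + d * N" using N by (cases N) (simp_all add: algebra_simps)
  hence "hom_rat N (Fract A B)"
    unfolding W hom_rat_def using h1 hom_poly_power[OF hom_a(3), of N] b
    by (intro exI[of _ "a1 * a2 ^ (N - 1)"] exI[of _ "b ^ N"] exI[of _ "d * N"]) simp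
  then obtain e where e: "hom_poly (N + e) A" "hom_poly e B" by (rule coprime_hom_representation[OF _ B cop])
  have "eval_poly A x = fst (l x) * snd (l x) ^ (N - 1) * eval_poly B x" if x: "eval_poly D1 x \<noteq> 0" for x
  proof -
    have bx: "eval_poly b x \<noteq> 0" using dom1[OF x] by blast
    have "eval_poly A x * eval_poly b x ^ N = eval_poly a1 x * eval_poly a2 x ^ (N - 1) * eval_poly B x"
      using arg_cong[OF eq, of "\<lambda>p. eval_poly p x"] by (simp add: eval_poly_simps)
    moreover have "eval_poly b x ^ N = eval_poly b x * eval_poly b x ^ (N - 1)" using N by (cases N) auto
    ultimately show ?thesis using bx by (simp add: quot_map_def power_divide field_simps)
  qed
  hence "conj_level a1 a2 b p1 p2 q D1 D2 d f d1 d2 N \<phi> A B e"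
    using N B cop e by unfold_locales (auto simp: add.commute)
  thus ?thesis by blast
qed


section \<open>Flows of level zero\<close>

text \<open>
  For \<open>N = 0\<close> the orbit map of the canonical flow is \<open>y / (1 + z y\<^sub>2)\<close>, and the homogeneity of \<open>k\<close>
  moves the scalar outside. The resulting proportionality is a polynomial identity and extends to all
  points.
\<close>

lemma (in conj_flow) level_0_radial:
  assumes N: "N = 0" and z: "z \<noteq> 0" "map_regular_at \<phi> (z *\<^sub>R a)"
  shows "fst (traj \<phi> a z) * snd a = snd (traj \<phi> a z) * fst a"
proof -
  obtain P1 P2 Q where rep: "rat_map_rep \<phi> P1 P2 Q" using rat_map_rep_exists by blast
  interpret rat_map_rep \<phi> P1 P2 Q by fact
  have "P1 * py - P2 * px = 0"
  proof (rule eval_poly_0_of_rays[OF D0(1)])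
    fix x assume x: "eval_poly D1 x \<noteq> 0"
    have Dy: "eval_poly D2 (l x) \<noteq> 0" using dom1[OF x] by blast
    have "eval_poly (P1 * py - P2 * px) (t *\<^sub>R x) = 0" if t: "t \<noteq> 0" "good (l x) t" for t
    proof -
      note T = traj_eq[OF x t]
      have nz: "1 + t * snd (l x) \<noteq> 0" using t(2) unfolding good_def by blast
      have "co (l x) t = (1 / (1 + t * snd (l x))) *\<^sub>R l x"
        unfolding canonical_orbit_scaled[OF nz] using N by simp
      hence "traj \<phi> x t = (1 / (1 + t * snd (l x))) *\<^sub>R x"
        unfolding T(2) using k_scale[of "1 / (1 + t * snd (l x))" "l x"] nz dom1[OF x] by simp
      moreover have "eval_map \<phi> (t *\<^sub>R x) = t *\<^sub>R traj \<phi> x t" using t(1) by (simp add: traj_def)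
      ultimately have e: "eval_map \<phi> (t *\<^sub>R x) = (1 / (1 + t * snd (l x))) *\<^sub>R (t *\<^sub>R x)" by simp
      have Q: "eval_poly Q (t *\<^sub>R x) \<noteq> 0" using T(1) regular_iff by blast
      define r where "r = 1 / (1 + t * snd (l x))"
      have "eval_poly P1 (t *\<^sub>R x) = eval_poly Q (t *\<^sub>R x) * r * (t * fst x)" "eval_poly P2 (t *\<^sub>R x) = eval_poly Q (t *\<^sub>R x) * r * (t * snd x)"
        using e Q unfolding eval[OF Q] r_def[symmetric] by (auto simp: prod_eq_iff field_simps)
      thus ?thesis unfolding eval_poly_simps eval_poly_gens by simp
    qed
    hence "- ({t. \<not> good (l x) t} \<union> {0}) \<subseteq> {t. eval_poly (P1 * py - P2 * px) (t *\<^sub>R x) = 0}" by blast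
    moreover have "infinite (- ({t. \<not> good (l x) t} \<union> {0}))"
      by (rule infinite_compl_finite) (use finite_bad[OF Dy] in simp)
    ultimately show "infinite {t. eval_poly (P1 * py - P2 * px) (t *\<^sub>R x) = 0}" using finite_subset by blast
  qed
  hence "eval_poly (P1 * py - P2 * px) (z *\<^sub>R a) = 0" by (simp only: eval_poly_simps)
  hence "eval_poly P1 (z *\<^sub>R a) * (z * snd a) = eval_poly P2 (z *\<^sub>R a) * (z * fst a)"
    unfolding eval_poly_simps eval_poly_gens by simp
  moreover have "eval_poly Q (z *\<^sub>R a) \<noteq> 0" using z regular_iff by blast
  ultimately show ?thesis using z(1) by (simp add: traj_def eval field_simps)
qed

lemma coprime_linear_forms:
  assumes det: "\<alpha>1 * \<beta>2 - \<alpha>2 * \<beta>1 \<noteq> (0 :: real)"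
  shows "coprime (cpoly \<alpha>1 * px + cpoly \<alpha>2 * py) (cpoly \<beta>1 * px + cpoly \<beta>2 * py)"
proof (rule coprimeI)
  let ?A = "cpoly \<alpha>1 * px + cpoly \<alpha>2 * py" and ?B = "cpoly \<beta>1 * px + cpoly \<beta>2 * py"
  define \<delta> where "\<delta> = \<alpha>1 * \<beta>2 - \<alpha>2 * \<beta>1"
  have \<delta>: "\<delta> \<noteq> 0" using det by (simp add: \<delta>_def)
  fix c assume c: "c dvd ?A" "c dvd ?B"
  have "fst a = \<beta>2 / \<delta> * (\<alpha>1 * fst a + \<alpha>2 * snd a) - \<alpha>2 / \<delta> * (\<beta>1 * fst a + \<beta>2 * snd a)"
    "snd a = \<alpha>1 / \<delta> * (\<beta>1 * fst a + \<beta>2 * snd a) - \<beta>1 / \<delta> * (\<alpha>1 * fst a + \<alpha>2 * snd a)" for a :: "real \<times> real"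
    using \<delta> by (simp_all add: field_simps) (simp_all add: \<delta>_def algebra_simps)
  hence "px = cpoly (\<beta>2 / \<delta>) * ?A - cpoly (\<alpha>2 / \<delta>) * ?B" "py = cpoly (\<alpha>1 / \<delta>) * ?B - cpoly (\<beta>1 / \<delta>) * ?A"
    by (rule_tac eval_poly_eqI, simp only: eval_poly_simps eval_poly_gens)+
  hence "c dvd px" "c dvd py" using c by (metis dvd_diff dvd_mult)+
  thus "is_unit c" using coprime_px_py coprime_common_divisor by blast
qed

text \<open>
  The level sets of a quotient of two independent linear forms are the lines through the origin.
\<close>

lemma (in conj_flow) level_0_orbits:
  assumes N: "N = 0" and det: "\<alpha>1 * \<beta>2 - \<alpha>2 * \<beta>1 \<noteq> 0"
  defines "A \<equiv> cpoly \<alpha>1 * px + cpoly \<alpha>2 * py" and "B \<equiv> cpoly \<beta>1 * px + cpoly \<beta>2 * py"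
  shows "orbit_equation \<phi> (Fract A B)"
    "\<And>a. nondegenerate_at \<phi> a \<Longrightarrow> algebraic_curve_of_genus_0 (orbit \<phi> a) \<and> orbit_given_by \<phi> (Fract A B) a"
proof -
  have cop: "coprime A B" unfolding A_def B_def by (rule coprime_linear_forms[OF det])
  have B0: "B \<noteq> 0" using det unfolding B_def linear_form_eq_0_iff by auto
  have hom: "hom_poly 1 A" "hom_poly 1 B" unfolding A_def B_def by (rule hom_linear)+
  have rad: "\<exists>r. traj \<phi> a z = r *\<^sub>R a" if "z \<noteq> 0" "map_regular_at \<phi> (z *\<^sub>R a)" "a \<noteq> 0" for a z
  proof (rule on_line[of "snd a" "- fst a"])
    show "snd a \<noteq> 0 \<or> - fst a \<noteq> 0" using that(3) by (auto simp: prod_eq_iff)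
    show "snd a * fst (traj \<phi> a z) + - fst a * snd (traj \<phi> a z) = 0"
      using level_0_radial[OF N that(1,2)] by (simp add: mult.commute)
  qed (use that in auto)
  show given: "algebraic_curve_of_genus_0 (orbit \<phi> a) \<and> orbit_given_by \<phi> (Fract A B) a" if nd: "nondegenerate_at \<phi> a" for a
  proof -
    have a0: "a \<noteq> 0" by (rule boundary_imp_nonzero[OF nd])
    define p q where "p = eval_poly B a * \<alpha>1 - eval_poly A a * \<beta>1" and "q = eval_poly B a * \<alpha>2 - eval_poly A a * \<beta>2"
    have line: "p * fst a + q * snd a = 0" unfolding p_def q_def A_def B_def eval_linear by (simp add: algebra_simps)
    have pq: "p \<noteq> 0 \<or> q \<noteq> 0"
    proof (rule ccontr)
      assume "\<not> ?thesis"
      hence "p = 0" "q = 0" by auto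
      moreover have "p * \<beta>2 - q * \<beta>1 = eval_poly B a * (\<alpha>1 * \<beta>2 - \<alpha>2 * \<beta>1)"
        "p * \<alpha>2 - q * \<alpha>1 = eval_poly A a * (\<alpha>1 * \<beta>2 - \<alpha>2 * \<beta>1)"
        by (simp_all add: p_def q_def algebra_simps)
      ultimately have "eval_poly A a = 0" "eval_poly B a = 0" using det by auto
      thus False using coprime_forms_no_common_zero[OF hom cop a0] by blast
    qed
    have "cpoly (eval_poly B a) * A - cpoly (eval_poly A a) * B = cpoly p * px + cpoly q * py"
      by (rule eval_poly_eqI) (simp only: A_def B_def p_def q_def eval_poly_simps eval_poly_gens, simp add: algebra_simps)
    thus ?thesis
      using radial_orbit[OF translation nd rad[OF _ _ a0] pq line] B0 cop unfolding orbit_given_by_def by metis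
  qed
  have "proj_value (Fract A B) y = proj_value (Fract A B) a" if a: "a \<noteq> 0" and y: "y \<in> orbit \<phi> a" "y \<noteq> 0" for a y
  proof -
    have "\<exists>r. y = r *\<^sub>R a"
    proof (cases "y = a")
      case True
      thus ?thesis by (intro exI[of _ 1]) simp
    next
      case False
      thus ?thesis using y(1) rad[OF _ _ a] unfolding orbit_eq_traj by blast
    qed
    then obtain r where r: "y = r *\<^sub>R a" by blast
    hence "r \<noteq> 0" using y(2) by auto
    thus ?thesis unfolding proj_value_coprime[OF B0 cop] r hom_eval[OF hom(1)] hom_eval[OF hom(2)] by simp
  qed
  thus "orbit_equation \<phi> (Fract A B)"
    unfolding orbit_equation_def generically_def using given nondegenerate D0(1) by blast
qed


section \<open>A flow for every equation in normal form\<close>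

text \<open>
  Let \<open>l(x) = (P/Q)(x) L(x)\<close>. The function \<open>P/Q\<close> has degree zero, so that it takes the same value at
  \<open>x\<close> and at \<open>L\<^sup>-\<^sup>1(l(x))\<close>, and the scalar factor can be undone.
\<close>

lemma hom_birational_of_form:
  assumes P: "hom_poly n P" "P \<noteq> 0" and Q: "hom_poly n Q" "Q \<noteq> 0" and det: "a * d - b * c \<noteq> 0"
  defines "L1 \<equiv> cpoly a * px + cpoly b * py" and "L2 \<equiv> cpoly c * px + cpoly d * py"
  obtains p1 p2 q D1 D2 d1 d2 where "hom_birational (P * L1) (P * L2) Q p1 p2 q D1 D2 n n d1 d2"
proof -
  let ?\<delta> = "a * d - b * c"
  define M1 M2 where "M1 = cpoly (d / ?\<delta>) * px + cpoly (- b / ?\<delta>) * py" and "M2 = cpoly (- c / ?\<delta>) * px + cpoly (a / ?\<delta>) * py"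
  define M where "M y = (eval_poly M1 y, eval_poly M2 y)" for y
  define L where "L x = (eval_poly L1 x, eval_poly L2 x)" for x
  have M_scale: "M (r *\<^sub>R y) = r *\<^sub>R M y" for r y unfolding M_def M1_def M2_def eval_linear by (simp add: algebra_simps)
  have L_scale: "L (r *\<^sub>R y) = r *\<^sub>R L y" for r y unfolding L_def L1_def L2_def eval_linear by (simp add: algebra_simps)
  have M_L: "M (L x) = x" for x
  proof (rule prod_eqI)
    have "fst (M (L x)) = fst x * ?\<delta> / ?\<delta>" "snd (M (L x)) = snd x * ?\<delta> / ?\<delta>"
      unfolding M_def L_def M1_def M2_def L1_def L2_def eval_linear fst_conv snd_conv
      by (simp_all add: algebra_simps flip: diff_divide_distrib add_divide_distrib)
    thus "fst (M (L x)) = fst x" "snd (M (L x)) = snd x" using det by simp_all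
  qed
  have L_M: "L (M x) = x" for x
  proof (rule prod_eqI)
    have "fst (L (M x)) = fst x * ?\<delta> / ?\<delta>" "snd (L (M x)) = snd x * ?\<delta> / ?\<delta>"
      unfolding M_def L_def M1_def M2_def L1_def L2_def eval_linear fst_conv snd_conv
      by (simp_all add: algebra_simps flip: diff_divide_distrib add_divide_distrib)
    thus "fst (L (M x)) = fst x" "snd (L (M x)) = snd x" using det by simp_all
  qed
  define P' Q' where "P' = subst_poly cpoly P M1 M2" and "Q' = subst_poly cpoly Q M1 M2"
  have PQ': "eval_poly P' y = eval_poly P (M y)" "eval_poly Q' y = eval_poly Q (M y)" for y
    unfolding P'_def Q'_def M_def by (rule eval_poly_comp)+
  have hom_M: "hom_poly 1 M1" "hom_poly 1 M2" unfolding M1_def M2_def by (rule hom_linear)+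
  have hom_L: "hom_poly 1 L1" "hom_poly 1 L2" unfolding L1_def L2_def by (rule hom_linear)+
  have hom': "hom_poly n P'" "hom_poly n Q'"
    using hom_poly_subst[OF P(1) hom_M] hom_poly_subst[OF Q(1) hom_M] by (simp_all add: P'_def Q'_def)
  have k: "quot_map (Q' * M1) (Q' * M2) P' y = (eval_poly Q (M y) / eval_poly P (M y)) *\<^sub>R M y" for y
    by (simp add: quot_map_def eval_poly_simps PQ') (simp add: M_def)
  have l: "quot_map (P * L1) (P * L2) Q x = (eval_poly P x / eval_poly Q x) *\<^sub>R L x" for x
    by (simp add: quot_map_def eval_poly_simps L_def)
  have P'l: "eval_poly P' (quot_map (P * L1) (P * L2) Q x) = (eval_poly P x / eval_poly Q x) ^ n * eval_poly P x" for x
    unfolding PQ' l M_scale M_L hom_eval[OF P(1)] ..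
  have "\<exists>D1 D2 d1 d2. hom_birational (P * L1) (P * L2) Q (Q' * M1) (Q' * M2) P' D1 D2 n n d1 d2"
  proof (rule hom_birationalI)
    have L0: "L1 \<noteq> 0" "L2 \<noteq> 0" using det unfolding L1_def L2_def linear_form_eq_0_iff by auto
    thus "P * L1 \<noteq> 0" "P * L2 \<noteq> 0" using P by auto
    have "P * Q \<noteq> 0" using P Q by simp
    then obtain x where "eval_poly (P * Q) x \<noteq> 0" using generic_point_exists by blast
    hence x: "eval_poly P x \<noteq> 0" "eval_poly Q x \<noteq> 0" by (auto simp: eval_poly_simps)
    show "subst_poly cpoly P' (P * L1) (P * L2) \<noteq> 0"
    proof
      assume "subst_poly cpoly P' (P * L1) (P * L2) = 0"
      hence "eval_poly (subst_poly cpoly P' (P * L1) (P * L2)) x = 0" by (simp add: eval_poly_simps)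
      thus False unfolding eval_form_comp[OF hom'(1) x(2)] P'l using x by simp
    qed
  next
    fix x assume x: "eval_poly Q x \<noteq> 0" "eval_poly P' (quot_map (P * L1) (P * L2) Q x) \<noteq> 0"
    define r where "r = eval_poly P x / eval_poly Q x"
    have Px: "eval_poly P x \<noteq> 0" using x(2) unfolding P'l by simp
    hence r: "r \<noteq> 0" using x(1) by (simp add: r_def)
    show "quot_map (Q' * M1) (Q' * M2) P' (quot_map (P * L1) (P * L2) Q x) = x"
      unfolding k l r_def[symmetric] M_scale M_L hom_eval[OF P(1)] hom_eval[OF Q(1)] using r Px x(1) by (simp add: r_def)
  next
    fix y assume y: "eval_poly P' y \<noteq> 0" "eval_poly Q (quot_map (Q' * M1) (Q' * M2) P' y) \<noteq> 0"
    define t where "t = eval_poly Q (M y) / eval_poly P (M y)"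
    have Py: "eval_poly P (M y) \<noteq> 0" using y(1) unfolding PQ' .
    have Qy: "eval_poly Q (M y) \<noteq> 0" using y(2) unfolding k hom_eval[OF Q(1)] by simp
    hence t: "t \<noteq> 0" using Py by (simp add: t_def)
    show "quot_map (P * L1) (P * L2) Q (quot_map (Q' * M1) (Q' * M2) P' y) = y"
      unfolding k l t_def[symmetric] L_scale L_M hom_eval[OF P(1)] hom_eval[OF Q(1)] using t Py Qy by (simp add: t_def)
  qed (use hom_poly_mult[OF P(1) hom_L(1)] hom_poly_mult[OF P(1) hom_L(2)] hom_poly_mult[OF hom'(2) hom_M(1)]
     hom_poly_mult[OF hom'(2) hom_M(2)] hom' P Q in simp_all)
  thus thesis using that by blast
qed

text \<open>The required flow is the conjugate of the canonical flow by \<open>(P/Q) L\<close>.\<close>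

lemma form_imp_orbit_equation:
  assumes "orbit_equation_form N W" shows "\<exists>\<phi>. flow \<phi> \<and> orbit_equation \<phi> W"
proof -
  obtain P Q n a b c d where P: "hom_poly n P" "P \<noteq> 0" and Q: "hom_poly n Q" "Q \<noteq> 0" and det: "a * d - b * c \<noteq> 0"
    and W: "W = ratf P ^ N / ratf Q ^ N * subst_rat constf (Xf * Yf powi (int N - 1))
        (constf a * Xf + constf b * Yf) (constf c * Xf + constf d * Yf)"
    using assms unfolding orbit_equation_form_def by blast
  define L1 L2 where "L1 = cpoly a * px + cpoly b * py" and "L2 = cpoly c * px + cpoly d * py"
  have L2: "L2 \<noteq> 0" using det unfolding L2_def linear_form_eq_0_iff by auto
  have W': "W = ratf P ^ N / ratf Q ^ N * (ratf L1 * ratf L2 powi (int N - 1))"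
    unfolding W L1_def L2_def ratf_linear
    by (subst subst_linear_monomial) (use L2 in \<open>auto simp: L2_def ratf_linear[symmetric] simp del: ratf_eq_0_iff simp: ratf_eq_0_iff\<close>)
  obtain p1 p2 q D1 D2 d1 d2 where "hom_birational (P * L1) (P * L2) Q p1 p2 q D1 D2 n n d1 d2"
    unfolding L1_def L2_def by (rule hom_birational_of_form[OF P Q det])
  then interpret hom_birational "P * L1" "P * L2" Q p1 p2 q D1 D2 n n d1 d2 .
  obtain \<phi> where "conj_flow (P * L1) (P * L2) Q p1 p2 q D1 D2 n n d1 d2 N \<phi>" using conj_flow by blast
  then interpret conj_flow "P * L1" "P * L2" Q p1 p2 q D1 D2 n n d1 d2 N \<phi> .
  have "orbit_equation \<phi> W"
  proof (cases "N = 0")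
    case True
    have "W = Fract L1 L2" unfolding W' Fract_eq_ratf by (simp add: True power_int_minus divide_inverse)
    thus ?thesis using level_0_orbits(1)[OF True det] unfolding L1_def L2_def by simp
  next
    case False
    obtain A B where AB: "B \<noteq> 0" "coprime A B" "W = Fract A B" by (rule rat_fun_coprime)
    have e: "int N - 1 = int (N - 1)" using False by simp
    have s: "P ^ N * (L1 * L2 ^ (N - 1)) = P * L1 * (P * L2) ^ (N - 1)"
      using False by (cases N) (simp_all add: power_mult_distrib mult_ac)
    have "W = ratf (P ^ N * (L1 * L2 ^ (N - 1))) / ratf (Q ^ N)"
      unfolding W' e power_int_of_nat by (simp add: ringhom.hom_simps[OF ringhom_ratf])
    hence "Fract A B = Fract (P * L1 * (P * L2) ^ (N - 1)) (Q ^ N)" unfolding AB(3) s Fract_eq_ratf .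
    then obtain e where "conj_level (P * L1) (P * L2) Q p1 p2 q D1 D2 n n d1 d2 N \<phi> A B e"
      using conj_level[OF _ AB(1,2)] False by blast
    then interpret conj_level "P * L1" "P * L2" Q p1 p2 q D1 D2 n n d1 d2 N \<phi> A B e .
    show ?thesis unfolding AB(3) by (rule is_orbit_equation)
  qed
  thus ?thesis using is_flow by blast
qed


section \<open>Orbits of flows and their equations\<close>

lemma orbit_equation_of_level:
  assumes "has_level \<phi> N"
  shows "\<exists>W. hom_rat N W \<and> orbit_equation \<phi> W \<and>
    (\<forall>a. nondegenerate_at \<phi> a \<longrightarrow> algebraic_curve_of_genus_0 (orbit \<phi> a) \<and>
      (N = 0 \<or> proj_value W a \<notin> {Some 0, None} \<longrightarrow> orbit_given_by \<phi> W a))"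
proof -
  obtain l m where lm: "one_BIR l" "inverse_maps l m" and \<phi>: "\<phi> = comp_map m (comp_map (canonical_flow N) l)"
    using assms unfolding has_level_def by blast
  obtain a1 a2 b p1 p2 q D1 D2 d f d1 d2 where "hom_birational a1 a2 b p1 p2 q D1 D2 d f d1 d2"
    and l: "l = (Fract a1 b, Fract a2 b)" and m: "m = (Fract p1 q, Fract p2 q)"
    by (rule hom_birational_of_one_BIR[OF lm])
  then interpret hom_birational a1 a2 b p1 p2 q D1 D2 d f d1 d2 by blast
  interpret conj_flow a1 a2 b p1 p2 q D1 D2 d f d1 d2 N \<phi> unfolding \<phi> l m by (rule conj_flow)
  show ?thesis
  proof (cases "N = 0")
    case True
    define A B :: "real poly poly" where "A = cpoly 1 * px + cpoly 0 * py" and "B = cpoly 0 * px + cpoly 1 * py"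
    have "B \<noteq> 0" unfolding B_def linear_form_eq_0_iff by simp
    hence "hom_rat 0 (Fract A B)"
      unfolding hom_rat_def using hom_linear[of 1 0] hom_linear[of 0 1] unfolding A_def B_def
      by (intro exI[of _ A] exI[of _ B] exI[of _ 1]) (simp add: A_def B_def)
    thus ?thesis
      using level_0_orbits[OF True, of 1 1 0 0, folded A_def B_def] True by (intro exI[of _ "Fract A B"]) simp
  next
    case False
    obtain A B where AB: "B \<noteq> 0" "coprime A B" "Fract (a1 * a2 ^ (N - 1)) (b ^ N) = Fract A B" by (rule rat_fun_coprime)
    then obtain e where "conj_level a1 a2 b p1 p2 q D1 D2 d f d1 d2 N \<phi> A B e"
      using conj_level[OF _ AB(1,2)] False by (metis neq0_conv)
    then interpret conj_level a1 a2 b p1 p2 q D1 D2 d f d1 d2 N \<phi> A B e .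
    have "hom_rat N (Fract A B)"
      unfolding hom_rat_def using hom_A hom_B B0 by (metis add.commute)
    thus ?thesis using is_orbit_equation orbit_genus orbit_given_proj False by (intro exI[of _ "Fract A B"]) blast
  qed
qed

text \<open>Among the generic points there is one where \<open>W\<close> is finite.\<close>

lemma orbit_equation_imp_orbit_given_by:
  assumes "orbit_equation \<phi> W" obtains a where "proj_value W a \<noteq> None" "orbit_given_by \<phi> W a"
proof -
  obtain D where D: "D \<noteq> 0" "\<And>a. eval_poly D a \<noteq> 0 \<Longrightarrow> orbit_given_by \<phi> W a"
    using assms unfolding orbit_equation_def generically_def by blast
  obtain A B where AB: "B \<noteq> 0" "coprime A B" "W = Fract A B" by (rule rat_fun_coprime)
  have "D * B \<noteq> 0" using D AB by simp
  then obtain a where "eval_poly (D * B) a \<noteq> 0" using generic_point_exists by blast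
  hence "eval_poly D a \<noteq> 0" "eval_poly B a \<noteq> 0" by (auto simp: eval_poly_simps)
  thus thesis using that[of a] D(2) by (simp add: AB(3) proj_value_coprime[OF AB(1,2)])
qed

theorem corollary1:
  shows "(\<forall>N \<phi>. flow \<phi> \<longrightarrow> has_level \<phi> N \<longrightarrow>
            (\<exists>W. hom_rat N W \<and> orbit_equation \<phi> W \<and>
               (\<forall>a. nondegenerate_at \<phi> a \<longrightarrow>
                  algebraic_curve_of_genus_0 (orbit \<phi> a) \<and>
                  (N = 0 \<or> proj_value W a \<notin> {Some 0, None} \<longrightarrow> orbit_given_by \<phi> W a))))
       \<and> (\<forall>N W. hom_rat N W \<longrightarrow>
            ((\<exists>\<phi>. flow \<phi> \<and> orbit_equation \<phi> W) \<longleftrightarrow> orbit_equation_form N W) \<and>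
            ((\<exists>\<phi> a. flow \<phi> \<and> proj_value W a \<noteq> None \<and> orbit_given_by \<phi> W a)
                \<longleftrightarrow> orbit_equation_form N W))"
proof (intro conjI allI impI)
  fix N \<phi> assume "has_level \<phi> N"
  thus "\<exists>W. hom_rat N W \<and> orbit_equation \<phi> W \<and>
               (\<forall>a. nondegenerate_at \<phi> a \<longrightarrow>
                  algebraic_curve_of_genus_0 (orbit \<phi> a) \<and>
                  (N = 0 \<or> proj_value W a \<notin> {Some 0, None} \<longrightarrow> orbit_given_by \<phi> W a))"
    by (rule orbit_equation_of_level)
next
  fix N and W :: "real rat_fun" assume W: "hom_rat N W"
  have imp: "orbit_equation_form N W" if "flow \<phi>" "proj_value W a \<noteq> None" "orbit_given_by \<phi> W a" for \<phi> a
    using orbit_given_by_imp_form[OF _ W that(2,3)] that(1) unfolding flow_def by blast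
  show "(\<exists>\<phi>. flow \<phi> \<and> orbit_equation \<phi> W) \<longleftrightarrow> orbit_equation_form N W"
    using imp orbit_equation_imp_orbit_given_by form_imp_orbit_equation by metis
  show "(\<exists>\<phi> a. flow \<phi> \<and> proj_value W a \<noteq> None \<and> orbit_given_by \<phi> W a) \<longleftrightarrow> orbit_equation_form N W"
    using imp orbit_equation_imp_orbit_given_by form_imp_orbit_equation by metis
qed

end
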